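(* A regular fibration $\mathbf{E}$ has comprehension if and only if the equipment $\mathrm{Matr}(\mathbf{E})$ has tabulation, and $\mathbf{E}$ has full comprehension if and only if $\mathrm{Matr}(\mathbf{E})$ has full tabulation.
   Context: Everything is weak by default (2-category = bicategory, functor = pseudofunctor). Regular fibrations. A fibration over a category $\mathbf{B}$ is identified with a pseudofunctor $\mathbf{E} \colon \mathbf{B}^{\mathrm{op}} \to \mathcal{C}at$, with fibres $\mathbf{E}X$ and reindexing $f^* = \mathbf{E}f$. It is a regular fibration if: (i) $\mathbf{B}$ has finite products $(\times,\mathbf{1})$ and each $\mathbf{E}X$ has finite products $(\cap,\top)$; (ii) each $f^*$ has a left adjoint $f_!$ (and preserves finite products); (iii) Frobenius reciprocity: the canonical map $f_!(A \cap f^*B) \to f_!A \cap B$ is invertible; (iv) the Beck--Chevalley condition holds for product-absolute pullbacks. Here, for a square $tu = sv$ in $\mathbf{B}$, Beck--Chevalley means both mates $v_!u^* \to s^*t_!$ and $u_!v^* \to t^*s_!$ of $u^*t^* \cong v^*s^*$ are invertible. The product-absolute pullbacks are generated, under taking the product of a square with an object and pasting side by side, from: (A) $(t\times Y)\circ(1_X,t) = d\circ t$ for $t\colon X\to Y$, with $d\colon Y\to Y\times Y$ the diagonal; (B) $d\circ 1_X = d\circ 1_X$ for $d \colon X\to X\times X$; (C) $(t'\times Y)\circ(X'\times t) = (Y'\times t)\circ(t'\times X)$ for $t\colon X\to Y$, $t'\colon X'\to Y'$. Comprehension. For each $X\in\mathbf{B}$ there is a functor $\mathrm{im}\colon\mathbf{B}/X\to\mathbf{E}X$,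 $\mathrm{im}(t\colon Y\to X)=t_!\top_Y$. $\mathbf{E}$ has comprehension if for each $X$ this functor has a right adjoint $P\mapsto\{P\}$ (extension); it has full comprehension if each extension functor $\mathbf{E}X\to\mathbf{B}/X$ is moreover fully faithful. Equipments. An equipment is a functor $(-)_\bullet\colon\mathbf{K}\to\mathcal{M}$, the identity on objects, from a 1-category $\mathbf{K}$ (whose morphisms are called tight) to a 2-category $\mathcal{M}$, such that each $f_\bullet$ has a right adjoint $f^\bullet$. $\mathrm{Matr}(\mathbf{E})$ is the equipment whose objects and tight maps are the objects and morphisms of $\mathbf{B}$, with hom-categories $\mathrm{Matr}(\mathbf{E})(X,Y)=\mathbf{E}(X\times Y)$, composition $S\circ R=(p_Y)_!(p_Z^*R\cap p_X^*S)$ for $R\in\mathbf{E}(X\times Y)$, $S\in\mathbf{E}(Y\times Z)$, where $p_Y,p_Z,p_X$ are the projections from $X\times Y\times Z$ omitting the indicated factor, identities $1_X=d_!\top_X$, and $f_\bullet=(f\times1)^*1_{X'}$, $f^\bullet=(1\times f)^*1_{X'}$ for $f\colon X\to X'$. Tabulation. A tabulation of a morphism $R\colon X\to Y$ of $\mathcal{M}$ is an object $\{R\}$ with tight maps $i\colon\{R\}\to X$, $j\colon\{R\}\to Y$ and a universal 2-cell $j_\bullet\to R\,i_\bullet$, i.e. such that for all tight $f\colon Z\to X$, $g\colon Z\to Y$, every 2-cell $g_\bullet\to R f_\bullet$ is obtained from the universal one by composing with (the identity cell on) a unique tight map $h\colon Z\to\{R\}$ (in particular $ih=f$, $jh=g$).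 An equipment has tabulation if every morphism has a tabulation; the tabulations are full if for each $R$ the mate $j_\bullet i^\bullet\to R$ of the universal 2-cell is invertible. *)

theory Defs
  imports Main
begin

section \<open>Categories, functors, adjunctions\<close>

record ('o, 'a) cat =
  Obj :: "'o set"
  Arr :: "'a set"
  Dom :: "'a \<Rightarrow> 'o"
  Cod :: "'a \<Rightarrow> 'o"
  Ide :: "'o \<Rightarrow> 'a"
  Comp :: "'a \<Rightarrow> 'a \<Rightarrow> 'a"  (infixr "\<cdot>\<index>" 70)

definition Hom :: "('o, 'a, 'm) cat_scheme \<Rightarrow> 'o \<Rightarrow> 'o \<Rightarrow> 'a set" where
  "Hom C A B = {f \<in> Arr C. Dom C f = A \<and> Cod C f = B}"

locale category =
  fixes C :: "('o, 'a, 'm) cat_scheme" (structure)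
  assumes Dom_in: "f \<in> Arr C \<Longrightarrow> Dom C f \<in> Obj C"
    and Cod_in: "f \<in> Arr C \<Longrightarrow> Cod C f \<in> Obj C"
    and Ide_in: "A \<in> Obj C \<Longrightarrow> Ide C A \<in> Hom C A A"
    and Comp_in: "\<lbrakk>f \<in> Hom C X Y; g \<in> Hom C Y Z\<rbrakk> \<Longrightarrow> g \<cdot> f \<in> Hom C X Z"
    and Comp_Ide: "f \<in> Hom C X Y \<Longrightarrow> f \<cdot> Ide C X = f"
    and Ide_Comp: "f \<in> Hom C X Y \<Longrightarrow> Ide C Y \<cdot> f = f"
    and Comp_assoc:
      "\<lbrakk>f \<in> Hom C W X; g \<in> Hom C X Y; h \<in> Hom C Y Z\<rbrakk> \<Longrightarrow> (h \<cdot> g) \<cdot> f = h \<cdot> (g \<cdot> f)"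

definition inverse_arrows :: "('o, 'a, 'm) cat_scheme \<Rightarrow> 'a \<Rightarrow> 'a \<Rightarrow> bool" where
  "inverse_arrows C f g \<longleftrightarrow>
     f \<in> Hom C (Dom C f) (Cod C f) \<and> g \<in> Hom C (Cod C f) (Dom C f) \<and>
     g \<cdot>\<^bsub>C\<^esub> f = Ide C (Dom C f) \<and> f \<cdot>\<^bsub>C\<^esub> g = Ide C (Cod C f)"

definition is_iso :: "('o, 'a, 'm) cat_scheme \<Rightarrow> 'a \<Rightarrow> bool" where
  "is_iso C f \<longleftrightarrow> (\<exists>g. inverse_arrows C f g)"

definition Inv :: "('o, 'a, 'm) cat_scheme \<Rightarrow> 'a \<Rightarrow> 'a" where
  "Inv C f = (THE g. inverse_arrows C f g)"

record ('o, 'a, 'p, 'q) func =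
  FObj :: "'o \<Rightarrow> 'p"
  FArr :: "'a \<Rightarrow> 'q"

definition is_functor ::
  "('o, 'a, 'm) cat_scheme \<Rightarrow> ('p, 'q, 'n) cat_scheme \<Rightarrow> ('o, 'a, 'p, 'q) func \<Rightarrow> bool" where
  "is_functor C D F \<longleftrightarrow>
     (\<forall>A \<in> Obj C. FObj F A \<in> Obj D) \<and>
     (\<forall>A B. \<forall>f \<in> Hom C A B. FArr F f \<in> Hom D (FObj F A) (FObj F B)) \<and>
     (\<forall>A \<in> Obj C. FArr F (Ide C A) = Ide D (FObj F A)) \<and>
     (\<forall>X Y Z. \<forall>f \<in> Hom C X Y. \<forall>g \<in> Hom C Y Z.
        FArr F (g \<cdot>\<^bsub>C\<^esub> f) = FArr F g \<cdot>\<^bsub>D\<^esub> FArr F f)"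

definition Id_func :: "('o, 'a, 'o, 'a) func" where
  "Id_func = \<lparr>FObj = (\<lambda>A. A), FArr = (\<lambda>f. f)\<rparr>"

definition comp_func ::
  "('p, 'q, 'r, 's) func \<Rightarrow> ('o, 'a, 'p, 'q) func \<Rightarrow> ('o, 'a, 'r, 's) func" where
  "comp_func G F = \<lparr>FObj = FObj G \<circ> FObj F, FArr = FArr G \<circ> FArr F\<rparr>"

definition natural ::
  "('o, 'a, 'm) cat_scheme \<Rightarrow> ('p, 'q, 'n) cat_scheme \<Rightarrow> ('o, 'a, 'p, 'q) func \<Rightarrow>
   ('o, 'a, 'p, 'q) func \<Rightarrow> ('o \<Rightarrow> 'q) \<Rightarrow> bool" where
  "natural C D F G \<tau> \<longleftrightarrow>
     (\<forall>A \<in> Obj C. \<tau> A \<in> Hom D (FObj F A) (FObj G A)) \<and>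
     (\<forall>A B. \<forall>f \<in> Hom C A B. FArr G f \<cdot>\<^bsub>D\<^esub> \<tau> A = \<tau> B \<cdot>\<^bsub>D\<^esub> FArr F f)"

definition natural_iso ::
  "('o, 'a, 'm) cat_scheme \<Rightarrow> ('p, 'q, 'n) cat_scheme \<Rightarrow> ('o, 'a, 'p, 'q) func \<Rightarrow>
   ('o, 'a, 'p, 'q) func \<Rightarrow> ('o \<Rightarrow> 'q) \<Rightarrow> bool" where
  "natural_iso C D F G \<tau> \<longleftrightarrow> natural C D F G \<tau> \<and> (\<forall>A \<in> Obj C. is_iso D (\<tau> A))"

text \<open>\<open>F\<close> is left adjoint to \<open>G\<close>, with unit \<open>\<eta>\<close> and counit \<open>\<epsilon>\<close>.\<close>

definition adjunction ::
  "('o, 'a, 'm) cat_scheme \<Rightarrow> ('p, 'q, 'n) cat_scheme \<Rightarrow> ('o, 'a, 'p, 'q) func \<Rightarrow>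
   ('p, 'q, 'o, 'a) func \<Rightarrow> ('o \<Rightarrow> 'a) \<Rightarrow> ('p \<Rightarrow> 'q) \<Rightarrow> bool" where
  "adjunction C D F G \<eta> \<epsilon> \<longleftrightarrow>
     is_functor C D F \<and> is_functor D C G \<and>
     natural C C Id_func (comp_func G F) \<eta> \<and>
     natural D D (comp_func F G) Id_func \<epsilon> \<and>
     (\<forall>A \<in> Obj C. \<epsilon> (FObj F A) \<cdot>\<^bsub>D\<^esub> FArr F (\<eta> A) = Ide D (FObj F A)) \<and>
     (\<forall>B \<in> Obj D. FArr G (\<epsilon> B) \<cdot>\<^bsub>C\<^esub> \<eta> (FObj G B) = Ide C (FObj G B))"

definition fully_faithful ::
  "('o, 'a, 'm) cat_scheme \<Rightarrow> ('p, 'q, 'n) cat_scheme \<Rightarrow> ('o, 'a, 'p, 'q) func \<Rightarrow> bool" where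
  "fully_faithful C D F \<longleftrightarrow>
     (\<forall>A \<in> Obj C. \<forall>B \<in> Obj C. bij_betw (FArr F) (Hom C A B) (Hom D (FObj F A) (FObj F B)))"

text \<open>In the slice over \<open>X\<close> the arrow \<open>(t, h, s)\<close> is \<open>h\<close> regarded as a map from \<open>t\<close> to \<open>s\<close>.\<close>

definition slice :: "('o, 'a, 'm) cat_scheme \<Rightarrow> 'o \<Rightarrow> ('a, 'a \<times> 'a \<times> 'a) cat" where
  "slice C X =
     \<lparr>Obj = {t \<in> Arr C. Cod C t = X},
      Arr = {(t, h, s). t \<in> Arr C \<and> Cod C t = X \<and> s \<in> Arr C \<and> Cod C s = X \<and>
                        h \<in> Hom C (Dom C t) (Dom C s) \<and> s \<cdot>\<^bsub>C\<^esub> h = t},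
      Dom = (\<lambda>(t, h, s). t),
      Cod = (\<lambda>(t, h, s). s),
      Ide = (\<lambda>t. (t, Ide C (Dom C t), t)),
      Comp = (\<lambda>(t', h', s') (t, h, s). (t, h' \<cdot>\<^bsub>C\<^esub> h, s'))\<rparr>"


section \<open>Categories with chosen finite products\<close>

definition is_terminal :: "('o, 'a, 'm) cat_scheme \<Rightarrow> 'o \<Rightarrow> bool" where
  "is_terminal C T \<longleftrightarrow> T \<in> Obj C \<and> (\<forall>A \<in> Obj C. \<exists>!f. f \<in> Hom C A T)"

definition is_product ::
  "('o, 'a, 'm) cat_scheme \<Rightarrow> 'o \<Rightarrow> 'o \<Rightarrow> 'o \<Rightarrow> 'a \<Rightarrow> 'a \<Rightarrow> bool" where
  "is_product C A B P p q \<longleftrightarrow>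
     p \<in> Hom C P A \<and> q \<in> Hom C P B \<and>
     (\<forall>X. \<forall>f \<in> Hom C X A. \<forall>g \<in> Hom C X B.
        \<exists>!h. h \<in> Hom C X P \<and> p \<cdot>\<^bsub>C\<^esub> h = f \<and> q \<cdot>\<^bsub>C\<^esub> h = g)"

definition pairing :: "('o, 'a, 'm) cat_scheme \<Rightarrow> 'o \<Rightarrow> 'a \<Rightarrow> 'a \<Rightarrow> 'a \<Rightarrow> 'a \<Rightarrow> 'a" where
  "pairing C P p q f g =
     (THE h. h \<in> Hom C (Dom C f) P \<and> p \<cdot>\<^bsub>C\<^esub> h = f \<and> q \<cdot>\<^bsub>C\<^esub> h = g)"

record ('o, 'a) fpcat = "('o, 'a) cat" +
  Prod :: "'o \<Rightarrow> 'o \<Rightarrow> 'o"  (infixr "\<otimes>\<index>" 75)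
  Pr1 :: "'o \<Rightarrow> 'o \<Rightarrow> 'a"
  Pr2 :: "'o \<Rightarrow> 'o \<Rightarrow> 'a"
  Term :: "'o"

locale finite_product_category = category C
  for C :: "('o, 'a, 'm) fpcat_scheme" (structure) +
  assumes terminal: "is_terminal C (Term C)"
    and product:
      "\<lbrakk>A \<in> Obj C; B \<in> Obj C\<rbrakk> \<Longrightarrow> is_product C A B (A \<otimes> B) (Pr1 C A B) (Pr2 C A B)"

definition tuple :: "('o, 'a, 'm) fpcat_scheme \<Rightarrow> 'a \<Rightarrow> 'a \<Rightarrow> 'a" where
  "tuple C f g =
     pairing C (Cod C f \<otimes>\<^bsub>C\<^esub> Cod C g) (Pr1 C (Cod C f) (Cod C g)) (Pr2 C (Cod C f) (Cod C g)) f g"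

definition prod_map :: "('o, 'a, 'm) fpcat_scheme \<Rightarrow> 'a \<Rightarrow> 'a \<Rightarrow> 'a" where
  "prod_map C f g =
     tuple C (f \<cdot>\<^bsub>C\<^esub> Pr1 C (Dom C f) (Dom C g)) (g \<cdot>\<^bsub>C\<^esub> Pr2 C (Dom C f) (Dom C g))"

definition diag :: "('o, 'a, 'm) fpcat_scheme \<Rightarrow> 'o \<Rightarrow> 'a" where
  "diag C X = tuple C (Ide C X) (Ide C X)"

text \<open>
  A quadruple \<open>u v t s\<close> stands for the commutative square \<open>t \<cdot> u = s \<cdot> v\<close>, in which \<open>u\<close> and \<open>s\<close> are
  parallel sides, as are \<open>v\<close> and \<open>t\<close>.  Squares may be pasted along either pair of sides.
\<close>

inductive product_absolute ::
  "('o, 'a, 'm) fpcat_scheme \<Rightarrow> 'a \<Rightarrow> 'a \<Rightarrow> 'a \<Rightarrow> 'a \<Rightarrow> bool"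
  for C :: "('o, 'a, 'm) fpcat_scheme" where
  graph: "t \<in> Hom C X Y \<Longrightarrow>
    product_absolute C (tuple C (Ide C X) t) t (prod_map C t (Ide C Y)) (diag C Y)"
| diagonal: "X \<in> Obj C \<Longrightarrow>
    product_absolute C (Ide C X) (Ide C X) (diag C X) (diag C X)"
| interchange: "\<lbrakk>t \<in> Hom C X Y; t' \<in> Hom C X' Y'\<rbrakk> \<Longrightarrow>
    product_absolute C (prod_map C (Ide C X') t) (prod_map C t' (Ide C X))
                       (prod_map C t' (Ide C Y)) (prod_map C (Ide C Y') t)"
| times_right: "\<lbrakk>product_absolute C u v t s; W \<in> Obj C\<rbrakk> \<Longrightarrow>
    product_absolute C (prod_map C u (Ide C W)) (prod_map C v (Ide C W))
                       (prod_map C t (Ide C W)) (prod_map C s (Ide C W))"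
| times_left: "\<lbrakk>product_absolute C u v t s; W \<in> Obj C\<rbrakk> \<Longrightarrow>
    product_absolute C (prod_map C (Ide C W) u) (prod_map C (Ide C W) v)
                       (prod_map C (Ide C W) t) (prod_map C (Ide C W) s)"
| paste_horizontal: "\<lbrakk>product_absolute C u v t s; product_absolute C u' t t' s'\<rbrakk> \<Longrightarrow>
    product_absolute C (u' \<cdot>\<^bsub>C\<^esub> u) v t' (s' \<cdot>\<^bsub>C\<^esub> s)"
| paste_vertical: "\<lbrakk>product_absolute C u v t s; product_absolute C s v' t' s'\<rbrakk> \<Longrightarrow>
    product_absolute C u (v' \<cdot>\<^bsub>C\<^esub> v) (t' \<cdot>\<^bsub>C\<^esub> t) s'"


section \<open>Regular fibrations\<close>

text \<open>
  The data of a pseudofunctor \<open>base\<^sup>o\<^sup>p \<Rightarrow> Cat\<close> together with a left adjoint of each reindexing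
  functor.  The structural isomorphisms are \<open>pull_comp f g A : f\<^sup>* (g\<^sup>* A) \<rightarrow> (g \<cdot> f)\<^sup>* A\<close> and
  \<open>pull_id X A : A \<rightarrow> (Ide X)\<^sup>* A\<close>; the left adjoint \<open>ex f\<close> of \<open>pull f\<close> comes with unit \<open>ex_unit f\<close> and
  counit \<open>ex_counit f\<close>.  In a fibre, \<open>Prod\<close> and \<open>Term\<close> are \<open>\<inter>\<close> and \<open>\<top>\<close>.
\<close>

record ('o, 'a, 'p, 'q) fibration =
  base :: "('o, 'a) fpcat"
  fib :: "'o \<Rightarrow> ('p, 'q) fpcat"
  pull :: "'a \<Rightarrow> ('p, 'q, 'p, 'q) func"
  pull_comp :: "'a \<Rightarrow> 'a \<Rightarrow> 'p \<Rightarrow> 'q"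
  pull_id :: "'o \<Rightarrow> 'p \<Rightarrow> 'q"
  ex :: "'a \<Rightarrow> ('p, 'q, 'p, 'q) func"
  ex_unit :: "'a \<Rightarrow> 'p \<Rightarrow> 'q"
  ex_counit :: "'a \<Rightarrow> 'p \<Rightarrow> 'q"

locale indexed_category =
  fixes E :: "('o, 'a, 'p, 'q) fibration"
  assumes base_category: "category (base E)"
    and fib_category: "X \<in> Obj (base E) \<Longrightarrow> category (fib E X)"
    and pull_functor:
      "f \<in> Hom (base E) X Y \<Longrightarrow> is_functor (fib E Y) (fib E X) (pull E f)"
    and pull_comp_iso:
      "\<lbrakk>f \<in> Hom (base E) X Y; g \<in> Hom (base E) Y Z\<rbrakk> \<Longrightarrow>
       natural_iso (fib E Z) (fib E X)
         (comp_func (pull E f) (pull E g)) (pull E (g \<cdot>\<^bsub>base E\<^esub> f)) (pull_comp E f g)"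
    and pull_id_iso:
      "X \<in> Obj (base E) \<Longrightarrow>
       natural_iso (fib E X) (fib E X) Id_func (pull E (Ide (base E) X)) (pull_id E X)"
    and pull_comp_assoc:
      "\<lbrakk>f \<in> Hom (base E) W X; g \<in> Hom (base E) X Y; h \<in> Hom (base E) Y Z; A \<in> Obj (fib E Z)\<rbrakk> \<Longrightarrow>
       pull_comp E f (h \<cdot>\<^bsub>base E\<^esub> g) A \<cdot>\<^bsub>fib E W\<^esub> FArr (pull E f) (pull_comp E g h A) =
       pull_comp E (g \<cdot>\<^bsub>base E\<^esub> f) h A \<cdot>\<^bsub>fib E W\<^esub> pull_comp E f g (FObj (pull E h) A)"
    and pull_comp_id_left:
      "\<lbrakk>f \<in> Hom (base E) X Y; A \<in> Obj (fib E Y)\<rbrakk> \<Longrightarrow>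
       pull_comp E f (Ide (base E) Y) A \<cdot>\<^bsub>fib E X\<^esub> FArr (pull E f) (pull_id E Y A) =
       Ide (fib E X) (FObj (pull E f) A)"
    and pull_comp_id_right:
      "\<lbrakk>f \<in> Hom (base E) X Y; A \<in> Obj (fib E Y)\<rbrakk> \<Longrightarrow>
       pull_comp E (Ide (base E) X) f A \<cdot>\<^bsub>fib E X\<^esub> pull_id E X (FObj (pull E f) A) =
       Ide (fib E X) (FObj (pull E f) A)"

text \<open>The canonical map \<open>f\<^sub>! (A \<inter> f\<^sup>* B) \<rightarrow> f\<^sub>! A \<inter> B\<close>.\<close>

definition frobenius_map ::
  "('o, 'a, 'p, 'q) fibration \<Rightarrow> 'a \<Rightarrow> 'p \<Rightarrow> 'p \<Rightarrow> 'q" where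
  "frobenius_map E f A B =
     (let FX = fib E (Dom (base E) f); FY = fib E (Cod (base E) f); fB = FObj (pull E f) B in
      tuple FY (FArr (ex E f) (Pr1 FX A fB))
               (ex_counit E f B \<cdot>\<^bsub>FY\<^esub> FArr (ex E f) (Pr2 FX A fB)))"

text \<open>The mate \<open>v\<^sub>! u\<^sup>* A \<rightarrow> s\<^sup>* t\<^sub>! A\<close> for a square \<open>t \<cdot> u = s \<cdot> v\<close>.\<close>

definition bc_map ::
  "('o, 'a, 'p, 'q) fibration \<Rightarrow> 'a \<Rightarrow> 'a \<Rightarrow> 'a \<Rightarrow> 'a \<Rightarrow> 'p \<Rightarrow> 'q" where
  "bc_map E u v t s A =
     (let FP = fib E (Dom (base E) u); FY = fib E (Cod (base E) v); tA = FObj (ex E t) A in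
      ex_counit E v (FObj (pull E s) tA) \<cdot>\<^bsub>FY\<^esub>
      FArr (ex E v)
        (Inv FP (pull_comp E v s tA) \<cdot>\<^bsub>FP\<^esub> (pull_comp E u t tA \<cdot>\<^bsub>FP\<^esub> FArr (pull E u) (ex_unit E t A))))"

definition beck_chevalley ::
  "('o, 'a, 'p, 'q) fibration \<Rightarrow> 'a \<Rightarrow> 'a \<Rightarrow> 'a \<Rightarrow> 'a \<Rightarrow> bool" where
  "beck_chevalley E u v t s \<longleftrightarrow>
     (\<forall>A \<in> Obj (fib E (Cod (base E) u)). is_iso (fib E (Cod (base E) v)) (bc_map E u v t s A)) \<and>
     (\<forall>A \<in> Obj (fib E (Cod (base E) v)). is_iso (fib E (Cod (base E) u)) (bc_map E v u s t A))"

locale regular_fibration = indexed_category E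
  for E :: "('o, 'a, 'p, 'q) fibration" +
  assumes base_products: "finite_product_category (base E)"
    and fib_products: "X \<in> Obj (base E) \<Longrightarrow> finite_product_category (fib E X)"
    and ex_pull_adjunction:
      "f \<in> Hom (base E) X Y \<Longrightarrow>
       adjunction (fib E X) (fib E Y) (ex E f) (pull E f) (ex_unit E f) (ex_counit E f)"
    and pull_terminal:
      "f \<in> Hom (base E) X Y \<Longrightarrow> is_terminal (fib E X) (FObj (pull E f) (Term (fib E Y)))"
    and pull_product:
      "\<lbrakk>f \<in> Hom (base E) X Y; A \<in> Obj (fib E Y); B \<in> Obj (fib E Y)\<rbrakk> \<Longrightarrow>
       is_product (fib E X) (FObj (pull E f) A) (FObj (pull E f) B)
         (FObj (pull E f) (A \<otimes>\<^bsub>fib E Y\<^esub> B))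
         (FArr (pull E f) (Pr1 (fib E Y) A B)) (FArr (pull E f) (Pr2 (fib E Y) A B))"
    and frobenius:
      "\<lbrakk>f \<in> Hom (base E) X Y; A \<in> Obj (fib E X); B \<in> Obj (fib E Y)\<rbrakk> \<Longrightarrow>
       is_iso (fib E Y) (frobenius_map E f A B)"
    and product_absolute_bc:
      "product_absolute (base E) u v t s \<Longrightarrow> beck_chevalley E u v t s"


section \<open>Arrows over a base arrow\<close>

text \<open>
  The canonical cells below are described in the total category (Grothendieck construction) of
  the pseudofunctor.  A triple \<open>(f, \<phi>, B)\<close> with \<open>f : X \<rightarrow> Y\<close>, \<open>\<phi> : A \<rightarrow> f\<^sup>* B\<close> in the fibre over \<open>X\<close>
  and \<open>B\<close> in the fibre over \<open>Y\<close> represents an arrow \<open>A \<rightarrow> B\<close> over \<open>f\<close>.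
\<close>

type_synonym ('a, 'p, 'q) over = "'a \<times> 'q \<times> 'p"

definition over_comp ::
  "('o, 'a, 'p, 'q) fibration \<Rightarrow> ('a, 'p, 'q) over \<Rightarrow> ('a, 'p, 'q) over \<Rightarrow> ('a, 'p, 'q) over" where
  "over_comp E = (\<lambda>(g, \<psi>, C) (f, \<phi>, B).
     let FX = fib E (Dom (base E) f) in
     (g \<cdot>\<^bsub>base E\<^esub> f, pull_comp E f g C \<cdot>\<^bsub>FX\<^esub> (FArr (pull E f) \<psi> \<cdot>\<^bsub>FX\<^esub> \<phi>), C))"

definition over_id :: "('o, 'a, 'p, 'q) fibration \<Rightarrow> 'o \<Rightarrow> 'p \<Rightarrow> ('a, 'p, 'q) over" where
  "over_id E X A = (Ide (base E) X, pull_id E X A, A)"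

text \<open>The vertical arrow \<open>A \<rightarrow> B\<close> in the fibre over \<open>X\<close> given by an arrow over \<open>Ide X\<close>.\<close>

definition vertical :: "('o, 'a, 'p, 'q) fibration \<Rightarrow> 'o \<Rightarrow> ('a, 'p, 'q) over \<Rightarrow> 'q" where
  "vertical E X = (\<lambda>(f, \<phi>, B). Inv (fib E X) (pull_id E X B) \<cdot>\<^bsub>fib E X\<^esub> \<phi>)"

definition cart :: "('o, 'a, 'p, 'q) fibration \<Rightarrow> 'a \<Rightarrow> 'p \<Rightarrow> ('a, 'p, 'q) over" where
  "cart E f B = (f, Ide (fib E (Dom (base E) f)) (FObj (pull E f) B), B)"

text \<open>
  The factorisation through \<open>cart E g C\<close>, as an arrow over \<open>f\<close>, of an arrow into \<open>C\<close> over \<open>g \<cdot> f\<close>.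
\<close>

definition cart_factor ::
  "('o, 'a, 'p, 'q) fibration \<Rightarrow> 'a \<Rightarrow> 'a \<Rightarrow> ('a, 'p, 'q) over \<Rightarrow> ('a, 'p, 'q) over" where
  "cart_factor E g f = (\<lambda>(h, \<phi>, C).
     let FX = fib E (Dom (base E) f) in
     (f, Inv FX (pull_comp E f g C) \<cdot>\<^bsub>FX\<^esub> \<phi>, FObj (pull E g) C))"

definition opcart :: "('o, 'a, 'p, 'q) fibration \<Rightarrow> 'a \<Rightarrow> 'p \<Rightarrow> ('a, 'p, 'q) over" where
  "opcart E f A = (f, ex_unit E f A, FObj (ex E f) A)"

text \<open>The vertical arrow \<open>f\<^sub>! A \<rightarrow> C\<close> corresponding to an arrow \<open>A \<rightarrow> C\<close> over \<open>f\<close>.\<close>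

definition opcart_factor :: "('o, 'a, 'p, 'q) fibration \<Rightarrow> ('a, 'p, 'q) over \<Rightarrow> 'q" where
  "opcart_factor E =
     (\<lambda>(f, \<phi>, C). ex_counit E f C \<cdot>\<^bsub>fib E (Cod (base E) f)\<^esub> FArr (ex E f) \<phi>)"

text \<open>
  The arrow into \<open>B \<inter> C\<close> over \<open>f\<close> given by arrows into \<open>B\<close> and \<open>C\<close> over the same \<open>f\<close>, and
  the unique arrow \<open>A \<rightarrow> \<top>\<close> over \<open>f\<close>; they exist because \<open>f\<^sup>*\<close> preserves finite products.
\<close>

definition over_pair ::
  "('o, 'a, 'p, 'q) fibration \<Rightarrow> ('a, 'p, 'q) over \<Rightarrow> ('a, 'p, 'q) over \<Rightarrow> ('a, 'p, 'q) over" where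
  "over_pair E = (\<lambda>(f, \<phi>, B) (f', \<psi>, C).
     let FX = fib E (Dom (base E) f); FY = fib E (Cod (base E) f) in
     (f, pairing FX (FObj (pull E f) (B \<otimes>\<^bsub>FY\<^esub> C))
           (FArr (pull E f) (Pr1 FY B C)) (FArr (pull E f) (Pr2 FY B C)) \<phi> \<psi>,
      B \<otimes>\<^bsub>FY\<^esub> C))"

definition over_top :: "('o, 'a, 'p, 'q) fibration \<Rightarrow> 'a \<Rightarrow> 'p \<Rightarrow> ('a, 'p, 'q) over" where
  "over_top E f A =
     (let FX = fib E (Dom (base E) f); T = Term (fib E (Cod (base E) f)) in
      (f, (THE \<phi>. \<phi> \<in> Hom FX A (FObj (pull E f) T)), T))"


section \<open>Comprehension\<close>

text \<open>
  On arrows, \<open>im\<close> sends \<open>h : t \<rightarrow> s\<close> to the map \<open>t\<^sub>! \<top> \<rightarrow> s\<^sub>! \<top>\<close> corresponding to the composite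
  \<open>\<top> \<rightarrow> \<top> \<rightarrow> s\<^sub>! \<top>\<close> over \<open>s \<cdot> h = t\<close>.
\<close>

definition im :: "('o, 'a, 'p, 'q) fibration \<Rightarrow> ('a, 'a \<times> 'a \<times> 'a, 'p, 'q) func" where
  "im E =
     (let top = (\<lambda>t. Term (fib E (Dom (base E) t))) in
      \<lparr>FObj = (\<lambda>t. FObj (ex E t) (top t)),
       FArr = (\<lambda>(t, h, s).
         opcart_factor E (over_comp E (opcart E s (top s)) (over_top E h (top t))))\<rparr>)"

definition has_comprehension :: "('o, 'a, 'p, 'q) fibration \<Rightarrow> bool" where
  "has_comprehension E \<longleftrightarrow>
     (\<forall>X \<in> Obj (base E). \<exists>ext \<eta> \<epsilon>.
        adjunction (slice (base E) X) (fib E X) (im E) ext \<eta> \<epsilon>)"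

definition has_full_comprehension :: "('o, 'a, 'p, 'q) fibration \<Rightarrow> bool" where
  "has_full_comprehension E \<longleftrightarrow>
     (\<forall>X \<in> Obj (base E). \<exists>ext \<eta> \<epsilon>.
        adjunction (slice (base E) X) (fib E X) (im E) ext \<eta> \<epsilon> \<and>
        fully_faithful (fib E X) (slice (base E) X) ext)"


section \<open>Equipments and tabulation\<close>

text \<open>
  The structure of an equipment: the category of tight maps; the bicategory with the same
  objects, given by its hom-categories, composition (\<open>hcomp X Y Z S R\<close> is \<open>S \<circ> R\<close> for
  \<open>R : X \<rightarrow> Y\<close> and \<open>S : Y \<rightarrow> Z\<close>, and \<open>hcomp2\<close> is its action on 2-cells), identities and constraints
    \<^item> \<open>assoc W X Y Z T S R : (T \<circ> S) \<circ> R \<rightarrow> T \<circ> (S \<circ> R)\<close>,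
    \<^item> \<open>lunit X Y R : 1 \<circ> R \<rightarrow> R\<close> and \<open>runit X Y R : R \<circ> 1 \<rightarrow> R\<close>;
  the pseudofunctor \<open>lower\<close>, which is the identity on objects, with invertible constraints
    \<^item> \<open>lower_comp g f : (g \<cdot> f)\<^sub>\<bullet> \<rightarrow> g\<^sub>\<bullet> \<circ> f\<^sub>\<bullet>\<close> and \<open>lower_id X : 1 \<rightarrow> (Ide X)\<^sub>\<bullet>\<close>;
  and the right adjoint \<open>upper f\<close> of \<open>lower f\<close>, for \<open>f : X \<rightarrow> Y\<close>, with
    \<^item> \<open>adj_unit f : 1 \<rightarrow> f\<^sup>\<bullet> \<circ> f\<^sub>\<bullet>\<close> and \<open>adj_counit f : f\<^sub>\<bullet> \<circ> f\<^sup>\<bullet> \<rightarrow> 1\<close>.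
\<close>

record ('o, 'a, 'c, 'd) equipment =
  tight :: "('o, 'a) cat"
  hom :: "'o \<Rightarrow> 'o \<Rightarrow> ('c, 'd) cat"
  hcomp :: "'o \<Rightarrow> 'o \<Rightarrow> 'o \<Rightarrow> 'c \<Rightarrow> 'c \<Rightarrow> 'c"
  hcomp2 :: "'o \<Rightarrow> 'o \<Rightarrow> 'o \<Rightarrow> 'd \<Rightarrow> 'd \<Rightarrow> 'd"
  hid :: "'o \<Rightarrow> 'c"
  assoc :: "'o \<Rightarrow> 'o \<Rightarrow> 'o \<Rightarrow> 'o \<Rightarrow> 'c \<Rightarrow> 'c \<Rightarrow> 'c \<Rightarrow> 'd"
  lunit :: "'o \<Rightarrow> 'o \<Rightarrow> 'c \<Rightarrow> 'd"
  runit :: "'o \<Rightarrow> 'o \<Rightarrow> 'c \<Rightarrow> 'd"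
  lower :: "'a \<Rightarrow> 'c"
  lower_comp :: "'a \<Rightarrow> 'a \<Rightarrow> 'd"
  lower_id :: "'o \<Rightarrow> 'd"
  upper :: "'a \<Rightarrow> 'c"
  adj_unit :: "'a \<Rightarrow> 'd"
  adj_counit :: "'a \<Rightarrow> 'd"

text \<open>
  The pasting of \<open>\<tau> : j\<^sub>\<bullet> \<rightarrow> R \<circ> i\<^sub>\<bullet>\<close> with a tight map \<open>h : Z \<rightarrow> T\<close>, that is the composite
  \<open>(j \<cdot> h)\<^sub>\<bullet> \<rightarrow> j\<^sub>\<bullet> \<circ> h\<^sub>\<bullet> \<rightarrow> (R \<circ> i\<^sub>\<bullet>) \<circ> h\<^sub>\<bullet> \<rightarrow> R \<circ> (i\<^sub>\<bullet> \<circ> h\<^sub>\<bullet>) \<rightarrow> R \<circ> (i \<cdot> h)\<^sub>\<bullet>\<close>.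
\<close>

definition tab_paste ::
  "('o, 'a, 'c, 'd) equipment \<Rightarrow> 'o \<Rightarrow> 'o \<Rightarrow> 'c \<Rightarrow> 'o \<Rightarrow> 'a \<Rightarrow> 'a \<Rightarrow> 'd \<Rightarrow> 'o \<Rightarrow> 'a \<Rightarrow> 'd" where
  "tab_paste Q X Y R T i j \<tau> Z h =
     (let M = hom Q Z Y in
      hcomp2 Q Z X Y (Ide (hom Q X Y) R) (Inv (hom Q Z X) (lower_comp Q i h)) \<cdot>\<^bsub>M\<^esub>
      (assoc Q Z T X Y R (lower Q i) (lower Q h) \<cdot>\<^bsub>M\<^esub>
       (hcomp2 Q Z T Y \<tau> (Ide (hom Q Z T) (lower Q h)) \<cdot>\<^bsub>M\<^esub> lower_comp Q j h)))"

definition is_tabulation ::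
  "('o, 'a, 'c, 'd) equipment \<Rightarrow> 'o \<Rightarrow> 'o \<Rightarrow> 'c \<Rightarrow> 'o \<Rightarrow> 'a \<Rightarrow> 'a \<Rightarrow> 'd \<Rightarrow> bool" where
  "is_tabulation Q X Y R T i j \<tau> \<longleftrightarrow>
     T \<in> Obj (tight Q) \<and> i \<in> Hom (tight Q) T X \<and> j \<in> Hom (tight Q) T Y \<and>
     \<tau> \<in> Hom (hom Q T Y) (lower Q j) (hcomp Q T X Y R (lower Q i)) \<and>
     (\<forall>Z \<in> Obj (tight Q). \<forall>f \<in> Hom (tight Q) Z X. \<forall>g \<in> Hom (tight Q) Z Y.
      \<forall>\<phi> \<in> Hom (hom Q Z Y) (lower Q g) (hcomp Q Z X Y R (lower Q f)).
        \<exists>!h. h \<in> Hom (tight Q) Z T \<and> i \<cdot>\<^bsub>tight Q\<^esub> h = f \<and> j \<cdot>\<^bsub>tight Q\<^esub> h = g \<and>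
             \<phi> = tab_paste Q X Y R T i j \<tau> Z h)"

text \<open>
  The mate of \<open>\<tau> : j\<^sub>\<bullet> \<rightarrow> R \<circ> i\<^sub>\<bullet>\<close>, that is the composite
  \<open>j\<^sub>\<bullet> \<circ> i\<^sup>\<bullet> \<rightarrow> (R \<circ> i\<^sub>\<bullet>) \<circ> i\<^sup>\<bullet> \<rightarrow> R \<circ> (i\<^sub>\<bullet> \<circ> i\<^sup>\<bullet>) \<rightarrow> R \<circ> 1 \<rightarrow> R\<close>.
\<close>

definition tab_mate ::
  "('o, 'a, 'c, 'd) equipment \<Rightarrow> 'o \<Rightarrow> 'o \<Rightarrow> 'c \<Rightarrow> 'o \<Rightarrow> 'a \<Rightarrow> 'd \<Rightarrow> 'd" where
  "tab_mate Q X Y R T i \<tau> =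
     (let M = hom Q X Y in
      runit Q X Y R \<cdot>\<^bsub>M\<^esub>
      (hcomp2 Q X X Y (Ide M R) (adj_counit Q i) \<cdot>\<^bsub>M\<^esub>
       (assoc Q X T X Y R (lower Q i) (upper Q i) \<cdot>\<^bsub>M\<^esub>
        hcomp2 Q X T Y \<tau> (Ide (hom Q X T) (upper Q i)))))"

definition has_tabulation :: "('o, 'a, 'c, 'd) equipment \<Rightarrow> bool" where
  "has_tabulation Q \<longleftrightarrow>
     (\<forall>X \<in> Obj (tight Q). \<forall>Y \<in> Obj (tight Q). \<forall>R \<in> Obj (hom Q X Y).
        \<exists>T i j \<tau>. is_tabulation Q X Y R T i j \<tau>)"

definition has_full_tabulation :: "('o, 'a, 'c, 'd) equipment \<Rightarrow> bool" where
  "has_full_tabulation Q \<longleftrightarrow>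
     (\<forall>X \<in> Obj (tight Q). \<forall>Y \<in> Obj (tight Q). \<forall>R \<in> Obj (hom Q X Y).
        \<exists>T i j \<tau>. is_tabulation Q X Y R T i j \<tau> \<and> is_iso (hom Q X Y) (tab_mate Q X Y R T i \<tau>))"


section \<open>The equipment of matrices\<close>

text \<open>
  Threefold products are \<open>(X \<times> Y) \<times> Z\<close>; \<open>p12\<close>, \<open>p23\<close> and \<open>p13\<close> are the projections
  omitting \<open>Z\<close>, \<open>X\<close> and \<open>Y\<close> respectively.
\<close>

definition p12 :: "('o, 'a, 'm) fpcat_scheme \<Rightarrow> 'o \<Rightarrow> 'o \<Rightarrow> 'o \<Rightarrow> 'a" where
  "p12 B X Y Z = Pr1 B (X \<otimes>\<^bsub>B\<^esub> Y) Z"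

definition p23 :: "('o, 'a, 'm) fpcat_scheme \<Rightarrow> 'o \<Rightarrow> 'o \<Rightarrow> 'o \<Rightarrow> 'a" where
  "p23 B X Y Z = tuple B (Pr2 B X Y \<cdot>\<^bsub>B\<^esub> Pr1 B (X \<otimes>\<^bsub>B\<^esub> Y) Z) (Pr2 B (X \<otimes>\<^bsub>B\<^esub> Y) Z)"

definition p13 :: "('o, 'a, 'm) fpcat_scheme \<Rightarrow> 'o \<Rightarrow> 'o \<Rightarrow> 'o \<Rightarrow> 'a" where
  "p13 B X Y Z = tuple B (Pr1 B X Y \<cdot>\<^bsub>B\<^esub> Pr1 B (X \<otimes>\<^bsub>B\<^esub> Y) Z) (Pr2 B (X \<otimes>\<^bsub>B\<^esub> Y) Z)"

definition matr_meet ::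
  "('o, 'a, 'p, 'q) fibration \<Rightarrow> 'o \<Rightarrow> 'o \<Rightarrow> 'o \<Rightarrow> 'p \<Rightarrow> 'p \<Rightarrow> 'p" where
  "matr_meet E X Y Z S R =
     FObj (pull E (p12 (base E) X Y Z)) R
       \<otimes>\<^bsub>fib E ((X \<otimes>\<^bsub>base E\<^esub> Y) \<otimes>\<^bsub>base E\<^esub> Z)\<^esub> FObj (pull E (p23 (base E) X Y Z)) S"

definition matr_comp ::
  "('o, 'a, 'p, 'q) fibration \<Rightarrow> 'o \<Rightarrow> 'o \<Rightarrow> 'o \<Rightarrow> 'p \<Rightarrow> 'p \<Rightarrow> 'p" where
  "matr_comp E X Y Z S R = FObj (ex E (p13 (base E) X Y Z)) (matr_meet E X Y Z S R)"

definition matr_comp2 ::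
  "('o, 'a, 'p, 'q) fibration \<Rightarrow> 'o \<Rightarrow> 'o \<Rightarrow> 'o \<Rightarrow> 'q \<Rightarrow> 'q \<Rightarrow> 'q" where
  "matr_comp2 E X Y Z \<sigma> \<rho> =
     FArr (ex E (p13 (base E) X Y Z))
       (prod_map (fib E ((X \<otimes>\<^bsub>base E\<^esub> Y) \<otimes>\<^bsub>base E\<^esub> Z))
          (FArr (pull E (p12 (base E) X Y Z)) \<rho>) (FArr (pull E (p23 (base E) X Y Z)) \<sigma>))"

text \<open>
  For \<open>w\<close> with codomain \<open>(X \<times> Y) \<times> Z\<close>, an arrow \<open>a\<close> into \<open>R\<close> over \<open>p12 \<cdot> w\<close> and an arrow \<open>b\<close> into \<open>S\<close>
  over \<open>p23 \<cdot> w\<close> with the same domain induce an arrow into \<open>S \<circ> R\<close> over \<open>p13 \<cdot> w\<close>.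
\<close>

definition into_comp ::
  "('o, 'a, 'p, 'q) fibration \<Rightarrow> 'o \<Rightarrow> 'o \<Rightarrow> 'o \<Rightarrow> 'p \<Rightarrow> 'p \<Rightarrow> 'a \<Rightarrow>
   ('a, 'p, 'q) over \<Rightarrow> ('a, 'p, 'q) over \<Rightarrow> ('a, 'p, 'q) over" where
  "into_comp E X Y Z S R w a b =
     over_comp E (opcart E (p13 (base E) X Y Z) (matr_meet E X Y Z S R))
       (over_pair E (cart_factor E (p12 (base E) X Y Z) w a) (cart_factor E (p23 (base E) X Y Z) w b))"

definition matr_id :: "('o, 'a, 'p, 'q) fibration \<Rightarrow> 'o \<Rightarrow> 'p" where
  "matr_id E X = FObj (ex E (diag (base E) X)) (Term (fib E X))"

text \<open>For \<open>f : V \<rightarrow> X\<close> and \<open>A\<close> over \<open>V\<close>, the arrow \<open>A \<rightarrow> \<top> \<rightarrow> 1\<^sub>X\<close> over \<open>diag X \<cdot> f\<close>.\<close>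

definition matr_refl :: "('o, 'a, 'p, 'q) fibration \<Rightarrow> 'a \<Rightarrow> 'p \<Rightarrow> ('a, 'p, 'q) over" where
  "matr_refl E f A =
     (let X = Cod (base E) f in
      over_comp E (opcart E (diag (base E) X) (Term (fib E X))) (over_top E f A))"

text \<open>
  The inverse unit constraints are given by the arrows from \<open>R\<close> over \<open>(x, y) \<mapsto> ((x, y), y)\<close> and
  \<open>(x, y) \<mapsto> ((x, x), y)\<close>.
\<close>

definition matr_lunit :: "('o, 'a, 'p, 'q) fibration \<Rightarrow> 'o \<Rightarrow> 'o \<Rightarrow> 'p \<Rightarrow> 'q" where
  "matr_lunit E X Y R =
     (let B = base E; XY = X \<otimes>\<^bsub>B\<^esub> Y in
      Inv (fib E XY) (vertical E XY
        (into_comp E X Y Y (matr_id E Y) R (tuple B (Ide B XY) (Pr2 B X Y))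
           (over_id E XY R) (matr_refl E (Pr2 B X Y) R))))"

definition matr_runit :: "('o, 'a, 'p, 'q) fibration \<Rightarrow> 'o \<Rightarrow> 'o \<Rightarrow> 'p \<Rightarrow> 'q" where
  "matr_runit E X Y R =
     (let B = base E; XY = X \<otimes>\<^bsub>B\<^esub> Y in
      Inv (fib E XY) (vertical E XY
        (into_comp E X X Y R (matr_id E X) (prod_map B (diag B X) (Ide B Y))
           (matr_refl E (Pr1 B X Y) R) (over_id E XY R))))"

text \<open>
  On \<open>V = ((W \<times> X) \<times> Y) \<times> Z\<close> let \<open>N\<close> be the meet of the reindexings of \<open>R\<close>, \<open>S\<close> and \<open>T\<close>, with
  its projections \<open>r\<close>, \<open>s\<close> and \<open>t\<close>.  With \<open>\<pi>\<close> the projection \<open>V \<rightarrow> W \<times> Z\<close>, the two bracketings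
  of the threefold composite both receive \<open>\<pi>\<^sub>! N\<close>; these comparison maps are invertible by the
  Beck--Chevalley and Frobenius conditions.
\<close>

definition matr_assoc ::
  "('o, 'a, 'p, 'q) fibration \<Rightarrow> 'o \<Rightarrow> 'o \<Rightarrow> 'o \<Rightarrow> 'o \<Rightarrow> 'p \<Rightarrow> 'p \<Rightarrow> 'p \<Rightarrow> 'q" where
  "matr_assoc E W X Y Z T S R =
     (let B = base E;
          WXY = (W \<otimes>\<^bsub>B\<^esub> X) \<otimes>\<^bsub>B\<^esub> Y;
          FV = fib E (WXY \<otimes>\<^bsub>B\<^esub> Z);
          FWZ = fib E (W \<otimes>\<^bsub>B\<^esub> Z);
          qWXY = Pr1 B WXY Z;
          qZ = Pr2 B WXY Z;
          qWX = p12 B W X Y \<cdot>\<^bsub>B\<^esub> qWXY;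
          qXY = p23 B W X Y \<cdot>\<^bsub>B\<^esub> qWXY;
          qWY = p13 B W X Y \<cdot>\<^bsub>B\<^esub> qWXY;
          qYZ = tuple B (Pr2 B (W \<otimes>\<^bsub>B\<^esub> X) Y \<cdot>\<^bsub>B\<^esub> qWXY) qZ;
          R' = FObj (pull E qWX) R;
          S' = FObj (pull E qXY) S;
          T' = FObj (pull E qYZ) T;
          RS = R' \<otimes>\<^bsub>FV\<^esub> S';
          r = (qWX, Pr1 FV R' S' \<cdot>\<^bsub>FV\<^esub> Pr1 FV RS T', R);
          s = (qXY, Pr2 FV R' S' \<cdot>\<^bsub>FV\<^esub> Pr1 FV RS T', S);
          t = (qYZ, Pr2 FV RS T', T);
          left = into_comp E W X Z (matr_comp E X Y Z T S) R (tuple B qWX qZ)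
                   r (into_comp E X Y Z T S (tuple B qXY qZ) s t);
          right = into_comp E W Y Z T (matr_comp E W X Y S R) (tuple B qWY qZ)
                    (into_comp E W X Y S R qWXY r s) t
      in opcart_factor E right \<cdot>\<^bsub>FWZ\<^esub> Inv FWZ (opcart_factor E left))"

definition matr_lower :: "('o, 'a, 'p, 'q) fibration \<Rightarrow> 'a \<Rightarrow> 'p" where
  "matr_lower E f =
     (let B = base E; Y = Cod B f in
      FObj (pull E (prod_map B f (Ide B Y))) (matr_id E Y))"

definition matr_upper :: "('o, 'a, 'p, 'q) fibration \<Rightarrow> 'a \<Rightarrow> 'p" where
  "matr_upper E f =
     (let B = base E; Y = Cod B f in
      FObj (pull E (prod_map B (Ide B Y) f)) (matr_id E Y))"

text \<open>
  For \<open>h : V \<rightarrow> X\<close>, \<open>f : X \<rightarrow> Y\<close> and \<open>A\<close> over \<open>V\<close>, the canonical arrows from \<open>A\<close> to \<open>f\<^sub>\<bullet>\<close> over \<open>(h, f \<cdot> h)\<close>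
  and to \<open>f\<^sup>\<bullet>\<close> over \<open>(f \<cdot> h, h)\<close>.
\<close>

definition lower_refl ::
  "('o, 'a, 'p, 'q) fibration \<Rightarrow> 'a \<Rightarrow> 'a \<Rightarrow> 'p \<Rightarrow> ('a, 'p, 'q) over" where
  "lower_refl E f h A =
     (let B = base E in
      cart_factor E (prod_map B f (Ide B (Cod B f))) (tuple B h (f \<cdot>\<^bsub>B\<^esub> h))
        (matr_refl E (f \<cdot>\<^bsub>B\<^esub> h) A))"

definition upper_refl ::
  "('o, 'a, 'p, 'q) fibration \<Rightarrow> 'a \<Rightarrow> 'a \<Rightarrow> 'p \<Rightarrow> ('a, 'p, 'q) over" where
  "upper_refl E f h A =
     (let B = base E in
      cart_factor E (prod_map B (Ide B (Cod B f)) f) (tuple B (f \<cdot>\<^bsub>B\<^esub> h) h)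
        (matr_refl E (f \<cdot>\<^bsub>B\<^esub> h) A))"

text \<open>The arrow \<open>(g \<cdot> f)\<^sub>\<bullet> \<rightarrow> g\<^sub>\<bullet> \<circ> f\<^sub>\<bullet>\<close> lies over \<open>(x, z) \<mapsto> ((x, f x), z)\<close>.\<close>

definition matr_lower_comp :: "('o, 'a, 'p, 'q) fibration \<Rightarrow> 'a \<Rightarrow> 'a \<Rightarrow> 'q" where
  "matr_lower_comp E g f =
     (let B = base E; X = Dom B f; Y = Cod B f; Z = Cod B g; gf = g \<cdot>\<^bsub>B\<^esub> f in
      vertical E (X \<otimes>\<^bsub>B\<^esub> Z)
        (into_comp E X Y Z (matr_lower E g) (matr_lower E f)
           (prod_map B (tuple B (Ide B X) f) (Ide B Z))
           (lower_refl E f (Pr1 B X Z) (matr_lower E gf))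
           (cart_factor E (prod_map B g (Ide B Z)) (prod_map B f (Ide B Z))
              (cart E (prod_map B gf (Ide B Z)) (matr_id E Z)))))"

text \<open>
  The unit is induced by \<open>x \<mapsto> ((x, f x), x)\<close>.  The counit is induced by the arrow over
  \<open>((y, x), y') \<mapsto> ((y, f x), y')\<close> from the meet defining \<open>f\<^sub>\<bullet> \<circ> f\<^sup>\<bullet>\<close>, into \<open>1 \<circ> 1\<close>.
\<close>

definition matr_adj_unit :: "('o, 'a, 'p, 'q) fibration \<Rightarrow> 'a \<Rightarrow> 'q" where
  "matr_adj_unit E f =
     (let B = base E; X = Dom B f; Y = Cod B f; top = Term (fib E X) in
      opcart_factor E
        (into_comp E X Y X (matr_upper E f) (matr_lower E f)
           (tuple B (tuple B (Ide B X) f) (Ide B X))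
           (lower_refl E f (Ide B X) top) (upper_refl E f (Ide B X) top)))"

definition matr_adj_counit :: "('o, 'a, 'p, 'q) fibration \<Rightarrow> 'a \<Rightarrow> 'q" where
  "matr_adj_counit E f =
     (let B = base E; X = Dom B f; Y = Cod B f;
          FV = fib E ((Y \<otimes>\<^bsub>B\<^esub> X) \<otimes>\<^bsub>B\<^esub> Y);
          U = FObj (pull E (p12 B Y X Y)) (matr_upper E f);
          L = FObj (pull E (p23 B Y X Y)) (matr_lower E f);
          a = over_comp E (cart E (prod_map B (Ide B Y) f) (matr_id E Y))
                (p12 B Y X Y, Pr1 FV U L, matr_upper E f);
          b = over_comp E (cart E (prod_map B f (Ide B Y)) (matr_id E Y))
                (p23 B Y X Y, Pr2 FV U L, matr_lower E f)
      in matr_lunit E Y Y (matr_id E Y) \<cdot>\<^bsub>fib E (Y \<otimes>\<^bsub>B\<^esub> Y)\<^esub>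
         opcart_factor E
           (into_comp E Y Y Y (matr_id E Y) (matr_id E Y)
              (prod_map B (prod_map B (Ide B Y) f) (Ide B Y)) a b))"

definition Matr :: "('o, 'a, 'p, 'q) fibration \<Rightarrow> ('o, 'a, 'p, 'q) equipment" where
  "Matr E =
     \<lparr>tight = cat.truncate (base E),
      hom = (\<lambda>X Y. cat.truncate (fib E (X \<otimes>\<^bsub>base E\<^esub> Y))),
      hcomp = matr_comp E,
      hcomp2 = matr_comp2 E,
      hid = matr_id E,
      assoc = matr_assoc E,
      lunit = matr_lunit E,
      runit = matr_runit E,
      lower = matr_lower E,
      lower_comp = matr_lower_comp E,
      lower_id = (\<lambda>X. pull_id E (X \<otimes>\<^bsub>base E\<^esub> X) (matr_id E X)),
      upper = matr_upper E,
      adj_unit = matr_adj_unit E,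
      adj_counit = matr_adj_counit E\<rparr>"

end

theory Submission
  imports Defs
begin

text \<open>
  The argument takes place in the total category of \<open>E\<close>, where reindexing and its left adjoints become
  cartesian and opcartesian arrows.  There Frobenius reciprocity says that pairing an opcartesian with a
  cartesian arrow yields an opcartesian arrow (\<open>frobenius_opcartesian\<close>), and the Beck--Chevalley condition
  that opcartesian arrows pull back to opcartesian arrows (\<open>stable_square\<close>).

  An extension of \<open>P\<close> over \<open>X\<close> is a universal arrow \<open>\<chi> : \<top> \<rightarrow> P\<close> over some \<open>{P} \<rightarrow> X\<close>, and extension is
  fully faithful exactly when these arrows \<open>\<chi>\<close> are opcartesian, since that expresses invertibility of the
  counit (\<open>comprehension_adjunction_iff\<close>).

  On the side of matrices, the companion \<open>g\<^sub>\<bullet>\<close> is the image of \<open>\<top>\<close> along the graph of \<open>g\<close>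
  (\<open>lower_refl_opcartesian\<close>), and \<open>R \<circ> f\<^sub>\<bullet>\<close> is the reindexing of \<open>R\<close> along \<open>f \<times> 1\<close> (\<open>lower_out_simps\<close>).  Hence
  2-cells \<open>g\<^sub>\<bullet> \<rightarrow> R \<circ> f\<^sub>\<bullet>\<close> correspond to arrows \<open>\<top> \<rightarrow> R\<close> over \<open>(f, g)\<close>, and pasting a 2-cell with a tight map \<open>h\<close>
  corresponds to precomposition with the arrow \<open>\<top> \<rightarrow> \<top>\<close> over \<open>h\<close> (\<open>cell_arrow_tab_paste\<close>).  So a tabulation of
  \<open>R : X \<rightarrow> Y\<close> is precisely an extension of \<open>R\<close> over \<open>X \<times> Y\<close> (\<open>tabulation_iff_comprehends\<close>).  Dually \<open>S \<circ> i\<^sup>\<bullet>\<close> is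
  the image of \<open>S\<close> along \<open>i \<times> 1\<close>, whence \<open>j\<^sub>\<bullet> \<circ> i\<^sup>\<bullet>\<close> is the image of \<open>\<top>\<close> along \<open>(i, j)\<close> and the mate
  \<open>j\<^sub>\<bullet> \<circ> i\<^sup>\<bullet> \<rightarrow> R\<close> is invertible exactly when the universal arrow \<open>\<top> \<rightarrow> R\<close> is opcartesian (\<open>tab_mate_iso_iff\<close>).
  It remains to see that every \<open>P\<close> over \<open>X\<close> arises from a matrix, namely from its reindexing along the
  isomorphism \<open>X \<times> 1 \<cong> X\<close>.

  The structural 2-cells of the equipment of matrices are handled through their effect on the arrows
  \<open>into_comp w a b\<close>, which behave like pairs of composable elements: naturality in the source and in the
  two components (\<open>into_comp_Comp\<close>, \<open>matr_comp2_simps\<close>) lets every constraint be computed as an operation on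
  tuples of such elements.
\<close>

section \<open>Categories, isomorphisms and universal arrows\<close>

context category
begin

lemma Arr_Comp [simp]: "\<lbrakk>f \<in> Arr C; g \<in> Arr C; Dom C g = Cod C f\<rbrakk> \<Longrightarrow> g \<cdot> f \<in> Arr C"
  and Dom_Comp [simp]: "\<lbrakk>f \<in> Arr C; g \<in> Arr C; Dom C g = Cod C f\<rbrakk> \<Longrightarrow> Dom C (g \<cdot> f) = Dom C f"
  and Cod_Comp [simp]: "\<lbrakk>f \<in> Arr C; g \<in> Arr C; Dom C g = Cod C f\<rbrakk> \<Longrightarrow> Cod C (g \<cdot> f) = Cod C g"
  using Comp_in[of f "Dom C f" "Cod C f" g "Cod C g"] by (auto simp: Hom_def)

lemma Arr_Ide [simp]: "A \<in> Obj C \<Longrightarrow> Ide C A \<in> Arr C"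
  and Dom_Ide [simp]: "A \<in> Obj C \<Longrightarrow> Dom C (Ide C A) = A"
  and Cod_Ide [simp]: "A \<in> Obj C \<Longrightarrow> Cod C (Ide C A) = A"
  using Ide_in[of A] by (auto simp: Hom_def)

lemma Obj_Dom [simp]: "f \<in> Arr C \<Longrightarrow> Dom C f \<in> Obj C"
  and Obj_Cod [simp]: "f \<in> Arr C \<Longrightarrow> Cod C f \<in> Obj C"
  by (auto intro: Dom_in Cod_in)

lemma Comp_Ide_right [simp]: "\<lbrakk>f \<in> Arr C; A = Dom C f\<rbrakk> \<Longrightarrow> f \<cdot> Ide C A = f"
  and Comp_Ide_left [simp]: "\<lbrakk>f \<in> Arr C; A = Cod C f\<rbrakk> \<Longrightarrow> Ide C A \<cdot> f = f"
  using Comp_Ide[of f "Dom C f" "Cod C f"] Ide_Comp[of f "Dom C f" "Cod C f"]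
  by (auto simp: Hom_def)

lemma Comp_assoc_Arr [simp]:
  "\<lbrakk>f \<in> Arr C; g \<in> Arr C; h \<in> Arr C; Dom C g = Cod C f; Dom C h = Cod C g\<rbrakk> \<Longrightarrow>
   (h \<cdot> g) \<cdot> f = h \<cdot> (g \<cdot> f)"
  using Comp_assoc[of f "Dom C f" "Cod C f" g "Cod C g" h "Cod C h"] by (auto simp: Hom_def)

lemma is_iso_alt:
  "is_iso C f \<longleftrightarrow> f \<in> Arr C \<and> (\<exists>g \<in> Arr C. Dom C g = Cod C f \<and> Cod C g = Dom C f \<and>
     g \<cdot> f = Ide C (Dom C f) \<and> f \<cdot> g = Ide C (Cod C f))"
  by (auto simp: is_iso_def inverse_arrows_def Hom_def)

lemma is_isoI:
  "\<lbrakk>f \<in> Arr C; g \<in> Arr C; Dom C g = Cod C f; Cod C g = Dom C f;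
    g \<cdot> f = Ide C (Dom C f); f \<cdot> g = Ide C (Cod C f)\<rbrakk> \<Longrightarrow> is_iso C f"
  by (auto simp: is_iso_alt)

lemma is_iso_Arr: "is_iso C f \<Longrightarrow> f \<in> Arr C"
  by (simp add: is_iso_alt)

lemma inverse_arrows_Inv:
  assumes "is_iso C f"
  shows "inverse_arrows C f (Inv C f)"
proof -
  obtain g where g: "inverse_arrows C f g"
    using assms by (auto simp: is_iso_def)
  have "h = g" if "inverse_arrows C f h" for h
  proof -
    have "(h \<cdot> f) \<cdot> g = h \<cdot> (f \<cdot> g)"
      by (rule Comp_assoc_Arr) (use g that in \<open>auto simp: inverse_arrows_def Hom_def\<close>)
    moreover have "h \<cdot> f = Ide C (Dom C f)" "f \<cdot> g = Ide C (Cod C f)"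
      using g that by (auto simp: inverse_arrows_def)
    ultimately show ?thesis
      using g that by (auto simp: inverse_arrows_def Hom_def simp del: Comp_assoc_Arr)
  qed
  then show ?thesis
    unfolding Inv_def using g by (metis theI)
qed

lemma Inv_simps [simp]:
  assumes "is_iso C f"
  shows "Inv C f \<in> Arr C" "Dom C (Inv C f) = Cod C f" "Cod C (Inv C f) = Dom C f"
    "Inv C f \<cdot> f = Ide C (Dom C f)" "f \<cdot> Inv C f = Ide C (Cod C f)"
  using inverse_arrows_Inv[OF assms] by (auto simp: inverse_arrows_def Hom_def)

lemma Inv_cancel [simp]:
  assumes "is_iso C f"
  shows "\<lbrakk>h \<in> Arr C; Cod C h = Dom C f\<rbrakk> \<Longrightarrow> Inv C f \<cdot> (f \<cdot> h) = h"
    and "\<lbrakk>h \<in> Arr C; Cod C h = Cod C f\<rbrakk> \<Longrightarrow> f \<cdot> (Inv C f \<cdot> h) = h"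
proof -
  note f = is_iso_Arr[OF assms]
  show "Inv C f \<cdot> (f \<cdot> h) = h" if "h \<in> Arr C" "Cod C h = Dom C f"
    using Comp_assoc_Arr[of h f "Inv C f"] that f assms by (simp del: Comp_assoc_Arr)
  show "f \<cdot> (Inv C f \<cdot> h) = h" if "h \<in> Arr C" "Cod C h = Cod C f"
    using Comp_assoc_Arr[of h "Inv C f" f] that f assms by (simp del: Comp_assoc_Arr)
qed

lemma is_iso_Ide [simp]: "A \<in> Obj C \<Longrightarrow> is_iso C (Ide C A)"
  by (rule is_isoI[of _ "Ide C A"]) auto

lemma is_iso_Inv: "is_iso C f \<Longrightarrow> is_iso C (Inv C f)"
  by (rule is_isoI[of _ f]) (auto simp: is_iso_Arr)

lemma iso_mono:
  assumes "is_iso C f" "f \<cdot> g = f \<cdot> h" "g \<in> Arr C" "h \<in> Arr C" "Cod C g = Dom C f" "Cod C h = Dom C f"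
  shows "g = h"
  using assms(2-) Inv_cancel(1)[OF assms(1), of g] Inv_cancel(1)[OF assms(1), of h] by metis

lemma iso_epi:
  assumes "is_iso C f" "g \<cdot> f = h \<cdot> f" "g \<in> Arr C" "h \<in> Arr C" "Dom C g = Cod C f" "Dom C h = Cod C f"
  shows "g = h"
proof -
  have "(g \<cdot> f) \<cdot> Inv C f = (h \<cdot> f) \<cdot> Inv C f"
    by (simp only: assms(2))
  then show ?thesis
    using assms(1,3-) is_iso_Arr[OF assms(1)] by simp
qed

end

lemma functor_simps:
  assumes "is_functor C D F"
  shows "A \<in> Obj C \<Longrightarrow> FObj F A \<in> Obj D"
    and "f \<in> Arr C \<Longrightarrow> FArr F f \<in> Arr D"
    and "f \<in> Arr C \<Longrightarrow> Dom D (FArr F f) = FObj F (Dom C f)"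
    and "f \<in> Arr C \<Longrightarrow> Cod D (FArr F f) = FObj F (Cod C f)"
    and "A \<in> Obj C \<Longrightarrow> FArr F (Ide C A) = Ide D (FObj F A)"
    and "\<lbrakk>f \<in> Arr C; g \<in> Arr C; Dom C g = Cod C f\<rbrakk> \<Longrightarrow>
         FArr F (g \<cdot>\<^bsub>C\<^esub> f) = FArr F g \<cdot>\<^bsub>D\<^esub> FArr F f"
  using assms unfolding is_functor_def Hom_def by auto

definition couniversal ::
  "('o, 'a, 'm) cat_scheme \<Rightarrow> ('p, 'q, 'n) cat_scheme \<Rightarrow> ('o, 'a, 'p, 'q) func \<Rightarrow> 'p \<Rightarrow> 'o \<Rightarrow> 'q \<Rightarrow> bool"
  where "couniversal C D F P U e \<longleftrightarrow> U \<in> Obj C \<and> e \<in> Hom D (FObj F U) P \<and>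
    (\<forall>A \<in> Obj C. \<forall>k \<in> Hom D (FObj F A) P. \<exists>!h. h \<in> Hom C A U \<and> e \<cdot>\<^bsub>D\<^esub> FArr F h = k)"

lemma couniversalD:
  assumes "couniversal C D F P U e" "category C" "is_functor C D F" "category D"
    and "h \<in> Arr C" "h' \<in> Arr C" "Dom C h' = Dom C h" "Cod C h = U" "Cod C h' = U"
    and "e \<cdot>\<^bsub>D\<^esub> FArr F h = e \<cdot>\<^bsub>D\<^esub> FArr F h'"
  shows "h = h'"
proof -
  interpret C: category C by fact
  interpret D: category D by fact
  have "e \<cdot>\<^bsub>D\<^esub> FArr F h \<in> Hom D (FObj F (Dom C h)) P"
    using assms(1,5,8) functor_simps[OF assms(3)] by (auto simp: couniversal_def Hom_def)
  then have "\<exists>!x. x \<in> Hom C (Dom C h) U \<and> e \<cdot>\<^bsub>D\<^esub> FArr F x = e \<cdot>\<^bsub>D\<^esub> FArr F h"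
    using assms(1) C.Obj_Dom[OF assms(5)] by (auto simp: couniversal_def)
  then show ?thesis
    using assms(5-) by (auto simp: Hom_def)
qed

context
  fixes C :: "('o, 'a, 'm) cat_scheme" and D :: "('p, 'q, 'n) cat_scheme"
    and F :: "('o, 'a, 'p, 'q) func"
  assumes C: "category C" and D: "category D"
begin

interpretation C: category C by (rule C)
interpretation D: category D by (rule D)

lemma adjunction_couniversal:
  assumes adj: "adjunction C D F G \<eta> \<epsilon>" and P: "P \<in> Obj D"
  shows "couniversal C D F P (FObj G P) (\<epsilon> P)"
proof -
  have F: "is_functor C D F" and G: "is_functor D C G"
    using adj by (auto simp: adjunction_def)
  note [simp] = functor_simps[OF F] functor_simps[OF G]
  have \<epsilon>: "\<epsilon> Q \<in> Arr D" "Dom D (\<epsilon> Q) = FObj F (FObj G Q)" "Cod D (\<epsilon> Q) = Q" if "Q \<in> Obj D" for Q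
    using adj that by (auto simp: adjunction_def natural_def comp_func_def Id_func_def Hom_def)
  have \<eta>: "\<eta> A \<in> Arr C" "Cod C (\<eta> A) = FObj G (FObj F A)" "Dom C (\<eta> A) = A" if "A \<in> Obj C" for A
    using adj that by (auto simp: adjunction_def natural_def comp_func_def Id_func_def Hom_def)
  have \<epsilon>nat: "\<epsilon> (Cod D k) \<cdot>\<^bsub>D\<^esub> FArr F (FArr G k) = k \<cdot>\<^bsub>D\<^esub> \<epsilon> (Dom D k)" if "k \<in> Arr D" for k
    using adj that by (auto simp: adjunction_def natural_def comp_func_def Id_func_def Hom_def)
  have \<eta>nat: "FArr G (FArr F h) \<cdot>\<^bsub>C\<^esub> \<eta> (Dom C h) = \<eta> (Cod C h) \<cdot>\<^bsub>C\<^esub> h" if "h \<in> Arr C" for h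
    using adj that by (auto simp: adjunction_def natural_def comp_func_def Id_func_def Hom_def)
  have tri1: "\<epsilon> (FObj F A) \<cdot>\<^bsub>D\<^esub> FArr F (\<eta> A) = Ide D (FObj F A)" if "A \<in> Obj C" for A
    using adj that by (auto simp: adjunction_def)
  have tri2: "FArr G (\<epsilon> Q) \<cdot>\<^bsub>C\<^esub> \<eta> (FObj G Q) = Ide C (FObj G Q)" if "Q \<in> Obj D" for Q
    using adj that by (auto simp: adjunction_def)
  note [simp] = \<epsilon> \<eta>
  show ?thesis
    unfolding couniversal_def
  proof (intro conjI ballI)
    fix A k
    assume A: "A \<in> Obj C" and k: "k \<in> Hom D (FObj F A) P"
    have k' [simp]: "k \<in> Arr D" "Dom D k = FObj F A" "Cod D k = P"
      using k by (auto simp: Hom_def)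
    show "\<exists>!h. h \<in> Hom C A (FObj G P) \<and> \<epsilon> P \<cdot>\<^bsub>D\<^esub> FArr F h = k"
    proof (rule ex1I[of _ "FArr G k \<cdot>\<^bsub>C\<^esub> \<eta> A"], intro conjI)
      show "FArr G k \<cdot>\<^bsub>C\<^esub> \<eta> A \<in> Hom C A (FObj G P)"
        using A by (simp add: Hom_def)
      have "\<epsilon> P \<cdot>\<^bsub>D\<^esub> FArr F (FArr G k \<cdot>\<^bsub>C\<^esub> \<eta> A) = (\<epsilon> P \<cdot>\<^bsub>D\<^esub> FArr F (FArr G k)) \<cdot>\<^bsub>D\<^esub> FArr F (\<eta> A)"
        using A P by simp
      also have "\<dots> = (k \<cdot>\<^bsub>D\<^esub> \<epsilon> (FObj F A)) \<cdot>\<^bsub>D\<^esub> FArr F (\<eta> A)"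
        using \<epsilon>nat[of k] by simp
      also have "\<dots> = k"
        using A tri1[OF A] by simp
      finally show "\<epsilon> P \<cdot>\<^bsub>D\<^esub> FArr F (FArr G k \<cdot>\<^bsub>C\<^esub> \<eta> A) = k" .
    next
      fix h assume "h \<in> Hom C A (FObj G P) \<and> \<epsilon> P \<cdot>\<^bsub>D\<^esub> FArr F h = k"
      then have h [simp]: "h \<in> Arr C" "Dom C h = A" "Cod C h = FObj G P" and eq: "\<epsilon> P \<cdot>\<^bsub>D\<^esub> FArr F h = k"
        by (auto simp: Hom_def)
      have "FArr G k \<cdot>\<^bsub>C\<^esub> \<eta> A = FArr G (\<epsilon> P) \<cdot>\<^bsub>C\<^esub> (FArr G (FArr F h) \<cdot>\<^bsub>C\<^esub> \<eta> A)"
        using A P by (simp flip: eq)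
      also have "\<dots> = (FArr G (\<epsilon> P) \<cdot>\<^bsub>C\<^esub> \<eta> (FObj G P)) \<cdot>\<^bsub>C\<^esub> h"
        using \<eta>nat[of h] P by simp
      also have "\<dots> = h"
        using tri2[OF P] P by simp
      finally show "h = FArr G k \<cdot>\<^bsub>C\<^esub> \<eta> A" by simp
    qed
  qed (use P in \<open>auto simp: Hom_def\<close>)
qed

lemma couniversal_adjunction:
  assumes F: "is_functor C D F" and univ: "\<And>P. P \<in> Obj D \<Longrightarrow> couniversal C D F P (U P) (\<epsilon> P)"
  shows "\<exists>G \<eta>. adjunction C D F G \<eta> \<epsilon>"
proof -
  note [simp] = functor_simps[OF F]
  have U [simp]: "U P \<in> Obj C" "\<epsilon> P \<in> Arr D" "Dom D (\<epsilon> P) = FObj F (U P)" "Cod D (\<epsilon> P) = P"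
    if "P \<in> Obj D" for P
    using univ[OF that] by (auto simp: couniversal_def Hom_def)
  define tr where "tr P A k = (THE h. h \<in> Hom C A (U P) \<and> \<epsilon> P \<cdot>\<^bsub>D\<^esub> FArr F h = k)" for P A k
  have tr: "tr P A k \<in> Hom C A (U P) \<and> \<epsilon> P \<cdot>\<^bsub>D\<^esub> FArr F (tr P A k) = k"
    if "P \<in> Obj D" "A \<in> Obj C" "k \<in> Arr D" "Dom D k = FObj F A" "Cod D k = P" for P A k
    unfolding tr_def by (rule theI') (use univ[of P] that in \<open>auto simp: couniversal_def Hom_def\<close>)
  have tr_simps [simp]: "tr P A k \<in> Arr C" "Dom C (tr P A k) = A" "Cod C (tr P A k) = U P"
      "\<epsilon> P \<cdot>\<^bsub>D\<^esub> FArr F (tr P A k) = k"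
    if "P \<in> Obj D" "A \<in> Obj C" "k \<in> Arr D" "Dom D k = FObj F A" "Cod D k = P" for P A k
    using tr[OF that] by (auto simp: Hom_def)
  have ext: "h = h'"
    if "P \<in> Obj D" "h \<in> Arr C" "h' \<in> Arr C" "Dom C h' = Dom C h" "Cod C h = U P" "Cod C h' = U P"
      "\<epsilon> P \<cdot>\<^bsub>D\<^esub> FArr F h = \<epsilon> P \<cdot>\<^bsub>D\<^esub> FArr F h'" for P h h'
    using couniversalD[OF univ C F D, of P h h'] that by simp
  define G where "G = \<lparr>FObj = U, FArr = (\<lambda>k. tr (Cod D k) (U (Dom D k)) (k \<cdot>\<^bsub>D\<^esub> \<epsilon> (Dom D k)))\<rparr>"
  define \<eta> where "\<eta> A = tr (FObj F A) A (Ide D (FObj F A))" for A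
  have \<eta> [simp]: "\<eta> A \<in> Arr C" "Cod C (\<eta> A) = U (FObj F A)" "Dom C (\<eta> A) = A"
    "\<epsilon> (FObj F A) \<cdot>\<^bsub>D\<^esub> FArr F (\<eta> A) = Ide D (FObj F A)" if "A \<in> Obj C" for A
    using that by (simp_all add: \<eta>_def)
  have GO [simp]: "FObj G = U"
    by (simp add: G_def)
  have GA [simp]: "FArr G k \<in> Arr C" "Dom C (FArr G k) = U (Dom D k)" "Cod C (FArr G k) = U (Cod D k)"
    "\<epsilon> (Cod D k) \<cdot>\<^bsub>D\<^esub> FArr F (FArr G k) = k \<cdot>\<^bsub>D\<^esub> \<epsilon> (Dom D k)" if "k \<in> Arr D" for k
    using that by (simp_all add: G_def)
  have \<epsilon>F: "\<epsilon> P \<cdot>\<^bsub>D\<^esub> FArr F (h \<cdot>\<^bsub>C\<^esub> h') = (\<epsilon> P \<cdot>\<^bsub>D\<^esub> FArr F h) \<cdot>\<^bsub>D\<^esub> FArr F h'"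
    if "P \<in> Obj D" "h \<in> Arr C" "h' \<in> Arr C" "Cod C h = U P" "Dom C h = Cod C h'" for P h h'
    using that by simp
  have GF: "is_functor D C G"
    unfolding is_functor_def
  proof (intro conjI ballI allI)
    fix P assume P: "P \<in> Obj D"
    then show "FArr G (Ide D P) = Ide C (FObj G P)"
      using GA(4)[of "Ide D P"] by (intro ext[of P]) auto
  next
    fix P Q R k l assume "k \<in> Hom D P Q" "l \<in> Hom D Q R"
    then have [simp]: "k \<in> Arr D" "l \<in> Arr D" "Dom D k = P" "Cod D k = Q" "Dom D l = Q" "Cod D l = R"
      by (auto simp: Hom_def)
    have [simp]: "P \<in> Obj D" "Q \<in> Obj D" "R \<in> Obj D"
      using D.Obj_Dom[of k] D.Obj_Dom[of l] D.Obj_Cod[of l] by auto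
    show "FArr G (l \<cdot>\<^bsub>D\<^esub> k) = FArr G l \<cdot>\<^bsub>C\<^esub> FArr G k"
    proof (rule ext[of R])
      show "\<epsilon> R \<cdot>\<^bsub>D\<^esub> FArr F (FArr G (l \<cdot>\<^bsub>D\<^esub> k)) = \<epsilon> R \<cdot>\<^bsub>D\<^esub> FArr F (FArr G l \<cdot>\<^bsub>C\<^esub> FArr G k)"
        using GA(4)[of "l \<cdot>\<^bsub>D\<^esub> k"] GA(4)[of l] GA(4)[of k]
        by (simp add: \<epsilon>F del: functor_simps(6)[OF F])
    qed auto
  qed (auto simp: Hom_def)
  have "adjunction C D F G \<eta> \<epsilon>"
    unfolding adjunction_def
  proof (intro conjI ballI)
    show "natural C C Id_func (comp_func G F) \<eta>"
      unfolding natural_def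
    proof (intro conjI ballI allI)
      fix A B h assume "h \<in> Hom C A B"
      then have [simp]: "h \<in> Arr C" "Dom C h = A" "Cod C h = B"
        by (auto simp: Hom_def)
      have [simp]: "A \<in> Obj C" "B \<in> Obj C"
        using C.Obj_Dom[of h] C.Obj_Cod[of h] by auto
      have "FArr G (FArr F h) \<cdot>\<^bsub>C\<^esub> \<eta> A = \<eta> B \<cdot>\<^bsub>C\<^esub> h"
      proof (rule ext[of "FObj F B"])
        show "\<epsilon> (FObj F B) \<cdot>\<^bsub>D\<^esub> FArr F (FArr G (FArr F h) \<cdot>\<^bsub>C\<^esub> \<eta> A) =
          \<epsilon> (FObj F B) \<cdot>\<^bsub>D\<^esub> FArr F (\<eta> B \<cdot>\<^bsub>C\<^esub> h)"
          using GA(4)[of "FArr F h"] by (simp add: \<epsilon>F del: functor_simps(6)[OF F])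
      qed auto
      then show "FArr (comp_func G F) h \<cdot>\<^bsub>C\<^esub> \<eta> A = \<eta> B \<cdot>\<^bsub>C\<^esub> FArr Id_func h"
        by (simp add: comp_func_def Id_func_def)
    qed (auto simp: comp_func_def Id_func_def Hom_def)
    show "natural D D (comp_func F G) Id_func \<epsilon>"
      using GA(4) by (auto simp: natural_def comp_func_def Id_func_def Hom_def)
  next
    fix P assume P: "P \<in> Obj D"
    show "FArr G (\<epsilon> P) \<cdot>\<^bsub>C\<^esub> \<eta> (FObj G P) = Ide C (FObj G P)"
      using P GA(4)[of "\<epsilon> P"] by (intro ext[of P]) (auto simp: \<epsilon>F simp del: functor_simps(6)[OF F])
  qed (use F GF in auto)
  then show ?thesis by blast
qed

text \<open>
  The arrow \<open>G k\<close> is the transpose of \<open>k \<cdot> \<epsilon> P\<close>, so \<open>G\<close> is bijective on arrows out of \<open>P\<close> when precomposition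
  with \<open>\<epsilon> P\<close> is.  Conversely the preimage under \<open>G\<close> of the unit at \<open>G P\<close> is inverse to \<open>\<epsilon> P\<close>.
\<close>

lemma fully_faithful_iff_counit_iso:
  assumes adj: "adjunction C D F G \<eta> \<epsilon>"
  shows "fully_faithful D C G \<longleftrightarrow> (\<forall>P \<in> Obj D. is_iso D (\<epsilon> P))"
proof -
  have F: "is_functor C D F" and G: "is_functor D C G"
    using adj by (auto simp: adjunction_def)
  note [simp] = functor_simps[OF F] functor_simps[OF G]
  have \<epsilon> [simp]: "\<epsilon> Q \<in> Arr D" "Dom D (\<epsilon> Q) = FObj F (FObj G Q)" "Cod D (\<epsilon> Q) = Q"
    if "Q \<in> Obj D" for Q
    using adj that by (auto simp: adjunction_def natural_def comp_func_def Id_func_def Hom_def)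
  have \<eta> [simp]: "\<eta> A \<in> Arr C" "Cod C (\<eta> A) = FObj G (FObj F A)" "Dom C (\<eta> A) = A" if "A \<in> Obj C" for A
    using adj that by (auto simp: adjunction_def natural_def comp_func_def Id_func_def Hom_def)
  have \<epsilon>nat: "\<epsilon> (Cod D k) \<cdot>\<^bsub>D\<^esub> FArr F (FArr G k) = k \<cdot>\<^bsub>D\<^esub> \<epsilon> (Dom D k)" if "k \<in> Arr D" for k
    using adj that by (auto simp: adjunction_def natural_def comp_func_def Id_func_def Hom_def)
  show ?thesis
  proof (intro iffI ballI)
    fix P assume ff: "fully_faithful D C G" and P: "P \<in> Obj D"
    let ?Q = "FObj F (FObj G P)"
    have bij: "bij_betw (FArr G) (Hom D P' Q') (Hom C (FObj G P') (FObj G Q'))"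
      if "P' \<in> Obj D" "Q' \<in> Obj D" for P' Q'
      using ff that by (auto simp: fully_faithful_def)
    have "\<eta> (FObj G P) \<in> FArr G ` Hom D P ?Q"
      using bij[of P ?Q] P by (auto simp: bij_betw_def Hom_def)
    then obtain k where k [simp]: "k \<in> Arr D" "Dom D k = P" "Cod D k = ?Q" and Gk: "FArr G k = \<eta> (FObj G P)"
      by (auto simp: Hom_def)
    have 1: "k \<cdot>\<^bsub>D\<^esub> \<epsilon> P = Ide D ?Q"
      using \<epsilon>nat[of k] P adj by (auto simp: Gk adjunction_def)
    have "FArr G (\<epsilon> P \<cdot>\<^bsub>D\<^esub> k) = FArr G (Ide D P)"
      using P adj by (simp add: Gk adjunction_def)
    then have "\<epsilon> P \<cdot>\<^bsub>D\<^esub> k = Ide D P"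
      using bij[of P P] P by (auto simp: bij_betw_def inj_on_def Hom_def)
    then show "is_iso D (\<epsilon> P)"
      using 1 P by (intro D.is_isoI[of _ k]) auto
  next
    assume iso: "\<forall>P \<in> Obj D. is_iso D (\<epsilon> P)"
    show "fully_faithful D C G"
      unfolding fully_faithful_def
    proof (intro ballI)
      fix P Q assume P: "P \<in> Obj D" and Q: "Q \<in> Obj D"
      show "bij_betw (FArr G) (Hom D P Q) (Hom C (FObj G P) (FObj G Q))"
        unfolding bij_betw_def
      proof (intro conjI inj_onI set_eqI iffI)
        fix k l assume kl: "k \<in> Hom D P Q" "l \<in> Hom D P Q" "FArr G k = FArr G l"
        then have "k \<cdot>\<^bsub>D\<^esub> \<epsilon> P = l \<cdot>\<^bsub>D\<^esub> \<epsilon> P"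
          using \<epsilon>nat[of k] \<epsilon>nat[of l] by (auto simp: Hom_def)
        then show "k = l"
          using kl iso P by (intro D.iso_epi[of "\<epsilon> P" k l]) (auto simp: Hom_def)
      next
        fix h assume h: "h \<in> Hom C (FObj G P) (FObj G Q)"
        then have [simp]: "h \<in> Arr C" "Dom C h = FObj G P" "Cod C h = FObj G Q"
          by (auto simp: Hom_def)
        have [simp]: "is_iso D (\<epsilon> P)"
          using iso P by simp
        define k where "k = \<epsilon> Q \<cdot>\<^bsub>D\<^esub> (FArr F h \<cdot>\<^bsub>D\<^esub> Inv D (\<epsilon> P))"
        have [simp]: "k \<in> Arr D" "Dom D k = P" "Cod D k = Q"
          using P Q by (auto simp: k_def)
        have "\<epsilon> Q \<cdot>\<^bsub>D\<^esub> FArr F (FArr G k) = \<epsilon> Q \<cdot>\<^bsub>D\<^esub> FArr F h"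
          using \<epsilon>nat[of k] P Q by (simp add: k_def)
        moreover have "\<epsilon> Q \<cdot>\<^bsub>D\<^esub> FArr F h \<in> Hom D (FObj F (FObj G P)) Q"
          using P Q by (auto simp: Hom_def)
        ultimately have "FArr G k = h"
          using couniversalD[OF adjunction_couniversal[OF adj Q] C F D, of h "FArr G k"] P Q by simp
        then show "h \<in> FArr G ` Hom D P Q"
          by (auto simp: Hom_def intro!: image_eqI[of _ _ k])
      qed (auto simp: Hom_def)
    qed
  qed
qed

end

section \<open>Finite products\<close>

lemma (in category) pairing_simps:
  assumes "is_product C A B P p q" "f \<in> Arr C" "g \<in> Arr C" "Dom C f = Dom C g" "Cod C f = A" "Cod C g = B"
  shows "pairing C P p q f g \<in> Arr C" "Dom C (pairing C P p q f g) = Dom C g"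
    "Cod C (pairing C P p q f g) = P" "p \<cdot> pairing C P p q f g = f" "q \<cdot> pairing C P p q f g = g"
proof -
  have ex: "\<exists>!h. h \<in> Hom C (Dom C f) P \<and> p \<cdot> h = f \<and> q \<cdot> h = g"
  proof -
    have "f \<in> Hom C (Dom C f) A" "g \<in> Hom C (Dom C f) B"
      using assms(2-) by (auto simp: Hom_def)
    then show ?thesis
      using assms(1) unfolding is_product_def by blast
  qed
  have "pairing C P p q f g \<in> Hom C (Dom C f) P \<and> p \<cdot> pairing C P p q f g = f \<and> q \<cdot> pairing C P p q f g = g"
    unfolding pairing_def by (rule theI'[OF ex])
  then show "pairing C P p q f g \<in> Arr C" "Dom C (pairing C P p q f g) = Dom C g"
    "Cod C (pairing C P p q f g) = P" "p \<cdot> pairing C P p q f g = f" "q \<cdot> pairing C P p q f g = g"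
    using assms(4) by (auto simp: Hom_def)
qed

lemma (in category) is_product_ext:
  assumes "is_product C A B P p q" "h \<in> Arr C" "k \<in> Arr C" "Cod C h = P" "Cod C k = P" "Dom C h = Dom C k"
    "p \<cdot> h = p \<cdot> k" "q \<cdot> h = q \<cdot> k"
  shows "h = k"
proof -
  have "p \<cdot> k \<in> Hom C (Dom C k) A" "q \<cdot> k \<in> Hom C (Dom C k) B"
    using assms(1-5) by (auto simp: Hom_def is_product_def)
  then have "\<exists>!x. x \<in> Hom C (Dom C k) P \<and> p \<cdot> x = p \<cdot> k \<and> q \<cdot> x = q \<cdot> k"
    using assms(1) unfolding is_product_def by blast
  then show ?thesis
    using assms by (auto simp: Hom_def)
qed

context finite_product_category
begin

lemma Pr_simps [simp]:
  assumes "A \<in> Obj C" "B \<in> Obj C"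
  shows "Pr1 C A B \<in> Arr C" "Dom C (Pr1 C A B) = A \<otimes> B" "Cod C (Pr1 C A B) = A"
    "Pr2 C A B \<in> Arr C" "Dom C (Pr2 C A B) = A \<otimes> B" "Cod C (Pr2 C A B) = B"
  using product[OF assms] by (auto simp: is_product_def Hom_def)

lemma Obj_Prod [simp]: "\<lbrakk>A \<in> Obj C; B \<in> Obj C\<rbrakk> \<Longrightarrow> A \<otimes> B \<in> Obj C"
  using Obj_Dom[of "Pr1 C A B"] by simp

lemma tuple_simps [simp]:
  assumes "f \<in> Arr C" "g \<in> Arr C" "Dom C f = Dom C g"
  shows "tuple C f g \<in> Arr C" "Dom C (tuple C f g) = Dom C g" "Cod C (tuple C f g) = Cod C f \<otimes> Cod C g"
    "\<lbrakk>A = Cod C f; B = Cod C g\<rbrakk> \<Longrightarrow> Pr1 C A B \<cdot> tuple C f g = f"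
    "\<lbrakk>A = Cod C f; B = Cod C g\<rbrakk> \<Longrightarrow> Pr2 C A B \<cdot> tuple C f g = g"
  unfolding tuple_def
  using pairing_simps[OF product[of "Cod C f" "Cod C g"] assms] assms by auto

lemma tuple_ext:
  assumes "h \<in> Arr C" "k \<in> Arr C" "A \<in> Obj C" "B \<in> Obj C" "Cod C h = A \<otimes> B" "Cod C k = A \<otimes> B"
    "Dom C h = Dom C k" "Pr1 C A B \<cdot> h = Pr1 C A B \<cdot> k" "Pr2 C A B \<cdot> h = Pr2 C A B \<cdot> k"
  shows "h = k"
  using is_product_ext[OF product[OF assms(3,4)]] assms by auto

lemma tuple_Comp [simp]:
  assumes "f \<in> Arr C" "g \<in> Arr C" "h \<in> Arr C" "Dom C f = Cod C h" "Dom C g = Cod C h"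
  shows "tuple C f g \<cdot> h = tuple C (f \<cdot> h) (g \<cdot> h)"
proof (rule tuple_ext[where A = "Cod C f" and B = "Cod C g"])
  show "Pr1 C (Cod C f) (Cod C g) \<cdot> (tuple C f g \<cdot> h) = Pr1 C (Cod C f) (Cod C g) \<cdot> tuple C (f \<cdot> h) (g \<cdot> h)"
    using Comp_assoc_Arr[of h "tuple C f g" "Pr1 C (Cod C f) (Cod C g)"] assms
    by (simp del: Comp_assoc_Arr)
  show "Pr2 C (Cod C f) (Cod C g) \<cdot> (tuple C f g \<cdot> h) = Pr2 C (Cod C f) (Cod C g) \<cdot> tuple C (f \<cdot> h) (g \<cdot> h)"
    using Comp_assoc_Arr[of h "tuple C f g" "Pr2 C (Cod C f) (Cod C g)"] assms
    by (simp del: Comp_assoc_Arr)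
qed (use assms in auto)

lemma tuple_eta [simp]:
  assumes "h \<in> Arr C" "A \<in> Obj C" "B \<in> Obj C" "Cod C h = A \<otimes> B"
  shows "tuple C (Pr1 C A B \<cdot> h) (Pr2 C A B \<cdot> h) = h"
  by (rule tuple_ext[where A = A and B = B]) (use assms in auto)

lemma tuple_Pr [simp]:
  "\<lbrakk>A \<in> Obj C; B \<in> Obj C\<rbrakk> \<Longrightarrow> tuple C (Pr1 C A B) (Pr2 C A B) = Ide C (A \<otimes> B)"
  by (rule tuple_ext[where A = A and B = B]) auto

lemma prod_map_simps [simp]:
  assumes "f \<in> Arr C" "g \<in> Arr C"
  shows "prod_map C f g \<in> Arr C" "Dom C (prod_map C f g) = Dom C f \<otimes> Dom C g"
    "Cod C (prod_map C f g) = Cod C f \<otimes> Cod C g"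
  using assms by (auto simp: prod_map_def)

lemma diag_simps [simp]:
  assumes "X \<in> Obj C"
  shows "diag C X \<in> Arr C" "Dom C (diag C X) = X" "Cod C (diag C X) = X \<otimes> X"
  using assms by (auto simp: diag_def)

lemma Obj_Term [simp]: "Term C \<in> Obj C"
  using terminal by (simp add: is_terminal_def)

lemma proj_simps [simp]:
  assumes "X \<in> Obj C" "Y \<in> Obj C" "Z \<in> Obj C"
  shows "p12 C X Y Z \<in> Arr C" "Dom C (p12 C X Y Z) = (X \<otimes> Y) \<otimes> Z" "Cod C (p12 C X Y Z) = X \<otimes> Y"
    "p23 C X Y Z \<in> Arr C" "Dom C (p23 C X Y Z) = (X \<otimes> Y) \<otimes> Z" "Cod C (p23 C X Y Z) = Y \<otimes> Z"
    "p13 C X Y Z \<in> Arr C" "Dom C (p13 C X Y Z) = (X \<otimes> Y) \<otimes> Z" "Cod C (p13 C X Y Z) = X \<otimes> Z"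
  using assms by (auto simp: p12_def p13_def p23_def)

lemmas proj_defs = p12_def p13_def p23_def diag_def prod_map_def

end

section \<open>The total category\<close>

text \<open>
  An arrow \<open>(f, \<phi>, C)\<close> does not mention its source, which is recovered as the domain of \<open>\<phi>\<close>.
\<close>

definition tot :: "('o, 'a, 'p, 'q) fibration \<Rightarrow> ('o \<times> 'p, ('a, 'p, 'q) over) cat" where
  "tot E =
     \<lparr>Obj = {(X, A). X \<in> Obj (base E) \<and> A \<in> Obj (fib E X)},
      Arr = {(f, \<phi>, C). f \<in> Arr (base E) \<and> C \<in> Obj (fib E (Cod (base E) f)) \<and>
               \<phi> \<in> Arr (fib E (Dom (base E) f)) \<and>
               Cod (fib E (Dom (base E) f)) \<phi> = FObj (pull E f) C},
      Dom = (\<lambda>(f, \<phi>, C). (Dom (base E) f, Dom (fib E (Dom (base E) f)) \<phi>)),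
      Cod = (\<lambda>(f, \<phi>, C). (Cod (base E) f, C)),
      Ide = (\<lambda>(X, A). over_id E X A),
      Comp = over_comp E\<rparr>"

context indexed_category
begin

abbreviation base_comp (infixr "\<bullet>" 70) where "g \<bullet> f \<equiv> g \<cdot>\<^bsub>base E\<^esub> f"
abbreviation total_comp (infixr "\<star>" 70) where "l \<star> k \<equiv> l \<cdot>\<^bsub>tot E\<^esub> k"
abbreviation base_cat ("\<B>") where "\<B> \<equiv> base E"
abbreviation total_cat ("\<T>") where "\<T> \<equiv> tot E"

lemmas fib_simps [simp] =
  category.Arr_Comp[OF fib_category] category.Dom_Comp[OF fib_category] category.Cod_Comp[OF fib_category]
  category.Arr_Ide[OF fib_category] category.Dom_Ide[OF fib_category] category.Cod_Ide[OF fib_category]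
  category.Obj_Dom[OF fib_category] category.Obj_Cod[OF fib_category]
  category.Comp_Ide_right[OF fib_category] category.Comp_Ide_left[OF fib_category]
  category.Comp_assoc_Arr[OF fib_category] category.Inv_simps[OF fib_category]
  category.Inv_cancel[OF fib_category] category.is_iso_Ide[OF fib_category]

end

sublocale indexed_category \<subseteq> B: category "base E"
  by (rule base_category)

context indexed_category
begin

lemma pull_simps [simp]:
  assumes "f \<in> Arr \<B>" "X = Dom \<B> f"
  shows "A \<in> Obj (fib E (Cod \<B> f)) \<Longrightarrow> FObj (pull E f) A \<in> Obj (fib E X)"
    and "\<phi> \<in> Arr (fib E (Cod \<B> f)) \<Longrightarrow> FArr (pull E f) \<phi> \<in> Arr (fib E X)"
    and "\<phi> \<in> Arr (fib E (Cod \<B> f)) \<Longrightarrow>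
         Dom (fib E X) (FArr (pull E f) \<phi>) = FObj (pull E f) (Dom (fib E (Cod \<B> f)) \<phi>)"
    and "\<phi> \<in> Arr (fib E (Cod \<B> f)) \<Longrightarrow>
         Cod (fib E X) (FArr (pull E f) \<phi>) = FObj (pull E f) (Cod (fib E (Cod \<B> f)) \<phi>)"
  using functor_simps[OF pull_functor[of f "Dom \<B> f" "Cod \<B> f"]] assms by (auto simp: Hom_def)

lemma pull_Comp:
  assumes "f \<in> Arr \<B>" "X = Dom \<B> f" "Y = Cod \<B> f"
    and "\<phi> \<in> Arr (fib E Y)" "\<psi> \<in> Arr (fib E Y)" "Dom (fib E Y) \<psi> = Cod (fib E Y) \<phi>"
  shows "FArr (pull E f) (\<psi> \<cdot>\<^bsub>fib E Y\<^esub> \<phi>) = FArr (pull E f) \<psi> \<cdot>\<^bsub>fib E X\<^esub> FArr (pull E f) \<phi>"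
  using functor_simps[OF pull_functor[of f "Dom \<B> f" "Cod \<B> f"]] assms by (auto simp: Hom_def)

lemma pull_Ide:
  assumes "f \<in> Arr \<B>" "X = Dom \<B> f" "Y = Cod \<B> f" "A \<in> Obj (fib E Y)"
  shows "FArr (pull E f) (Ide (fib E Y) A) = Ide (fib E X) (FObj (pull E f) A)"
  using functor_simps[OF pull_functor[of f "Dom \<B> f" "Cod \<B> f"]] assms by (auto simp: Hom_def)

lemma pull_comp_simps [simp]:
  assumes "f \<in> Arr \<B>" "g \<in> Arr \<B>" "Dom \<B> g = Cod \<B> f" "X = Dom \<B> f" "A \<in> Obj (fib E (Cod \<B> g))"
  shows "is_iso (fib E X) (pull_comp E f g A)" "pull_comp E f g A \<in> Arr (fib E X)"
    "Dom (fib E X) (pull_comp E f g A) = FObj (pull E f) (FObj (pull E g) A)"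
    "Cod (fib E X) (pull_comp E f g A) = FObj (pull E (g \<bullet> f)) A"
  using pull_comp_iso[of f "Dom \<B> f" "Cod \<B> f" g "Cod \<B> g"] assms
  by (auto simp: Hom_def natural_iso_def natural_def comp_func_def)

lemma pull_comp_natural:
  assumes "f \<in> Arr \<B>" "g \<in> Arr \<B>" "Dom \<B> g = Cod \<B> f" "X = Dom \<B> f" "Z = Cod \<B> g" "\<phi> \<in> Arr (fib E Z)"
  shows "pull_comp E f g (Cod (fib E Z) \<phi>) \<cdot>\<^bsub>fib E X\<^esub> FArr (pull E f) (FArr (pull E g) \<phi>) =
    FArr (pull E (g \<bullet> f)) \<phi> \<cdot>\<^bsub>fib E X\<^esub> pull_comp E f g (Dom (fib E Z) \<phi>)"
  using pull_comp_iso[of f "Dom \<B> f" "Cod \<B> f" g "Cod \<B> g"] assms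
  by (auto simp: Hom_def natural_iso_def natural_def comp_func_def)

lemma pull_id_simps [simp]:
  assumes "X \<in> Obj \<B>" "A \<in> Obj (fib E X)"
  shows "is_iso (fib E X) (pull_id E X A)" "pull_id E X A \<in> Arr (fib E X)"
    "Dom (fib E X) (pull_id E X A) = A"
    "Cod (fib E X) (pull_id E X A) = FObj (pull E (Ide \<B> X)) A"
  using pull_id_iso[of X] assms
  by (auto simp: Hom_def natural_iso_def natural_def Id_func_def)

lemma pull_id_natural:
  assumes "X \<in> Obj \<B>" "\<phi> \<in> Arr (fib E X)"
  shows "FArr (pull E (Ide \<B> X)) \<phi> \<cdot>\<^bsub>fib E X\<^esub> pull_id E X (Dom (fib E X) \<phi>) =
    pull_id E X (Cod (fib E X) \<phi>) \<cdot>\<^bsub>fib E X\<^esub> \<phi>"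
  using pull_id_iso[of X] assms
  by (auto simp: Hom_def natural_iso_def natural_def Id_func_def)

lemma tot_simps:
  "Obj \<T> = {(X, A). X \<in> Obj \<B> \<and> A \<in> Obj (fib E X)}"
  "(f, \<phi>, C) \<in> Arr \<T> \<longleftrightarrow> f \<in> Arr \<B> \<and> C \<in> Obj (fib E (Cod \<B> f)) \<and>
     \<phi> \<in> Arr (fib E (Dom \<B> f)) \<and> Cod (fib E (Dom \<B> f)) \<phi> = FObj (pull E f) C"
  "Dom \<T> (f, \<phi>, C) = (Dom \<B> f, Dom (fib E (Dom \<B> f)) \<phi>)"
  "Cod \<T> (f, \<phi>, C) = (Cod \<B> f, C)"
  "Ide \<T> (X, A) = (Ide \<B> X, pull_id E X A, A)"
  "(g, \<psi>, D) \<star> (f, \<phi>, C) =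
     (g \<bullet> f, pull_comp E f g D \<cdot>\<^bsub>fib E (Dom \<B> f)\<^esub> (FArr (pull E f) \<psi> \<cdot>\<^bsub>fib E (Dom \<B> f)\<^esub> \<phi>), D)"
  by (simp_all add: tot_def over_comp_def over_id_def Let_def)

text \<open>
  The category laws are the coherence conditions of the pseudofunctor, together with the naturality
  of its structural isomorphisms.
\<close>

lemma tot_category: "category \<T>"
proof -
  have typing: "(g, \<psi>, D) \<star> (f, \<phi>, C) \<in> Arr \<T>" "Dom \<T> ((g, \<psi>, D) \<star> (f, \<phi>, C)) = Dom \<T> (f, \<phi>, C)"
    "Cod \<T> ((g, \<psi>, D) \<star> (f, \<phi>, C)) = Cod \<T> (g, \<psi>, D)"
    if "(g, \<psi>, D) \<in> Arr \<T>" "(f, \<phi>, C) \<in> Arr \<T>" "Dom \<T> (g, \<psi>, D) = Cod \<T> (f, \<phi>, C)" for f \<phi> C g \<psi> D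
    using that by (auto simp: tot_simps)
  have assoc: "((h, \<chi>, D) \<star> (g, \<psi>, C)) \<star> (f, \<phi>, A) = (h, \<chi>, D) \<star> ((g, \<psi>, C) \<star> (f, \<phi>, A))"
    if "(h, \<chi>, D) \<in> Arr \<T>" "(g, \<psi>, C) \<in> Arr \<T>" "(f, \<phi>, A) \<in> Arr \<T>"
      "Dom \<T> (h, \<chi>, D) = Cod \<T> (g, \<psi>, C)" "Dom \<T> (g, \<psi>, C) = Cod \<T> (f, \<phi>, A)"
    for f \<phi> A g \<psi> C h \<chi> D
  proof -
    let ?X = "Dom \<B> f" let ?Y = "Dom \<B> g"
    note t = that[unfolded tot_simps, simplified]
    have [simp]: "f \<in> Arr \<B>" "g \<in> Arr \<B>" "h \<in> Arr \<B>" "Cod \<B> f = ?Y" "Dom \<B> h = Cod \<B> g"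
      "\<phi> \<in> Arr (fib E ?X)" "\<psi> \<in> Arr (fib E ?Y)" "\<chi> \<in> Arr (fib E (Cod \<B> g))" "D \<in> Obj (fib E (Cod \<B> h))"
      "C \<in> Obj (fib E (Cod \<B> g))" "A = Dom (fib E ?Y) \<psi>" 
      "Cod (fib E ?X) \<phi> = FObj (pull E f) (Dom (fib E ?Y) \<psi>)"
      "Cod (fib E ?Y) \<psi> = FObj (pull E g) C" "Cod (fib E (Cod \<B> g)) \<chi> = FObj (pull E h) D"
      "Dom (fib E (Cod \<B> g)) \<chi> = C"
      using t by auto
    have nat: "pull_comp E f g (FObj (pull E h) D) \<cdot>\<^bsub>fib E ?X\<^esub> FArr (pull E f) (FArr (pull E g) \<chi>) =
        FArr (pull E (g \<bullet> f)) \<chi> \<cdot>\<^bsub>fib E ?X\<^esub> pull_comp E f g C"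
      using pull_comp_natural[of f g ?X "Cod \<B> g" \<chi>] by simp
    let ?r = "FArr (pull E f) \<psi> \<cdot>\<^bsub>fib E ?X\<^esub> \<phi>"
    have "pull_comp E f (h \<bullet> g) D \<cdot>\<^bsub>fib E ?X\<^esub>
        (FArr (pull E f) (pull_comp E g h D \<cdot>\<^bsub>fib E ?Y\<^esub> (FArr (pull E g) \<chi> \<cdot>\<^bsub>fib E ?Y\<^esub> \<psi>)) \<cdot>\<^bsub>fib E ?X\<^esub> \<phi>) =
      (pull_comp E f (h \<bullet> g) D \<cdot>\<^bsub>fib E ?X\<^esub> FArr (pull E f) (pull_comp E g h D)) \<cdot>\<^bsub>fib E ?X\<^esub>
        (FArr (pull E f) (FArr (pull E g) \<chi>) \<cdot>\<^bsub>fib E ?X\<^esub> ?r)"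
      by (simp add: pull_Comp)
    also have "\<dots> = (pull_comp E (g \<bullet> f) h D \<cdot>\<^bsub>fib E ?X\<^esub> pull_comp E f g (FObj (pull E h) D)) \<cdot>\<^bsub>fib E ?X\<^esub>
        (FArr (pull E f) (FArr (pull E g) \<chi>) \<cdot>\<^bsub>fib E ?X\<^esub> ?r)"
      using pull_comp_assoc[of f ?X ?Y g "Cod \<B> g" h "Cod \<B> h" D] by (simp add: Hom_def del: fib_simps)
    also have "\<dots> = pull_comp E (g \<bullet> f) h D \<cdot>\<^bsub>fib E ?X\<^esub>
       ((pull_comp E f g (FObj (pull E h) D) \<cdot>\<^bsub>fib E ?X\<^esub> FArr (pull E f) (FArr (pull E g) \<chi>)) \<cdot>\<^bsub>fib E ?X\<^esub> ?r)"
      by simp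
    also have "\<dots> = pull_comp E (g \<bullet> f) h D \<cdot>\<^bsub>fib E ?X\<^esub>
       (FArr (pull E (g \<bullet> f)) \<chi> \<cdot>\<^bsub>fib E ?X\<^esub> (pull_comp E f g C \<cdot>\<^bsub>fib E ?X\<^esub> ?r))"
      unfolding nat by simp
    finally show ?thesis
      by (simp add: tot_simps)
  qed
  have unit: "(f, \<phi>, C) \<star> Ide \<T> (Dom \<T> (f, \<phi>, C)) = (f, \<phi>, C)"
    "Ide \<T> (Cod \<T> (f, \<phi>, C)) \<star> (f, \<phi>, C) = (f, \<phi>, C)" if "(f, \<phi>, C) \<in> Arr \<T>" for f \<phi> C
  proof -
    let ?X = "Dom \<B> f"
    have t [simp]: "f \<in> Arr \<B>" "C \<in> Obj (fib E (Cod \<B> f))" "\<phi> \<in> Arr (fib E ?X)"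
      "Cod (fib E ?X) \<phi> = FObj (pull E f) C"
      using that by (auto simp: tot_simps)
    have "pull_comp E (Ide \<B> ?X) f C \<cdot>\<^bsub>fib E ?X\<^esub>
        (FArr (pull E (Ide \<B> ?X)) \<phi> \<cdot>\<^bsub>fib E ?X\<^esub> pull_id E ?X (Dom (fib E ?X) \<phi>)) =
      (pull_comp E (Ide \<B> ?X) f C \<cdot>\<^bsub>fib E ?X\<^esub> pull_id E ?X (FObj (pull E f) C)) \<cdot>\<^bsub>fib E ?X\<^esub> \<phi>"
      using pull_id_natural[of ?X \<phi>] by simp
    also have "\<dots> = \<phi>"
      using pull_comp_id_right[of f ?X "Cod \<B> f" C] by (simp add: Hom_def del: category.Comp_assoc_Arr[OF fib_category])
    finally show "(f, \<phi>, C) \<star> Ide \<T> (Dom \<T> (f, \<phi>, C)) = (f, \<phi>, C)"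
      by (simp add: tot_simps)
    have "pull_comp E f (Ide \<B> (Cod \<B> f)) C \<cdot>\<^bsub>fib E ?X\<^esub> (FArr (pull E f) (pull_id E (Cod \<B> f) C) \<cdot>\<^bsub>fib E ?X\<^esub> \<phi>) =
      (pull_comp E f (Ide \<B> (Cod \<B> f)) C \<cdot>\<^bsub>fib E ?X\<^esub> FArr (pull E f) (pull_id E (Cod \<B> f) C)) \<cdot>\<^bsub>fib E ?X\<^esub> \<phi>"
      by simp
    also have "\<dots> = \<phi>"
      using pull_comp_id_left[of f ?X "Cod \<B> f" C] by (simp add: Hom_def del: category.Comp_assoc_Arr[OF fib_category])
    finally show "Ide \<T> (Cod \<T> (f, \<phi>, C)) \<star> (f, \<phi>, C) = (f, \<phi>, C)"
      by (simp add: tot_simps)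
  qed
  show ?thesis
  proof
    fix k assume "k \<in> Arr \<T>" then show "Dom \<T> k \<in> Obj \<T>" "Cod \<T> k \<in> Obj \<T>"
      by (cases k; auto simp: tot_simps)+
  next
    fix A assume "A \<in> Obj \<T>" then show "Ide \<T> A \<in> Hom \<T> A A"
      by (auto simp: tot_simps Hom_def)
  next
    fix k l X Y Z assume "k \<in> Hom \<T> X Y" "l \<in> Hom \<T> Y Z"
    then show "l \<star> k \<in> Hom \<T> X Z"
      by (cases k; cases l) (simp add: Hom_def typing)
  next
    fix k X Y assume "k \<in> Hom \<T> X Y"
    then show "k \<star> Ide \<T> X = k" "Ide \<T> Y \<star> k = k"
      by (cases k; auto simp: Hom_def unit)+
  next
    fix k l m W X Y Z assume "k \<in> Hom \<T> W X" "l \<in> Hom \<T> X Y" "m \<in> Hom \<T> Y Z"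
    then show "(m \<star> l) \<star> k = m \<star> (l \<star> k)"
      by (cases k; cases l; cases m) (simp add: Hom_def assoc)
  qed
qed

end

sublocale indexed_category \<subseteq> T: category "tot E"
  by (rule tot_category)

(* Arrows of the total category are triples, which should not be taken apart under quantifiers. *)
declare split_paired_Ex [simp del] split_paired_All [simp del]

text \<open>
  The inclusion of the fibre over \<open>X\<close> into the total category; the correction by \<open>pull_id\<close> is needed
  because reindexing along an identity is only isomorphic to the identity.
\<close>

definition vert :: "('o, 'a, 'p, 'q) fibration \<Rightarrow> 'o \<Rightarrow> 'q \<Rightarrow> ('a, 'p, 'q) over" where
  "vert E X \<phi> =
     (Ide (base E) X, pull_id E X (Cod (fib E X) \<phi>) \<cdot>\<^bsub>fib E X\<^esub> \<phi>, Cod (fib E X) \<phi>)"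

context indexed_category
begin

lemma fst_total_comp [simp]: "fst (l \<star> k) = fst l \<bullet> fst k"
  by (cases k; cases l) (simp add: tot_simps)

lemma fst_total_Ide [simp]: "fst (Ide \<T> A) = Ide \<B> (fst A)"
  by (cases A) (simp add: tot_simps)

lemma fst_Arr [simp]:
  assumes "k \<in> Arr \<T>"
  shows "fst k \<in> Arr \<B>" "Dom \<B> (fst k) = fst (Dom \<T> k)" "Cod \<B> (fst k) = fst (Cod \<T> k)"
  using assms by (cases k; simp add: tot_simps)+

lemma Obj_total [simp]: "(X, A) \<in> Obj \<T> \<longleftrightarrow> X \<in> Obj \<B> \<and> A \<in> Obj (fib E X)"
  by (simp add: tot_simps)

lemma Dom_total_Obj:
  assumes "k \<in> Arr \<T>" "Dom \<T> k = (X, A)"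
  shows "X \<in> Obj \<B>" "A \<in> Obj (fib E X)"
  using T.Obj_Dom[OF assms(1)] assms(2) by auto

lemma Cod_total_Obj:
  assumes "k \<in> Arr \<T>" "Cod \<T> k = (Y, C)"
  shows "Y \<in> Obj \<B>" "C \<in> Obj (fib E Y)"
  using T.Obj_Cod[OF assms(1)] assms(2) by auto

lemma Obj_total_fst [simp]: "A \<in> Obj \<T> \<Longrightarrow> fst A \<in> Obj \<B>"
  and Obj_total_snd [simp]: "A \<in> Obj \<T> \<Longrightarrow> X = fst A \<Longrightarrow> snd A \<in> Obj (fib E X)"
  by (cases A; simp)+

subsection \<open>Vertical arrows\<close>

lemma vert_simps [simp]:
  assumes "X \<in> Obj \<B>" "\<phi> \<in> Arr (fib E X)"
  shows "vert E X \<phi> \<in> Arr \<T>" "Dom \<T> (vert E X \<phi>) = (X, Dom (fib E X) \<phi>)"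
    "Cod \<T> (vert E X \<phi>) = (X, Cod (fib E X) \<phi>)"
  using assms by (simp_all add: vert_def tot_simps)

lemma fst_vert [simp]: "fst (vert E X \<phi>) = Ide \<B> X"
  by (simp add: vert_def)

lemma vert_Comp:
  assumes "X \<in> Obj \<B>" "\<phi> \<in> Arr (fib E X)" "\<psi> \<in> Arr (fib E X)" "Dom (fib E X) \<psi> = Cod (fib E X) \<phi>"
  shows "vert E X (\<psi> \<cdot>\<^bsub>fib E X\<^esub> \<phi>) = vert E X \<psi> \<star> vert E X \<phi>"
proof -
  let ?I = "Ide \<B> X" and ?C = "Cod (fib E X) \<psi>"
  have "pull_comp E ?I ?I ?C \<cdot>\<^bsub>fib E X\<^esub> (FArr (pull E ?I) (pull_id E X ?C) \<cdot>\<^bsub>fib E X\<^esub>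
      ((FArr (pull E ?I) \<psi> \<cdot>\<^bsub>fib E X\<^esub> pull_id E X (Cod (fib E X) \<phi>)) \<cdot>\<^bsub>fib E X\<^esub> \<phi>)) =
    (pull_comp E ?I ?I ?C \<cdot>\<^bsub>fib E X\<^esub> FArr (pull E ?I) (pull_id E X ?C)) \<cdot>\<^bsub>fib E X\<^esub>
      ((FArr (pull E ?I) \<psi> \<cdot>\<^bsub>fib E X\<^esub> pull_id E X (Cod (fib E X) \<phi>)) \<cdot>\<^bsub>fib E X\<^esub> \<phi>)"
    using assms by simp
  also have "\<dots> = pull_id E X ?C \<cdot>\<^bsub>fib E X\<^esub> (\<psi> \<cdot>\<^bsub>fib E X\<^esub> \<phi>)"
    using assms pull_comp_id_left[of ?I X X ?C] pull_id_natural[of X \<psi>] by (simp add: Hom_def)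
  finally show ?thesis
    using assms by (simp add: vert_def tot_simps pull_Comp)
qed

lemma vert_Ide [simp]:
  "\<lbrakk>X \<in> Obj \<B>; A \<in> Obj (fib E X)\<rbrakk> \<Longrightarrow> vert E X (Ide (fib E X) A) = Ide \<T> (X, A)"
  by (simp add: vert_def tot_simps)

lemma vertical_simps [simp]:
  assumes "k \<in> Arr \<T>" "fst k = Ide \<B> X" "X \<in> Obj \<B>"
  shows "vertical E X k \<in> Arr (fib E X)" "Dom (fib E X) (vertical E X k) = snd (Dom \<T> k)"
    "Cod (fib E X) (vertical E X k) = snd (Cod \<T> k)" "vert E X (vertical E X k) = k"
  using assms by (cases k; auto simp: vertical_def vert_def tot_simps)+

lemma vertical_vert [simp]:
  "\<lbrakk>X \<in> Obj \<B>; \<phi> \<in> Arr (fib E X)\<rbrakk> \<Longrightarrow> vertical E X (vert E X \<phi>) = \<phi>"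
  by (simp add: vertical_def vert_def)

lemma vert_iso_iff:
  assumes "X \<in> Obj \<B>" "\<phi> \<in> Arr (fib E X)"
  shows "is_iso \<T> (vert E X \<phi>) \<longleftrightarrow> is_iso (fib E X) \<phi>"
proof
  interpret F: category "fib E X" using assms by (simp add: fib_category)
  assume "is_iso (fib E X) \<phi>"
  then show "is_iso \<T> (vert E X \<phi>)"
    using assms by (intro T.is_isoI[of _ "vert E X (Inv (fib E X) \<phi>)"]) (auto simp flip: vert_Comp)
next
  interpret F: category "fib E X" using assms by (simp add: fib_category)
  let ?k = "vert E X \<phi>" and ?l = "Inv \<T> (vert E X \<phi>)"
  assume k: "is_iso \<T> ?k"
  have "fst ?l = fst ?l \<bullet> fst ?k"
    using k assms B.Comp_Ide_right[of "fst ?l" X] by simp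
  also have "\<dots> = Ide \<B> X"
    using k assms unfolding fst_total_comp[symmetric] by simp
  finally have l: "fst ?l = Ide \<B> X" .
  have v: "vertical E X ?l \<in> Arr (fib E X)" "Dom (fib E X) (vertical E X ?l) = Cod (fib E X) \<phi>"
    "Cod (fib E X) (vertical E X ?l) = Dom (fib E X) \<phi>" "vert E X (vertical E X ?l) = ?l"
    using k l assms by simp_all
  have inj: "\<alpha> = \<beta>" if "vert E X \<alpha> = vert E X \<beta>" "\<alpha> \<in> Arr (fib E X)" "\<beta> \<in> Arr (fib E X)" for \<alpha> \<beta>
    using that assms by (metis vertical_vert)
  have "vert E X (vertical E X ?l \<cdot>\<^bsub>fib E X\<^esub> \<phi>) = vert E X (Ide (fib E X) (Dom (fib E X) \<phi>))"
    using k assms v by (simp add: vert_Comp)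
  then have 1: "vertical E X ?l \<cdot>\<^bsub>fib E X\<^esub> \<phi> = Ide (fib E X) (Dom (fib E X) \<phi>)"
    by (rule inj) (use assms v in auto)
  have "vert E X (\<phi> \<cdot>\<^bsub>fib E X\<^esub> vertical E X ?l) = vert E X (Ide (fib E X) (Cod (fib E X) \<phi>))"
    using k assms v by (simp add: vert_Comp)
  then have "\<phi> \<cdot>\<^bsub>fib E X\<^esub> vertical E X ?l = Ide (fib E X) (Cod (fib E X) \<phi>)"
    by (rule inj) (use assms v in auto)
  with 1 show "is_iso (fib E X) \<phi>"
    using v assms by (intro F.is_isoI[of _ "vertical E X ?l"]) auto
qed

lemma vert_Inv:
  assumes "X \<in> Obj \<B>" "is_iso (fib E X) \<phi>"
  shows "vert E X (Inv (fib E X) \<phi>) = Inv \<T> (vert E X \<phi>)"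
proof -
  interpret F: category "fib E X" using assms by (simp add: fib_category)
  have [simp]: "\<phi> \<in> Arr (fib E X)" using assms by (simp add: F.is_iso_Arr)
  have iso: "is_iso \<T> (vert E X \<phi>)" using assms by (simp add: vert_iso_iff)
  have "vert E X \<phi> \<star> vert E X (Inv (fib E X) \<phi>) = vert E X \<phi> \<star> Inv \<T> (vert E X \<phi>)"
    using assms iso by (simp flip: vert_Comp)
  then show ?thesis
    by (rule T.iso_mono[OF iso]) (use assms iso in auto)
qed

subsection \<open>Cartesian and opcartesian arrows\<close>

text \<open>
  Both notions are the strong ones, with factorisations over arbitrary base arrows rather than
  vertical ones only, so that cartesian and opcartesian arrows compose.
\<close>

definition cartesian :: "('a, 'p, 'q) over \<Rightarrow> bool" where
  "cartesian k \<longleftrightarrow> k \<in> Arr \<T> \<and>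
     (\<forall>l f. l \<in> Arr \<T> \<longrightarrow> f \<in> Arr \<B> \<longrightarrow> Cod \<T> l = Cod \<T> k \<longrightarrow> Cod \<B> f = Dom \<B> (fst k) \<longrightarrow>
        fst l = fst k \<bullet> f \<longrightarrow>
        (\<exists>!m. m \<in> Arr \<T> \<and> fst m = f \<and> Cod \<T> m = Dom \<T> k \<and> k \<star> m = l))"

definition opcartesian :: "('a, 'p, 'q) over \<Rightarrow> bool" where
  "opcartesian k \<longleftrightarrow> k \<in> Arr \<T> \<and>
     (\<forall>l g. l \<in> Arr \<T> \<longrightarrow> g \<in> Arr \<B> \<longrightarrow> Dom \<T> l = Dom \<T> k \<longrightarrow> Dom \<B> g = Cod \<B> (fst k) \<longrightarrow>
        fst l = g \<bullet> fst k \<longrightarrow>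
        (\<exists>!m. m \<in> Arr \<T> \<and> fst m = g \<and> Dom \<T> m = Cod \<T> k \<and> m \<star> k = l))"

lemma cartesian_Arr [simp]: "cartesian k \<Longrightarrow> k \<in> Arr \<T>"
  and opcartesian_Arr [simp]: "opcartesian k \<Longrightarrow> k \<in> Arr \<T>"
  by (auto simp: cartesian_def opcartesian_def)

lemma cartesian_obtain:
  assumes "cartesian k" "l \<in> Arr \<T>" "f \<in> Arr \<B>" "Cod \<T> l = Cod \<T> k" "Cod \<B> f = Dom \<B> (fst k)"
    "fst l = fst k \<bullet> f"
  obtains m where "m \<in> Arr \<T>" "fst m = f" "Dom \<T> m = Dom \<T> l" "Cod \<T> m = Dom \<T> k" "k \<star> m = l"
proof -
  obtain m where m: "m \<in> Arr \<T>" "fst m = f" "Cod \<T> m = Dom \<T> k" "k \<star> m = l"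
    using assms unfolding cartesian_def by blast
  then have "Dom \<T> m = Dom \<T> l"
    using assms(1) T.Dom_Comp[of m k] by simp
  with m that show thesis by blast
qed

lemma opcartesian_obtain:
  assumes "opcartesian k" "l \<in> Arr \<T>" "g \<in> Arr \<B>" "Dom \<T> l = Dom \<T> k" "Dom \<B> g = Cod \<B> (fst k)"
    "fst l = g \<bullet> fst k"
  obtains m where "m \<in> Arr \<T>" "fst m = g" "Dom \<T> m = Cod \<T> k" "Cod \<T> m = Cod \<T> l" "m \<star> k = l"
proof -
  obtain m where m: "m \<in> Arr \<T>" "fst m = g" "Dom \<T> m = Cod \<T> k" "m \<star> k = l"
    using assms unfolding opcartesian_def by blast
  then have "Cod \<T> m = Cod \<T> l"
    using assms(1) T.Cod_Comp[of k m] by simp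
  with m that show thesis by blast
qed

lemma cartesian_ext:
  assumes k: "cartesian k" and "k \<star> m = k \<star> n" "fst m = fst n"
    and "m \<in> Arr \<T>" "n \<in> Arr \<T>" "Cod \<T> m = Dom \<T> k" "Cod \<T> n = Dom \<T> k"
  shows "m = n"
proof -
  have "\<exists>!x. x \<in> Arr \<T> \<and> fst x = fst m \<and> Cod \<T> x = Dom \<T> k \<and> k \<star> x = k \<star> m"
    using k assms(4,6) unfolding cartesian_def
    by (elim conjE allE[of _ "k \<star> m"] allE[of _ "fst m"]) simp
  then show ?thesis using assms by metis
qed

lemma opcartesian_ext:
  assumes k: "opcartesian k" and "m \<star> k = n \<star> k" "fst m = fst n"
    and "m \<in> Arr \<T>" "n \<in> Arr \<T>" "Dom \<T> m = Cod \<T> k" "Dom \<T> n = Cod \<T> k"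
  shows "m = n"
proof -
  have "\<exists>!x. x \<in> Arr \<T> \<and> fst x = fst m \<and> Dom \<T> x = Cod \<T> k \<and> x \<star> k = m \<star> k"
    using k assms(4,6) unfolding opcartesian_def
    by (elim conjE allE[of _ "m \<star> k"] allE[of _ "fst m"]) simp
  then show ?thesis using assms by metis
qed

lemma cartesianI:
  assumes "k \<in> Arr \<T>"
    and "\<And>l f. \<lbrakk>l \<in> Arr \<T>; f \<in> Arr \<B>; Cod \<T> l = Cod \<T> k; Cod \<B> f = fst (Dom \<T> k); fst l = fst k \<bullet> f\<rbrakk> \<Longrightarrow>
      \<exists>m. m \<in> Arr \<T> \<and> fst m = f \<and> Cod \<T> m = Dom \<T> k \<and> k \<star> m = l"
    and "\<And>m n. \<lbrakk>k \<star> m = k \<star> n; fst m = fst n; m \<in> Arr \<T>; n \<in> Arr \<T>; Cod \<T> m = Dom \<T> k; Cod \<T> n = Dom \<T> k\<rbrakk> \<Longrightarrow> m = n"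
  shows "cartesian k"
  unfolding cartesian_def
proof (intro conjI allI impI)
  fix l f assume a: "l \<in> Arr \<T>" "f \<in> Arr \<B>" "Cod \<T> l = Cod \<T> k" "Cod \<B> f = Dom \<B> (fst k)" "fst l = fst k \<bullet> f"
  with assms(1) have "\<exists>m. m \<in> Arr \<T> \<and> fst m = f \<and> Cod \<T> m = Dom \<T> k \<and> k \<star> m = l"
    by (intro assms(2)) auto
  then obtain m where m: "m \<in> Arr \<T>" "fst m = f" "Cod \<T> m = Dom \<T> k" "k \<star> m = l" by blast
  then show "\<exists>!m. m \<in> Arr \<T> \<and> fst m = f \<and> Cod \<T> m = Dom \<T> k \<and> k \<star> m = l"
    using assms(3) by (intro ex1I[of _ m]) auto
qed fact

lemma opcartesianI:
  assumes "k \<in> Arr \<T>"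
    and "\<And>l g. \<lbrakk>l \<in> Arr \<T>; g \<in> Arr \<B>; Dom \<T> l = Dom \<T> k; Dom \<B> g = fst (Cod \<T> k); fst l = g \<bullet> fst k\<rbrakk> \<Longrightarrow>
      \<exists>m. m \<in> Arr \<T> \<and> fst m = g \<and> Dom \<T> m = Cod \<T> k \<and> m \<star> k = l"
    and "\<And>m n. \<lbrakk>m \<star> k = n \<star> k; fst m = fst n; m \<in> Arr \<T>; n \<in> Arr \<T>; Dom \<T> m = Cod \<T> k; Dom \<T> n = Cod \<T> k\<rbrakk> \<Longrightarrow> m = n"
  shows "opcartesian k"
  unfolding opcartesian_def
proof (intro conjI allI impI)
  fix l g assume a: "l \<in> Arr \<T>" "g \<in> Arr \<B>" "Dom \<T> l = Dom \<T> k" "Dom \<B> g = Cod \<B> (fst k)" "fst l = g \<bullet> fst k"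
  with assms(1) have "\<exists>m. m \<in> Arr \<T> \<and> fst m = g \<and> Dom \<T> m = Cod \<T> k \<and> m \<star> k = l"
    by (intro assms(2)) auto
  then obtain m where m: "m \<in> Arr \<T>" "fst m = g" "Dom \<T> m = Cod \<T> k" "m \<star> k = l" by blast
  then show "\<exists>!m. m \<in> Arr \<T> \<and> fst m = g \<and> Dom \<T> m = Cod \<T> k \<and> m \<star> k = l"
    using assms(3) by (intro ex1I[of _ m]) auto
qed fact

lemma iso_cartesian:
  assumes k: "is_iso \<T> k"
  shows "cartesian k"
proof (rule cartesianI)
  show [simp]: "k \<in> Arr \<T>" using k by (rule T.is_iso_Arr)
  fix l f assume a: "l \<in> Arr \<T>" "f \<in> Arr \<B>" "Cod \<T> l = Cod \<T> k" "Cod \<B> f = fst (Dom \<T> k)" "fst l = fst k \<bullet> f"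
  have "fst (Inv \<T> k) \<bullet> (fst k \<bullet> f) = (fst (Inv \<T> k) \<bullet> fst k) \<bullet> f"
    using a k by simp
  also have "\<dots> = f"
    using a k unfolding fst_total_comp[symmetric] by simp
  finally show "\<exists>m. m \<in> Arr \<T> \<and> fst m = f \<and> Cod \<T> m = Dom \<T> k \<and> k \<star> m = l"
    using a k by (intro exI[of _ "Inv \<T> k \<star> l"]) simp
qed (rule T.iso_mono[OF k])

lemma iso_opcartesian:
  assumes k: "is_iso \<T> k"
  shows "opcartesian k"
proof (rule opcartesianI)
  show [simp]: "k \<in> Arr \<T>" using k by (rule T.is_iso_Arr)
  fix l g assume a: "l \<in> Arr \<T>" "g \<in> Arr \<B>" "Dom \<T> l = Dom \<T> k" "Dom \<B> g = fst (Cod \<T> k)" "fst l = g \<bullet> fst k"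
  have "g \<bullet> (fst k \<bullet> fst (Inv \<T> k)) = g"
    using a k unfolding fst_total_comp[symmetric] by simp
  then show "\<exists>m. m \<in> Arr \<T> \<and> fst m = g \<and> Dom \<T> m = Cod \<T> k \<and> m \<star> k = l"
    using a k by (intro exI[of _ "l \<star> Inv \<T> k"]) simp
qed (rule T.iso_epi[OF k])

lemma cartesian_Comp:
  assumes k: "cartesian k" and l: "cartesian l" and [simp]: "Dom \<T> l = Cod \<T> k"
  shows "cartesian (l \<star> k)"
proof (rule cartesianI)
  note [simp] = cartesian_Arr[OF k] cartesian_Arr[OF l]
  show "l \<star> k \<in> Arr \<T>" by simp
  fix x f assume a: "x \<in> Arr \<T>" "f \<in> Arr \<B>" "Cod \<T> x = Cod \<T> (l \<star> k)" "Cod \<B> f = fst (Dom \<T> (l \<star> k))"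
    "fst x = fst (l \<star> k) \<bullet> f"
  obtain y where y: "y \<in> Arr \<T>" "fst y = fst k \<bullet> f" "Cod \<T> y = Dom \<T> l" "l \<star> y = x"
    by (rule cartesian_obtain[OF l, of x "fst k \<bullet> f"]) (use a in auto)
  obtain z where z: "z \<in> Arr \<T>" "fst z = f" "Cod \<T> z = Dom \<T> k" "k \<star> z = y"
    by (rule cartesian_obtain[OF k, of y f]) (use a y in auto)
  show "\<exists>m. m \<in> Arr \<T> \<and> fst m = f \<and> Cod \<T> m = Dom \<T> (l \<star> k) \<and> (l \<star> k) \<star> m = x"
    using y z by (intro exI[of _ z]) auto
next
  note [simp] = cartesian_Arr[OF k] cartesian_Arr[OF l]
  fix m n assume a: "(l \<star> k) \<star> m = (l \<star> k) \<star> n" "fst m = fst n" "m \<in> Arr \<T>" "n \<in> Arr \<T>"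
    "Cod \<T> m = Dom \<T> (l \<star> k)" "Cod \<T> n = Dom \<T> (l \<star> k)"
  have "k \<star> m = k \<star> n"
    by (rule cartesian_ext[OF l]) (use a in auto)
  then show "m = n"
    by (rule cartesian_ext[OF k]) (use a in auto)
qed

lemma opcartesian_Comp:
  assumes k: "opcartesian k" and l: "opcartesian l" and [simp]: "Dom \<T> l = Cod \<T> k"
  shows "opcartesian (l \<star> k)"
proof (rule opcartesianI)
  note [simp] = opcartesian_Arr[OF k] opcartesian_Arr[OF l]
  show "l \<star> k \<in> Arr \<T>" by simp
  fix x g assume a: "x \<in> Arr \<T>" "g \<in> Arr \<B>" "Dom \<T> x = Dom \<T> (l \<star> k)" "Dom \<B> g = fst (Cod \<T> (l \<star> k))"
    "fst x = g \<bullet> fst (l \<star> k)"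
  obtain y where y: "y \<in> Arr \<T>" "fst y = g \<bullet> fst l" "Dom \<T> y = Cod \<T> k" "y \<star> k = x"
    by (rule opcartesian_obtain[OF k, of x "g \<bullet> fst l"]) (use a in auto)
  obtain z where z: "z \<in> Arr \<T>" "fst z = g" "Dom \<T> z = Cod \<T> l" "z \<star> l = y"
    by (rule opcartesian_obtain[OF l, of y g]) (use a y in auto)
  show "\<exists>m. m \<in> Arr \<T> \<and> fst m = g \<and> Dom \<T> m = Cod \<T> (l \<star> k) \<and> m \<star> (l \<star> k) = x"
    using y z by (intro exI[of _ z]) (auto simp flip: T.Comp_assoc_Arr)
next
  note [simp] = opcartesian_Arr[OF k] opcartesian_Arr[OF l]
  fix m n assume a: "m \<star> (l \<star> k) = n \<star> (l \<star> k)" "fst m = fst n" "m \<in> Arr \<T>" "n \<in> Arr \<T>"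
    "Dom \<T> m = Cod \<T> (l \<star> k)" "Dom \<T> n = Cod \<T> (l \<star> k)"
  have "m \<star> l = n \<star> l"
    by (rule opcartesian_ext[OF k]) (use a in auto)
  then show "m = n"
    by (rule opcartesian_ext[OF l]) (use a in auto)
qed

lemma cartesian_cancel:
  assumes lk: "cartesian (l \<star> k)" and l: "cartesian l" and [simp]: "k \<in> Arr \<T>" "Cod \<T> k = Dom \<T> l"
  shows "cartesian k"
proof (rule cartesianI)
  note [simp] = cartesian_Arr[OF l]
  fix x f assume a: "x \<in> Arr \<T>" "f \<in> Arr \<B>" "Cod \<T> x = Cod \<T> k" "Cod \<B> f = fst (Dom \<T> k)" "fst x = fst k \<bullet> f"
  obtain m where m: "m \<in> Arr \<T>" "fst m = f" "Cod \<T> m = Dom \<T> k" "l \<star> (k \<star> m) = l \<star> x"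
    by (rule cartesian_obtain[OF lk, of "l \<star> x" f]) (use a in auto)
  have "k \<star> m = x"
    by (rule cartesian_ext[OF l m(4)]) (use a m in auto)
  with m show "\<exists>m. m \<in> Arr \<T> \<and> fst m = f \<and> Cod \<T> m = Dom \<T> k \<and> k \<star> m = x" by blast
next
  note [simp] = cartesian_Arr[OF l]
  fix m n assume a: "k \<star> m = k \<star> n" "fst m = fst n" "m \<in> Arr \<T>" "n \<in> Arr \<T>" "Cod \<T> m = Dom \<T> k" "Cod \<T> n = Dom \<T> k"
  show "m = n"
    by (rule cartesian_ext[OF lk]) (use a in auto)
qed simp

lemma opcartesian_cancel:
  assumes lk: "opcartesian (l \<star> k)" and k: "opcartesian k" and [simp]: "l \<in> Arr \<T>" "Cod \<T> k = Dom \<T> l"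
  shows "opcartesian l"
proof (rule opcartesianI)
  note [simp] = opcartesian_Arr[OF k]
  fix x g assume a: "x \<in> Arr \<T>" "g \<in> Arr \<B>" "Dom \<T> x = Dom \<T> l" "Dom \<B> g = fst (Cod \<T> l)" "fst x = g \<bullet> fst l"
  obtain m where m: "m \<in> Arr \<T>" "fst m = g" "Dom \<T> m = Cod \<T> l" "m \<star> (l \<star> k) = x \<star> k"
    by (rule opcartesian_obtain[OF lk, of "x \<star> k" g]) (use a in auto)
  have "m \<star> l = x"
    by (rule opcartesian_ext[OF k]) (use a m in auto)
  with m show "\<exists>m. m \<in> Arr \<T> \<and> fst m = g \<and> Dom \<T> m = Cod \<T> l \<and> m \<star> l = x" by blast
next
  note [simp] = opcartesian_Arr[OF k]
  fix m n assume a: "m \<star> l = n \<star> l" "fst m = fst n" "m \<in> Arr \<T>" "n \<in> Arr \<T>" "Dom \<T> m = Cod \<T> l" "Dom \<T> n = Cod \<T> l"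
  have eq: "m \<star> (l \<star> k) = (m \<star> l) \<star> k" "n \<star> (l \<star> k) = (n \<star> l) \<star> k"
    using a(3-) by simp_all
  have "m \<star> (l \<star> k) = n \<star> (l \<star> k)"
    by (simp only: eq a(1))
  then show "m = n"
    by (rule opcartesian_ext[OF lk]) (use a in auto)
qed simp

lemma cartesian_iso:
  assumes k: "cartesian k" and p: "is_iso \<B> (fst k)"
  shows "is_iso \<T> k"
proof -
  note [simp] = cartesian_Arr[OF k]
  let ?q = "Inv \<B> (fst k)"
  obtain m where m: "m \<in> Arr \<T>" "fst m = ?q" "Dom \<T> m = Cod \<T> k" "Cod \<T> m = Dom \<T> k" "k \<star> m = Ide \<T> (Cod \<T> k)"
    by (rule cartesian_obtain[OF k, of "Ide \<T> (Cod \<T> k)" ?q]) (use p in auto)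
  have "k \<star> (m \<star> k) = (k \<star> m) \<star> k" using m(1-4) by simp
  also have "\<dots> = k \<star> Ide \<T> (Dom \<T> k)" unfolding m(5) by simp
  finally have "m \<star> k = Ide \<T> (Dom \<T> k)"
    by (rule cartesian_ext[OF k]) (use m p in auto)
  with m show ?thesis by (intro T.is_isoI[of _ m]) auto
qed

lemma opcartesian_iso:
  assumes k: "opcartesian k" and p: "is_iso \<B> (fst k)"
  shows "is_iso \<T> k"
proof -
  note [simp] = opcartesian_Arr[OF k]
  let ?q = "Inv \<B> (fst k)"
  obtain m where m: "m \<in> Arr \<T>" "fst m = ?q" "Dom \<T> m = Cod \<T> k" "Cod \<T> m = Dom \<T> k" "m \<star> k = Ide \<T> (Dom \<T> k)"
    by (rule opcartesian_obtain[OF k, of "Ide \<T> (Dom \<T> k)" ?q]) (use p in auto)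
  have "(k \<star> m) \<star> k = k \<star> (m \<star> k)" using m(1-4) by simp
  also have "\<dots> = Ide \<T> (Cod \<T> k) \<star> k" unfolding m(5) by simp
  finally have "k \<star> m = Ide \<T> (Cod \<T> k)"
    by (rule opcartesian_ext[OF k]) (use m p in auto)
  with m show ?thesis by (intro T.is_isoI[of _ m]) auto
qed

lemma cart_simps [simp]:
  assumes "f \<in> Arr \<B>" "C \<in> Obj (fib E (Cod \<B> f))"
  shows "cart E f C \<in> Arr \<T>" "Dom \<T> (cart E f C) = (Dom \<B> f, FObj (pull E f) C)"
    "Cod \<T> (cart E f C) = (Cod \<B> f, C)"
  using assms by (simp_all add: cart_def tot_simps)

lemma fst_cart [simp]: "fst (cart E f C) = f"
  by (simp add: cart_def)

lemma cart_factor_simps: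
  assumes "f \<in> Arr \<B>" "g \<in> Arr \<B>" "Dom \<B> g = Cod \<B> f" "l \<in> Arr \<T>" "fst l = g \<bullet> f" "Cod \<T> l = (Cod \<B> g, C)"
  shows "cart_factor E g f l \<in> Arr \<T>" "fst (cart_factor E g f l) = f"
    "Dom \<T> (cart_factor E g f l) = Dom \<T> l" "Cod \<T> (cart_factor E g f l) = (Dom \<B> g, FObj (pull E g) C)"
    "cart E g C \<star> cart_factor E g f l = l"
  using assms by (cases l; auto simp: cart_factor_def cart_def tot_simps Let_def pull_Ide)+

lemma cart_Comp_ext:
  assumes "g \<in> Arr \<B>" "C \<in> Obj (fib E (Cod \<B> g))" "m \<in> Arr \<T>" "n \<in> Arr \<T>" "fst m = fst n"
    "Cod \<T> m = (Dom \<B> g, FObj (pull E g) C)" "Cod \<T> n = (Dom \<B> g, FObj (pull E g) C)"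
    "cart E g C \<star> m = cart E g C \<star> n"
  shows "m = n"
proof -
  obtain f \<phi> where m: "m = (f, \<phi>, FObj (pull E g) C)"
    using assms(3,6) by (cases m) (auto simp: tot_simps)
  obtain \<psi> where n: "n = (f, \<psi>, FObj (pull E g) C)"
    using assms(4,5,7) m by (cases n) (auto simp: tot_simps)
  let ?X = "Dom \<B> f"
  have t [simp]: "f \<in> Arr \<B>" "Cod \<B> f = Dom \<B> g" "\<phi> \<in> Arr (fib E ?X)" "\<psi> \<in> Arr (fib E ?X)"
    "Cod (fib E ?X) \<phi> = FObj (pull E f) (FObj (pull E g) C)" "Cod (fib E ?X) \<psi> = FObj (pull E f) (FObj (pull E g) C)"
    using assms m n by (auto simp: tot_simps)
  have "pull_comp E f g C \<cdot>\<^bsub>fib E ?X\<^esub> \<phi> = pull_comp E f g C \<cdot>\<^bsub>fib E ?X\<^esub> \<psi>"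
    using assms by (simp add: m n cart_def tot_simps pull_Ide)
  then have "\<phi> = \<psi>"
    using category.iso_mono[OF fib_category, of ?X "pull_comp E f g C" \<phi> \<psi>] assms by simp
  with m n show ?thesis by simp
qed

lemma cart_cartesian: 
  assumes "g \<in> Arr \<B>" "C \<in> Obj (fib E (Cod \<B> g))"
  shows "cartesian (cart E g C)"
proof (rule cartesianI)
  fix l f assume a: "l \<in> Arr \<T>" "f \<in> Arr \<B>" "Cod \<T> l = Cod \<T> (cart E g C)" "Cod \<B> f = fst (Dom \<T> (cart E g C))"
    "fst l = fst (cart E g C) \<bullet> f"
  show "\<exists>m. m \<in> Arr \<T> \<and> fst m = f \<and> Cod \<T> m = Dom \<T> (cart E g C) \<and> cart E g C \<star> m = l"
    using assms a cart_factor_simps[of f g l C] by (intro exI[of _ "cart_factor E g f l"]) auto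
qed (use assms cart_Comp_ext in auto)

end

section \<open>Images and Frobenius reciprocity in the total category\<close>

sublocale regular_fibration \<subseteq> B: finite_product_category "base E"
  by (rule base_products)

context regular_fibration
begin

lemmas fib_product_simps [simp] =
  finite_product_category.Pr_simps[OF fib_products] finite_product_category.Obj_Prod[OF fib_products]
  finite_product_category.Obj_Term[OF fib_products]

lemma ex_simps [simp]:
  assumes "f \<in> Arr \<B>" "Y = Cod \<B> f"
  shows "A \<in> Obj (fib E (Dom \<B> f)) \<Longrightarrow> FObj (ex E f) A \<in> Obj (fib E Y)"
    and "\<phi> \<in> Arr (fib E (Dom \<B> f)) \<Longrightarrow> FArr (ex E f) \<phi> \<in> Arr (fib E Y)"
    and "\<phi> \<in> Arr (fib E (Dom \<B> f)) \<Longrightarrow>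
         Dom (fib E Y) (FArr (ex E f) \<phi>) = FObj (ex E f) (Dom (fib E (Dom \<B> f)) \<phi>)"
    and "\<phi> \<in> Arr (fib E (Dom \<B> f)) \<Longrightarrow>
         Cod (fib E Y) (FArr (ex E f) \<phi>) = FObj (ex E f) (Cod (fib E (Dom \<B> f)) \<phi>)"
  using functor_simps[of "fib E (Dom \<B> f)" "fib E (Cod \<B> f)" "ex E f"]
    ex_pull_adjunction[of f "Dom \<B> f" "Cod \<B> f"] assms by (auto simp: Hom_def adjunction_def)

lemma ex_unit_counit_simps [simp]:
  assumes "f \<in> Arr \<B>"
  shows "\<lbrakk>X = Dom \<B> f; A \<in> Obj (fib E X)\<rbrakk> \<Longrightarrow> ex_unit E f A \<in> Arr (fib E X)"
    and "\<lbrakk>X = Dom \<B> f; A \<in> Obj (fib E X)\<rbrakk> \<Longrightarrow> Dom (fib E X) (ex_unit E f A) = A"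
    and "\<lbrakk>X = Dom \<B> f; A \<in> Obj (fib E X)\<rbrakk> \<Longrightarrow>
         Cod (fib E X) (ex_unit E f A) = FObj (pull E f) (FObj (ex E f) A)"
    and "\<lbrakk>Y = Cod \<B> f; C \<in> Obj (fib E Y)\<rbrakk> \<Longrightarrow> ex_counit E f C \<in> Arr (fib E Y)"
    and "\<lbrakk>Y = Cod \<B> f; C \<in> Obj (fib E Y)\<rbrakk> \<Longrightarrow>
         Dom (fib E Y) (ex_counit E f C) = FObj (ex E f) (FObj (pull E f) C)"
    and "\<lbrakk>Y = Cod \<B> f; C \<in> Obj (fib E Y)\<rbrakk> \<Longrightarrow> Cod (fib E Y) (ex_counit E f C) = C"
  using ex_pull_adjunction[of f "Dom \<B> f" "Cod \<B> f"] assms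
  by (auto simp: Hom_def adjunction_def natural_def comp_func_def Id_func_def)

lemma opcart_simps [simp]:
  assumes "f \<in> Arr \<B>" "A \<in> Obj (fib E (Dom \<B> f))"
  shows "opcart E f A \<in> Arr \<T>" "Dom \<T> (opcart E f A) = (Dom \<B> f, A)"
    "Cod \<T> (opcart E f A) = (Cod \<B> f, FObj (ex E f) A)"
  using assms by (simp_all add: opcart_def tot_simps)

lemma fst_opcart [simp]: "fst (opcart E f A) = f"
  by (simp add: opcart_def)

lemma vert_Comp_left:
  assumes "(f, \<phi>, C) \<in> Arr \<T>" "Cod \<B> f = Y" "\<psi> \<in> Arr (fib E Y)" "Dom (fib E Y) \<psi> = C"
  shows "vert E Y \<psi> \<star> (f, \<phi>, C) =
    (f, FArr (pull E f) \<psi> \<cdot>\<^bsub>fib E (Dom \<B> f)\<^esub> \<phi>, Cod (fib E Y) \<psi>)"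
proof -
  let ?X = "Dom \<B> f" and ?C = "Cod (fib E Y) \<psi>"
  have [simp]: "f \<in> Arr \<B>" "\<phi> \<in> Arr (fib E ?X)" "Cod (fib E ?X) \<phi> = FObj (pull E f) C" "Y \<in> Obj \<B>"
    using assms(1) B.Obj_Cod[of f] assms(2) by (auto simp: tot_simps)
  have "pull_comp E f (Ide \<B> Y) ?C \<cdot>\<^bsub>fib E ?X\<^esub> (FArr (pull E f) (pull_id E Y ?C) \<cdot>\<^bsub>fib E ?X\<^esub>
      (FArr (pull E f) \<psi> \<cdot>\<^bsub>fib E ?X\<^esub> \<phi>)) =
    (pull_comp E f (Ide \<B> Y) ?C \<cdot>\<^bsub>fib E ?X\<^esub> FArr (pull E f) (pull_id E Y ?C)) \<cdot>\<^bsub>fib E ?X\<^esub>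
      (FArr (pull E f) \<psi> \<cdot>\<^bsub>fib E ?X\<^esub> \<phi>)"
    using assms by simp
  also have "\<dots> = FArr (pull E f) \<psi> \<cdot>\<^bsub>fib E ?X\<^esub> \<phi>"
    using assms pull_comp_id_left[of f ?X Y ?C] by (simp add: Hom_def)
  finally show ?thesis
    using assms by (simp add: vert_def tot_simps pull_Comp)
qed

lemma vert_Comp_right:
  assumes "(f, \<phi>, C) \<in> Arr \<T>" "Dom \<B> f = X" "\<alpha> \<in> Arr (fib E X)" "Cod (fib E X) \<alpha> = Dom (fib E X) \<phi>"
  shows "(f, \<phi>, C) \<star> vert E X \<alpha> = (f, \<phi> \<cdot>\<^bsub>fib E X\<^esub> \<alpha>, C)"
proof -
  let ?I = "Ide \<B> X"
  have [simp]: "f \<in> Arr \<B>" "\<phi> \<in> Arr (fib E X)" "Cod (fib E X) \<phi> = FObj (pull E f) C" "C \<in> Obj (fib E (Cod \<B> f))" "X \<in> Obj \<B>"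
    using assms(1) B.Obj_Dom[of f] assms(2) by (auto simp: tot_simps)
  have "pull_comp E ?I f C \<cdot>\<^bsub>fib E X\<^esub>
      ((FArr (pull E ?I) \<phi> \<cdot>\<^bsub>fib E X\<^esub> pull_id E X (Dom (fib E X) \<phi>)) \<cdot>\<^bsub>fib E X\<^esub> \<alpha>) =
    (pull_comp E ?I f C \<cdot>\<^bsub>fib E X\<^esub> pull_id E X (FObj (pull E f) C)) \<cdot>\<^bsub>fib E X\<^esub> (\<phi> \<cdot>\<^bsub>fib E X\<^esub> \<alpha>)"
    using assms pull_id_natural[of X \<phi>] by simp
  also have "\<dots> = \<phi> \<cdot>\<^bsub>fib E X\<^esub> \<alpha>"
    using assms pull_comp_id_right[of f X "Cod \<B> f" C] by (simp add: Hom_def)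
  finally show ?thesis
    using assms by (simp add: vert_def tot_simps)
qed

lemma vert_opcart:
  assumes "f \<in> Arr \<B>" "Y = Cod \<B> f" "A \<in> Obj (fib E (Dom \<B> f))" "\<psi> \<in> Arr (fib E Y)"
    "Dom (fib E Y) \<psi> = FObj (ex E f) A"
  shows "vert E Y \<psi> \<star> opcart E f A =
    (f, FArr (pull E f) \<psi> \<cdot>\<^bsub>fib E (Dom \<B> f)\<^esub> ex_unit E f A, Cod (fib E Y) \<psi>)"
  unfolding opcart_def by (rule vert_Comp_left) (use assms in \<open>auto simp: tot_simps\<close>)

lemma opcart_factor_simps:
  assumes "l \<in> Arr \<T>" "fst l = f" "Dom \<T> l = (X, A)" "Cod \<T> l = (Y, C)"
  shows "opcart_factor E l \<in> Arr (fib E Y)" "Dom (fib E Y) (opcart_factor E l) = FObj (ex E f) A"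
    "Cod (fib E Y) (opcart_factor E l) = C" "vert E Y (opcart_factor E l) \<star> opcart E f A = l"
proof -
  obtain \<phi> where l: "l = (f, \<phi>, C)"
    using assms by (cases l) (auto simp: tot_simps)
  have t [simp]: "f \<in> Arr \<B>" "Dom \<B> f = X" "Cod \<B> f = Y" "C \<in> Obj (fib E Y)" "\<phi> \<in> Arr (fib E X)"
    "Cod (fib E X) \<phi> = FObj (pull E f) C" "Dom (fib E X) \<phi> = A" "X \<in> Obj \<B>" "Y \<in> Obj \<B>" "A \<in> Obj (fib E X)"
    using assms Dom_total_Obj[OF assms(1,3)] Cod_total_Obj[OF assms(1,4)] by (auto simp: l tot_simps)
  show *: "opcart_factor E l \<in> Arr (fib E Y)" "Dom (fib E Y) (opcart_factor E l) = FObj (ex E f) A"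
    "Cod (fib E Y) (opcart_factor E l) = C"
    by (simp_all add: opcart_factor_def l)
  have adj: "adjunction (fib E X) (fib E Y) (ex E f) (pull E f) (ex_unit E f) (ex_counit E f)"
    by (rule ex_pull_adjunction) (simp add: Hom_def)
  have nat: "FArr (pull E f) (FArr (ex E f) \<phi>) \<cdot>\<^bsub>fib E X\<^esub> ex_unit E f A = ex_unit E f (FObj (pull E f) C) \<cdot>\<^bsub>fib E X\<^esub> \<phi>"
  proof -
    have "FArr (pull E f) (FArr (ex E f) \<chi>) \<cdot>\<^bsub>fib E X\<^esub> ex_unit E f (Dom (fib E X) \<chi>) =
        ex_unit E f (Cod (fib E X) \<chi>) \<cdot>\<^bsub>fib E X\<^esub> \<chi>" if "\<chi> \<in> Arr (fib E X)" for \<chi>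
      using adj that by (auto simp: adjunction_def natural_def comp_func_def Id_func_def Hom_def)
    from this[of \<phi>] show ?thesis by simp
  qed
  have tri: "FArr (pull E f) (ex_counit E f C) \<cdot>\<^bsub>fib E X\<^esub> ex_unit E f (FObj (pull E f) C) = Ide (fib E X) (FObj (pull E f) C)"
    using adj by (auto simp: adjunction_def)
  have "FArr (pull E f) (opcart_factor E l) \<cdot>\<^bsub>fib E X\<^esub> ex_unit E f A =
     FArr (pull E f) (ex_counit E f C) \<cdot>\<^bsub>fib E X\<^esub> (FArr (pull E f) (FArr (ex E f) \<phi>) \<cdot>\<^bsub>fib E X\<^esub> ex_unit E f A)"
    by (simp add: opcart_factor_def l pull_Comp)
  also have "\<dots> = (FArr (pull E f) (ex_counit E f C) \<cdot>\<^bsub>fib E X\<^esub> ex_unit E f (FObj (pull E f) C)) \<cdot>\<^bsub>fib E X\<^esub> \<phi>"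
    unfolding nat by simp
  also have "\<dots> = \<phi>"
    unfolding tri by simp
  finally show "vert E Y (opcart_factor E l) \<star> opcart E f A = l"
    using * by (subst vert_opcart) (simp_all add: l)
qed

lemma vert_opcart_ext:
  assumes "f \<in> Arr \<B>" "Y = Cod \<B> f" "A \<in> Obj (fib E (Dom \<B> f))"
    "\<psi> \<in> Arr (fib E Y)" "\<psi>' \<in> Arr (fib E Y)" "Dom (fib E Y) \<psi> = FObj (ex E f) A" "Dom (fib E Y) \<psi>' = FObj (ex E f) A"
    and eq: "vert E Y \<psi> \<star> opcart E f A = vert E Y \<psi>' \<star> opcart E f A"
  shows "\<psi> = \<psi>'"
proof -
  let ?X = "Dom \<B> f"
  have adj: "adjunction (fib E ?X) (fib E Y) (ex E f) (pull E f) (ex_unit E f) (ex_counit E f)"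
    by (rule ex_pull_adjunction) (simp add: assms Hom_def)
  note exf = functor_simps[of "fib E ?X" "fib E Y" "ex E f"]
  have "opcart_factor E (vert E Y \<chi> \<star> opcart E f A) = \<chi>"
    if \<chi>: "\<chi> \<in> Arr (fib E Y)" "Dom (fib E Y) \<chi> = FObj (ex E f) A" for \<chi>
  proof -
    let ?D = "Cod (fib E Y) \<chi>"
    have nat: "\<chi> \<cdot>\<^bsub>fib E Y\<^esub> ex_counit E f (FObj (ex E f) A) =
      ex_counit E f ?D \<cdot>\<^bsub>fib E Y\<^esub> FArr (ex E f) (FArr (pull E f) \<chi>)"
      using adj \<chi> by (auto simp: adjunction_def natural_def comp_func_def Id_func_def Hom_def)
    have tri: "ex_counit E f (FObj (ex E f) A) \<cdot>\<^bsub>fib E Y\<^esub> FArr (ex E f) (ex_unit E f A) = Ide (fib E Y) (FObj (ex E f) A)"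
      using adj assms by (auto simp: adjunction_def)
    have "opcart_factor E (vert E Y \<chi> \<star> opcart E f A) =
      (ex_counit E f ?D \<cdot>\<^bsub>fib E Y\<^esub> FArr (ex E f) (FArr (pull E f) \<chi>)) \<cdot>\<^bsub>fib E Y\<^esub> FArr (ex E f) (ex_unit E f A)"
      using assms \<chi> exf adj by (simp add: vert_opcart opcart_factor_def adjunction_def)
    also have "\<dots> = \<chi> \<cdot>\<^bsub>fib E Y\<^esub> (ex_counit E f (FObj (ex E f) A) \<cdot>\<^bsub>fib E Y\<^esub> FArr (ex E f) (ex_unit E f A))"
      unfolding nat[symmetric] using assms \<chi> by simp
    also have "\<dots> = \<chi>"
      unfolding tri using assms \<chi> by simp
    finally show ?thesis .
  qed
  then show ?thesis
    using assms eq by metis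
qed

lemma vertical_factor_obtain:
  assumes "m \<in> Arr \<T>" "fst m = g" "Cod \<T> m = (Z, C)" "Dom \<T> m = (Y, D)"
  obtains \<psi> where "\<psi> \<in> Arr (fib E Y)" "Dom (fib E Y) \<psi> = D" "Cod (fib E Y) \<psi> = FObj (pull E g) C"
    "m = cart E g C \<star> vert E Y \<psi>"
proof -
  have [simp]: "g \<in> Arr \<B>" "Dom \<B> g = Y" "Cod \<B> g = Z"
    using assms fst_Arr[OF assms(1)] by auto
  note [simp] = Dom_total_Obj[OF assms(1,4)]
  let ?n = "cart_factor E g (Ide \<B> Y) m"
  have n: "?n \<in> Arr \<T>" "fst ?n = Ide \<B> Y" "Dom \<T> ?n = (Y, D)" "Cod \<T> ?n = (Y, FObj (pull E g) C)"
    "cart E g C \<star> ?n = m"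
    using cart_factor_simps[of "Ide \<B> Y" g m C] assms by auto
  show thesis
    by (rule that[of "vertical E Y ?n"]) (use n in auto)
qed

text \<open>
  The adjunction yields factorisations through vertical arrows only.  To factor an arrow over \<open>g \<bullet> f\<close>,
  one first lifts it through the cartesian arrow over \<open>g\<close>.
\<close>

lemma opcart_opcartesian [simp]:
  assumes "f \<in> Arr \<B>" "A \<in> Obj (fib E (Dom \<B> f))"
  shows "opcartesian (opcart E f A)"
proof (rule opcartesianI)
  let ?Y = "Cod \<B> f"
  show "opcart E f A \<in> Arr \<T>" using assms by simp
  fix l g assume a: "l \<in> Arr \<T>" "g \<in> Arr \<B>" "Dom \<T> l = Dom \<T> (opcart E f A)"
    "Dom \<B> g = fst (Cod \<T> (opcart E f A))" "fst l = g \<bullet> fst (opcart E f A)"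
  obtain Z C where [simp]: "Cod \<T> l = (Z, C)" by (cases "Cod \<T> l")
  have [simp]: "Cod \<B> g = Z"
    using fst_Arr(3)[OF a(1)] a(2,4,5) assms by simp
  note [simp] = Cod_total_Obj[OF a(1), of Z C]
  let ?k = "cart_factor E g f l"
  have k: "?k \<in> Arr \<T>" "fst ?k = f" "Dom \<T> ?k = (Dom \<B> f, A)" "Cod \<T> ?k = (?Y, FObj (pull E g) C)"
    "cart E g C \<star> ?k = l"
    using cart_factor_simps[of f g l C] a assms by auto
  note w = opcart_factor_simps[OF k(1-4)]
  show "\<exists>m. m \<in> Arr \<T> \<and> fst m = g \<and> Dom \<T> m = Cod \<T> (opcart E f A) \<and> m \<star> opcart E f A = l"
    by (rule exI[of _ "cart E g C \<star> vert E ?Y (opcart_factor E ?k)"]) (use a assms k w in auto)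
next
  let ?Y = "Cod \<B> f"
  fix m n assume a: "m \<star> opcart E f A = n \<star> opcart E f A" "fst m = fst n" "m \<in> Arr \<T>" "n \<in> Arr \<T>"
    "Dom \<T> m = Cod \<T> (opcart E f A)" "Dom \<T> n = Cod \<T> (opcart E f A)"
  obtain Z C where c: "Cod \<T> m = (Z, C)" by (cases "Cod \<T> m")
  have "Cod \<T> n = Cod \<T> m"
    using T.Cod_Comp[of "opcart E f A" m] T.Cod_Comp[of "opcart E f A" n] a assms by simp
  with c have c': "Cod \<T> n = (Z, C)" by simp
  have d: "Dom \<T> m = (?Y, FObj (ex E f) A)" "Dom \<T> n = (?Y, FObj (ex E f) A)" using a assms by simp_all
  obtain \<psi> where \<psi>: "\<psi> \<in> Arr (fib E ?Y)" "Dom (fib E ?Y) \<psi> = FObj (ex E f) A" "Cod (fib E ?Y) \<psi> = FObj (pull E (fst m)) C"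
    "m = cart E (fst m) C \<star> vert E ?Y \<psi>"
    using vertical_factor_obtain[OF a(3) refl c d(1)] .
  obtain \<psi>' where \<psi>': "\<psi>' \<in> Arr (fib E ?Y)" "Dom (fib E ?Y) \<psi>' = FObj (ex E f) A" "Cod (fib E ?Y) \<psi>' = FObj (pull E (fst m)) C"
    "n = cart E (fst m) C \<star> vert E ?Y \<psi>'"
    using vertical_factor_obtain[OF a(4) a(2)[symmetric] c' d(2)] .
  have t: "fst m \<in> Arr \<B>" "Dom \<B> (fst m) = ?Y" "Cod \<B> (fst m) = Z" "C \<in> Obj (fib E Z)"
    using a(3) d c Cod_total_Obj[OF a(3) c] by auto
  have e1: "cart E (fst m) C \<star> (vert E ?Y \<psi> \<star> opcart E f A) = m \<star> opcart E f A"
    by (subst (2) \<psi>(4)) (use t \<psi>(1-3) assms in simp)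
  have e2: "cart E (fst m) C \<star> (vert E ?Y \<psi>' \<star> opcart E f A) = n \<star> opcart E f A"
    by (subst \<psi>'(4)) (use t \<psi>'(1-3) assms in simp)
  have "vert E ?Y \<psi> \<star> opcart E f A = vert E ?Y \<psi>' \<star> opcart E f A"
    by (rule cart_Comp_ext[of "fst m" C]) (use t \<psi>(1-3) \<psi>'(1-3) assms e1 e2 a(1) in auto)
  then have "\<psi> = \<psi>'"
    by (intro vert_opcart_ext[of f ?Y A]) (use \<psi> \<psi>' assms in auto)
  then show "m = n" using \<psi>(4) \<psi>'(4) by simp
qed

lemma opcart_factor_unique:
  assumes "f \<in> Arr \<B>" "Y = Cod \<B> f" "A \<in> Obj (fib E (Dom \<B> f))" "\<psi> \<in> Arr (fib E Y)" "Dom (fib E Y) \<psi> = FObj (ex E f) A"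
    "vert E Y \<psi> \<star> opcart E f A = l"
  shows "opcart_factor E l = \<psi>"
proof -
  have l: "l \<in> Arr \<T>" "fst l = f" "Dom \<T> l = (Dom \<B> f, A)" "Cod \<T> l = (Y, Cod (fib E Y) \<psi>)"
    using assms by (auto simp flip: assms(6))
  show ?thesis
    by (rule vert_opcart_ext[of f Y A]) (use assms opcart_factor_simps[OF l] in auto)
qed

text \<open>
  The factorisation compares the chosen image \<open>f\<^sub>! A\<close> with \<open>C\<close>; the Frobenius and
  Beck--Chevalley conditions become statements about opcartesian arrows through this equivalence.
\<close>

lemma opcartesian_iff_factor_iso:
  assumes "l \<in> Arr \<T>" "fst l = f" "Dom \<T> l = (X, A)" "Cod \<T> l = (Y, C)"
  shows "opcartesian l \<longleftrightarrow> is_iso (fib E Y) (opcart_factor E l)"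
proof -
  note w = opcart_factor_simps[OF assms]
  have t [simp]: "f \<in> Arr \<B>" "Dom \<B> f = X" "Cod \<B> f = Y"
    using assms fst_Arr[OF assms(1)] by auto
  note [simp] = Dom_total_Obj[OF assms(1,3)] Cod_total_Obj[OF assms(1,4)]
  let ?v = "vert E Y (opcart_factor E l)"
  have "opcartesian l \<longleftrightarrow> is_iso \<T> ?v"
  proof
    assume l: "opcartesian l"
    have "opcartesian ?v"
      by (rule opcartesian_cancel[of _ "opcart E f A"]) (use l w in auto)
    then show "is_iso \<T> ?v" by (rule opcartesian_iso) simp
  next
    assume "is_iso \<T> ?v"
    then have "opcartesian (?v \<star> opcart E f A)"
      by (intro opcartesian_Comp[OF opcart_opcartesian iso_opcartesian]) (use w in auto)
    then show "opcartesian l" using w by simp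
  qed
  also have "\<dots> \<longleftrightarrow> is_iso (fib E Y) (opcart_factor E l)"
    using w by (intro vert_iso_iff) auto
  finally show ?thesis .
qed

lemma fst_vertical:
  assumes "k \<in> Arr \<T>" "fst k = Ide \<B> X" "X \<in> Obj \<B>"
  shows "fst (Dom \<T> k) = X" "fst (Cod \<T> k) = X"
  using fst_Arr(2,3)[OF assms(1)] assms(2,3) by (simp_all del: fst_Arr)

lemma fst_Inv_vertical:
  assumes "is_iso \<T> k" "fst k = Ide \<B> X" "X \<in> Obj \<B>"
  shows "fst (Inv \<T> k) = Ide \<B> X"
proof -
  have [simp]: "k \<in> Arr \<T>" using assms(1) by (rule T.is_iso_Arr)
  note [simp] = fst_vertical[OF this assms(2,3)]
  have "fst (Inv \<T> k) = fst (Inv \<T> k) \<bullet> fst k"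
    using assms by simp
  also have "\<dots> = Ide \<B> X"
    using assms unfolding fst_total_comp[symmetric] by simp
  finally show ?thesis .
qed

subsection \<open>Meets in the fibres\<close>

text \<open>
  A product cone in a fibre whose universal property extends to arrows over any base arrow into it;
  quantifying over cones rather than using the chosen products makes rebracketing free.
\<close>

definition meet_cone :: "('a, 'p, 'q) over \<Rightarrow> ('a, 'p, 'q) over \<Rightarrow> bool" where
  "meet_cone m1 m2 \<longleftrightarrow> m1 \<in> Arr \<T> \<and> m2 \<in> Arr \<T> \<and> Dom \<T> m1 = Dom \<T> m2 \<and>
     fst m1 = Ide \<B> (fst (Dom \<T> m1)) \<and> fst m2 = Ide \<B> (fst (Dom \<T> m1)) \<and>
     (\<forall>k1 \<in> Arr \<T>. \<forall>k2 \<in> Arr \<T>. Dom \<T> k1 = Dom \<T> k2 \<longrightarrow> fst k1 = fst k2 \<longrightarrow>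
        Cod \<T> k1 = Cod \<T> m1 \<longrightarrow> Cod \<T> k2 = Cod \<T> m2 \<longrightarrow>
        (\<exists>k. k \<in> Arr \<T> \<and> fst k = fst k1 \<and> Cod \<T> k = Dom \<T> m1 \<and> m1 \<star> k = k1 \<and> m2 \<star> k = k2)) \<and>
     (\<forall>k \<in> Arr \<T>. \<forall>l \<in> Arr \<T>. Cod \<T> k = Dom \<T> m1 \<longrightarrow> Cod \<T> l = Dom \<T> m1 \<longrightarrow> fst k = fst l \<longrightarrow>
        m1 \<star> k = m1 \<star> l \<longrightarrow> m2 \<star> k = m2 \<star> l \<longrightarrow> k = l)"

lemma meet_cone_simps:
  assumes "meet_cone m1 m2"
  shows "m1 \<in> Arr \<T>" "m2 \<in> Arr \<T>" "Dom \<T> m2 = Dom \<T> m1"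
    "fst m1 = Ide \<B> (fst (Dom \<T> m1))" "fst m2 = Ide \<B> (fst (Dom \<T> m1))"
    "fst (Cod \<T> m1) = fst (Dom \<T> m1)" "fst (Cod \<T> m2) = fst (Dom \<T> m1)"
proof -
  show *: "m1 \<in> Arr \<T>" "m2 \<in> Arr \<T>" "Dom \<T> m2 = Dom \<T> m1"
    "fst m1 = Ide \<B> (fst (Dom \<T> m1))" "fst m2 = Ide \<B> (fst (Dom \<T> m1))"
    using assms unfolding meet_cone_def by auto
  show "fst (Cod \<T> m1) = fst (Dom \<T> m1)" "fst (Cod \<T> m2) = fst (Dom \<T> m1)"
    using fst_Arr(3)[OF *(1)] fst_Arr(3)[OF *(2)] * by simp_all
qed

lemma meet_cone_obtain:
  assumes "meet_cone m1 m2" "k1 \<in> Arr \<T>" "k2 \<in> Arr \<T>" "Dom \<T> k1 = Dom \<T> k2" "fst k1 = fst k2"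
    "Cod \<T> k1 = Cod \<T> m1" "Cod \<T> k2 = Cod \<T> m2"
  obtains k where "k \<in> Arr \<T>" "fst k = fst k1" "Dom \<T> k = Dom \<T> k1" "Cod \<T> k = Dom \<T> m1"
    "m1 \<star> k = k1" "m2 \<star> k = k2"
proof -
  note m = meet_cone_simps[OF assms(1)]
  obtain k where k: "k \<in> Arr \<T>" "fst k = fst k1" "Cod \<T> k = Dom \<T> m1" "m1 \<star> k = k1" "m2 \<star> k = k2"
    using assms unfolding meet_cone_def by blast
  then have "Dom \<T> k = Dom \<T> k1"
    using T.Dom_Comp[of k m1] m by simp
  with k that show thesis by blast
qed

lemma meet_cone_ext:
  assumes "meet_cone m1 m2" "k \<in> Arr \<T>" "l \<in> Arr \<T>" "Cod \<T> k = Dom \<T> m1" "Cod \<T> l = Dom \<T> m1" "fst k = fst l"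
    "m1 \<star> k = m1 \<star> l" "m2 \<star> k = m2 \<star> l"
  shows "k = l"
  using assms unfolding meet_cone_def by blast

lemma meet_cone_sym: "meet_cone m1 m2 \<Longrightarrow> meet_cone m2 m1"
proof -
  assume m: "meet_cone m1 m2"
  note M = meet_cone_simps[OF m]
  show ?thesis
    unfolding meet_cone_def
  proof (intro conjI ballI impI)
    fix k1 k2 assume a: "k1 \<in> Arr \<T>" "k2 \<in> Arr \<T>" "Dom \<T> k1 = Dom \<T> k2" "fst k1 = fst k2"
      "Cod \<T> k1 = Cod \<T> m2" "Cod \<T> k2 = Cod \<T> m1"
    obtain k where "k \<in> Arr \<T>" "fst k = fst k2" "Dom \<T> k = Dom \<T> k2" "Cod \<T> k = Dom \<T> m1" "m1 \<star> k = k2" "m2 \<star> k = k1"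
      by (rule meet_cone_obtain[OF m, of k2 k1]) (use a in auto)
    then show "\<exists>k. k \<in> Arr \<T> \<and> fst k = fst k1 \<and> Cod \<T> k = Dom \<T> m2 \<and> m2 \<star> k = k1 \<and> m1 \<star> k = k2"
      using a(4) M(3) by metis
  next
    fix k l assume "k \<in> Arr \<T>" "l \<in> Arr \<T>" "Cod \<T> k = Dom \<T> m2" "Cod \<T> l = Dom \<T> m2" "fst k = fst l"
      "m2 \<star> k = m2 \<star> l" "m1 \<star> k = m1 \<star> l"
    then show "k = l" by (intro meet_cone_ext[OF m, of k l]) (simp_all only: M)
  qed (use M in auto)
qed

lemma meet_cone_iso:
  assumes m: "meet_cone m1 m2" and n: "meet_cone n1 n2"
    and i: "is_iso \<T> i1" "is_iso \<T> i2" "Dom \<T> i1 = Cod \<T> n1" "Cod \<T> i1 = Cod \<T> m1" "Dom \<T> i2 = Cod \<T> n2" "Cod \<T> i2 = Cod \<T> m2"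
    and iv: "fst i1 = Ide \<B> X" "fst i2 = Ide \<B> X" "X \<in> Obj \<B>"
    and k: "k \<in> Arr \<T>" "Dom \<T> k = Dom \<T> n1" "Cod \<T> k = Dom \<T> m1" "fst k = Ide \<B> X"
      "m1 \<star> k = i1 \<star> n1" "m2 \<star> k = i2 \<star> n2"
  shows "is_iso \<T> k"
proof -
  note M = meet_cone_simps[OF m] and N = meet_cone_simps[OF n]
  have iA [simp]: "i1 \<in> Arr \<T>" "i2 \<in> Arr \<T>" using i(1,2) by (auto intro: T.is_iso_Arr)
  have [simp]: "fst (Dom \<T> n1) = X" "fst (Dom \<T> m1) = X"
    using fst_vertical[OF iA(1) iv(1,3)] M(6) N(6) i by simp_all
  have iI: "fst (Inv \<T> i1) = Ide \<B> X" "fst (Inv \<T> i2) = Ide \<B> X"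
    using i iv by (auto intro: fst_Inv_vertical)
  obtain l where l: "l \<in> Arr \<T>" "fst l = Ide \<B> X" "Dom \<T> l = Dom \<T> m1" "Cod \<T> l = Dom \<T> n1"
    "n1 \<star> l = Inv \<T> i1 \<star> m1" "n2 \<star> l = Inv \<T> i2 \<star> m2"
    by (rule meet_cone_obtain[OF n, of "Inv \<T> i1 \<star> m1" "Inv \<T> i2 \<star> m2"]) (use i M N iI in auto)
  have a: "n1 \<star> (l \<star> k) = (n1 \<star> l) \<star> k" "n2 \<star> (l \<star> k) = (n2 \<star> l) \<star> k"
    "m1 \<star> (k \<star> l) = (m1 \<star> k) \<star> l" "m2 \<star> (k \<star> l) = (m2 \<star> k) \<star> l"
    using M N l(1-4) k(1-4) by simp_all
  have b: "n1 \<star> (l \<star> k) = n1"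
    unfolding a(1) l(5) using M(1-3) N(1-3) k i by simp
  have c: "n2 \<star> (l \<star> k) = n2"
    unfolding a(2) l(6) using M(1-3) N(1-3) k i by simp
  have d: "m1 \<star> (k \<star> l) = m1"
    unfolding a(3) k(5) using M(1-3) N(1-3) l i by simp
  have e: "m2 \<star> (k \<star> l) = m2"
    unfolding a(4) k(6) using M(1-3) N(1-3) l i by simp
  have "l \<star> k = Ide \<T> (Dom \<T> k)"
    by (rule meet_cone_ext[OF n]) (use b c N(1-3) l(1-4) k(1-4) iv in simp_all)
  moreover have "k \<star> l = Ide \<T> (Cod \<T> k)"
    by (rule meet_cone_ext[OF m]) (use d e M(1-3) l(1-4) k(1-4) iv in simp_all)
  ultimately show ?thesis
    using l k by (intro T.is_isoI[of _ l]) auto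
qed

lemma over_pair_simps:
  assumes "k1 \<in> Arr \<T>" "k2 \<in> Arr \<T>" "Dom \<T> k1 = Dom \<T> k2" "fst k1 = fst k2" "Cod \<T> k1 = (Y, C)" "Cod \<T> k2 = (Y, D)"
  shows "over_pair E k1 k2 \<in> Arr \<T>" "fst (over_pair E k1 k2) = fst k1" "Dom \<T> (over_pair E k1 k2) = Dom \<T> k1"
    "Cod \<T> (over_pair E k1 k2) = (Y, C \<otimes>\<^bsub>fib E Y\<^esub> D)"
    "vert E Y (Pr1 (fib E Y) C D) \<star> over_pair E k1 k2 = k1"
    "vert E Y (Pr2 (fib E Y) C D) \<star> over_pair E k1 k2 = k2"
proof -
  obtain f \<phi> where 1: "k1 = (f, \<phi>, C)" using assms by (cases k1) (auto simp: tot_simps)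
  obtain \<psi> where 2: "k2 = (f, \<psi>, D)" using assms 1 by (cases k2) (auto simp: tot_simps)
  let ?X = "Dom \<B> f"
  have t [simp]: "f \<in> Arr \<B>" "Cod \<B> f = Y" "C \<in> Obj (fib E Y)" "D \<in> Obj (fib E Y)" "\<phi> \<in> Arr (fib E ?X)" "\<psi> \<in> Arr (fib E ?X)"
    "Cod (fib E ?X) \<phi> = FObj (pull E f) C" "Cod (fib E ?X) \<psi> = FObj (pull E f) D" "Dom (fib E ?X) \<psi> = Dom (fib E ?X) \<phi>" "Y \<in> Obj \<B>"
    using assms Cod_total_Obj[OF assms(1,5)] by (auto simp: 1 2 tot_simps)
  have prod: "is_product (fib E ?X) (FObj (pull E f) C) (FObj (pull E f) D)
         (FObj (pull E f) (C \<otimes>\<^bsub>fib E Y\<^esub> D))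
         (FArr (pull E f) (Pr1 (fib E Y) C D)) (FArr (pull E f) (Pr2 (fib E Y) C D))"
    by (rule pull_product) (auto simp: Hom_def)
  note p = category.pairing_simps[OF fib_category prod, of \<phi> \<psi>, simplified]
  show "over_pair E k1 k2 \<in> Arr \<T>" "fst (over_pair E k1 k2) = fst k1" "Dom \<T> (over_pair E k1 k2) = Dom \<T> k1"
    "Cod \<T> (over_pair E k1 k2) = (Y, C \<otimes>\<^bsub>fib E Y\<^esub> D)"
    using p by (simp_all add: over_pair_def Let_def 1 2 tot_simps)
  show "vert E Y (Pr1 (fib E Y) C D) \<star> over_pair E k1 k2 = k1"
    "vert E Y (Pr2 (fib E Y) C D) \<star> over_pair E k1 k2 = k2"
    using p by (simp_all add: over_pair_def Let_def 1 2 tot_simps vert_Comp_left)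
qed

text \<open>
  A product in a fibre has the extended universal property since reindexing preserves it.
\<close>

lemma meet_cone_Pr:
  assumes [simp]: "Y \<in> Obj \<B>" "C \<in> Obj (fib E Y)" "D \<in> Obj (fib E Y)"
  shows "meet_cone (vert E Y (Pr1 (fib E Y) C D)) (vert E Y (Pr2 (fib E Y) C D))"
  unfolding meet_cone_def
proof (intro conjI ballI impI)
  let ?p = "vert E Y (Pr1 (fib E Y) C D)" and ?q = "vert E Y (Pr2 (fib E Y) C D)"
  fix k1 k2 assume "k1 \<in> Arr \<T>" "k2 \<in> Arr \<T>" "Dom \<T> k1 = Dom \<T> k2" "fst k1 = fst k2" "Cod \<T> k1 = Cod \<T> ?p" "Cod \<T> k2 = Cod \<T> ?q"
  then show "\<exists>k. k \<in> Arr \<T> \<and> fst k = fst k1 \<and> Cod \<T> k = Dom \<T> ?p \<and> ?p \<star> k = k1 \<and> ?q \<star> k = k2"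
    using over_pair_simps[of k1 k2 Y C D] by (intro exI[of _ "over_pair E k1 k2"]) auto
next
  let ?p = "vert E Y (Pr1 (fib E Y) C D)" and ?q = "vert E Y (Pr2 (fib E Y) C D)"
  fix k l assume a: "k \<in> Arr \<T>" "l \<in> Arr \<T>" "Cod \<T> k = Dom \<T> ?p" "Cod \<T> l = Dom \<T> ?p" "fst k = fst l"
    "?p \<star> k = ?p \<star> l" "?q \<star> k = ?q \<star> l"
  obtain f \<phi> where 1: "k = (f, \<phi>, C \<otimes>\<^bsub>fib E Y\<^esub> D)" using a by (cases k) (auto simp: tot_simps)
  obtain \<psi> where 2: "l = (f, \<psi>, C \<otimes>\<^bsub>fib E Y\<^esub> D)" using a 1 by (cases l) (auto simp: tot_simps)
  let ?X = "Dom \<B> f"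
  have t [simp]: "f \<in> Arr \<B>" "Cod \<B> f = Y" "\<phi> \<in> Arr (fib E ?X)" "\<psi> \<in> Arr (fib E ?X)"
    "Cod (fib E ?X) \<phi> = FObj (pull E f) (C \<otimes>\<^bsub>fib E Y\<^esub> D)" "Cod (fib E ?X) \<psi> = FObj (pull E f) (C \<otimes>\<^bsub>fib E Y\<^esub> D)"
    using a by (auto simp: 1 2 tot_simps)
  have prod: "is_product (fib E ?X) (FObj (pull E f) C) (FObj (pull E f) D)
         (FObj (pull E f) (C \<otimes>\<^bsub>fib E Y\<^esub> D))
         (FArr (pull E f) (Pr1 (fib E Y) C D)) (FArr (pull E f) (Pr2 (fib E Y) C D))"
    by (rule pull_product) (auto simp: Hom_def)
  have e: "FArr (pull E f) (Pr1 (fib E Y) C D) \<cdot>\<^bsub>fib E ?X\<^esub> \<phi> = FArr (pull E f) (Pr1 (fib E Y) C D) \<cdot>\<^bsub>fib E ?X\<^esub> \<psi>"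
     "FArr (pull E f) (Pr2 (fib E Y) C D) \<cdot>\<^bsub>fib E ?X\<^esub> \<phi> = FArr (pull E f) (Pr2 (fib E Y) C D) \<cdot>\<^bsub>fib E ?X\<^esub> \<psi>"
    using a by (simp_all add: 1 2 vert_Comp_left)
  have d: "Dom (fib E ?X) \<phi> = Dom (fib E ?X) \<psi>"
    using arg_cong[OF e(1), of "Dom (fib E ?X)"] by simp
  show "k = l"
    unfolding 1 2 using category.is_product_ext[OF fib_category prod, of \<phi> \<psi>] e d by simp
qed auto

lemma over_top_simps:
  assumes "f \<in> Arr \<B>" "A \<in> Obj (fib E (Dom \<B> f))"
  shows "over_top E f A \<in> Arr \<T>" "fst (over_top E f A) = f" "Dom \<T> (over_top E f A) = (Dom \<B> f, A)"
    "Cod \<T> (over_top E f A) = (Cod \<B> f, Term (fib E (Cod \<B> f)))"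
proof -
  let ?FX = "fib E (Dom \<B> f)" and ?T = "FObj (pull E f) (Term (fib E (Cod \<B> f)))"
  have "is_terminal ?FX ?T"
    by (rule pull_terminal) (use assms in \<open>auto simp: Hom_def\<close>)
  then have "\<exists>!\<phi>. \<phi> \<in> Hom ?FX A ?T"
    using assms by (simp add: is_terminal_def)
  from theI'[OF this] have t: "(THE \<phi>. \<phi> \<in> Hom ?FX A ?T) \<in> Hom ?FX A ?T" .
  then show "over_top E f A \<in> Arr \<T>" "fst (over_top E f A) = f" "Dom \<T> (over_top E f A) = (Dom \<B> f, A)"
    "Cod \<T> (over_top E f A) = (Cod \<B> f, Term (fib E (Cod \<B> f)))"
    using assms by (auto simp: over_top_def Let_def tot_simps Hom_def)
qed

lemma over_top_ext:
  assumes "k \<in> Arr \<T>" "l \<in> Arr \<T>" "fst k = fst l" "Dom \<T> k = Dom \<T> l"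
    "Cod \<T> k = (Y, Term (fib E Y))" "Cod \<T> l = (Y, Term (fib E Y))"
  shows "k = l"
proof -
  obtain f \<phi> where 1: "k = (f, \<phi>, Term (fib E Y))" using assms by (cases k) (auto simp: tot_simps)
  obtain \<psi> where 2: "l = (f, \<psi>, Term (fib E Y))" using assms 1 by (cases l) (auto simp: tot_simps)
  let ?FX = "fib E (Dom \<B> f)" and ?T = "FObj (pull E f) (Term (fib E (Cod \<B> f)))"
  have t: "f \<in> Arr \<B>" "Cod \<B> f = Y" "\<phi> \<in> Arr ?FX" "\<psi> \<in> Arr ?FX"
    "Cod ?FX \<phi> = ?T" "Cod ?FX \<psi> = ?T" "Dom ?FX \<phi> = Dom ?FX \<psi>"
    using assms by (auto simp: 1 2 tot_simps)
  have "is_terminal ?FX ?T"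
    by (rule pull_terminal) (use t in \<open>auto simp: Hom_def\<close>)
  then have "\<exists>!\<chi>. \<chi> \<in> Hom ?FX (Dom ?FX \<psi>) ?T"
    using t by (simp add: is_terminal_def)
  moreover have "\<phi> \<in> Hom ?FX (Dom ?FX \<psi>) ?T" "\<psi> \<in> Hom ?FX (Dom ?FX \<psi>) ?T"
    using t by (simp_all add: Hom_def)
  ultimately have "\<phi> = \<psi>" by blast
  then show ?thesis by (simp add: 1 2)
qed

subsection \<open>Frobenius reciprocity for opcartesian arrows\<close>

lemma opcart_natural:
  assumes "f \<in> Arr \<B>" "X = Dom \<B> f" "Y = Cod \<B> f" "\<phi> \<in> Arr (fib E X)"
  shows "vert E Y (FArr (ex E f) \<phi>) \<star> opcart E f (Dom (fib E X) \<phi>) = opcart E f (Cod (fib E X) \<phi>) \<star> vert E X \<phi>"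
proof -
  have adj: "adjunction (fib E X) (fib E Y) (ex E f) (pull E f) (ex_unit E f) (ex_counit E f)"
    by (rule ex_pull_adjunction) (simp add: Hom_def assms)
  have "FArr (pull E f) (FArr (ex E f) \<phi>) \<cdot>\<^bsub>fib E X\<^esub> ex_unit E f (Dom (fib E X) \<phi>) =
      ex_unit E f (Cod (fib E X) \<phi>) \<cdot>\<^bsub>fib E X\<^esub> \<phi>"
    using adj assms(4) by (auto simp: adjunction_def natural_def comp_func_def Id_func_def Hom_def)
  then show ?thesis
    using assms by (simp add: vert_opcart) (simp add: opcart_def vert_Comp_right tot_simps)
qed

lemma opcart_counit:
  assumes "f \<in> Arr \<B>" "Y = Cod \<B> f" "C \<in> Obj (fib E Y)"
  shows "vert E Y (ex_counit E f C) \<star> opcart E f (FObj (pull E f) C) = cart E f C"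
proof -
  have adj: "adjunction (fib E (Dom \<B> f)) (fib E Y) (ex E f) (pull E f) (ex_unit E f) (ex_counit E f)"
    by (rule ex_pull_adjunction) (simp add: Hom_def assms)
  then show ?thesis
    using assms by (simp add: vert_opcart cart_def adjunction_def)
qed

text \<open>
  The canonical map of Frobenius reciprocity is the comparison map of the arrow
  \<open>A \<inter> f\<^sup>* C \<rightarrow> f\<^sub>! A \<inter> C\<close> over \<open>f\<close> that is opcartesian in the first and cartesian in the second component.
\<close>

lemma frobenius_opcartesian_chosen:
  assumes [simp]: "f \<in> Arr \<B>" "Dom \<B> f = X" "Cod \<B> f = Y" "A \<in> Obj (fib E X)" "C \<in> Obj (fib E Y)"
  defines "P \<equiv> FObj (pull E f) C"
  defines "k \<equiv> over_pair E (opcart E f A \<star> vert E X (Pr1 (fib E X) A P)) (cart E f C \<star> vert E X (Pr2 (fib E X) A P))"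
  shows "opcartesian k"
proof -
  have [simp]: "X \<in> Obj \<B>" "Y \<in> Obj \<B>" "P \<in> Obj (fib E X)"
    using B.Obj_Dom[of f] B.Obj_Cod[of f] by (auto simp: P_def)
  interpret FY: finite_product_category "fib E Y" by (rule fib_products) simp
  have k: "k \<in> Arr \<T>" "fst k = f" "Dom \<T> k = (X, A \<otimes>\<^bsub>fib E X\<^esub> P)" "Cod \<T> k = (Y, FObj (ex E f) A \<otimes>\<^bsub>fib E Y\<^esub> C)"
    "vert E Y (Pr1 (fib E Y) (FObj (ex E f) A) C) \<star> k = opcart E f A \<star> vert E X (Pr1 (fib E X) A P)"
    "vert E Y (Pr2 (fib E Y) (FObj (ex E f) A) C) \<star> k = cart E f C \<star> vert E X (Pr2 (fib E X) A P)"
    using over_pair_simps[of "opcart E f A \<star> vert E X (Pr1 (fib E X) A P)" "cart E f C \<star> vert E X (Pr2 (fib E X) A P)" Y "FObj (ex E f) A" C]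
    by (simp_all add: k_def P_def)
  let ?m = "frobenius_map E f A C"
  have eq: "?m = tuple (fib E Y) (FArr (ex E f) (Pr1 (fib E X) A P)) (ex_counit E f C \<cdot>\<^bsub>fib E Y\<^esub> FArr (ex E f) (Pr2 (fib E X) A P))"
    by (simp add: frobenius_map_def P_def Let_def)
  have d: "Dom (fib E Y) (ex_counit E f C) = FObj (ex E f) P" by (simp add: P_def)
  have m: "?m \<in> Arr (fib E Y)" "Dom (fib E Y) ?m = FObj (ex E f) (A \<otimes>\<^bsub>fib E X\<^esub> P)"
    "Cod (fib E Y) ?m = FObj (ex E f) A \<otimes>\<^bsub>fib E Y\<^esub> C"
    "Pr1 (fib E Y) (FObj (ex E f) A) C \<cdot>\<^bsub>fib E Y\<^esub> ?m = FArr (ex E f) (Pr1 (fib E X) A P)"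
    "Pr2 (fib E Y) (FObj (ex E f) A) C \<cdot>\<^bsub>fib E Y\<^esub> ?m = ex_counit E f C \<cdot>\<^bsub>fib E Y\<^esub> FArr (ex E f) (Pr2 (fib E X) A P)"
    unfolding eq by (simp_all add: d)
  have "vert E Y ?m \<star> opcart E f (A \<otimes>\<^bsub>fib E X\<^esub> P) = k"
  proof (rule meet_cone_ext[OF meet_cone_Pr[of Y "FObj (ex E f) A" C]])
    let ?O = "opcart E f (A \<otimes>\<^bsub>fib E X\<^esub> P)"
    have "vert E Y (Pr1 (fib E Y) (FObj (ex E f) A) C) \<star> (vert E Y ?m \<star> ?O) =
      vert E Y (Pr1 (fib E Y) (FObj (ex E f) A) C \<cdot>\<^bsub>fib E Y\<^esub> ?m) \<star> ?O"
      using m(1-3) by (simp add: vert_Comp)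
    then show "vert E Y (Pr1 (fib E Y) (FObj (ex E f) A) C) \<star> (vert E Y ?m \<star> ?O) =
      vert E Y (Pr1 (fib E Y) (FObj (ex E f) A) C) \<star> k"
      using opcart_natural[of f X Y "Pr1 (fib E X) A P"] by (simp add: m k)
    have "vert E Y (Pr2 (fib E Y) (FObj (ex E f) A) C) \<star> (vert E Y ?m \<star> ?O) =
      vert E Y (Pr2 (fib E Y) (FObj (ex E f) A) C \<cdot>\<^bsub>fib E Y\<^esub> ?m) \<star> ?O"
      using m(1-3) by (simp add: vert_Comp)
    also have "\<dots> = vert E Y (ex_counit E f C) \<star> (vert E Y (FArr (ex E f) (Pr2 (fib E X) A P)) \<star> ?O)"
      unfolding m(5) by (simp add: vert_Comp d)
    also have "\<dots> = (vert E Y (ex_counit E f C) \<star> opcart E f P) \<star> vert E X (Pr2 (fib E X) A P)"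
      using opcart_natural[of f X Y "Pr2 (fib E X) A P"] by (simp add: d)
    finally show "vert E Y (Pr2 (fib E Y) (FObj (ex E f) A) C) \<star> (vert E Y ?m \<star> ?O) =
      vert E Y (Pr2 (fib E Y) (FObj (ex E f) A) C) \<star> k"
      using opcart_counit[of f Y C] by (simp add: k P_def)
  qed (use m k in auto)
  then have "opcart_factor E k = ?m"
    by (intro opcart_factor_unique[of f Y "A \<otimes>\<^bsub>fib E X\<^esub> P"]) (use m in auto)
  moreover have "is_iso (fib E Y) ?m"
    by (rule frobenius[of f X Y]) (auto simp: Hom_def)
  ultimately show ?thesis
    using opcartesian_iff_factor_iso[OF k(1-4)] by simp
qed

text \<open>
  Any such arrow between meets differs from the chosen one by vertical isomorphisms.
\<close>

lemma frobenius_opcartesian: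
  assumes e: "opcartesian e" and c: "cartesian c" and ec: "fst e = f" "fst c = f"
    and n: "meet_cone n1 n2" and m: "meet_cone m1 m2"
    and nm: "Cod \<T> n1 = Dom \<T> e" "Cod \<T> n2 = Dom \<T> c" "Cod \<T> m1 = Cod \<T> e" "Cod \<T> m2 = Cod \<T> c"
    and k: "k \<in> Arr \<T>" "fst k = f" "Dom \<T> k = Dom \<T> n1" "Cod \<T> k = Dom \<T> m1"
      "m1 \<star> k = e \<star> n1" "m2 \<star> k = c \<star> n2"
  shows "opcartesian k"
proof -
  note M = meet_cone_simps[OF m] and N = meet_cone_simps[OF n]
  note [simp] = opcartesian_Arr[OF e] cartesian_Arr[OF c]
  obtain X A where de: "Dom \<T> e = (X, A)" by (cases "Dom \<T> e")
  obtain Y B where ce: "Cod \<T> e = (Y, B)" by (cases "Cod \<T> e")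
  have f [simp]: "f \<in> Arr \<B>" "Dom \<B> f = X" "Cod \<B> f = Y"
    using fst_Arr[of e] de ce ec by simp_all
  obtain C where cc: "Cod \<T> c = (Y, C)" using fst_Arr(3)[of c] ec by (cases "Cod \<T> c") simp
  obtain A' where dc: "Dom \<T> c = (X, A')" using fst_Arr(2)[of c] ec by (cases "Dom \<T> c") simp
  note [simp] = Dom_total_Obj[OF _ de] Cod_total_Obj[OF _ ce] Dom_total_Obj[OF _ dc] Cod_total_Obj[OF _ cc]
  define P where "P = FObj (pull E f) C"
  have P [simp]: "P \<in> Obj (fib E X)" by (simp add: P_def)
  let ?p1 = "vert E Y (Pr1 (fib E Y) (FObj (ex E f) A) C)" and ?p2 = "vert E Y (Pr2 (fib E Y) (FObj (ex E f) A) C)"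
  let ?q1 = "vert E X (Pr1 (fib E X) A P)" and ?q2 = "vert E X (Pr2 (fib E X) A P)"
  define k0 where "k0 = over_pair E (opcart E f A \<star> ?q1) (cart E f C \<star> ?q2)"
  have k0: "opcartesian k0" unfolding k0_def P_def by (rule frobenius_opcartesian_chosen) auto
  have k0': "k0 \<in> Arr \<T>" "fst k0 = f" "Dom \<T> k0 = (X, A \<otimes>\<^bsub>fib E X\<^esub> P)" "Cod \<T> k0 = (Y, FObj (ex E f) A \<otimes>\<^bsub>fib E Y\<^esub> C)"
    "?p1 \<star> k0 = opcart E f A \<star> ?q1" "?p2 \<star> k0 = cart E f C \<star> ?q2"
    using over_pair_simps[of "opcart E f A \<star> ?q1" "cart E f C \<star> ?q2" Y "FObj (ex E f) A" C]
    by (simp_all add: k0_def P_def)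
  define v where "v = vert E Y (opcart_factor E e)"
  note w = opcart_factor_simps[OF _ ec(1) de ce, simplified]
  have v: "v \<in> Arr \<T>" "fst v = Ide \<B> Y" "Dom \<T> v = (Y, FObj (ex E f) A)" "Cod \<T> v = (Y, B)" "v \<star> opcart E f A = e"
    using w by (simp_all add: v_def)
  have v_iso: "is_iso \<T> v"
    using opcartesian_iff_factor_iso[OF _ ec(1) de ce] e w by (simp add: v_def vert_iso_iff)
  obtain j where j: "j \<in> Arr \<T>" "fst j = Ide \<B> X" "Dom \<T> j = Dom \<T> c" "Cod \<T> j = (X, P)" "cart E f C \<star> j = c"
    by (rule cartesian_obtain[OF cart_cartesian[of f C], of c "Ide \<B> X"]) (use cc ec in \<open>auto simp: P_def\<close>)
  have j_iso: "is_iso \<T> j"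
    by (rule cartesian_iso[OF cartesian_cancel[of "cart E f C"]]) (use j c in \<open>auto simp: P_def intro: cart_cartesian\<close>)
  have N' [simp]: "fst (Dom \<T> n1) = X" using N nm(1) de by simp
  have M' [simp]: "fst (Dom \<T> m1) = Y" using M nm(3) ce by simp
  obtain a where a: "a \<in> Arr \<T>" "fst a = Ide \<B> X" "Dom \<T> a = Dom \<T> n1" "Cod \<T> a = (X, A \<otimes>\<^bsub>fib E X\<^esub> P)"
      "?q1 \<star> a = n1" "?q2 \<star> a = j \<star> n2"
    by (rule meet_cone_obtain[OF meet_cone_Pr[of X A P], of n1 "j \<star> n2"]) (use N nm j de dc in auto)
  have a_iso: "is_iso \<T> a"
    by (rule meet_cone_iso[OF meet_cone_Pr[of X A P] n, of "Ide \<T> (X, A)" j X])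
      (use N nm j j_iso de dc a in auto)
  obtain b where b: "b \<in> Arr \<T>" "fst b = Ide \<B> Y" "Dom \<T> b = (Y, FObj (ex E f) A \<otimes>\<^bsub>fib E Y\<^esub> C)" "Cod \<T> b = Dom \<T> m1"
      "m1 \<star> b = v \<star> ?p1" "m2 \<star> b = ?p2"
    by (rule meet_cone_obtain[OF m, of "v \<star> ?p1" ?p2]) (use M nm v cc ce in auto)
  have b_iso: "is_iso \<T> b"
    by (rule meet_cone_iso[OF m meet_cone_Pr[of Y "FObj (ex E f) A" C], of v "Ide \<T> (Y, C)" Y])
      (use M nm v v_iso ce cc b in auto)
  have "b \<star> (k0 \<star> a) = k"
  proof (rule meet_cone_ext[OF m])
    have "m1 \<star> (b \<star> (k0 \<star> a)) = (m1 \<star> b) \<star> (k0 \<star> a)"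
      using M(1-3) b(1-4) k0'(1-4) a(1-4) by simp
    also have "\<dots> = v \<star> ((?p1 \<star> k0) \<star> a)"
      unfolding b(5) using v(1-4) k0'(1-4) a(1-4) by simp
    also have "\<dots> = (v \<star> opcart E f A) \<star> (?q1 \<star> a)"
      unfolding k0'(5) using v(1-4) a(1-4) by simp
    finally show "m1 \<star> (b \<star> (k0 \<star> a)) = m1 \<star> k"
      by (simp only: v(5) a(5) k(5))
    have "m2 \<star> (b \<star> (k0 \<star> a)) = (m2 \<star> b) \<star> (k0 \<star> a)"
      using M(1-3) b(1-4) k0'(1-4) a(1-4) by simp
    also have "\<dots> = (?p2 \<star> k0) \<star> a"
      unfolding b(6) using k0'(1-4) a(1-4) by simp
    also have "\<dots> = cart E f C \<star> (?q2 \<star> a)"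
      unfolding k0'(6) using a(1-4) by (simp add: P_def)
    also have "\<dots> = (cart E f C \<star> j) \<star> n2"
      unfolding a(6) using j(1-4) N(1-3) nm by (simp add: P_def)
    finally show "m2 \<star> (b \<star> (k0 \<star> a)) = m2 \<star> k"
      by (simp only: j(5) k(6))
  qed (use M(1-3) b(1-4) k0'(1-4) a(1-4) k in auto)
  moreover have "opcartesian (b \<star> (k0 \<star> a))"
    by (intro opcartesian_Comp iso_opcartesian a_iso b_iso k0) (use b(1-4) k0'(1-4) a(1-4) in auto)
  ultimately show ?thesis by simp
qed

end

section \<open>Stability of opcartesian arrows under pullback\<close>

context finite_product_category
begin

lemma projection_tuple [simp]:
  assumes "a \<in> Arr C" "b \<in> Arr C" "c \<in> Arr C" "Dom C a = Dom C c" "Dom C b = Dom C c"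
    "X = Cod C a" "Y = Cod C b" "Z = Cod C c"
  shows "p12 C X Y Z \<cdot> tuple C (tuple C a b) c = tuple C a b"
    "p23 C X Y Z \<cdot> tuple C (tuple C a b) c = tuple C b c"
    "p13 C X Y Z \<cdot> tuple C (tuple C a b) c = tuple C a c"
  using assms by (simp_all add: proj_defs)

lemma prod_map_tuple [simp]:
  assumes "f \<in> Arr C" "g \<in> Arr C" "a \<in> Arr C" "b \<in> Arr C" "Dom C f = Cod C a" "Dom C g = Cod C b" "Dom C a = Dom C b"
  shows "prod_map C f g \<cdot> tuple C a b = tuple C (f \<cdot> a) (g \<cdot> b)"
  using assms by (simp add: proj_defs)

lemma diag_Comp [simp]: "\<lbrakk>f \<in> Arr C; X = Cod C f\<rbrakk> \<Longrightarrow> diag C X \<cdot> f = tuple C f f"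
  by (simp add: diag_def)

lemma terminal_obtain:
  assumes "W \<in> Obj C"
  obtains z where "z \<in> Arr C" "Dom C z = W" "Cod C z = Term C"
  using terminal assms unfolding is_terminal_def Hom_def by blast

lemma terminal_ext: "\<lbrakk>f \<in> Arr C; g \<in> Arr C; Dom C f = Dom C g; Cod C f = Term C; Cod C g = Term C\<rbrakk> \<Longrightarrow> f = g"
  using terminal Obj_Dom[of g] unfolding is_terminal_def Hom_def by blast

lemma is_iso_swap:
  assumes "A \<in> Obj C" "B \<in> Obj C"
  shows "is_iso C (tuple C (Pr2 C A B) (Pr1 C A B))"
  by (rule is_isoI[of _ "tuple C (Pr2 C B A) (Pr1 C B A)"]) (use assms in auto)

lemma is_iso_Pr2_Term:
  assumes "A \<in> Obj C"
  shows "is_iso C (Pr2 C (Term C) A)"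
proof -
  obtain z where z: "z \<in> Arr C" "Dom C z = A" "Cod C z = Term C"
    using terminal_obtain[OF assms] .
  have "z \<cdot> Pr2 C (Term C) A = Pr1 C (Term C) A"
    by (rule terminal_ext) (use assms z in auto)
  then show ?thesis
    by (intro is_isoI[of _ "tuple C z (Ide C A)"]) (use assms z in auto)
qed

lemma is_iso_Pr1_Term:
  assumes "A \<in> Obj C"
  shows "is_iso C (Pr1 C A (Term C))"
proof -
  obtain z where z: "z \<in> Arr C" "Dom C z = A" "Cod C z = Term C"
    using terminal_obtain[OF assms] .
  have "z \<cdot> Pr1 C A (Term C) = Pr2 C A (Term C)"
    by (rule terminal_ext) (use assms z in auto)
  then show ?thesis
    by (intro is_isoI[of _ "tuple C (Ide C A) z"]) (use assms z in auto)
qed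

end

context regular_fibration
begin

text \<open>
  One half of the Beck--Chevalley condition for the square \<open>t \<bullet> u = s \<bullet> v\<close>, freed of the choice of
  lifts: over it, the pullback of an opcartesian arrow is opcartesian.
\<close>

definition stable_square :: "'a \<Rightarrow> 'a \<Rightarrow> 'a \<Rightarrow> 'a \<Rightarrow> bool" where
  "stable_square u v t s \<longleftrightarrow>
     u \<in> Arr \<B> \<and> v \<in> Arr \<B> \<and> t \<in> Arr \<B> \<and> s \<in> Arr \<B> \<and> Dom \<B> v = Dom \<B> u \<and> Dom \<B> t = Cod \<B> u \<and>
     Dom \<B> s = Cod \<B> v \<and> Cod \<B> s = Cod \<B> t \<and> t \<bullet> u = s \<bullet> v \<and>
     (\<forall>e c c' e'. opcartesian e \<longrightarrow> cartesian c \<longrightarrow> cartesian c' \<longrightarrow> e' \<in> Arr \<T> \<longrightarrow>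
        fst e = t \<longrightarrow> fst c = u \<longrightarrow> fst c' = s \<longrightarrow> fst e' = v \<longrightarrow>
        Cod \<T> c = Dom \<T> e \<longrightarrow> Cod \<T> c' = Cod \<T> e \<longrightarrow> Dom \<T> e' = Dom \<T> c \<longrightarrow> Cod \<T> e' = Dom \<T> c' \<longrightarrow>
        c' \<star> e' = e \<star> c \<longrightarrow> opcartesian e')"

lemma stable_squareD:
  assumes "stable_square u v t s" "opcartesian e" "cartesian c" "cartesian c'" "e' \<in> Arr \<T>"
    "fst e = t" "fst c = u" "fst c' = s" "fst e' = v" "Cod \<T> c = Dom \<T> e" "Cod \<T> c' = Cod \<T> e"
    "Dom \<T> e' = Dom \<T> c" "Cod \<T> e' = Dom \<T> c'" "c' \<star> e' = e \<star> c"
  shows "opcartesian e'"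
  using assms unfolding stable_square_def by blast

lemma opcartesian_iso_cancel:
  assumes "opcartesian (i \<star> k)" "is_iso \<T> i" "k \<in> Arr \<T>" "Cod \<T> k = Dom \<T> i"
  shows "opcartesian k"
proof -
  have "opcartesian (Inv \<T> i \<star> (i \<star> k))"
    by (intro opcartesian_Comp[OF assms(1)] iso_opcartesian T.is_iso_Inv) (use assms T.is_iso_Arr[OF assms(2)] in auto)
  then show ?thesis using assms by simp
qed

lemma cartesian_comparison:
  assumes c: "cartesian c" and c': "cartesian c'" and "fst c = fst c'" "Cod \<T> c = Cod \<T> c'"
  obtains j where "is_iso \<T> j" "j \<in> Arr \<T>" "fst j = Ide \<B> (fst (Dom \<T> c))" "Dom \<T> j = Dom \<T> c" "Cod \<T> j = Dom \<T> c'" "c' \<star> j = c"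
proof -
  note [simp] = cartesian_Arr[OF c] cartesian_Arr[OF c']
  have d: "fst (Dom \<T> c') = fst (Dom \<T> c)"
    using fst_Arr(2)[of c] fst_Arr(2)[of c'] assms(3) by simp
  obtain j where j: "j \<in> Arr \<T>" "fst j = Ide \<B> (fst (Dom \<T> c))" "Dom \<T> j = Dom \<T> c" "Cod \<T> j = Dom \<T> c'" "c' \<star> j = c"
    by (rule cartesian_obtain[OF c', of c "Ide \<B> (fst (Dom \<T> c))"]) (use assms(4) d in \<open>auto simp: assms(3)[symmetric]\<close>)
  have "is_iso \<T> j"
    by (rule cartesian_iso[OF cartesian_cancel[of c']]) (use j c c' in auto)
  with j that show thesis by blast
qed

lemma opcartesian_comparison:
  assumes c: "opcartesian c" and c': "opcartesian c'" and "fst c = fst c'" "Dom \<T> c = Dom \<T> c'"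
  obtains j where "is_iso \<T> j" "j \<in> Arr \<T>" "fst j = Ide \<B> (fst (Cod \<T> c))" "Dom \<T> j = Cod \<T> c'" "Cod \<T> j = Cod \<T> c" "j \<star> c' = c"
proof -
  note [simp] = opcartesian_Arr[OF c] opcartesian_Arr[OF c']
  have d: "fst (Cod \<T> c') = fst (Cod \<T> c)"
    using fst_Arr(3)[of c] fst_Arr(3)[of c'] assms(3) by simp
  obtain j where j: "j \<in> Arr \<T>" "fst j = Ide \<B> (fst (Cod \<T> c))" "Dom \<T> j = Cod \<T> c'" "Cod \<T> j = Cod \<T> c" "j \<star> c' = c"
    by (rule opcartesian_obtain[OF c', of c "Ide \<B> (fst (Cod \<T> c))"]) (use assms(4) d in \<open>auto simp: assms(3)[symmetric]\<close>)
  have "is_iso \<T> j"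
    by (rule opcartesian_iso[OF opcartesian_cancel[of _ c']]) (use j c c' in auto)
  with j that show thesis by blast
qed

text \<open>
  For the chosen lifts, \<open>bc_map\<close> is the comparison map of the arrow induced over \<open>v\<close>; all other lifts
  are isomorphic to the chosen ones.
\<close>

lemma bc_iso_stable_square:
  assumes t: "u \<in> Arr \<B>" "v \<in> Arr \<B>" "t \<in> Arr \<B>" "s \<in> Arr \<B>" "Dom \<B> v = Dom \<B> u" "Dom \<B> t = Cod \<B> u"
     "Dom \<B> s = Cod \<B> v" "Cod \<B> s = Cod \<B> t" "t \<bullet> u = s \<bullet> v"
    and bc: "\<forall>A \<in> Obj (fib E (Cod \<B> u)). is_iso (fib E (Cod \<B> v)) (bc_map E u v t s A)"
  shows "stable_square u v t s"
proof -
  have "opcartesian e'"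
    if e: "opcartesian e" and c: "cartesian c" and c': "cartesian c'" and e': "e' \<in> Arr \<T>"
      and f: "fst e = t" "fst c = u" "fst c' = s" "fst e' = v"
      and d: "Cod \<T> c = Dom \<T> e" "Cod \<T> c' = Cod \<T> e" "Dom \<T> e' = Dom \<T> c" "Cod \<T> e' = Dom \<T> c'"
      and eq: "c' \<star> e' = e \<star> c" for e c c' e'
  proof -
    note [simp] = opcartesian_Arr[OF e] cartesian_Arr[OF c] cartesian_Arr[OF c']
    obtain A where de: "Dom \<T> e = (Dom \<B> t, A)"
      using fst_Arr(2)[of e] f by (cases "Dom \<T> e") simp
    have A [simp]: "A \<in> Obj (fib E (Cod \<B> u))"
      using Dom_total_Obj[OF _ de] t by simp
    let ?tA = "FObj (ex E t) A"
    define e0 where "e0 = opcart E t A"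
    define c0 where "c0 = cart E u A"
    define c0' where "c0' = cart E s ?tA"
    define e0' where "e0' = cart_factor E s v (e0 \<star> c0)"
    have e0: "opcartesian e0" "fst e0 = t" "Dom \<T> e0 = Dom \<T> e" "Cod \<T> e0 = (Cod \<B> t, ?tA)" "e0 \<in> Arr \<T>"
      using t de by (auto simp: e0_def)
    have c0: "cartesian c0" "fst c0 = u" "Cod \<T> c0 = Dom \<T> e" "c0 \<in> Arr \<T>" "Dom \<T> c0 = (Dom \<B> u, FObj (pull E u) A)"
      using t de by (auto simp: c0_def cart_cartesian)
    have c0': "cartesian c0'" "fst c0' = s" "Cod \<T> c0' = Cod \<T> e0" "c0' \<in> Arr \<T>" "Dom \<T> c0' = (Dom \<B> s, FObj (pull E s) ?tA)"
      using t de by (auto simp: c0'_def cart_cartesian e0_def)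
    have e0': "e0' \<in> Arr \<T>" "fst e0' = v" "Dom \<T> e0' = Dom \<T> c0" "Cod \<T> e0' = Dom \<T> c0'" "c0' \<star> e0' = e0 \<star> c0"
      using cart_factor_simps[of v s "e0 \<star> c0" ?tA] t e0 c0 c0' by (auto simp: e0'_def c0'_def)
    have "opcart_factor E e0' = bc_map E u v t s A"
      using t by (simp add: e0'_def e0_def c0_def opcart_def cart_def tot_simps cart_factor_def opcart_factor_def bc_map_def Let_def)
    then have e0'_op: "opcartesian e0'"
      using opcartesian_iff_factor_iso[of e0' v "Dom \<B> u" "FObj (pull E u) A" "Cod \<B> v" "FObj (pull E s) ?tA"] e0' c0 c0' bc t
      by simp
    obtain i where i: "is_iso \<T> i" "i \<in> Arr \<T>" "fst i = Ide \<B> (fst (Cod \<T> e))" "Dom \<T> i = Cod \<T> e0" "Cod \<T> i = Cod \<T> e" "i \<star> e0 = e"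
      by (rule opcartesian_comparison[OF e e0(1)]) (use f e0 in auto)
    obtain j where j: "is_iso \<T> j" "j \<in> Arr \<T>" "fst j = Ide \<B> (fst (Dom \<T> c))" "Dom \<T> j = Dom \<T> c" "Cod \<T> j = Dom \<T> c0" "c0 \<star> j = c"
      by (rule cartesian_comparison[OF c c0(1)]) (use f c0 d in auto)
    have ic: "cartesian (i \<star> c0')"
      by (rule cartesian_Comp[OF c0'(1) iso_cartesian[OF i(1)]]) (use c0' i in auto)
    have fe: "fst (Cod \<T> e) = Cod \<B> t" using fst_Arr(3)[of e] f by simp
    have dc: "fst (Dom \<T> c) = Dom \<B> u" using fst_Arr(2)[of c] f by simp
    obtain l where l: "is_iso \<T> l" "l \<in> Arr \<T>" "fst l = Ide \<B> (Dom \<B> s)" "Dom \<T> l = Dom \<T> c0'" "Cod \<T> l = Dom \<T> c'" "c' \<star> l = i \<star> c0'"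
      by (rule cartesian_comparison[OF ic c']) (use i c0' f d fe t in auto)
    have "e' = l \<star> (e0' \<star> j)"
    proof (rule cartesian_ext[OF c'])
      have "c' \<star> (l \<star> (e0' \<star> j)) = (c' \<star> l) \<star> (e0' \<star> j)"
        using l(1-5) e0'(1-4) j(1-5) by simp
      also have "\<dots> = i \<star> ((c0' \<star> e0') \<star> j)"
        unfolding l(6) using i c0' e0'(1-4) j(1-5) by simp
      also have "\<dots> = (i \<star> e0) \<star> (c0 \<star> j)"
        unfolding e0'(5) using i(1-5) c0 e0 j(1-5) by simp
      finally show "c' \<star> e' = c' \<star> (l \<star> (e0' \<star> j))"
        by (simp only: i(6) j(6) eq)
    qed (use l e0' j e' f d t dc in auto)
    moreover have "opcartesian (l \<star> (e0' \<star> j))"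
      by (intro opcartesian_Comp iso_opcartesian l(1) j(1) e0'_op) (use l e0' j in auto)
    ultimately show ?thesis by simp
  qed
  then show ?thesis unfolding stable_square_def using t by blast
qed

lemma graph_stable:
  assumes f [simp]: "f \<in> Arr \<B>"
  shows "stable_square f (tuple \<B> (Ide \<B> (Dom \<B> f)) f) (diag \<B> (Cod \<B> f)) (prod_map \<B> f (Ide \<B> (Cod \<B> f)))"
proof (rule bc_iso_stable_square)
  show "\<forall>A\<in>Obj (fib E (Cod \<B> f)). is_iso (fib E (Cod \<B> (tuple \<B> (Ide \<B> (Dom \<B> f)) f)))
     (bc_map E f (tuple \<B> (Ide \<B> (Dom \<B> f)) f) (diag \<B> (Cod \<B> f)) (prod_map \<B> f (Ide \<B> (Cod \<B> f))) A)"
    using product_absolute_bc[OF product_absolute.graph[of f \<B> "Dom \<B> f" "Cod \<B> f"]]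
    by (simp add: Hom_def beck_chevalley_def)
qed auto

text \<open>
  Among the generating squares there is one for the graph \<open>x \<mapsto> (x, f x)\<close> but none for \<open>x \<mapsto> (f x, x)\<close>;
  conjugating with isomorphisms passes from one to the other.
\<close>

lemma stable_square_iso:
  assumes st: "stable_square u v (b \<bullet> t) s" and b: "is_iso \<B> b" and c: "is_iso \<B> c"
    and "t \<in> Arr \<B>" "v2 \<in> Arr \<B>" "s2 \<in> Arr \<B>" "Dom \<B> b = Cod \<B> t" "Dom \<B> c = Cod \<B> v2" "Dom \<B> s2 = Cod \<B> v2"
    and "Cod \<B> s2 = Cod \<B> t" "c \<bullet> v2 = v" "s \<bullet> c = b \<bullet> s2" "Cod \<B> c = Dom \<B> s"
  shows "stable_square u v2 t s2"
proof -
  note [simp] = B.is_iso_Arr[OF b] B.is_iso_Arr[OF c]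
  have t: "u \<in> Arr \<B>" "v \<in> Arr \<B>" "s \<in> Arr \<B>" "Dom \<B> v = Dom \<B> u" "Dom \<B> t = Cod \<B> u"
     "Dom \<B> s = Cod \<B> v" "Cod \<B> s = Cod \<B> b" "(b \<bullet> t) \<bullet> u = s \<bullet> v"
    using st assms(4-) unfolding stable_square_def by auto
  have dv: "Dom \<B> v2 = Dom \<B> u"
    using assms(5,8,11) t(4) by auto
  have "b \<bullet> (t \<bullet> u) = (b \<bullet> t) \<bullet> u" using t assms(4-) by simp
  also have "\<dots> = s \<bullet> (c \<bullet> v2)" using t(8) assms(11) by simp
  also have "\<dots> = (s \<bullet> c) \<bullet> v2" using t assms(5,8,13) by simp
  also have "\<dots> = b \<bullet> (s2 \<bullet> v2)" unfolding assms(12) using assms(4-10) by simp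
  finally have comm: "t \<bullet> u = s2 \<bullet> v2"
    by (rule B.iso_mono[OF b]) (use t assms(4-10) dv in auto)
  have "opcartesian e'"
    if e: "opcartesian e" and k: "cartesian k" and k': "cartesian k'" and e': "e' \<in> Arr \<T>"
      and f: "fst e = t" "fst k = u" "fst k' = s2" "fst e' = v2"
      and d: "Cod \<T> k = Dom \<T> e" "Cod \<T> k' = Cod \<T> e" "Dom \<T> e' = Dom \<T> k" "Cod \<T> e' = Dom \<T> k'"
      and eq: "k' \<star> e' = e \<star> k" for e k k' e'
  proof -
    note [simp] = opcartesian_Arr[OF e] cartesian_Arr[OF k] cartesian_Arr[OF k']
    obtain P where P: "Cod \<T> e = (Dom \<B> b, P)"
      using fst_Arr(3)[of e] f assms(7) by (cases "Cod \<T> e") simp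
    obtain Q where Q: "Cod \<T> e' = (Dom \<B> c, Q)"
      using fst_Arr(3)[of e'] e' f assms(8) by (cases "Cod \<T> e'") simp
    define \<beta> where "\<beta> = opcart E b P"
    define \<gamma> where "\<gamma> = opcart E c Q"
    have \<beta>: "\<beta> \<in> Arr \<T>" "fst \<beta> = b" "Dom \<T> \<beta> = Cod \<T> e" "is_iso \<T> \<beta>"
      using P Cod_total_Obj[OF _ P] b by (auto simp: \<beta>_def intro!: opcartesian_iso)
    have \<gamma>: "\<gamma> \<in> Arr \<T>" "fst \<gamma> = c" "Dom \<T> \<gamma> = Cod \<T> e'" "is_iso \<T> \<gamma>"
      using Q Cod_total_Obj[OF e' Q] c by (auto simp: \<gamma>_def intro!: opcartesian_iso)
    define m where "m = \<beta> \<star> (k' \<star> Inv \<T> \<gamma>)"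
    have "cartesian m"
      unfolding m_def using \<beta> \<gamma> d
      by (intro cartesian_Comp[OF cartesian_Comp[OF iso_cartesian k'] iso_cartesian] T.is_iso_Inv) auto
    then have m: "cartesian m" "m \<in> Arr \<T>" "Dom \<T> m = Cod \<T> \<gamma>" "Cod \<T> m = Cod \<T> \<beta>" "m \<star> \<gamma> = \<beta> \<star> k'"
      unfolding m_def using \<beta> \<gamma> d k' by auto
    have "fst m \<bullet> c = s \<bullet> c"
      using arg_cong[OF m(5), of fst] \<beta> \<gamma> f assms(12) by simp
    moreover have "Dom \<B> (fst m) = Cod \<B> c"
      using fst_Arr(2)[OF m(2)] fst_Arr(3)[OF \<gamma>(1)] m(3) \<gamma>(2) by simp
    ultimately have fm: "fst m = s"
      using m t assms(13) by (intro B.iso_epi[OF c, of "fst m" s]) auto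
    have "opcartesian (\<gamma> \<star> e')"
    proof (rule stable_squareD[OF st, of "\<beta> \<star> e" k m])
      show "opcartesian (\<beta> \<star> e)"
        by (rule opcartesian_Comp[OF e iso_opcartesian[OF \<beta>(4)]]) (use \<beta> in auto)
      have "m \<star> (\<gamma> \<star> e') = (m \<star> \<gamma>) \<star> e'"
        using m(1-4) \<gamma> e' by simp
      also have "\<dots> = \<beta> \<star> (k' \<star> e')"
        unfolding m(5) using \<beta> e' d by simp
      finally show "m \<star> (\<gamma> \<star> e') = (\<beta> \<star> e) \<star> k"
        unfolding eq using \<beta> d by simp
    qed (use k m fm \<beta> \<gamma> f d e' assms(11) in auto)
    then show ?thesis
      by (rule opcartesian_iso_cancel) (use \<gamma> e' in auto)
  qed
  moreover have "u \<in> Arr \<B> \<and> v2 \<in> Arr \<B> \<and> t \<in> Arr \<B> \<and> s2 \<in> Arr \<B> \<and> Dom \<B> v2 = Dom \<B> u \<and> Dom \<B> t = Cod \<B> u \<and>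
     Dom \<B> s2 = Cod \<B> v2 \<and> Cod \<B> s2 = Cod \<B> t \<and> t \<bullet> u = s2 \<bullet> v2"
    using t(1,5) assms(4-10) dv comm by simp
  ultimately show ?thesis
    unfolding stable_square_def by blast
qed

text \<open>
  The diagonal is invariant under swapping the factors of its codomain, so swapping turns the graph
  square into this one.
\<close>

lemma cograph_stable:
  assumes f [simp]: "f \<in> Arr \<B>"
  shows "stable_square f (tuple \<B> f (Ide \<B> (Dom \<B> f))) (diag \<B> (Cod \<B> f)) (prod_map \<B> (Ide \<B> (Cod \<B> f)) f)"
proof -
  let ?X = "Dom \<B> f" and ?Y = "Cod \<B> f"
  let ?b = "tuple \<B> (Pr2 \<B> ?Y ?Y) (Pr1 \<B> ?Y ?Y)" and ?c = "tuple \<B> (Pr2 \<B> ?Y ?X) (Pr1 \<B> ?Y ?X)"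
  have "?b \<bullet> diag \<B> ?Y = diag \<B> ?Y" by (simp add: diag_def)
  note swap = this
  show ?thesis
  proof (rule stable_square_iso[OF _ B.is_iso_swap[of ?Y ?Y] B.is_iso_swap[of ?Y ?X]])
    show "stable_square f (tuple \<B> (Ide \<B> ?X) f) (?b \<bullet> diag \<B> ?Y) (prod_map \<B> f (Ide \<B> ?Y))"
      unfolding swap by (rule graph_stable) simp
  qed (simp_all add: B.proj_defs)
qed

text \<open>
  Pulling back along the projection \<open>W \<times> Y \<rightarrow> Y\<close> amounts to pulling back along \<open>! \<times> Y : W \<times> Y \<rightarrow> 1 \<times> Y\<close>,
  for which there is an interchange square, and then along the isomorphism \<open>1 \<times> Y \<cong> Y\<close>.  Allowing
  arbitrary product cones \<open>(r, p)\<close> and \<open>(r', p')\<close> accounts for all bracketings of iterated products.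
\<close>

lemma projection_stable:
  assumes t [simp]: "t \<in> Arr \<B>" "p \<in> Arr \<B>" "p' \<in> Arr \<B>" "r \<in> Arr \<B>" "r' \<in> Arr \<B>" "m \<in> Arr \<B>"
    and d [simp]: "Cod \<B> p = Dom \<B> t" "Cod \<B> p' = Cod \<B> t" "Cod \<B> r' = Cod \<B> r" "Dom \<B> r = Dom \<B> p" "Dom \<B> r' = Dom \<B> p'"
      "Dom \<B> m = Dom \<B> p" "Cod \<B> m = Dom \<B> p'"
    and comm: "p' \<bullet> m = t \<bullet> p" "r' \<bullet> m = r"
    and iso: "is_iso \<B> (tuple \<B> r p)" "is_iso \<B> (tuple \<B> r' p')"
  shows "stable_square p m t p'"
proof -
  \<comment> \<open>The cone \<open>(r, p)\<close> is compared with the chosen product \<open>W \<times> X\<close>, and that with \<open>1 \<times> X\<close>.\<close>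
  let ?W = "Cod \<B> r" and ?X = "Dom \<B> t" and ?Y = "Cod \<B> t" and ?I = "Term \<B>"
  obtain z where z [simp]: "z \<in> Arr \<B>" "Dom \<B> z = ?W" "Cod \<B> z = ?I"
    using B.terminal_obtain[of ?W] by auto
  let ?u = "prod_map \<B> (Ide \<B> ?W) t" and ?v = "prod_map \<B> z (Ide \<B> ?X)"
  let ?T = "prod_map \<B> z (Ide \<B> ?Y)" and ?S = "prod_map \<B> (Ide \<B> ?I) t"
  let ?a = "tuple \<B> r p" and ?a' = "tuple \<B> r' p'"
  let ?q = "Pr2 \<B> ?I ?X" and ?q' = "Pr2 \<B> ?I ?Y"
  have st: "stable_square ?v ?u ?S ?T"
  proof (rule bc_iso_stable_square)
    show "\<forall>A\<in>Obj (fib E (Cod \<B> ?v)). is_iso (fib E (Cod \<B> ?u)) (bc_map E ?v ?u ?S ?T A)"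
      using product_absolute_bc[OF product_absolute.interchange[of t \<B> ?X ?Y z ?W ?I]]
      by (simp add: Hom_def beck_chevalley_def)
  qed (auto simp: B.proj_defs)
  have "opcartesian e'"
    if e: "opcartesian e" and c: "cartesian c" and c': "cartesian c'" and e': "e' \<in> Arr \<T>"
      and f: "fst e = t" "fst c = p" "fst c' = p'" "fst e' = m"
      and d: "Cod \<T> c = Dom \<T> e" "Cod \<T> c' = Cod \<T> e" "Dom \<T> e' = Dom \<T> c" "Cod \<T> e' = Dom \<T> c'"
      and eq: "c' \<star> e' = e \<star> c" for e c c' e'
  proof -
    note [simp] = opcartesian_Arr[OF e] cartesian_Arr[OF c] cartesian_Arr[OF c']
    obtain A where A: "Dom \<T> e = (?X, A)"
      using fst_Arr(2)[of e] f by (cases "Dom \<T> e") simp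
    obtain B where B: "Cod \<T> e = (?Y, B)"
      using fst_Arr(3)[of e] f by (cases "Cod \<T> e") simp
    note [simp] = Dom_total_Obj[OF _ A] Cod_total_Obj[OF _ B]
    define C1 where "C1 = cart E ?q A"
    define C1' where "C1' = cart E ?q' B"
    define c2 where "c2 = cart E ?v (FObj (pull E ?q) A)"
    define c2' where "c2' = cart E ?T (FObj (pull E ?q') B)"
    have C1: "cartesian C1" "C1 \<in> Arr \<T>" "fst C1 = ?q" "Cod \<T> C1 = (?X, A)" "fst (Dom \<T> C1) = ?I \<otimes>\<^bsub>\<B>\<^esub> ?X"
      by (auto simp: C1_def intro: cart_cartesian)
    have C1': "cartesian C1'" "C1' \<in> Arr \<T>" "fst C1' = ?q'" "Cod \<T> C1' = (?Y, B)" "fst (Dom \<T> C1') = ?I \<otimes>\<^bsub>\<B>\<^esub> ?Y"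
      by (auto simp: C1'_def intro: cart_cartesian)
    have c2: "cartesian c2" "c2 \<in> Arr \<T>" "fst c2 = ?v" "Cod \<T> c2 = Dom \<T> C1" "fst (Dom \<T> c2) = ?W \<otimes>\<^bsub>\<B>\<^esub> ?X"
      by (auto simp: c2_def C1_def intro: cart_cartesian)
    have c2': "cartesian c2'" "c2' \<in> Arr \<T>" "fst c2' = ?T" "Cod \<T> c2' = Dom \<T> C1'" "fst (Dom \<T> c2') = ?W \<otimes>\<^bsub>\<B>\<^esub> ?Y"
      by (auto simp: c2'_def C1'_def intro: cart_cartesian)
    have i1: "is_iso \<T> C1" "is_iso \<T> C1'"
      using C1 C1' by (auto intro!: cartesian_iso B.is_iso_Pr2_Term)
    have CC: "cartesian (C1 \<star> c2)" "cartesian (C1' \<star> c2')"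
      using C1 C1' c2 c2' by (auto intro: cartesian_Comp)
    obtain c3 where c3: "c3 \<in> Arr \<T>" "fst c3 = ?a" "Dom \<T> c3 = Dom \<T> c" "Cod \<T> c3 = Dom \<T> c2" "(C1 \<star> c2) \<star> c3 = c"
      by (rule cartesian_obtain[OF CC(1), of c ?a]) (use C1 c2 f d A in \<open>auto simp: B.proj_defs\<close>)
    obtain c3' where c3': "c3' \<in> Arr \<T>" "fst c3' = ?a'" "Dom \<T> c3' = Dom \<T> c'" "Cod \<T> c3' = Dom \<T> c2'" "(C1' \<star> c2') \<star> c3' = c'"
      by (rule cartesian_obtain[OF CC(2), of c' ?a']) (use C1' c2' f d B in \<open>auto simp: B.proj_defs\<close>)
    have i3: "is_iso \<T> c3" "is_iso \<T> c3'"
      using c3 c3' c c' iso C1 c2 C1' c2'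
      by (auto intro!: cartesian_iso intro: cartesian_cancel[OF _ CC(1)] cartesian_cancel[OF _ CC(2)] simp del: T.Comp_assoc_Arr)
    obtain e1 where e1: "e1 \<in> Arr \<T>" "fst e1 = ?S" "Dom \<T> e1 = Dom \<T> C1" "Cod \<T> e1 = Dom \<T> C1'" "C1' \<star> e1 = e \<star> C1"
      by (rule cartesian_obtain[OF C1'(1), of "e \<star> C1" ?S]) (use C1 C1' f A B in \<open>auto simp: B.proj_defs\<close>)
    have e1_op: "opcartesian e1"
    proof (rule opcartesian_iso_cancel[of C1'])
      show "opcartesian (C1' \<star> e1)"
        unfolding e1(5) by (intro opcartesian_Comp iso_opcartesian i1 e) (use C1 A in auto)
    qed (use e1 i1 in auto)
    obtain e2 where e2: "e2 \<in> Arr \<T>" "fst e2 = ?u" "Dom \<T> e2 = Dom \<T> c2" "Cod \<T> e2 = Dom \<T> c2'" "c2' \<star> e2 = e1 \<star> c2"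
      by (rule cartesian_obtain[OF c2'(1), of "e1 \<star> c2" ?u]) (use c2 c2' e1 in \<open>auto simp: B.proj_defs\<close>)
    have e2_op: "opcartesian e2"
      by (rule stable_squareD[OF st e1_op c2(1) c2'(1) e2(1)]) (use e1 e2 c2 c2' in auto)
    have "c3' \<star> e' = e2 \<star> c3"
    proof (rule cartesian_ext[OF CC(2)])
      have "(C1' \<star> c2') \<star> (c3' \<star> e') = ((C1' \<star> c2') \<star> c3') \<star> e'"
        using C1' c2' c3'(1-4) e' d by simp
      also have "\<dots> = e \<star> ((C1 \<star> c2) \<star> c3)"
        unfolding c3'(5) eq c3(5) ..
      also have "\<dots> = (C1' \<star> e1) \<star> (c2 \<star> c3)"
        unfolding e1(5) using C1 c2 c3(1-4) A by simp
      also have "\<dots> = C1' \<star> ((c2' \<star> e2) \<star> c3)"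
        unfolding e2(5) using C1' e1(1-4) c2 c3(1-4) by simp
      finally show "(C1' \<star> c2') \<star> (c3' \<star> e') = (C1' \<star> c2') \<star> (e2 \<star> c3)"
        using C1' e2(1-4) c2' c3(1-4) by simp
      show "fst (c3' \<star> e') = fst (e2 \<star> c3)"
        using f comm by (simp add: c3'(2) e2(2) c3(2))
    qed (use C1' e2(1-4) c2' c3(1-4) c3'(1-4) e' d in auto)
    moreover have "opcartesian (e2 \<star> c3)"
      by (intro opcartesian_Comp iso_opcartesian i3 e2_op) (use e2 c3 in auto)
    ultimately show ?thesis
      using opcartesian_iso_cancel[OF _ i3(2) e'] c3' d by simp
  qed
  moreover have "p \<in> Arr \<B> \<and> m \<in> Arr \<B> \<and> t \<in> Arr \<B> \<and> p' \<in> Arr \<B> \<and> Dom \<B> m = Dom \<B> p \<and> Dom \<B> t = Cod \<B> p \<and>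
     Dom \<B> p' = Cod \<B> m \<and> Cod \<B> p' = Cod \<B> t \<and> t \<bullet> p = p' \<bullet> m"
    by (simp add: comm)
  ultimately show ?thesis
    unfolding stable_square_def by blast
qed

end

context regular_fibration
begin

abbreviation base_prod (infixr "\<odot>" 75) where "X \<odot> Y \<equiv> X \<otimes>\<^bsub>base E\<^esub> Y"

section \<open>Arrows into a composite of matrices\<close>

lemma over_comp_eq [simp]: "over_comp E l k = l \<star> k"
  by (simp add: tot_def)

lemma over_id_eq [simp]: "over_id E X A = Ide \<T> (X, A)"
  by (simp add: tot_def)

text \<open>
  Cartesianness holds because reindexing preserves terminal objects.
\<close>

lemma over_top_cartesian:
  assumes f: "f \<in> Arr \<B>" "Dom \<B> f = X"
  shows "cartesian (over_top E f (Term (fib E X)))"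
proof (rule cartesianI)
  let ?t = "over_top E f (Term (fib E X))"
  have X: "X \<in> Obj \<B>" using f B.Obj_Dom[of f] by simp
  note t = over_top_simps[of f "Term (fib E X)", unfolded f(2)]
  show "?t \<in> Arr \<T>" using f X t by simp
  fix l g assume a: "l \<in> Arr \<T>" "g \<in> Arr \<B>" "Cod \<T> l = Cod \<T> ?t" "Cod \<B> g = fst (Dom \<T> ?t)" "fst l = fst ?t \<bullet> g"
  obtain A where A: "Dom \<T> l = (Dom \<B> g, A)"
    using fst_Arr(2)[OF a(1)] a f X t by (cases "Dom \<T> l") simp
  note A' = Dom_total_Obj[OF a(1) A]
  note m = over_top_simps[OF a(2), of A]
  have "?t \<star> over_top E g A = l"
    by (rule over_top_ext[of _ _ "Cod \<B> f"]) (use a A A' f X t m in auto)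
  then show "\<exists>m. m \<in> Arr \<T> \<and> fst m = g \<and> Cod \<T> m = Dom \<T> ?t \<and> ?t \<star> m = l"
    using a A' m t X f by (intro exI[of _ "over_top E g A"]) auto
next
  let ?t = "over_top E f (Term (fib E X))"
  have X: "X \<in> Obj \<B>" using f B.Obj_Dom[of f] by simp
  note t = over_top_simps[of f "Term (fib E X)", unfolded f(2)]
  fix m n assume a: "?t \<star> m = ?t \<star> n" "fst m = fst n" "m \<in> Arr \<T>" "n \<in> Arr \<T>" "Cod \<T> m = Dom \<T> ?t" "Cod \<T> n = Dom \<T> ?t"
  have "Dom \<T> m = Dom \<T> n"
    using arg_cong[OF a(1), of "Dom \<T>"] a(3-) t f X by simp
  then show "m = n"
    by (intro over_top_ext[of m n X]) (use a t f X in auto)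
qed

text \<open>
  With this cone, Frobenius reciprocity turns an image of \<open>\<top>\<close> into an image of an arbitrary object.
\<close>

lemma meet_cone_top:
  assumes X: "X \<in> Obj \<B>" and A: "A \<in> Obj (fib E X)"
  shows "meet_cone (over_top E (Ide \<B> X) A) (Ide \<T> (X, A))"
  unfolding meet_cone_def
proof (intro conjI ballI impI)
  let ?t = "over_top E (Ide \<B> X) A" and ?i = "Ide \<T> (X, A)"
  note t = over_top_simps[of "Ide \<B> X" A, simplified B.Dom_Ide[OF X] B.Cod_Ide[OF X], OF B.Arr_Ide[OF X] A]
  show "?t \<in> Arr \<T>" "?i \<in> Arr \<T>" "Dom \<T> ?t = Dom \<T> ?i" "fst ?t = Ide \<B> (fst (Dom \<T> ?t))"
    "fst ?i = Ide \<B> (fst (Dom \<T> ?t))"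
    using t X A by simp_all
  fix k1 k2 assume a: "k1 \<in> Arr \<T>" "k2 \<in> Arr \<T>" "Dom \<T> k1 = Dom \<T> k2" "fst k1 = fst k2" "Cod \<T> k1 = Cod \<T> ?t" "Cod \<T> k2 = Cod \<T> ?i"
  have f: "fst k2 \<in> Arr \<B>" "Cod \<B> (fst k2) = X" using fst_Arr[OF a(2)] a(6) X A by simp_all
  have "?t \<star> k2 = k1"
    by (rule over_top_ext[of _ _ X]) (use a t X A f in auto)
  then show "\<exists>k. k \<in> Arr \<T> \<and> fst k = fst k1 \<and> Cod \<T> k = Dom \<T> ?t \<and> ?t \<star> k = k1 \<and> ?i \<star> k = k2"
    using a t X A by (intro exI[of _ k2]) auto
next
  let ?t = "over_top E (Ide \<B> X) A" and ?i = "Ide \<T> (X, A)"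
  note t = over_top_simps[of "Ide \<B> X" A, simplified B.Dom_Ide[OF X] B.Cod_Ide[OF X], OF B.Arr_Ide[OF X] A]
  fix k l assume "k \<in> Arr \<T>" "l \<in> Arr \<T>" "Cod \<T> k = Dom \<T> ?t" "Cod \<T> l = Dom \<T> ?t" "?i \<star> k = ?i \<star> l"
  then show "k = l" using t X A by simp
qed

text \<open>
  The two projections of the meet defining \<open>S \<circ> R\<close>, composed with cartesian arrows so as to end in
  \<open>R\<close> and \<open>S\<close> themselves.
\<close>

definition meet_pr1 :: "'o \<Rightarrow> 'o \<Rightarrow> 'o \<Rightarrow> 'p \<Rightarrow> 'p \<Rightarrow> ('a, 'p, 'q) over" where
  "meet_pr1 X Y Z S R = cart E (p12 \<B> X Y Z) R \<star> vert E ((X \<odot> Y) \<odot> Z)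
     (Pr1 (fib E ((X \<odot> Y) \<odot> Z)) (FObj (pull E (p12 \<B> X Y Z)) R) (FObj (pull E (p23 \<B> X Y Z)) S))"

definition meet_pr2 :: "'o \<Rightarrow> 'o \<Rightarrow> 'o \<Rightarrow> 'p \<Rightarrow> 'p \<Rightarrow> ('a, 'p, 'q) over" where
  "meet_pr2 X Y Z S R = cart E (p23 \<B> X Y Z) S \<star> vert E ((X \<odot> Y) \<odot> Z)
     (Pr2 (fib E ((X \<odot> Y) \<odot> Z)) (FObj (pull E (p12 \<B> X Y Z)) R) (FObj (pull E (p23 \<B> X Y Z)) S))"

definition into_meet :: "'o \<Rightarrow> 'o \<Rightarrow> 'o \<Rightarrow> 'a \<Rightarrow> ('a, 'p, 'q) over \<Rightarrow> ('a, 'p, 'q) over \<Rightarrow> ('a, 'p, 'q) over" where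
  "into_meet X Y Z w a b = over_pair E (cart_factor E (p12 \<B> X Y Z) w a) (cart_factor E (p23 \<B> X Y Z) w b)"

text \<open>
  The typing under which \<open>into_comp E X Y Z S R w a b\<close> is meaningful.
\<close>

definition into_data :: "'o \<Rightarrow> 'o \<Rightarrow> 'o \<Rightarrow> 'p \<Rightarrow> 'p \<Rightarrow> 'a \<Rightarrow> ('a, 'p, 'q) over \<Rightarrow> ('a, 'p, 'q) over \<Rightarrow> bool" where
  "into_data X Y Z S R w a b \<longleftrightarrow>
     X \<in> Obj \<B> \<and> Y \<in> Obj \<B> \<and> Z \<in> Obj \<B> \<and> R \<in> Obj (fib E (X \<odot> Y)) \<and> S \<in> Obj (fib E (Y \<odot> Z)) \<and>
     w \<in> Arr \<B> \<and> Cod \<B> w = (X \<odot> Y) \<odot> Z \<and> a \<in> Arr \<T> \<and> b \<in> Arr \<T> \<and> Dom \<T> b = Dom \<T> a \<and>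
     fst a = p12 \<B> X Y Z \<bullet> w \<and> fst b = p23 \<B> X Y Z \<bullet> w \<and> Cod \<T> a = (X \<odot> Y, R) \<and> Cod \<T> b = (Y \<odot> Z, S)"

lemma matr_Obj [simp]:
  assumes "X \<in> Obj \<B>" "Y \<in> Obj \<B>" "Z \<in> Obj \<B>" "R \<in> Obj (fib E (X \<odot> Y))" "S \<in> Obj (fib E (Y \<odot> Z))"
  shows "matr_meet E X Y Z S R \<in> Obj (fib E ((X \<odot> Y) \<odot> Z))"
    "matr_comp E X Y Z S R \<in> Obj (fib E (X \<odot> Z))"
  using assms by (simp_all add: matr_meet_def matr_comp_def)

lemma meet_pr_simps [simp]:
  assumes "X \<in> Obj \<B>" "Y \<in> Obj \<B>" "Z \<in> Obj \<B>" "R \<in> Obj (fib E (X \<odot> Y))" "S \<in> Obj (fib E (Y \<odot> Z))"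
  shows "meet_pr1 X Y Z S R \<in> Arr \<T>" "fst (meet_pr1 X Y Z S R) = p12 \<B> X Y Z"
    "Dom \<T> (meet_pr1 X Y Z S R) = ((X \<odot> Y) \<odot> Z, matr_meet E X Y Z S R)" "Cod \<T> (meet_pr1 X Y Z S R) = (X \<odot> Y, R)"
    "meet_pr2 X Y Z S R \<in> Arr \<T>" "fst (meet_pr2 X Y Z S R) = p23 \<B> X Y Z"
    "Dom \<T> (meet_pr2 X Y Z S R) = ((X \<odot> Y) \<odot> Z, matr_meet E X Y Z S R)" "Cod \<T> (meet_pr2 X Y Z S R) = (Y \<odot> Z, S)"
  using assms by (simp_all add: meet_pr1_def meet_pr2_def matr_meet_def)

lemma into_meet_simps:
  assumes "into_data X Y Z S R w a b"
  shows "into_meet X Y Z w a b \<in> Arr \<T>" "fst (into_meet X Y Z w a b) = w" "Dom \<T> (into_meet X Y Z w a b) = Dom \<T> a"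
    "Cod \<T> (into_meet X Y Z w a b) = ((X \<odot> Y) \<odot> Z, matr_meet E X Y Z S R)"
    "meet_pr1 X Y Z S R \<star> into_meet X Y Z w a b = a" "meet_pr2 X Y Z S R \<star> into_meet X Y Z w a b = b"
proof -
  note d = assms[unfolded into_data_def]
  let ?a = "cart_factor E (p12 \<B> X Y Z) w a" and ?b = "cart_factor E (p23 \<B> X Y Z) w b"
  let ?XYZ = "(X \<odot> Y) \<odot> Z" and ?R = "FObj (pull E (p12 \<B> X Y Z)) R" and ?S = "FObj (pull E (p23 \<B> X Y Z)) S"
  have a: "?a \<in> Arr \<T>" "fst ?a = w" "Dom \<T> ?a = Dom \<T> a" "Cod \<T> ?a = (?XYZ, ?R)" "cart E (p12 \<B> X Y Z) R \<star> ?a = a"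
    using cart_factor_simps[of w "p12 \<B> X Y Z" a R] d by simp_all
  have b: "?b \<in> Arr \<T>" "fst ?b = w" "Dom \<T> ?b = Dom \<T> a" "Cod \<T> ?b = (?XYZ, ?S)" "cart E (p23 \<B> X Y Z) S \<star> ?b = b"
    using cart_factor_simps[of w "p23 \<B> X Y Z" b S] d by simp_all
  note p = over_pair_simps[of ?a ?b ?XYZ ?R ?S]
  show *: "into_meet X Y Z w a b \<in> Arr \<T>" "fst (into_meet X Y Z w a b) = w" "Dom \<T> (into_meet X Y Z w a b) = Dom \<T> a"
    "Cod \<T> (into_meet X Y Z w a b) = (?XYZ, matr_meet E X Y Z S R)"
    using p a b d by (simp_all add: into_meet_def matr_meet_def)
  show "meet_pr1 X Y Z S R \<star> into_meet X Y Z w a b = a" "meet_pr2 X Y Z S R \<star> into_meet X Y Z w a b = b"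
    using * p(5,6) a b d by (simp_all add: into_meet_def meet_pr1_def meet_pr2_def matr_meet_def)
qed

lemma into_meet_ext:
  assumes "X \<in> Obj \<B>" "Y \<in> Obj \<B>" "Z \<in> Obj \<B>" "R \<in> Obj (fib E (X \<odot> Y))" "S \<in> Obj (fib E (Y \<odot> Z))"
    and "k \<in> Arr \<T>" "l \<in> Arr \<T>" "fst k = fst l" "Cod \<T> k = ((X \<odot> Y) \<odot> Z, matr_meet E X Y Z S R)"
    "Cod \<T> l = ((X \<odot> Y) \<odot> Z, matr_meet E X Y Z S R)"
    "meet_pr1 X Y Z S R \<star> k = meet_pr1 X Y Z S R \<star> l" "meet_pr2 X Y Z S R \<star> k = meet_pr2 X Y Z S R \<star> l"
  shows "k = l"
proof -
  let ?XYZ = "(X \<odot> Y) \<odot> Z" and ?R = "FObj (pull E (p12 \<B> X Y Z)) R" and ?S = "FObj (pull E (p23 \<B> X Y Z)) S"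
  let ?p = "vert E ?XYZ (Pr1 (fib E ?XYZ) ?R ?S)" and ?q = "vert E ?XYZ (Pr2 (fib E ?XYZ) ?R ?S)"
  have c: "Cod \<T> k = (?XYZ, ?R \<otimes>\<^bsub>fib E ?XYZ\<^esub> ?S)" "Cod \<T> l = (?XYZ, ?R \<otimes>\<^bsub>fib E ?XYZ\<^esub> ?S)"
    using assms by (simp_all add: matr_meet_def)
  have "?p \<star> k = ?p \<star> l"
    by (rule cart_Comp_ext[of "p12 \<B> X Y Z" R]) (use assms c in \<open>auto simp: meet_pr1_def\<close>)
  moreover have "?q \<star> k = ?q \<star> l"
    by (rule cart_Comp_ext[of "p23 \<B> X Y Z" S]) (use assms c in \<open>auto simp: meet_pr2_def\<close>)
  ultimately show ?thesis
    by (intro meet_cone_ext[OF meet_cone_Pr[of ?XYZ ?R ?S], of k l]) (use assms c in auto)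
qed

lemma into_comp_eq:
  "into_comp E X Y Z S R w a b = opcart E (p13 \<B> X Y Z) (matr_meet E X Y Z S R) \<star> into_meet X Y Z w a b"
  by (simp add: into_comp_def into_meet_def)

lemma into_comp_simps:
  assumes "into_data X Y Z S R w a b"
  shows "into_comp E X Y Z S R w a b \<in> Arr \<T>" "fst (into_comp E X Y Z S R w a b) = p13 \<B> X Y Z \<bullet> w"
    "Dom \<T> (into_comp E X Y Z S R w a b) = Dom \<T> a" "Cod \<T> (into_comp E X Y Z S R w a b) = (X \<odot> Z, matr_comp E X Y Z S R)"
  using into_meet_simps[OF assms] assms[unfolded into_data_def] by (auto simp: into_comp_eq matr_comp_def)

lemma into_comp_Comp:
  assumes d: "into_data X Y Z S R w a b" and k: "k \<in> Arr \<T>" "Cod \<T> k = Dom \<T> a"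
  shows "into_comp E X Y Z S R w a b \<star> k = into_comp E X Y Z S R (w \<bullet> fst k) (a \<star> k) (b \<star> k)"
    "into_data X Y Z S R (w \<bullet> fst k) (a \<star> k) (b \<star> k)"
proof -
  note t = d[unfolded into_data_def]
  have w: "Dom \<B> w = fst (Dom \<T> a)"
    using fst_Arr(2)[of a] t by simp
  show d': "into_data X Y Z S R (w \<bullet> fst k) (a \<star> k) (b \<star> k)"
    using t k w unfolding into_data_def by simp
  note m = into_meet_simps[OF d] and m' = into_meet_simps[OF d']
  have 1: "meet_pr1 X Y Z S R \<star> (into_meet X Y Z w a b \<star> k) = (meet_pr1 X Y Z S R \<star> into_meet X Y Z w a b) \<star> k"
    "meet_pr2 X Y Z S R \<star> (into_meet X Y Z w a b \<star> k) = (meet_pr2 X Y Z S R \<star> into_meet X Y Z w a b) \<star> k"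
    using m(1-4) t k by simp_all
  have "into_meet X Y Z w a b \<star> k = into_meet X Y Z (w \<bullet> fst k) (a \<star> k) (b \<star> k)"
  proof (rule into_meet_ext[of X Y Z R S])
    show "meet_pr1 X Y Z S R \<star> (into_meet X Y Z w a b \<star> k) = meet_pr1 X Y Z S R \<star> into_meet X Y Z (w \<bullet> fst k) (a \<star> k) (b \<star> k)"
      "meet_pr2 X Y Z S R \<star> (into_meet X Y Z w a b \<star> k) = meet_pr2 X Y Z S R \<star> into_meet X Y Z (w \<bullet> fst k) (a \<star> k) (b \<star> k)"
      by (simp_all only: 1 m m')
  qed (use m m' t k in auto)
  then show "into_comp E X Y Z S R w a b \<star> k = into_comp E X Y Z S R (w \<bullet> fst k) (a \<star> k) (b \<star> k)"
    using m(1-4) t k by (simp add: into_comp_eq)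
qed

lemma matr_comp2_simps:
  assumes t [simp]: "X \<in> Obj \<B>" "Y \<in> Obj \<B>" "Z \<in> Obj \<B>" "\<rho> \<in> Arr (fib E (X \<odot> Y))" "\<sigma> \<in> Arr (fib E (Y \<odot> Z))"
    and dc: "Dom (fib E (X \<odot> Y)) \<rho> = R" "Cod (fib E (X \<odot> Y)) \<rho> = R'" "Dom (fib E (Y \<odot> Z)) \<sigma> = S" "Cod (fib E (Y \<odot> Z)) \<sigma> = S'"
  shows "matr_comp2 E X Y Z \<sigma> \<rho> \<in> Arr (fib E (X \<odot> Z))"
    "Dom (fib E (X \<odot> Z)) (matr_comp2 E X Y Z \<sigma> \<rho>) = matr_comp E X Y Z S R"
    "Cod (fib E (X \<odot> Z)) (matr_comp2 E X Y Z \<sigma> \<rho>) = matr_comp E X Y Z S' R'"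
    "into_data X Y Z S R w a b \<Longrightarrow> into_data X Y Z S' R' w (vert E (X \<odot> Y) \<rho> \<star> a) (vert E (Y \<odot> Z) \<sigma> \<star> b)"
    "into_data X Y Z S R w a b \<Longrightarrow> vert E (X \<odot> Z) (matr_comp2 E X Y Z \<sigma> \<rho>) \<star> into_comp E X Y Z S R w a b =
       into_comp E X Y Z S' R' w (vert E (X \<odot> Y) \<rho> \<star> a) (vert E (Y \<odot> Z) \<sigma> \<star> b)"
proof -
  let ?XYZ = "(X \<odot> Y) \<odot> Z" and ?r = "FArr (pull E (p12 \<B> X Y Z)) \<rho>" and ?s = "FArr (pull E (p23 \<B> X Y Z)) \<sigma>"
  have O [simp]: "R \<in> Obj (fib E (X \<odot> Y))" "R' \<in> Obj (fib E (X \<odot> Y))" "S \<in> Obj (fib E (Y \<odot> Z))" "S' \<in> Obj (fib E (Y \<odot> Z))"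
    using dc category.Obj_Dom[OF fib_category] category.Obj_Cod[OF fib_category] by auto
  interpret F: finite_product_category "fib E ?XYZ" by (rule fib_products) simp
  let ?m = "prod_map (fib E ?XYZ) ?r ?s"
  have m [simp]: "?m \<in> Arr (fib E ?XYZ)" "Dom (fib E ?XYZ) ?m = matr_meet E X Y Z S R" "Cod (fib E ?XYZ) ?m = matr_meet E X Y Z S' R'"
    by (simp_all add: matr_meet_def dc)
  show *: "matr_comp2 E X Y Z \<sigma> \<rho> \<in> Arr (fib E (X \<odot> Z))"
    "Dom (fib E (X \<odot> Z)) (matr_comp2 E X Y Z \<sigma> \<rho>) = matr_comp E X Y Z S R"
    "Cod (fib E (X \<odot> Z)) (matr_comp2 E X Y Z \<sigma> \<rho>) = matr_comp E X Y Z S' R'"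
    by (simp_all add: matr_comp2_def matr_comp_def)
  assume d: "into_data X Y Z S R w a b"
  note t' = d[unfolded into_data_def]
  have w: "Dom \<B> w = fst (Dom \<T> a)"
    using fst_Arr(2)[of a] t' by simp
  show d': "into_data X Y Z S' R' w (vert E (X \<odot> Y) \<rho> \<star> a) (vert E (Y \<odot> Z) \<sigma> \<star> b)"
    using t' dc w unfolding into_data_def by (simp flip: B.Comp_assoc_Arr)
  note k = into_meet_simps[OF d] and k' = into_meet_simps[OF d']
  have cartnat: "cart E p (Cod (fib E Q) \<psi>) \<star> vert E P (FArr (pull E p) \<psi>) = vert E Q \<psi> \<star> cart E p (Dom (fib E Q) \<psi>)"
    if "p \<in> Arr \<B>" "Dom \<B> p = P" "Cod \<B> p = Q" "\<psi> \<in> Arr (fib E Q)" for p P Q \<psi>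
  proof -
    have [simp]: "P \<in> Obj \<B>" "Q \<in> Obj \<B>" using that B.Obj_Dom[of p] B.Obj_Cod[of p] by auto
    show ?thesis
      using that by (simp add: cart_def vert_Comp_left vert_Comp_right tot_simps)
  qed
  let ?p1 = "Pr1 (fib E ?XYZ) (Dom (fib E ?XYZ) ?r) (Dom (fib E ?XYZ) ?s)" and ?p2 = "Pr2 (fib E ?XYZ) (Dom (fib E ?XYZ) ?r) (Dom (fib E ?XYZ) ?s)"
  let ?p1' = "Pr1 (fib E ?XYZ) (Cod (fib E ?XYZ) ?r) (Cod (fib E ?XYZ) ?s)" and ?p2' = "Pr2 (fib E ?XYZ) (Cod (fib E ?XYZ) ?r) (Cod (fib E ?XYZ) ?s)"
  have "?p1' \<cdot>\<^bsub>fib E ?XYZ\<^esub> ?m = ?r \<cdot>\<^bsub>fib E ?XYZ\<^esub> ?p1" "?p2' \<cdot>\<^bsub>fib E ?XYZ\<^esub> ?m = ?s \<cdot>\<^bsub>fib E ?XYZ\<^esub> ?p2"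
    unfolding prod_map_def by simp_all
  then have v: "vert E ?XYZ ?p1' \<star> vert E ?XYZ ?m = vert E ?XYZ ?r \<star> vert E ?XYZ ?p1"
     "vert E ?XYZ ?p2' \<star> vert E ?XYZ ?m = vert E ?XYZ ?s \<star> vert E ?XYZ ?p2"
    by (simp_all add: matr_meet_def dc flip: vert_Comp)
  have "meet_pr1 X Y Z S' R' \<star> vert E ?XYZ ?m = cart E (p12 \<B> X Y Z) R' \<star> (vert E ?XYZ ?p1' \<star> vert E ?XYZ ?m)"
    by (simp add: meet_pr1_def matr_meet_def dc)
  also have "\<dots> = (cart E (p12 \<B> X Y Z) R' \<star> vert E ?XYZ ?r) \<star> vert E ?XYZ ?p1"
    unfolding v by (simp add: dc)
  also have "\<dots> = (vert E (X \<odot> Y) \<rho> \<star> cart E (p12 \<B> X Y Z) R) \<star> vert E ?XYZ ?p1"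
    using cartnat[of "p12 \<B> X Y Z" ?XYZ "X \<odot> Y" \<rho>] by (simp only: dc) (simp add: dc)
  finally have m1: "meet_pr1 X Y Z S' R' \<star> vert E ?XYZ ?m = vert E (X \<odot> Y) \<rho> \<star> meet_pr1 X Y Z S R"
    by (simp add: dc meet_pr1_def)
  have "meet_pr2 X Y Z S' R' \<star> vert E ?XYZ ?m = cart E (p23 \<B> X Y Z) S' \<star> (vert E ?XYZ ?p2' \<star> vert E ?XYZ ?m)"
    by (simp add: meet_pr2_def matr_meet_def dc)
  also have "\<dots> = (cart E (p23 \<B> X Y Z) S' \<star> vert E ?XYZ ?s) \<star> vert E ?XYZ ?p2"
    unfolding v by (simp add: dc)
  also have "\<dots> = (vert E (Y \<odot> Z) \<sigma> \<star> cart E (p23 \<B> X Y Z) S) \<star> vert E ?XYZ ?p2"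
    using cartnat[of "p23 \<B> X Y Z" ?XYZ "Y \<odot> Z" \<sigma>] by (simp only: dc) (simp add: dc)
  finally have m2: "meet_pr2 X Y Z S' R' \<star> vert E ?XYZ ?m = vert E (Y \<odot> Z) \<sigma> \<star> meet_pr2 X Y Z S R"
    by (simp add: dc meet_pr2_def)
  have "vert E ?XYZ ?m \<star> into_meet X Y Z w a b = into_meet X Y Z w (vert E (X \<odot> Y) \<rho> \<star> a) (vert E (Y \<odot> Z) \<sigma> \<star> b)"
  proof (rule into_meet_ext[of X Y Z R' S'])
    have "meet_pr1 X Y Z S' R' \<star> (vert E ?XYZ ?m \<star> into_meet X Y Z w a b) = (meet_pr1 X Y Z S' R' \<star> vert E ?XYZ ?m) \<star> into_meet X Y Z w a b"
      using k(1-4) by simp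
    also have "\<dots> = vert E (X \<odot> Y) \<rho> \<star> (meet_pr1 X Y Z S R \<star> into_meet X Y Z w a b)"
      unfolding m1 using k(1-4) dc by simp
    finally show "meet_pr1 X Y Z S' R' \<star> (vert E ?XYZ ?m \<star> into_meet X Y Z w a b) =
        meet_pr1 X Y Z S' R' \<star> into_meet X Y Z w (vert E (X \<odot> Y) \<rho> \<star> a) (vert E (Y \<odot> Z) \<sigma> \<star> b)"
      by (simp only: k k')
    have "meet_pr2 X Y Z S' R' \<star> (vert E ?XYZ ?m \<star> into_meet X Y Z w a b) = (meet_pr2 X Y Z S' R' \<star> vert E ?XYZ ?m) \<star> into_meet X Y Z w a b"
      using k(1-4) by simp
    also have "\<dots> = vert E (Y \<odot> Z) \<sigma> \<star> (meet_pr2 X Y Z S R \<star> into_meet X Y Z w a b)"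
      unfolding m2 using k(1-4) dc by simp
    finally show "meet_pr2 X Y Z S' R' \<star> (vert E ?XYZ ?m \<star> into_meet X Y Z w a b) =
        meet_pr2 X Y Z S' R' \<star> into_meet X Y Z w (vert E (X \<odot> Y) \<rho> \<star> a) (vert E (Y \<odot> Z) \<sigma> \<star> b)"
      by (simp only: k k')
  qed (use k(1-4) k'(1-4) t' in auto)
  note e = this
  have "vert E (X \<odot> Z) (matr_comp2 E X Y Z \<sigma> \<rho>) \<star> into_comp E X Y Z S R w a b =
    (vert E (X \<odot> Z) (FArr (ex E (p13 \<B> X Y Z)) ?m) \<star> opcart E (p13 \<B> X Y Z) (matr_meet E X Y Z S R)) \<star> into_meet X Y Z w a b"
    using k(1-4) by (simp add: into_comp_eq matr_comp2_def)
  also have "\<dots> = opcart E (p13 \<B> X Y Z) (matr_meet E X Y Z S' R') \<star> (vert E ?XYZ ?m \<star> into_meet X Y Z w a b)"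
    using opcart_natural[of "p13 \<B> X Y Z" ?XYZ "X \<odot> Z" ?m] k(1-4) by simp
  finally show "vert E (X \<odot> Z) (matr_comp2 E X Y Z \<sigma> \<rho>) \<star> into_comp E X Y Z S R w a b =
       into_comp E X Y Z S' R' w (vert E (X \<odot> Y) \<rho> \<star> a) (vert E (Y \<odot> Z) \<sigma> \<star> b)"
    by (simp add: into_comp_eq e)
qed

text \<open>
  The arrow into the meet is opcartesian by Frobenius reciprocity, and \<open>S \<circ> R\<close> is the image of the meet.
\<close>

lemma into_comp_opcartesian_left:
  assumes d: "into_data X Y Z S R w (e \<star> n1) (c \<star> n2)"
    and n: "meet_cone n1 n2" "Cod \<T> n1 = Dom \<T> e" "Cod \<T> n2 = Dom \<T> c" "e \<in> Arr \<T>"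
    and e: "opcartesian (cart_factor E (p12 \<B> X Y Z) w e)" and c: "cartesian c"
  shows "opcartesian (into_comp E X Y Z S R w (e \<star> n1) (c \<star> n2))"
proof -
  note t = d[unfolded into_data_def] and m = into_meet_simps[OF d] and N = meet_cone_simps[OF n(1)]
  note [simp] = cartesian_Arr[OF c]
  let ?XYZ = "(X \<odot> Y) \<odot> Z" and ?R = "FObj (pull E (p12 \<B> X Y Z)) R" and ?S = "FObj (pull E (p23 \<B> X Y Z)) S"
  let ?p = "vert E ?XYZ (Pr1 (fib E ?XYZ) ?R ?S)" and ?q = "vert E ?XYZ (Pr2 (fib E ?XYZ) ?R ?S)"
  let ?k = "into_meet X Y Z w (e \<star> n1) (c \<star> n2)"
  let ?e = "cart_factor E (p12 \<B> X Y Z) w e" and ?c = "cart_factor E (p23 \<B> X Y Z) w c"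
  have u: "fst (e \<star> n1) = fst e" "fst (c \<star> n2) = fst c" "Cod \<T> (e \<star> n1) = Cod \<T> e" "Cod \<T> (c \<star> n2) = Cod \<T> c"
    using N(1-7) n(2-4) by simp_all
  have v: "fst e = p12 \<B> X Y Z \<bullet> w" "fst c = p23 \<B> X Y Z \<bullet> w" "Cod \<T> e = (X \<odot> Y, R)" "Cod \<T> c = (Y \<odot> Z, S)"
    using d[unfolded into_data_def u] by blast+
  have e': "?e \<in> Arr \<T>" "fst ?e = w" "Dom \<T> ?e = Dom \<T> e" "Cod \<T> ?e = (?XYZ, ?R)" "cart E (p12 \<B> X Y Z) R \<star> ?e = e"
    using cart_factor_simps[of w "p12 \<B> X Y Z" e R] t n(4) v by simp_all
  have c': "?c \<in> Arr \<T>" "fst ?c = w" "Dom \<T> ?c = Dom \<T> c" "Cod \<T> ?c = (?XYZ, ?S)" "cart E (p23 \<B> X Y Z) S \<star> ?c = c"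
    using cart_factor_simps[of w "p23 \<B> X Y Z" c S] t v by simp_all
  have w: "w \<in> Arr \<B>" "Cod \<B> w = ?XYZ" "?XYZ \<in> Obj \<B>"
    using t by simp_all
  have dw: "Dom \<B> w = fst (Dom \<T> n1)"
    using fst_Arr(2)[OF e'(1)] e'(2,3) n(2) N(6,7) by simp
  have cc: "cartesian ?c"
    by (rule cartesian_cancel[of "cart E (p23 \<B> X Y Z) S"]) (use c c' t in \<open>auto intro: cart_cartesian\<close>)
  have "?p \<star> ?k = ?e \<star> n1"
  proof (rule cart_Comp_ext[of "p12 \<B> X Y Z" R])
    have "cart E (p12 \<B> X Y Z) R \<star> (?p \<star> ?k) = meet_pr1 X Y Z S R \<star> ?k"
      using m(1-4) t by (simp add: meet_pr1_def matr_meet_def)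
    also have "\<dots> = (cart E (p12 \<B> X Y Z) R \<star> ?e) \<star> n1"
      by (simp only: m(5) e'(5))
    finally show "cart E (p12 \<B> X Y Z) R \<star> (?p \<star> ?k) = cart E (p12 \<B> X Y Z) R \<star> (?e \<star> n1)"
      using e'(1-4) t N n(2) by simp
    show "fst (?p \<star> ?k) = fst (?e \<star> n1)"
      using w by (simp add: m(2) e'(2) N dw)
  qed (use m(1-4) e'(1-4) t N n in \<open>auto simp: matr_meet_def\<close>)
  moreover have "?q \<star> ?k = ?c \<star> n2"
  proof (rule cart_Comp_ext[of "p23 \<B> X Y Z" S])
    have "cart E (p23 \<B> X Y Z) S \<star> (?q \<star> ?k) = meet_pr2 X Y Z S R \<star> ?k"
      using m(1-4) t by (simp add: meet_pr2_def matr_meet_def)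
    also have "\<dots> = (cart E (p23 \<B> X Y Z) S \<star> ?c) \<star> n2"
      by (simp only: m(6) c'(5))
    finally show "cart E (p23 \<B> X Y Z) S \<star> (?q \<star> ?k) = cart E (p23 \<B> X Y Z) S \<star> (?c \<star> n2)"
      using c'(1-4) t N n(3) by simp
    show "fst (?q \<star> ?k) = fst (?c \<star> n2)"
      using w by (simp add: m(2) c'(2) N dw)
  qed (use m(1-4) c'(1-4) t N n in \<open>auto simp: matr_meet_def\<close>)
  ultimately have "opcartesian ?k"
    by (intro frobenius_opcartesian[OF e cc e'(2) c'(2) n(1) meet_cone_Pr[of ?XYZ ?R ?S]])
      (use m(1-4) e'(1-4) c'(1-4) t N n in \<open>auto simp: matr_meet_def\<close>)
  then show ?thesis
    unfolding into_comp_eq by (rule opcartesian_Comp) (use m(4) t in auto)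
qed

lemma into_comp_opcartesian_right:
  assumes d: "into_data X Y Z S R w (c \<star> n1) (e \<star> n2)"
    and n: "meet_cone n1 n2" "Cod \<T> n2 = Dom \<T> e" "Cod \<T> n1 = Dom \<T> c" "e \<in> Arr \<T>"
    and e: "opcartesian (cart_factor E (p23 \<B> X Y Z) w e)" and c: "cartesian c"
  shows "opcartesian (into_comp E X Y Z S R w (c \<star> n1) (e \<star> n2))"
proof -
  note t = d[unfolded into_data_def] and m = into_meet_simps[OF d] and N = meet_cone_simps[OF n(1)]
  note [simp] = cartesian_Arr[OF c]
  let ?XYZ = "(X \<odot> Y) \<odot> Z" and ?R = "FObj (pull E (p12 \<B> X Y Z)) R" and ?S = "FObj (pull E (p23 \<B> X Y Z)) S"
  let ?p = "vert E ?XYZ (Pr1 (fib E ?XYZ) ?R ?S)" and ?q = "vert E ?XYZ (Pr2 (fib E ?XYZ) ?R ?S)"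
  let ?k = "into_meet X Y Z w (c \<star> n1) (e \<star> n2)"
  let ?e = "cart_factor E (p23 \<B> X Y Z) w e" and ?c = "cart_factor E (p12 \<B> X Y Z) w c"
  have u: "fst (e \<star> n2) = fst e" "fst (c \<star> n1) = fst c" "Cod \<T> (e \<star> n2) = Cod \<T> e" "Cod \<T> (c \<star> n1) = Cod \<T> c"
    using N(1-7) n(2-4) by simp_all
  have v: "fst e = p23 \<B> X Y Z \<bullet> w" "fst c = p12 \<B> X Y Z \<bullet> w" "Cod \<T> e = (Y \<odot> Z, S)" "Cod \<T> c = (X \<odot> Y, R)"
    using d[unfolded into_data_def u] by blast+
  have e': "?e \<in> Arr \<T>" "fst ?e = w" "Dom \<T> ?e = Dom \<T> e" "Cod \<T> ?e = (?XYZ, ?S)" "cart E (p23 \<B> X Y Z) S \<star> ?e = e"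
    using cart_factor_simps[of w "p23 \<B> X Y Z" e S] t n(4) v by simp_all
  have c': "?c \<in> Arr \<T>" "fst ?c = w" "Dom \<T> ?c = Dom \<T> c" "Cod \<T> ?c = (?XYZ, ?R)" "cart E (p12 \<B> X Y Z) R \<star> ?c = c"
    using cart_factor_simps[of w "p12 \<B> X Y Z" c R] t v by simp_all
  have w: "w \<in> Arr \<B>" "Cod \<B> w = ?XYZ" "?XYZ \<in> Obj \<B>"
    using t by simp_all
  have dw: "Dom \<B> w = fst (Dom \<T> n1)"
    using fst_Arr(2)[OF e'(1)] e'(2,3) n(2) N(6,7) by simp
  have cc: "cartesian ?c"
    by (rule cartesian_cancel[of "cart E (p12 \<B> X Y Z) R"]) (use c c' t in \<open>auto intro: cart_cartesian\<close>)
  have "?q \<star> ?k = ?e \<star> n2"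
  proof (rule cart_Comp_ext[of "p23 \<B> X Y Z" S])
    have "cart E (p23 \<B> X Y Z) S \<star> (?q \<star> ?k) = meet_pr2 X Y Z S R \<star> ?k"
      using m(1-4) t by (simp add: meet_pr2_def matr_meet_def)
    also have "\<dots> = (cart E (p23 \<B> X Y Z) S \<star> ?e) \<star> n2"
      by (simp only: m(6) e'(5))
    finally show "cart E (p23 \<B> X Y Z) S \<star> (?q \<star> ?k) = cart E (p23 \<B> X Y Z) S \<star> (?e \<star> n2)"
      using e'(1-4) t N n(2) by simp
    show "fst (?q \<star> ?k) = fst (?e \<star> n2)"
      using w by (simp add: m(2) e'(2) N dw)
  qed (use m(1-4) e'(1-4) t N n in \<open>auto simp: matr_meet_def\<close>)
  moreover have "?p \<star> ?k = ?c \<star> n1"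
  proof (rule cart_Comp_ext[of "p12 \<B> X Y Z" R])
    have "cart E (p12 \<B> X Y Z) R \<star> (?p \<star> ?k) = meet_pr1 X Y Z S R \<star> ?k"
      using m(1-4) t by (simp add: meet_pr1_def matr_meet_def)
    also have "\<dots> = (cart E (p12 \<B> X Y Z) R \<star> ?c) \<star> n1"
      by (simp only: m(5) c'(5))
    finally show "cart E (p12 \<B> X Y Z) R \<star> (?p \<star> ?k) = cart E (p12 \<B> X Y Z) R \<star> (?c \<star> n1)"
      using c'(1-4) t N n(3) by simp
    show "fst (?p \<star> ?k) = fst (?c \<star> n1)"
      using w by (simp add: m(2) c'(2) N dw)
  qed (use m(1-4) c'(1-4) t N n in \<open>auto simp: matr_meet_def\<close>)
  ultimately have "opcartesian ?k"
    by (intro frobenius_opcartesian[OF e cc e'(2) c'(2) meet_cone_sym[OF n(1)] meet_cone_sym[OF meet_cone_Pr[of ?XYZ ?R ?S]]])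
      (use m(1-4) e'(1-4) c'(1-4) t N n in \<open>auto simp: matr_meet_def\<close>)
  then show ?thesis
    unfolding into_comp_eq by (rule opcartesian_Comp) (use m(4) t in auto)
qed

section \<open>Companions and conjoints\<close>

lemma over_top_Comp:
  assumes "f \<in> Arr \<B>" "A \<in> Obj (fib E (Dom \<B> f))" "k \<in> Arr \<T>" "Cod \<T> k = (Dom \<B> f, A)"
  shows "over_top E f A \<star> k = over_top E (f \<bullet> fst k) (snd (Dom \<T> k))"
proof -
  have d: "Dom \<T> k = (Dom \<B> (fst k), snd (Dom \<T> k))" using assms by simp
  have k: "fst (Cod \<T> k) = Dom \<B> f" using assms by simp
  note o1 = over_top_simps[OF assms(1,2)]
  note o2 = over_top_simps[of "f \<bullet> fst k" "snd (Dom \<T> k)"]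
  have o: "snd (Dom \<T> k) \<in> Obj (fib E (Dom \<B> (f \<bullet> fst k)))" "f \<bullet> fst k \<in> Arr \<B>"
    using assms k by simp_all
  show ?thesis
    by (rule over_top_ext[of _ _ "Cod \<B> f"]) (use assms o1 o2[OF o(2,1)] k d in auto)
qed

lemma matr_id_Obj [simp]: "X \<in> Obj \<B> \<Longrightarrow> matr_id E X \<in> Obj (fib E (X \<odot> X))"
  by (simp add: matr_id_def)

lemma matr_refl_simps [simp]:
  assumes "f \<in> Arr \<B>" "A \<in> Obj (fib E (Dom \<B> f))"
  shows "matr_refl E f A \<in> Arr \<T>" "fst (matr_refl E f A) = tuple \<B> f f" "Dom \<T> (matr_refl E f A) = (Dom \<B> f, A)"
    "Cod \<T> (matr_refl E f A) = (Cod \<B> f \<odot> Cod \<B> f, matr_id E (Cod \<B> f))"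
  using over_top_simps[OF assms] assms by (simp_all add: matr_refl_def matr_id_def Let_def)

lemma matr_refl_Comp:
  assumes "f \<in> Arr \<B>" "A \<in> Obj (fib E (Dom \<B> f))" "k \<in> Arr \<T>" "Cod \<T> k = (Dom \<B> f, A)"
  shows "matr_refl E f A \<star> k = matr_refl E (f \<bullet> fst k) (snd (Dom \<T> k))"
proof -
  have k: "fst (Cod \<T> k) = Dom \<B> f" using assms by simp
  show ?thesis
    using over_top_simps[OF assms(1,2)] over_top_Comp[OF assms] assms k
    by (simp add: matr_refl_def Let_def)
qed

lemma matr_lower_Obj [simp]:
  "\<lbrakk>f \<in> Arr \<B>; V = Dom \<B> f; X = Cod \<B> f\<rbrakk> \<Longrightarrow> matr_lower E f \<in> Obj (fib E (V \<odot> X))"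
  by (simp add: matr_lower_def Let_def)

lemma matr_upper_Obj [simp]:
  "\<lbrakk>f \<in> Arr \<B>; V = Dom \<B> f; X = Cod \<B> f\<rbrakk> \<Longrightarrow> matr_upper E f \<in> Obj (fib E (X \<odot> V))"
  by (simp add: matr_upper_def Let_def)

lemma lower_refl_simps [simp]:
  assumes "f \<in> Arr \<B>" "h \<in> Arr \<B>" "Cod \<B> h = Dom \<B> f" "A \<in> Obj (fib E (Dom \<B> h))"
  shows "lower_refl E f h A \<in> Arr \<T>" "fst (lower_refl E f h A) = tuple \<B> h (f \<bullet> h)"
    "Dom \<T> (lower_refl E f h A) = (Dom \<B> h, A)"
    "Cod \<T> (lower_refl E f h A) = (Dom \<B> f \<odot> Cod \<B> f, matr_lower E f)"
    "cart E (prod_map \<B> f (Ide \<B> (Cod \<B> f))) (matr_id E (Cod \<B> f)) \<star> lower_refl E f h A = matr_refl E (f \<bullet> h) A"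
  using cart_factor_simps[of "tuple \<B> h (f \<bullet> h)" "prod_map \<B> f (Ide \<B> (Cod \<B> f))" "matr_refl E (f \<bullet> h) A" "matr_id E (Cod \<B> f)"] assms
  by (simp_all add: lower_refl_def matr_lower_def Let_def)

lemma upper_refl_simps [simp]:
  assumes "f \<in> Arr \<B>" "h \<in> Arr \<B>" "Cod \<B> h = Dom \<B> f" "A \<in> Obj (fib E (Dom \<B> h))"
  shows "upper_refl E f h A \<in> Arr \<T>" "fst (upper_refl E f h A) = tuple \<B> (f \<bullet> h) h"
    "Dom \<T> (upper_refl E f h A) = (Dom \<B> h, A)"
    "Cod \<T> (upper_refl E f h A) = (Cod \<B> f \<odot> Dom \<B> f, matr_upper E f)"
    "cart E (prod_map \<B> (Ide \<B> (Cod \<B> f)) f) (matr_id E (Cod \<B> f)) \<star> upper_refl E f h A = matr_refl E (f \<bullet> h) A"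
  using cart_factor_simps[of "tuple \<B> (f \<bullet> h) h" "prod_map \<B> (Ide \<B> (Cod \<B> f)) f" "matr_refl E (f \<bullet> h) A" "matr_id E (Cod \<B> f)"] assms
  by (simp_all add: upper_refl_def matr_upper_def Let_def)

lemma lower_refl_Comp:
  assumes "f \<in> Arr \<B>" "h \<in> Arr \<B>" "Cod \<B> h = Dom \<B> f" "A \<in> Obj (fib E (Dom \<B> h))" "k \<in> Arr \<T>" "Cod \<T> k = (Dom \<B> h, A)"
  shows "lower_refl E f h A \<star> k = lower_refl E f (h \<bullet> fst k) (snd (Dom \<T> k))"
proof -
  let ?p = "prod_map \<B> f (Ide \<B> (Cod \<B> f))" and ?I = "matr_id E (Cod \<B> f)"
  have k: "fst (Cod \<T> k) = Dom \<B> h" using assms by simp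
  have d: "Dom \<T> k = (Dom \<B> (fst k), snd (Dom \<T> k))" using assms by simp
  have o: "snd (Dom \<T> k) \<in> Obj (fib E (Dom \<B> (h \<bullet> fst k)))" "h \<bullet> fst k \<in> Arr \<B>" "Cod \<B> (h \<bullet> fst k) = Dom \<B> f"
    using assms k by simp_all
  note l = lower_refl_simps[OF assms(1-4)] and l' = lower_refl_simps[OF assms(1) o(2,3,1)]
  have "cart E ?p ?I \<star> (lower_refl E f h A \<star> k) = (cart E ?p ?I \<star> lower_refl E f h A) \<star> k"
    by (rule T.Comp_assoc_Arr[symmetric]) (use l(1-4) assms in \<open>simp_all add: matr_lower_def Let_def\<close>)
  also have "\<dots> = cart E ?p ?I \<star> lower_refl E f (h \<bullet> fst k) (snd (Dom \<T> k))"
    unfolding l(5) l'(5) using matr_refl_Comp[of "f \<bullet> h" A k] assms k by simp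
  finally show ?thesis
    by (rule cart_Comp_ext[rotated -1]) (use l(1-4) l'(1-4) assms k in \<open>simp_all add: matr_lower_def Let_def\<close>)
qed

lemma upper_refl_Comp:
  assumes "f \<in> Arr \<B>" "h \<in> Arr \<B>" "Cod \<B> h = Dom \<B> f" "A \<in> Obj (fib E (Dom \<B> h))" "k \<in> Arr \<T>" "Cod \<T> k = (Dom \<B> h, A)"
  shows "upper_refl E f h A \<star> k = upper_refl E f (h \<bullet> fst k) (snd (Dom \<T> k))"
proof -
  let ?p = "prod_map \<B> (Ide \<B> (Cod \<B> f)) f" and ?I = "matr_id E (Cod \<B> f)"
  have k: "fst (Cod \<T> k) = Dom \<B> h" using assms by simp
  have o: "snd (Dom \<T> k) \<in> Obj (fib E (Dom \<B> (h \<bullet> fst k)))" "h \<bullet> fst k \<in> Arr \<B>" "Cod \<B> (h \<bullet> fst k) = Dom \<B> f"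
    using assms k by simp_all
  note l = upper_refl_simps[OF assms(1-4)] and l' = upper_refl_simps[OF assms(1) o(2,3,1)]
  have "cart E ?p ?I \<star> (upper_refl E f h A \<star> k) = (cart E ?p ?I \<star> upper_refl E f h A) \<star> k"
    by (rule T.Comp_assoc_Arr[symmetric]) (use l(1-4) assms in \<open>simp_all add: matr_upper_def Let_def\<close>)
  also have "\<dots> = cart E ?p ?I \<star> upper_refl E f (h \<bullet> fst k) (snd (Dom \<T> k))"
    unfolding l(5) l'(5) using matr_refl_Comp[of "f \<bullet> h" A k] assms k by simp
  finally show ?thesis
    by (rule cart_Comp_ext[rotated -1]) (use l(1-4) l'(1-4) assms k in \<open>simp_all add: matr_upper_def Let_def\<close>)
qed

text \<open>
  The companion of \<open>f\<close> is the image of \<open>\<top>\<close> along the graph of \<open>f\<close>: the identity matrix is the image of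
  \<open>\<top>\<close> along the diagonal, and the graph square pulls this image back along \<open>f \<times> 1\<close>.
\<close>

lemma lower_refl_opcartesian:
  assumes f: "f \<in> Arr \<B>" "Dom \<B> f = V"
  shows "opcartesian (lower_refl E f (Ide \<B> V) (Term (fib E V)))"
proof -
  let ?X = "Cod \<B> f" and ?T = "Term (fib E V)"
  have V: "V \<in> Obj \<B>" using f B.Obj_Dom[of f] by simp
  have l: "cart E (prod_map \<B> f (Ide \<B> ?X)) (matr_id E ?X) \<star> lower_refl E f (Ide \<B> V) ?T =
      opcart E (diag \<B> ?X) (Term (fib E ?X)) \<star> over_top E f ?T"
    using lower_refl_simps(5)[of f "Ide \<B> V" ?T] f V by (simp add: matr_refl_def Let_def)
  show ?thesis
    by (rule stable_squareD[OF graph_stable[of f], of "opcart E (diag \<B> ?X) (Term (fib E ?X))" "over_top E f ?T"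
          "cart E (prod_map \<B> f (Ide \<B> ?X)) (matr_id E ?X)"])
      (use f V l over_top_simps[of f ?T] in \<open>auto intro: over_top_cartesian cart_cartesian simp: matr_id_def matr_lower_def Let_def\<close>)
qed

text \<open>
  Likewise the conjoint is the image of \<open>\<top>\<close> along the transposed graph.
\<close>

lemma upper_refl_opcartesian:
  assumes f: "f \<in> Arr \<B>" "Dom \<B> f = V"
  shows "opcartesian (upper_refl E f (Ide \<B> V) (Term (fib E V)))"
proof -
  let ?X = "Cod \<B> f" and ?T = "Term (fib E V)"
  have V: "V \<in> Obj \<B>" using f B.Obj_Dom[of f] by simp
  have l: "cart E (prod_map \<B> (Ide \<B> ?X) f) (matr_id E ?X) \<star> upper_refl E f (Ide \<B> V) ?T =
      opcart E (diag \<B> ?X) (Term (fib E ?X)) \<star> over_top E f ?T"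
    using upper_refl_simps(5)[of f "Ide \<B> V" ?T] f V by (simp add: matr_refl_def Let_def)
  show ?thesis
    by (rule stable_squareD[OF cograph_stable[of f], of "opcart E (diag \<B> ?X) (Term (fib E ?X))" "over_top E f ?T"
          "cart E (prod_map \<B> (Ide \<B> ?X) f) (matr_id E ?X)"])
      (use f V l over_top_simps[of f ?T] in \<open>auto intro: over_top_cartesian cart_cartesian simp: matr_id_def matr_upper_def Let_def\<close>)
qed

lemma opcartesian_times:
  assumes e: "opcartesian e" "fst e = t" "Dom \<T> e = (V, Term (fib E V))" "Cod \<T> e = (U, S)" and Y: "Y \<in> Obj \<B>"
  shows "opcartesian (cart_factor E (Pr1 \<B> U Y) (prod_map \<B> t (Ide \<B> Y)) (e \<star> over_top E (Pr1 \<B> V Y) (Term (fib E (V \<odot> Y)))))"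
proof -
  note [simp] = opcartesian_Arr[OF e(1)] Y
  have t [simp]: "t \<in> Arr \<B>" "Dom \<B> t = V" "Cod \<B> t = U"
    using fst_Arr[of e] e by simp_all
  note [simp] = Dom_total_Obj[OF _ e(3)] Cod_total_Obj[OF _ e(4)]
  let ?m = "prod_map \<B> t (Ide \<B> Y)"
  let ?c = "over_top E (Pr1 \<B> V Y) (Term (fib E (V \<odot> Y)))"
  have c: "cartesian ?c" "?c \<in> Arr \<T>" "fst ?c = Pr1 \<B> V Y" "Dom \<T> ?c = (V \<odot> Y, Term (fib E (V \<odot> Y)))" "Cod \<T> ?c = (V, Term (fib E V))"
    using over_top_simps[of "Pr1 \<B> V Y" "Term (fib E (V \<odot> Y))"] by (simp_all add: over_top_cartesian)
  have st: "stable_square (Pr1 \<B> V Y) ?m t (Pr1 \<B> U Y)"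
    by (rule projection_stable[of _ _ _ "Pr2 \<B> V Y" "Pr2 \<B> U Y"]) (auto simp: B.is_iso_swap prod_map_def)
  have k: "Pr1 \<B> U Y \<bullet> ?m = t \<bullet> Pr1 \<B> V Y"
    by (simp add: prod_map_def)
  note k' = cart_factor_simps[of ?m "Pr1 \<B> U Y" "e \<star> ?c" S]
  show ?thesis
    by (rule stable_squareD[OF st e(1) c(1) cart_cartesian[of "Pr1 \<B> U Y" S]]) (use k k' c e in auto)
qed

text \<open>
  The image \<open>e\<close> of \<open>\<top>\<close> is pulled back along the projection \<open>V \<times> Z \<rightarrow> V\<close>, where it stays an image by the
  Beck--Chevalley condition, and is then paired with the cartesian arrow \<open>c\<close>.
\<close>

lemma into_comp_graph_opcartesian:
  assumes e: "opcartesian e" "fst e = t" "Dom \<T> e = (V, Term (fib E V))" "Cod \<T> e = (X \<odot> Y, R)"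
    and X: "X \<in> Obj \<B>" "Y \<in> Obj \<B>" "Z \<in> Obj \<B>"
    and c: "cartesian c" "fst c = p23 \<B> X Y Z \<bullet> prod_map \<B> t (Ide \<B> Z)" "Cod \<T> c = (Y \<odot> Z, S)" "Dom \<T> c = (V \<odot> Z, L)"
  shows "into_data X Y Z S R (prod_map \<B> t (Ide \<B> Z)) (e \<star> over_top E (Pr1 \<B> V Z) L) c"
    "opcartesian (into_comp E X Y Z S R (prod_map \<B> t (Ide \<B> Z)) (e \<star> over_top E (Pr1 \<B> V Z) L) c)"
proof -
  note [simp] = opcartesian_Arr[OF e(1)] cartesian_Arr[OF c(1)] X
  have t [simp]: "t \<in> Arr \<B>" "Dom \<B> t = V" "Cod \<B> t = X \<odot> Y"
    using fst_Arr[of e] e by simp_all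
  note [simp] = Dom_total_Obj[OF _ e(3)] Cod_total_Obj[OF _ e(4)] Dom_total_Obj[OF _ c(4)] Cod_total_Obj[OF _ c(3)]
  let ?m = "prod_map \<B> t (Ide \<B> Z)" and ?p = "Pr1 \<B> V Z" and ?T = "Term (fib E (V \<odot> Z))"
  let ?n1 = "over_top E (Ide \<B> (V \<odot> Z)) L" and ?n2 = "Ide \<T> (V \<odot> Z, L)"
  note o1 = over_top_simps[of ?p L] and o2 = over_top_simps[of ?p ?T] and o3 = over_top_simps[of "Ide \<B> (V \<odot> Z)" L]
  have "over_top E ?p L = over_top E ?p ?T \<star> ?n1"
    using over_top_Comp[of ?p ?T ?n1] o3 by simp
  then have eq: "e \<star> over_top E ?p L = (e \<star> over_top E ?p ?T) \<star> ?n1"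
    using o2 o3 e by simp
  have k: "p12 \<B> X Y Z \<bullet> ?m = t \<bullet> ?p"
    by (simp add: B.proj_defs)
  show d: "into_data X Y Z S R ?m (e \<star> over_top E ?p L) c"
    using o1 e c k by (simp add: into_data_def)
  have "opcartesian (into_comp E X Y Z S R ?m ((e \<star> over_top E ?p ?T) \<star> ?n1) (c \<star> ?n2))"
  proof (rule into_comp_opcartesian_left[OF _ meet_cone_top])
    show "into_data X Y Z S R ?m ((e \<star> over_top E ?p ?T) \<star> ?n1) (c \<star> ?n2)"
      using d c by (simp only: eq[symmetric]) simp
    show "opcartesian (cart_factor E (p12 \<B> X Y Z) ?m (e \<star> over_top E ?p ?T))"
      unfolding p12_def by (rule opcartesian_times) (use e in auto)
  qed (use o1 o2 o3 e c in auto)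
  then show "opcartesian (into_comp E X Y Z S R ?m (e \<star> over_top E ?p L) c)"
    using c by (simp only: eq[symmetric]) simp
qed

subsection \<open>Composition with a companion is reindexing\<close>

text \<open>
  The arrow \<open>L \<rightarrow> R \<circ> f\<^sub>\<bullet>\<close> that pairs, over \<open>(v, y) \<mapsto> ((v, f v), y)\<close>, the canonical element of \<open>f\<^sub>\<bullet>\<close> at
  \<open>(v, f v)\<close> with \<open>c : L \<rightarrow> R\<close> over \<open>f \<times> 1\<close>.
\<close>

definition lower_in :: "'a \<Rightarrow> 'o \<Rightarrow> 'p \<Rightarrow> ('a, 'p, 'q) over \<Rightarrow> ('a, 'p, 'q) over" where
  "lower_in f Y R c = into_comp E (Dom \<B> f) (Cod \<B> f) Y R (matr_lower E f)
     (prod_map \<B> (tuple \<B> (Ide \<B> (Dom \<B> f)) f) (Ide \<B> Y))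
     (lower_refl E f (Pr1 \<B> (Dom \<B> f) Y) (snd (Dom \<T> c))) c"

text \<open>
  For cartesian \<open>c\<close> the arrow \<open>lower_in f Y R c\<close> is invertible, which identifies \<open>R \<circ> f\<^sub>\<bullet>\<close> with
  \<open>(f \<times> 1)\<^sup>* R\<close>; this is the resulting cartesian arrow \<open>R \<circ> f\<^sub>\<bullet> \<rightarrow> R\<close> over \<open>f \<times> 1\<close>.
\<close>

definition lower_out :: "'a \<Rightarrow> 'o \<Rightarrow> 'p \<Rightarrow> ('a, 'p, 'q) over" where
  "lower_out f Y R = cart E (prod_map \<B> f (Ide \<B> Y)) R \<star> Inv \<T> (lower_in f Y R (cart E (prod_map \<B> f (Ide \<B> Y)) R))"

lemma lower_in_simps:
  assumes f: "f \<in> Arr \<B>" "Dom \<B> f = V" "Cod \<B> f = X" "Y \<in> Obj \<B>"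
    and c: "c \<in> Arr \<T>" "fst c = prod_map \<B> f (Ide \<B> Y)" "Cod \<T> c = (X \<odot> Y, R)" "Dom \<T> c = (V \<odot> Y, L)"
  shows "into_data V X Y R (matr_lower E f) (tuple \<B> (tuple \<B> (Pr1 \<B> V Y) (f \<bullet> Pr1 \<B> V Y)) (Pr2 \<B> V Y)) (lower_refl E f (Pr1 \<B> V Y) L) c"
    and "lower_in f Y R c = into_comp E V X Y R (matr_lower E f) (tuple \<B> (tuple \<B> (Pr1 \<B> V Y) (f \<bullet> Pr1 \<B> V Y)) (Pr2 \<B> V Y))
       (lower_refl E f (Pr1 \<B> V Y) L) c"
    and "lower_in f Y R c \<in> Arr \<T>" "fst (lower_in f Y R c) = Ide \<B> (V \<odot> Y)" "Dom \<T> (lower_in f Y R c) = (V \<odot> Y, L)"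
      "Cod \<T> (lower_in f Y R c) = (V \<odot> Y, matr_comp E V X Y R (matr_lower E f))"
    and "cartesian c \<Longrightarrow> is_iso \<T> (lower_in f Y R c)"
proof -
  have [simp]: "V \<in> Obj \<B>" "X \<in> Obj \<B>" using f B.Obj_Dom[of f] B.Obj_Cod[of f] by auto
  note [simp] = f Dom_total_Obj[OF c(1,4)] Cod_total_Obj[OF c(1,3)]
  let ?w = "tuple \<B> (tuple \<B> (Pr1 \<B> V Y) (f \<bullet> Pr1 \<B> V Y)) (Pr2 \<B> V Y)"
  have w: "prod_map \<B> (tuple \<B> (Ide \<B> V) f) (Ide \<B> Y) = ?w" by (simp add: prod_map_def)
  show d: "into_data V X Y R (matr_lower E f) ?w (lower_refl E f (Pr1 \<B> V Y) L) c"
    using c by (simp add: into_data_def prod_map_def)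
  show eq: "lower_in f Y R c = into_comp E V X Y R (matr_lower E f) ?w (lower_refl E f (Pr1 \<B> V Y) L) c"
    using w c by (simp add: lower_in_def)
  show l: "lower_in f Y R c \<in> Arr \<T>" "fst (lower_in f Y R c) = Ide \<B> (V \<odot> Y)" "Dom \<T> (lower_in f Y R c) = (V \<odot> Y, L)"
      "Cod \<T> (lower_in f Y R c) = (V \<odot> Y, matr_comp E V X Y R (matr_lower E f))"
    using into_comp_simps[OF d] by (simp_all add: eq)
  assume cc: "cartesian c"
  let ?e = "lower_refl E f (Ide \<B> V) (Term (fib E V))"
  have "?e \<star> over_top E (Pr1 \<B> V Y) L = lower_refl E f (Pr1 \<B> V Y) L"
    using lower_refl_Comp[of f "Ide \<B> V" "Term (fib E V)" "over_top E (Pr1 \<B> V Y) L"] over_top_simps[of "Pr1 \<B> V Y" L] by simp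
  moreover have "opcartesian (into_comp E V X Y R (matr_lower E f) (prod_map \<B> (tuple \<B> (Ide \<B> V) f) (Ide \<B> Y)) (?e \<star> over_top E (Pr1 \<B> V Y) L) c)"
    by (rule into_comp_graph_opcartesian(2)[OF lower_refl_opcartesian]) (use cc c in \<open>auto simp: B.proj_defs\<close>)
  ultimately have "opcartesian (lower_in f Y R c)"
    by (simp add: w eq)
  then show "is_iso \<T> (lower_in f Y R c)"
    by (rule opcartesian_iso) (use l in simp)
qed

lemma lower_in_Comp:
  assumes f: "f \<in> Arr \<B>" "Dom \<B> f = V" "Cod \<B> f = X" "Y \<in> Obj \<B>"
    and c: "c \<in> Arr \<T>" "fst c = prod_map \<B> f (Ide \<B> Y)" "Cod \<T> c = (X \<odot> Y, R)" "Dom \<T> c = (V \<odot> Y, L)"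
    and k: "k \<in> Arr \<T>" "fst k = Ide \<B> (V \<odot> Y)" "Dom \<T> k = (V \<odot> Y, L')" "Cod \<T> k = (V \<odot> Y, L)"
  shows "lower_in f Y R c \<star> k = lower_in f Y R (c \<star> k)"
proof -
  have [simp]: "V \<in> Obj \<B>" "X \<in> Obj \<B>" using f B.Obj_Dom[of f] B.Obj_Cod[of f] by auto
  note [simp] = f Dom_total_Obj[OF c(1,4)] Cod_total_Obj[OF c(1,3)]
  note l = lower_in_simps[OF f c] and l' = lower_in_simps[OF f, of "c \<star> k" R L']
  have "lower_refl E f (Pr1 \<B> V Y) L \<star> k = lower_refl E f (Pr1 \<B> V Y) L'"
    using lower_refl_Comp[of f "Pr1 \<B> V Y" L k] k by simp
  then show ?thesis
    using into_comp_Comp(1)[OF l(1), of k] l(2) l'(2) k c by simp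
qed

lemma lower_out_simps:
  assumes f: "f \<in> Arr \<B>" "Dom \<B> f = V" "Cod \<B> f = X" "Y \<in> Obj \<B>" "R \<in> Obj (fib E (X \<odot> Y))"
  shows "lower_out f Y R \<in> Arr \<T>" "fst (lower_out f Y R) = prod_map \<B> f (Ide \<B> Y)"
    "Dom \<T> (lower_out f Y R) = (V \<odot> Y, matr_comp E V X Y R (matr_lower E f))" "Cod \<T> (lower_out f Y R) = (X \<odot> Y, R)"
    "cartesian (lower_out f Y R)"
    and "\<lbrakk>c \<in> Arr \<T>; fst c = prod_map \<B> f (Ide \<B> Y); Cod \<T> c = (X \<odot> Y, R); Dom \<T> c = (V \<odot> Y, L)\<rbrakk> \<Longrightarrow>
       lower_out f Y R \<star> lower_in f Y R c = c"
proof -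
  have [simp]: "V \<in> Obj \<B>" "X \<in> Obj \<B>" using f B.Obj_Dom[of f] B.Obj_Cod[of f] by auto
  note [simp] = f
  let ?q = "prod_map \<B> f (Ide \<B> Y)"
  let ?c = "cart E ?q R"
  have c: "?c \<in> Arr \<T>" "fst ?c = ?q" "Cod \<T> ?c = (X \<odot> Y, R)" "Dom \<T> ?c = (V \<odot> Y, FObj (pull E ?q) R)" "cartesian ?c"
    by (auto intro: cart_cartesian)
  note l = lower_in_simps[OF f(1-4) c(1-4)]
  note i = l(7)[OF c(5)]
  have v: "fst (Inv \<T> (lower_in f Y R ?c)) = Ide \<B> (V \<odot> Y)"
    by (rule fst_Inv_vertical[OF i l(4)]) simp
  show "lower_out f Y R \<in> Arr \<T>" "fst (lower_out f Y R) = ?q"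
    "Dom \<T> (lower_out f Y R) = (V \<odot> Y, matr_comp E V X Y R (matr_lower E f))" "Cod \<T> (lower_out f Y R) = (X \<odot> Y, R)"
    unfolding lower_out_def using c i l v by simp_all
  show "cartesian (lower_out f Y R)"
    unfolding lower_out_def by (rule cartesian_Comp[OF iso_cartesian[OF T.is_iso_Inv[OF i]] c(5)]) (use i l c in simp)
  fix c assume c': "c \<in> Arr \<T>" "fst c = ?q" "Cod \<T> c = (X \<odot> Y, R)" "Dom \<T> c = (V \<odot> Y, L)"
  obtain k where k: "k \<in> Arr \<T>" "fst k = Ide \<B> (V \<odot> Y)" "Dom \<T> k = Dom \<T> c" "Cod \<T> k = Dom \<T> ?c" "?c \<star> k = c"
    by (rule cartesian_obtain[OF c(5), of c "Ide \<B> (V \<odot> Y)"]) (use c c' in auto)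
  have "lower_in f Y R c = lower_in f Y R ?c \<star> k"
    using lower_in_Comp[OF f(1-4) c(1-4), of k L] k c c' by simp
  then show "lower_out f Y R \<star> lower_in f Y R c = c"
    unfolding lower_out_def using c i l(3-6) k by simp
qed

section \<open>The constraints of the bicategory of matrices\<close>

lemma cart_vert_eq:
  assumes "f \<in> Arr \<B>" "Dom \<B> f = X" "C \<in> Obj (fib E (Cod \<B> f))" "\<phi> \<in> Arr (fib E X)" "Cod (fib E X) \<phi> = FObj (pull E f) C"
  shows "cart E f C \<star> vert E X \<phi> = (f, \<phi>, C)"
proof -
  have "X \<in> Obj \<B>" using assms B.Obj_Dom[of f] by auto
  then show ?thesis
    using assms by (simp add: cart_def vert_Comp_right tot_simps)
qed

text \<open>
  The arrow defining the inverse unit constraint is opcartesian over an identity, hence invertible.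
  The last clause is how the constraint acts on all arrows induced by reflexivity.
\<close>

lemma matr_runit_simps:
  assumes [simp]: "X \<in> Obj \<B>" "Y \<in> Obj \<B>" "R \<in> Obj (fib E (X \<odot> Y))"
  shows "matr_runit E X Y R \<in> Arr (fib E (X \<odot> Y))"
    "Dom (fib E (X \<odot> Y)) (matr_runit E X Y R) = matr_comp E X X Y R (matr_id E X)"
    "Cod (fib E (X \<odot> Y)) (matr_runit E X Y R) = R"
    and "\<lbrakk>c \<in> Arr \<T>; Dom \<T> c = (V, A); Cod \<T> c = (X \<odot> Y, R); fst c = tuple \<B> f g; f \<in> Arr \<B>; g \<in> Arr \<B>;
       Dom \<B> f = V; Dom \<B> g = V; Cod \<B> f = X; Cod \<B> g = Y\<rbrakk> \<Longrightarrow>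
      vert E (X \<odot> Y) (matr_runit E X Y R) \<star> into_comp E X X Y R (matr_id E X) (tuple \<B> (tuple \<B> f f) g) (matr_refl E f A) c = c"
proof -
  let ?XY = "X \<odot> Y" and ?w = "prod_map \<B> (diag \<B> X) (Ide \<B> Y)"
  let ?i = "Ide \<T> (?XY, R)"
  define K where "K = into_comp E X X Y R (matr_id E X) ?w (matr_refl E (Pr1 \<B> X Y) R) ?i"
  have r: "opcart E (diag \<B> X) (Term (fib E X)) \<star> over_top E (Pr1 \<B> X Y) R = matr_refl E (Pr1 \<B> X Y) R"
    by (simp add: matr_refl_def Let_def)
  have K0: "into_data X X Y R (matr_id E X) ?w (matr_refl E (Pr1 \<B> X Y) R) ?i" "opcartesian K"
    unfolding K_def r[symmetric]
    by (rule into_comp_graph_opcartesian[where V = X and L = R]; simp add: iso_cartesian matr_id_def B.proj_defs)+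
  note K1 = into_comp_simps[OF K0(1), folded K_def]
  have K: "K \<in> Arr \<T>" "fst K = Ide \<B> ?XY" "Dom \<T> K = (?XY, R)" "Cod \<T> K = (?XY, matr_comp E X X Y R (matr_id E X))"
    using K1 by (simp_all add: B.proj_defs)
  have iso: "is_iso \<T> K" using K0(2) K by (intro opcartesian_iso) auto
  have "is_iso (fib E ?XY) (vertical E ?XY K)"
    using iso K by (subst vert_iso_iff[symmetric]) auto
  moreover have eq: "matr_runit E X Y R = Inv (fib E ?XY) (vertical E ?XY K)"
    by (simp add: matr_runit_def Let_def K_def)
  ultimately have res: "matr_runit E X Y R \<in> Arr (fib E ?XY)"
    "Dom (fib E ?XY) (matr_runit E X Y R) = matr_comp E X X Y R (matr_id E X)" "Cod (fib E ?XY) (matr_runit E X Y R) = R"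
    and v: "vert E ?XY (matr_runit E X Y R) = Inv \<T> K"
    using K by (auto simp: vert_Inv)
  show "matr_runit E X Y R \<in> Arr (fib E ?XY)"
    "Dom (fib E ?XY) (matr_runit E X Y R) = matr_comp E X X Y R (matr_id E X)" "Cod (fib E ?XY) (matr_runit E X Y R) = R"
    by (fact res)+
  assume c: "c \<in> Arr \<T>" "Dom \<T> c = (V, A)" "Cod \<T> c = (?XY, R)" "fst c = tuple \<B> f g" "f \<in> Arr \<B>" "g \<in> Arr \<B>"
       "Dom \<B> f = V" "Dom \<B> g = V" "Cod \<B> f = X" "Cod \<B> g = Y"
  have "K \<star> c = into_comp E X X Y R (matr_id E X) (tuple \<B> (tuple \<B> f f) g) (matr_refl E f A) c"
    unfolding K_def using into_comp_Comp(1)[OF K0(1), of c] matr_refl_Comp[of "Pr1 \<B> X Y" R c] c by simp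
  then show "vert E ?XY (matr_runit E X Y R) \<star> into_comp E X X Y R (matr_id E X) (tuple \<B> (tuple \<B> f f) g) (matr_refl E f A) c = c"
    unfolding v using iso K c by (simp flip: \<open>K \<star> c = _\<close>)
qed

text \<open>
  Here \<open>(x, y) \<mapsto> ((x, y), y)\<close> is the graph of the second projection \<open>q\<close>, and \<open>p23\<close> is \<open>q \<times> 1\<close>, so that
  the reindexed identity matrix is the companion of \<open>q\<close>, and thereby an image of \<open>\<top>\<close>.
\<close>

lemma matr_lunit_simps:
  assumes [simp]: "X \<in> Obj \<B>" "Y \<in> Obj \<B>" "R \<in> Obj (fib E (X \<odot> Y))"
  shows "matr_lunit E X Y R \<in> Arr (fib E (X \<odot> Y))"
    "Dom (fib E (X \<odot> Y)) (matr_lunit E X Y R) = matr_comp E X Y Y (matr_id E Y) R"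
    "Cod (fib E (X \<odot> Y)) (matr_lunit E X Y R) = R"
    and "\<lbrakk>c \<in> Arr \<T>; Dom \<T> c = (V, A); Cod \<T> c = (X \<odot> Y, R); fst c = tuple \<B> f g; f \<in> Arr \<B>; g \<in> Arr \<B>;
       Dom \<B> f = V; Dom \<B> g = V; Cod \<B> f = X; Cod \<B> g = Y\<rbrakk> \<Longrightarrow>
      vert E (X \<odot> Y) (matr_lunit E X Y R) \<star> into_comp E X Y Y (matr_id E Y) R (tuple \<B> (tuple \<B> f g) g) c (matr_refl E g A) = c"
proof -
  let ?XY = "X \<odot> Y" and ?w = "tuple \<B> (Ide \<B> (X \<odot> Y)) (Pr2 \<B> X Y)" and ?q = "Pr2 \<B> X Y"
  let ?i = "Ide \<T> (?XY, R)" and ?T = "Term (fib E ?XY)"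
  define K where "K = into_comp E X Y Y (matr_id E Y) R ?w ?i (matr_refl E ?q R)"
  have p: "p23 \<B> X Y Y = prod_map \<B> ?q (Ide \<B> Y)" by (simp add: B.proj_defs)
  have p2: "p12 \<B> X Y Y \<bullet> ?w = Ide \<B> ?XY" by (simp add: B.proj_defs)
  have K0: "into_data X Y Y (matr_id E Y) R ?w ?i (matr_refl E ?q R)"
    by (simp add: into_data_def p p2)
  have "matr_refl E ?q ?T \<star> over_top E (Ide \<B> ?XY) R = matr_refl E ?q R"
    using matr_refl_Comp[of ?q ?T "over_top E (Ide \<B> ?XY) R"] over_top_simps[of "Ide \<B> ?XY" R] by simp
  moreover have "opcartesian (into_comp E X Y Y (matr_id E Y) R ?w (?i \<star> ?i) (matr_refl E ?q ?T \<star> over_top E (Ide \<B> ?XY) R))"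
  proof (rule into_comp_opcartesian_right[OF _ meet_cone_sym[OF meet_cone_top]])
    show "into_data X Y Y (matr_id E Y) R ?w (?i \<star> ?i) (matr_refl E ?q ?T \<star> over_top E (Ide \<B> ?XY) R)"
      unfolding calculation using K0 by simp
    show "opcartesian (cart_factor E (p23 \<B> X Y Y) ?w (matr_refl E ?q ?T))"
      using lower_refl_opcartesian[of ?q ?XY] by (simp add: p lower_refl_def Let_def)
  qed (use over_top_simps[of "Ide \<B> ?XY" R] in \<open>auto simp: iso_cartesian\<close>)
  ultimately have Kop: "opcartesian K" by (simp add: K_def)
  note K1 = into_comp_simps[OF K0(1), folded K_def]
  have K: "K \<in> Arr \<T>" "fst K = Ide \<B> ?XY" "Dom \<T> K = (?XY, R)" "Cod \<T> K = (?XY, matr_comp E X Y Y (matr_id E Y) R)"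
    using K1 by (simp_all add: B.proj_defs)
  have iso: "is_iso \<T> K" using Kop K by (intro opcartesian_iso) auto
  have "is_iso (fib E ?XY) (vertical E ?XY K)"
    using iso K by (subst vert_iso_iff[symmetric]) auto
  moreover have eq: "matr_lunit E X Y R = Inv (fib E ?XY) (vertical E ?XY K)"
    by (simp add: matr_lunit_def Let_def K_def)
  ultimately have res: "matr_lunit E X Y R \<in> Arr (fib E ?XY)"
    "Dom (fib E ?XY) (matr_lunit E X Y R) = matr_comp E X Y Y (matr_id E Y) R" "Cod (fib E ?XY) (matr_lunit E X Y R) = R"
    and v: "vert E ?XY (matr_lunit E X Y R) = Inv \<T> K"
    using K by (auto simp: vert_Inv)
  show "matr_lunit E X Y R \<in> Arr (fib E ?XY)"
    "Dom (fib E ?XY) (matr_lunit E X Y R) = matr_comp E X Y Y (matr_id E Y) R" "Cod (fib E ?XY) (matr_lunit E X Y R) = R"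
    by (fact res)+
  assume c: "c \<in> Arr \<T>" "Dom \<T> c = (V, A)" "Cod \<T> c = (?XY, R)" "fst c = tuple \<B> f g" "f \<in> Arr \<B>" "g \<in> Arr \<B>"
       "Dom \<B> f = V" "Dom \<B> g = V" "Cod \<B> f = X" "Cod \<B> g = Y"
  have "K \<star> c = into_comp E X Y Y (matr_id E Y) R (tuple \<B> (tuple \<B> f g) g) c (matr_refl E g A)"
    unfolding K_def using into_comp_Comp(1)[OF K0(1), of c] matr_refl_Comp[of ?q R c] c by simp
  then show "vert E ?XY (matr_lunit E X Y R) \<star> into_comp E X Y Y (matr_id E Y) R (tuple \<B> (tuple \<B> f g) g) c (matr_refl E g A) = c"
    unfolding v using iso K c by (simp flip: \<open>K \<star> c = _\<close>)
qed

text \<open>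
  The constraint is \<open>lower_in\<close> of the cartesian arrow \<open>(g \<bullet> f)\<^sub>\<bullet> \<rightarrow> g\<^sub>\<bullet>\<close> over \<open>f \<times> 1\<close>.
\<close>

lemma matr_lower_comp_simps:
  assumes f: "f \<in> Arr \<B>" "Dom \<B> f = X" "Cod \<B> f = Y" and g: "g \<in> Arr \<B>" "Dom \<B> g = Y" "Cod \<B> g = Z"
  shows "matr_lower_comp E g f \<in> Arr (fib E (X \<odot> Z))"
    "Dom (fib E (X \<odot> Z)) (matr_lower_comp E g f) = matr_lower E (g \<bullet> f)"
    "Cod (fib E (X \<odot> Z)) (matr_lower_comp E g f) = matr_comp E X Y Z (matr_lower E g) (matr_lower E f)"
    "is_iso (fib E (X \<odot> Z)) (matr_lower_comp E g f)"
    and "\<lbrakk>h \<in> Arr \<B>; Cod \<B> h = X; Dom \<B> h = V; A \<in> Obj (fib E V)\<rbrakk> \<Longrightarrow>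
      vert E (X \<odot> Z) (matr_lower_comp E g f) \<star> lower_refl E (g \<bullet> f) h A =
      into_comp E X Y Z (matr_lower E g) (matr_lower E f) (tuple \<B> (tuple \<B> h (f \<bullet> h)) (g \<bullet> (f \<bullet> h)))
        (lower_refl E f h A) (lower_refl E g (f \<bullet> h) A)"
    and "\<lbrakk>h \<in> Arr \<B>; Cod \<B> h = X; Dom \<B> h = V; A \<in> Obj (fib E V)\<rbrakk> \<Longrightarrow>
      lower_out f Z (matr_lower E g) \<star> (vert E (X \<odot> Z) (matr_lower_comp E g f) \<star> lower_refl E (g \<bullet> f) h A) =
      lower_refl E g (f \<bullet> h) A"
proof -
  have [simp]: "X \<in> Obj \<B>" "Y \<in> Obj \<B>" "Z \<in> Obj \<B>" using f g B.Obj_Dom[of f] B.Obj_Dom[of g] B.Obj_Cod[of g] by auto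
  note [simp] = f g
  let ?gf = "g \<bullet> f" and ?I = "matr_id E Z"
  let ?cg = "cart E (prod_map \<B> g (Ide \<B> Z)) ?I" and ?cgf = "cart E (prod_map \<B> ?gf (Ide \<B> Z)) ?I"
  define c where "c = cart_factor E (prod_map \<B> g (Ide \<B> Z)) (prod_map \<B> f (Ide \<B> Z)) ?cgf"
  have gf: "prod_map \<B> ?gf (Ide \<B> Z) = prod_map \<B> g (Ide \<B> Z) \<bullet> prod_map \<B> f (Ide \<B> Z)"
    by (simp add: B.proj_defs)
  have lo: "matr_lower E ?gf = FObj (pull E (prod_map \<B> ?gf (Ide \<B> Z))) ?I"
    "matr_lower E g = FObj (pull E (prod_map \<B> g (Ide \<B> Z))) ?I"
    by (simp_all add: matr_lower_def Let_def)
  have c: "c \<in> Arr \<T>" "fst c = prod_map \<B> f (Ide \<B> Z)" "Cod \<T> c = (Y \<odot> Z, matr_lower E g)"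
    "Dom \<T> c = (X \<odot> Z, matr_lower E ?gf)" "?cg \<star> c = ?cgf"
    using cart_factor_simps[of "prod_map \<B> f (Ide \<B> Z)" "prod_map \<B> g (Ide \<B> Z)" ?cgf ?I]
    by (simp_all add: c_def gf lo)
  have cc: "cartesian c"
    by (rule cartesian_cancel[of ?cg]) (use c in \<open>auto simp: lo intro: cart_cartesian\<close>)
  let ?K = "lower_in f Z (matr_lower E g) c"
  note K = lower_in_simps[OF f B.Obj_Cod[OF g(1), unfolded g(3)] c(1-4)]
  note iso = K(7)[OF cc]
  have eq: "matr_lower_comp E g f = vertical E (X \<odot> Z) ?K"
    using c by (simp add: matr_lower_comp_def lower_in_def c_def Let_def)
  have res: "matr_lower_comp E g f \<in> Arr (fib E (X \<odot> Z))"
    "Dom (fib E (X \<odot> Z)) (matr_lower_comp E g f) = matr_lower E ?gf"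
    "Cod (fib E (X \<odot> Z)) (matr_lower_comp E g f) = matr_comp E X Y Z (matr_lower E g) (matr_lower E f)"
    and v: "vert E (X \<odot> Z) (matr_lower_comp E g f) = ?K"
    unfolding eq using K(3-6) by simp_all
  show "matr_lower_comp E g f \<in> Arr (fib E (X \<odot> Z))"
    "Dom (fib E (X \<odot> Z)) (matr_lower_comp E g f) = matr_lower E ?gf"
    "Cod (fib E (X \<odot> Z)) (matr_lower_comp E g f) = matr_comp E X Y Z (matr_lower E g) (matr_lower E f)"
    by (fact res)+
  show "is_iso (fib E (X \<odot> Z)) (matr_lower_comp E g f)"
    using iso res v by (subst vert_iso_iff[symmetric]) auto
  assume h [simp]: "h \<in> Arr \<B>" "Cod \<B> h = X" "Dom \<B> h = V" "A \<in> Obj (fib E V)"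
  let ?k = "lower_refl E ?gf h A"
  have k: "?k \<in> Arr \<T>" "fst ?k = tuple \<B> h (g \<bullet> (f \<bullet> h))" "Dom \<T> ?k = (V, A)" "Cod \<T> ?k = (X \<odot> Z, matr_lower E ?gf)"
    "?cgf \<star> ?k = matr_refl E (g \<bullet> (f \<bullet> h)) A"
    using lower_refl_simps[of ?gf h A] by simp_all
  have ck: "c \<star> ?k = lower_refl E g (f \<bullet> h) A"
  proof (rule cart_Comp_ext[of "prod_map \<B> g (Ide \<B> Z)" ?I])
    have "?cg \<star> (c \<star> ?k) = (?cg \<star> c) \<star> ?k"
      by (rule T.Comp_assoc_Arr[symmetric]) (use c(1-4) k(1-4) in \<open>simp_all add: lo\<close>)
    then show "?cg \<star> (c \<star> ?k) = ?cg \<star> lower_refl E g (f \<bullet> h) A"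
      unfolding c(5) k(5) using lower_refl_simps(5)[of g "f \<bullet> h" A] by simp
  qed (use c(1-4) k(1-4) lo in simp_all)
  have "lower_refl E f (Pr1 \<B> X Z) (matr_lower E ?gf) \<star> ?k = lower_refl E f h A"
    using lower_refl_Comp[of f "Pr1 \<B> X Z" "matr_lower E ?gf" ?k] k by simp
  then show "vert E (X \<odot> Z) (matr_lower_comp E g f) \<star> ?k =
      into_comp E X Y Z (matr_lower E g) (matr_lower E f) (tuple \<B> (tuple \<B> h (f \<bullet> h)) (g \<bullet> (f \<bullet> h)))
        (lower_refl E f h A) (lower_refl E g (f \<bullet> h) A)"
    unfolding v using into_comp_Comp(1)[OF K(1), of ?k] K(2) k ck by simp
  have lo_typ: "lower_out f Z (matr_lower E g) \<in> Arr \<T>"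
    "Dom \<T> (lower_out f Z (matr_lower E g)) = (X \<odot> Z, matr_comp E X Y Z (matr_lower E g) (matr_lower E f))"
    "lower_out f Z (matr_lower E g) \<star> ?K = c"
    using lower_out_simps[OF f, of Z "matr_lower E g"] c by simp_all
  have "lower_out f Z (matr_lower E g) \<star> (?K \<star> ?k) = (lower_out f Z (matr_lower E g) \<star> ?K) \<star> ?k"
    using lo_typ(1,2) K(3-6) k by simp
  then show "lower_out f Z (matr_lower E g) \<star> (vert E (X \<odot> Z) (matr_lower_comp E g f) \<star> ?k) = lower_refl E g (f \<bullet> h) A"
    unfolding v lo_typ(3) ck .
qed

text \<open>
  The counit collapses the pair of canonical elements of \<open>f\<^sup>\<bullet>\<close> and \<open>f\<^sub>\<bullet>\<close> to reflexivity at \<open>f \<bullet> h\<close>.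
\<close>

lemma matr_adj_counit_simps:
  assumes f: "f \<in> Arr \<B>" "Dom \<B> f = X" "Cod \<B> f = Y"
  shows "matr_adj_counit E f \<in> Arr (fib E (Y \<odot> Y))"
    "Dom (fib E (Y \<odot> Y)) (matr_adj_counit E f) = matr_comp E Y X Y (matr_lower E f) (matr_upper E f)"
    "Cod (fib E (Y \<odot> Y)) (matr_adj_counit E f) = matr_id E Y"
    and "\<lbrakk>h \<in> Arr \<B>; Cod \<B> h = X; Dom \<B> h = V; A \<in> Obj (fib E V)\<rbrakk> \<Longrightarrow>
      vert E (Y \<odot> Y) (matr_adj_counit E f) \<star> into_comp E Y X Y (matr_lower E f) (matr_upper E f)
        (tuple \<B> (tuple \<B> (f \<bullet> h) h) (f \<bullet> h)) (upper_refl E f h A) (lower_refl E f h A) = matr_refl E (f \<bullet> h) A"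
proof -
  have [simp]: "X \<in> Obj \<B>" "Y \<in> Obj \<B>" using f B.Obj_Dom[of f] B.Obj_Cod[of f] by auto
  note [simp] = f
  let ?L = "matr_lower E f" and ?U = "matr_upper E f" and ?I = "matr_id E Y"
  let ?cU = "cart E (prod_map \<B> (Ide \<B> Y) f) ?I" and ?cL = "cart E (prod_map \<B> f (Ide \<B> Y)) ?I"
  let ?p = "meet_pr1 Y X Y ?L ?U" and ?q = "meet_pr2 Y X Y ?L ?U"
  let ?w = "prod_map \<B> (prod_map \<B> (Ide \<B> Y) f) (Ide \<B> Y)"
  have lo: "?L = FObj (pull E (prod_map \<B> f (Ide \<B> Y))) ?I" "?U = FObj (pull E (prod_map \<B> (Ide \<B> Y) f)) ?I"
    by (simp_all add: matr_lower_def matr_upper_def Let_def)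
  have [simp]: "?L \<in> Obj (fib E (X \<odot> Y))" "?U \<in> Obj (fib E (Y \<odot> X))" by simp_all
  have cl: "?cL \<in> Arr \<T>" "Dom \<T> ?cL = (X \<odot> Y, ?L)" "?cU \<in> Arr \<T>" "Dom \<T> ?cU = (Y \<odot> X, ?U)"
    "Cod \<T> ?cL = (Y \<odot> Y, ?I)" "Cod \<T> ?cU = (Y \<odot> Y, ?I)"
    by (simp_all add: lo)
  define k where "k = into_comp E Y Y Y ?I ?I ?w (?cU \<star> ?p) (?cL \<star> ?q)"
  have d: "into_data Y Y Y ?I ?I ?w (?cU \<star> ?p) (?cL \<star> ?q)"
    using cl by (simp add: into_data_def) (simp add: B.proj_defs)
  have k: "k \<in> Arr \<T>" "fst k = p13 \<B> Y X Y" "Dom \<T> k = ((Y \<odot> X) \<odot> Y, matr_meet E Y X Y ?L ?U)"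
    "Cod \<T> k = (Y \<odot> Y, matr_comp E Y Y Y ?I ?I)"
    using into_comp_simps[OF d] cl by (simp_all add: k_def) (simp add: B.proj_defs)
  note o = opcart_factor_simps[OF k]
  have pq: "?p = (p12 \<B> Y X Y, Pr1 (fib E ((Y \<odot> X) \<odot> Y)) (FObj (pull E (p12 \<B> Y X Y)) ?U) (FObj (pull E (p23 \<B> Y X Y)) ?L), ?U)"
    "?q = (p23 \<B> Y X Y, Pr2 (fib E ((Y \<odot> X) \<odot> Y)) (FObj (pull E (p12 \<B> Y X Y)) ?U) (FObj (pull E (p23 \<B> Y X Y)) ?L), ?L)"
    unfolding meet_pr1_def meet_pr2_def by (rule cart_vert_eq; simp)+
  have eq: "matr_adj_counit E f = matr_lunit E Y Y ?I \<cdot>\<^bsub>fib E (Y \<odot> Y)\<^esub> opcart_factor E k"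
    by (simp add: matr_adj_counit_def Let_def k_def pq)
  note lu = matr_lunit_simps[of Y Y ?I]
  show "matr_adj_counit E f \<in> Arr (fib E (Y \<odot> Y))"
    "Dom (fib E (Y \<odot> Y)) (matr_adj_counit E f) = matr_comp E Y X Y ?L ?U"
    "Cod (fib E (Y \<odot> Y)) (matr_adj_counit E f) = ?I"
    unfolding eq using lu(1-3) o(1-3) by (simp_all add: matr_comp_def)
  assume h [simp]: "h \<in> Arr \<B>" "Cod \<B> h = X" "Dom \<B> h = V" "A \<in> Obj (fib E V)"
  let ?fh = "f \<bullet> h"
  let ?w' = "tuple \<B> (tuple \<B> ?fh h) ?fh" and ?u = "upper_refl E f h A" and ?l = "lower_refl E f h A"
  have d': "into_data Y X Y ?L ?U ?w' ?u ?l" by (simp add: into_data_def)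
  note m = into_meet_simps[OF d']
  let ?m = "into_meet Y X Y ?w' ?u ?l"
  have m': "Dom \<T> ?m = (V, A)" using m(3) by simp
  have e1: "(?cU \<star> ?p) \<star> ?m = matr_refl E ?fh A"
  proof -
    have "(?cU \<star> ?p) \<star> ?m = ?cU \<star> (?p \<star> ?m)"
      by (rule T.Comp_assoc_Arr) (use cl m in simp_all)
    then show ?thesis unfolding m(5) using upper_refl_simps(5)[of f h A] by simp
  qed
  have e2: "(?cL \<star> ?q) \<star> ?m = matr_refl E ?fh A"
  proof -
    have "(?cL \<star> ?q) \<star> ?m = ?cL \<star> (?q \<star> ?m)"
      by (rule T.Comp_assoc_Arr) (use cl m in simp_all)
    then show ?thesis unfolding m(6) using lower_refl_simps(5)[of f h A] by simp
  qed
  have dm: "Cod \<T> ?m = Dom \<T> (?cU \<star> ?p)" using m(4) cl by simp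
  have km: "k \<star> ?m = into_comp E Y Y Y ?I ?I (tuple \<B> (tuple \<B> ?fh ?fh) ?fh) (matr_refl E ?fh A) (matr_refl E ?fh A)"
    unfolding k_def into_comp_Comp(1)[OF d m(1) dm] e1 e2 m(2) by simp
  have "vert E (Y \<odot> Y) (matr_adj_counit E f) \<star> into_comp E Y X Y ?L ?U ?w' ?u ?l =
      vert E (Y \<odot> Y) (matr_lunit E Y Y ?I) \<star> ((vert E (Y \<odot> Y) (opcart_factor E k) \<star> opcart E (p13 \<B> Y X Y) (matr_meet E Y X Y ?L ?U)) \<star> ?m)"
    unfolding eq into_comp_eq using lu(1-3) o(1-3) m(1,2,4) by (simp add: vert_Comp matr_comp_def)
  also have "\<dots> = matr_refl E ?fh A"
    unfolding o(4) km by (rule lu(4)[of _ V A]) simp_all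
  finally show "vert E (Y \<odot> Y) (matr_adj_counit E f) \<star> into_comp E Y X Y ?L ?U ?w' ?u ?l = matr_refl E ?fh A" .
qed

end

context regular_fibration
begin

text \<open>
  The associativity constraint is the unique vertical arrow taking one bracketing of the universal
  arrows out of the threefold meet \<open>N\<close> to the other, provided that the first, \<open>l0\<close> below, is opcartesian.
  To see this, \<open>N\<close> is regarded as the meet of the reindexing of \<open>R\<close> with the reindexing of the meet
  defining \<open>T \<circ> S\<close>.  The image of the latter along \<open>p13\<close> is \<open>T \<circ> S\<close>; it is stable under pullback along
  the projection that omits \<open>W\<close>, and Frobenius reciprocity adds the meet with \<open>R\<close>.
\<close>

lemma matr_assoc_simps:
  assumes obs [simp]: "W \<in> Obj \<B>" "X \<in> Obj \<B>" "Y \<in> Obj \<B>" "Z \<in> Obj \<B>"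
    "R \<in> Obj (fib E (W \<odot> X))" "S \<in> Obj (fib E (X \<odot> Y))" "T \<in> Obj (fib E (Y \<odot> Z))"
  shows "matr_assoc E W X Y Z T S R \<in> Arr (fib E (W \<odot> Z))"
    "Dom (fib E (W \<odot> Z)) (matr_assoc E W X Y Z T S R) = matr_comp E W X Z (matr_comp E X Y Z T S) R"
    "Cod (fib E (W \<odot> Z)) (matr_assoc E W X Y Z T S R) = matr_comp E W Y Z T (matr_comp E W X Y S R)"
    and "\<lbrakk>a \<in> Arr \<B>; b \<in> Arr \<B>; c \<in> Arr \<B>; d \<in> Arr \<B>; Cod \<B> a = W; Cod \<B> b = X; Cod \<B> c = Y; Cod \<B> d = Z;
      Dom \<B> a = D; Dom \<B> b = D; Dom \<B> c = D; Dom \<B> d = D;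
      r' \<in> Arr \<T>; s' \<in> Arr \<T>; t' \<in> Arr \<T>; fst r' = tuple \<B> a b; fst s' = tuple \<B> b c; fst t' = tuple \<B> c d;
      Dom \<T> r' = (D, L); Dom \<T> s' = (D, L); Dom \<T> t' = (D, L);
      Cod \<T> r' = (W \<odot> X, R); Cod \<T> s' = (X \<odot> Y, S); Cod \<T> t' = (Y \<odot> Z, T)\<rbrakk> \<Longrightarrow>
      vert E (W \<odot> Z) (matr_assoc E W X Y Z T S R) \<star> into_comp E W X Z (matr_comp E X Y Z T S) R (tuple \<B> (tuple \<B> a b) d) r'
        (into_comp E X Y Z T S (tuple \<B> (tuple \<B> b c) d) s' t') =
      into_comp E W Y Z T (matr_comp E W X Y S R) (tuple \<B> (tuple \<B> a c) d)
        (into_comp E W X Y S R (tuple \<B> (tuple \<B> a b) c) r' s') t'"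
proof -
  let ?A = "matr_assoc E W X Y Z T S R"
  let ?TS = "matr_comp E X Y Z T S" and ?SR = "matr_comp E W X Y S R"
  let ?WXY = "(W \<odot> X) \<odot> Y"
  let ?V = "?WXY \<odot> Z"
  let ?p = "Pr1 \<B> ?WXY Z"
  define w where "w = Pr1 \<B> W X \<bullet> (Pr1 \<B> (W \<odot> X) Y \<bullet> ?p)"
  define x where "x = Pr2 \<B> W X \<bullet> (Pr1 \<B> (W \<odot> X) Y \<bullet> ?p)"
  define y where "y = Pr2 \<B> (W \<odot> X) Y \<bullet> ?p"
  define z where "z = Pr2 \<B> ?WXY Z"
  have [simp]: "w \<in> Arr \<B>" "x \<in> Arr \<B>" "y \<in> Arr \<B>" "z \<in> Arr \<B>" "Dom \<B> w = ?V" "Dom \<B> x = ?V" "Dom \<B> y = ?V" "Dom \<B> z = ?V"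
    "Cod \<B> w = W" "Cod \<B> x = X" "Cod \<B> y = Y" "Cod \<B> z = Z"
    by (simp_all add: w_def x_def y_def z_def)
  have proj: "w \<bullet> tuple \<B> (tuple \<B> (tuple \<B> a b) c) d = a" "x \<bullet> tuple \<B> (tuple \<B> (tuple \<B> a b) c) d = b"
     "y \<bullet> tuple \<B> (tuple \<B> (tuple \<B> a b) c) d = c" "z \<bullet> tuple \<B> (tuple \<B> (tuple \<B> a b) c) d = d"
    if "a \<in> Arr \<B>" "b \<in> Arr \<B>" "c \<in> Arr \<B>" "d \<in> Arr \<B>" "Cod \<B> a = W" "Cod \<B> b = X" "Cod \<B> c = Y" "Cod \<B> d = Z"
      "Dom \<B> a = Dom \<B> d" "Dom \<B> b = Dom \<B> d" "Dom \<B> c = Dom \<B> d" for a b c d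
    using that by (simp_all add: w_def x_def y_def z_def)
  have vid: "tuple \<B> (tuple \<B> (tuple \<B> w x) y) z = Ide \<B> ?V"
    by (simp add: w_def x_def y_def z_def)
  have q: "p12 \<B> W X Y \<bullet> ?p = tuple \<B> w x" "p23 \<B> W X Y \<bullet> ?p = tuple \<B> x y" "p13 \<B> W X Y \<bullet> ?p = tuple \<B> w y"
    "tuple \<B> (Pr2 \<B> (W \<odot> X) Y \<bullet> ?p) (Pr2 \<B> ?WXY Z) = tuple \<B> y z"
    by (simp_all add: w_def x_def y_def z_def B.proj_defs)
  have wxy: "tuple \<B> (tuple \<B> w x) y = ?p"
    by (simp add: w_def x_def y_def)
  let ?FV = "fib E ?V"
  define R' where "R' = FObj (pull E (tuple \<B> w x)) R"
  define S' where "S' = FObj (pull E (tuple \<B> x y)) S"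
  define T' where "T' = FObj (pull E (tuple \<B> y z)) T"
  have [simp]: "R' \<in> Obj ?FV" "S' \<in> Obj ?FV" "T' \<in> Obj ?FV" by (simp_all add: R'_def S'_def T'_def)
  define RS where "RS = R' \<otimes>\<^bsub>?FV\<^esub> S'"
  define N where "N = RS \<otimes>\<^bsub>?FV\<^esub> T'"
  have [simp]: "RS \<in> Obj ?FV" "N \<in> Obj ?FV" by (simp_all add: RS_def N_def)
  define n1 where "n1 = vert E ?V (Pr1 ?FV R' S') \<star> vert E ?V (Pr1 ?FV RS T')"
  define m2 where "m2 = vert E ?V (Pr2 ?FV R' S') \<star> vert E ?V (Pr1 ?FV RS T')"
  define m3 where "m3 = vert E ?V (Pr2 ?FV RS T')"
  have n: "n1 \<in> Arr \<T>" "fst n1 = Ide \<B> ?V" "Dom \<T> n1 = (?V, N)" "Cod \<T> n1 = (?V, R')"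
    "m2 \<in> Arr \<T>" "fst m2 = Ide \<B> ?V" "Dom \<T> m2 = (?V, N)" "Cod \<T> m2 = (?V, S')"
    "m3 \<in> Arr \<T>" "fst m3 = Ide \<B> ?V" "Dom \<T> m3 = (?V, N)" "Cod \<T> m3 = (?V, T')"
    by (simp_all add: n1_def m2_def m3_def N_def RS_def)
  let ?cR = "cart E (tuple \<B> w x) R" and ?cS = "cart E (tuple \<B> x y) S" and ?cT = "cart E (tuple \<B> y z) T"
  define r where "r = ?cR \<star> n1"
  define s where "s = ?cS \<star> m2"
  define t where "t = ?cT \<star> m3"
  have rst: "r \<in> Arr \<T>" "fst r = tuple \<B> w x" "Dom \<T> r = (?V, N)" "Cod \<T> r = (W \<odot> X, R)"
    "s \<in> Arr \<T>" "fst s = tuple \<B> x y" "Dom \<T> s = (?V, N)" "Cod \<T> s = (X \<odot> Y, S)"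
    "t \<in> Arr \<T>" "fst t = tuple \<B> y z" "Dom \<T> t = (?V, N)" "Cod \<T> t = (Y \<odot> Z, T)"
    using n by (simp_all add: r_def s_def t_def R'_def S'_def T'_def)
  have rst_eq: "r = (tuple \<B> w x, Pr1 ?FV R' S' \<cdot>\<^bsub>?FV\<^esub> Pr1 ?FV RS T', R)"
    "s = (tuple \<B> x y, Pr2 ?FV R' S' \<cdot>\<^bsub>?FV\<^esub> Pr1 ?FV RS T', S)"
    "t = (tuple \<B> y z, Pr2 ?FV RS T', T)"
    by (simp_all add: r_def s_def t_def n1_def m2_def m3_def RS_def R'_def S'_def T'_def cart_vert_eq flip: vert_Comp)
  \<comment> \<open>The meet \<open>N\<close> represents triples of arrows into \<open>R'\<close>, \<open>S'\<close> and \<open>T'\<close>.\<close>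
  have lift: "\<exists>k. k \<in> Arr \<T> \<and> fst k = v \<and> Dom \<T> k = Dom \<T> r' \<and> Cod \<T> k = (?V, N) \<and> n1 \<star> k = r' \<and> m2 \<star> k = s' \<and> m3 \<star> k = t'"
    if hyp: "r' \<in> Arr \<T>" "s' \<in> Arr \<T>" "t' \<in> Arr \<T>" "fst r' = v" "fst s' = v" "fst t' = v" "Dom \<T> s' = Dom \<T> r'" "Dom \<T> t' = Dom \<T> r'"
      "Cod \<T> r' = (?V, R')" "Cod \<T> s' = (?V, S')" "Cod \<T> t' = (?V, T')" for r' s' t' v
  proof -
    obtain k where k: "k \<in> Arr \<T>" "fst k = fst r'" "Dom \<T> k = Dom \<T> r'" "Cod \<T> k = (?V, RS)"
      "vert E ?V (Pr1 ?FV R' S') \<star> k = r'" "vert E ?V (Pr2 ?FV R' S') \<star> k = s'"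
      by (rule meet_cone_obtain[OF meet_cone_Pr[of ?V R' S'], of r' s']) (use hyp in \<open>auto simp: RS_def\<close>)
    obtain l where l: "l \<in> Arr \<T>" "fst l = fst k" "Dom \<T> l = Dom \<T> k" "Cod \<T> l = (?V, N)"
      "vert E ?V (Pr1 ?FV RS T') \<star> l = k" "vert E ?V (Pr2 ?FV RS T') \<star> l = t'"
      by (rule meet_cone_obtain[OF meet_cone_Pr[of ?V RS T'], of k t']) (use hyp k in \<open>auto simp: N_def\<close>)
    have "n1 \<star> l = r'" "m2 \<star> l = s'"
      using l k by (simp_all add: n1_def m2_def N_def RS_def)
    with l k hyp show ?thesis by (intro exI[of _ l]) (simp add: m3_def)
  qed
  have ext: "k = l" if "k \<in> Arr \<T>" "l \<in> Arr \<T>" "fst k = fst l" "Cod \<T> k = (?V, N)" "Cod \<T> l = (?V, N)"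
      "n1 \<star> k = n1 \<star> l" "m2 \<star> k = m2 \<star> l" "m3 \<star> k = m3 \<star> l" for k l
  proof -
    have "vert E ?V (Pr1 ?FV RS T') \<star> k = vert E ?V (Pr1 ?FV RS T') \<star> l"
      by (rule meet_cone_ext[OF meet_cone_Pr[of ?V R' S']]) (use that in \<open>auto simp: n1_def m2_def N_def RS_def\<close>)
    then show ?thesis
      by (intro meet_cone_ext[OF meet_cone_Pr[of ?V RS T'], of k l]) (use that in \<open>auto simp: m3_def N_def\<close>)
  qed
  \<comment> \<open>The two bracketings, in terms of the four coordinate projections \<open>w\<close>, \<open>x\<close>, \<open>y\<close> and \<open>z\<close>.\<close>
  let ?q = "tuple \<B> (tuple \<B> x y) z" and ?wL = "tuple \<B> (tuple \<B> w x) z"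
  let ?M = "matr_meet E X Y Z T S"
  let ?li = "into_comp E X Y Z T S ?q s t" and ?ri = "into_comp E W X Y S R (tuple \<B> (tuple \<B> w x) y) r s"
  define l0 where "l0 = into_comp E W X Z ?TS R ?wL r ?li"
  define r0 where "r0 = into_comp E W Y Z T ?SR (tuple \<B> (tuple \<B> w y) z) ?ri t"
  have dli: "into_data X Y Z T S ?q s t" using rst by (simp add: into_data_def)
  note li = into_comp_simps[OF dli]
  have dl: "into_data W X Z ?TS R ?wL r ?li" using rst li by (simp add: into_data_def)
  note l0 = into_comp_simps[OF dl, folded l0_def]
  have dri: "into_data W X Y S R (tuple \<B> (tuple \<B> w x) y) r s" using rst by (simp add: into_data_def)
  note ri = into_comp_simps[OF dri]
  have dr: "into_data W Y Z T ?SR (tuple \<B> (tuple \<B> w y) z) ?ri t" using rst ri by (simp add: into_data_def)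
  note r0 = into_comp_simps[OF dr, folded r0_def]
  have l0': "l0 \<in> Arr \<T>" "fst l0 = tuple \<B> w z" "Dom \<T> l0 = (?V, N)" "Cod \<T> l0 = (W \<odot> Z, matr_comp E W X Z ?TS R)"
    using l0 rst by simp_all
  have r0': "r0 \<in> Arr \<T>" "fst r0 = tuple \<B> w z" "Dom \<T> r0 = (?V, N)" "Cod \<T> r0 = (W \<odot> Z, matr_comp E W Y Z T ?SR)"
    using r0 rst ri by simp_all
  have l0_op: "opcartesian l0"
  proof -
    let ?cq = "cart E ?q ?M" and ?o = "opcart E (p13 \<B> X Y Z) ?M" and ?m = "into_meet X Y Z ?q s t"
    note m = into_meet_simps[OF dli]
    let ?A = "FObj (pull E ?q) ?M"
    have cq: "?cq \<in> Arr \<T>" "Dom \<T> ?cq = (?V, ?A)" "Cod \<T> ?cq = ((X \<odot> Y) \<odot> Z, ?M)" "cartesian ?cq"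
      by (simp_all add: cart_cartesian)
    obtain n2 where n2: "n2 \<in> Arr \<T>" "fst n2 = Ide \<B> ?V" "Dom \<T> n2 = (?V, N)" "Cod \<T> n2 = (?V, ?A)" "?cq \<star> n2 = ?m"
      by (rule cartesian_obtain[OF cq(4), of ?m "Ide \<B> ?V"]) (use m rst cq in auto)
    define e where "e = ?o \<star> ?cq"
    have e: "e \<in> Arr \<T>" "fst e = p13 \<B> X Y Z \<bullet> ?q" "Dom \<T> e = (?V, ?A)" "Cod \<T> e = (X \<odot> Z, ?TS)"
      using cq by (simp_all add: e_def matr_comp_def)
    have en: "e \<star> n2 = ?li"
      using cq n2 by (simp add: e_def into_comp_eq)
    \<comment> \<open>\<open>N\<close> is the meet of \<open>R'\<close> and the reindexing of the meet \<open>?M\<close> that defines \<open>T \<circ> S\<close>.\<close>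
    have cone: "meet_cone n1 n2"
      unfolding meet_cone_def
    proof (intro conjI ballI impI)
      fix k1 k2 assume k: "k1 \<in> Arr \<T>" "k2 \<in> Arr \<T>" "Dom \<T> k1 = Dom \<T> k2" "fst k1 = fst k2" "Cod \<T> k1 = Cod \<T> n1" "Cod \<T> k2 = Cod \<T> n2"
      let ?v = "fst k2"
      let ?mk = "?cq \<star> k2"
      let ?sk = "meet_pr1 X Y Z T S \<star> ?mk" and ?tk = "meet_pr2 X Y Z T S \<star> ?mk"
      have v: "?v \<in> Arr \<B>" "Cod \<B> ?v = ?V" "Dom \<B> ?v = fst (Dom \<T> k2)" using fst_Arr[OF k(2)] k(6) n2 by simp_all
      have mk: "?mk \<in> Arr \<T>" "Cod \<T> ?mk = ((X \<odot> Y) \<odot> Z, ?M)" "Dom \<T> ?mk = Dom \<T> k2" "fst ?mk = ?q \<bullet> ?v"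
        using k cq n2 by simp_all
      have sk: "?sk \<in> Arr \<T>" "fst ?sk = tuple \<B> x y \<bullet> ?v" "Dom \<T> ?sk = Dom \<T> k2" "Cod \<T> ?sk = (X \<odot> Y, S)"
        and tk: "?tk \<in> Arr \<T>" "fst ?tk = tuple \<B> y z \<bullet> ?v" "Dom \<T> ?tk = Dom \<T> k2" "Cod \<T> ?tk = (Y \<odot> Z, T)"
        using mk v by simp_all
      note s' = cart_factor_simps[OF v(1) _ _ sk(1,2), of S] and t' = cart_factor_simps[OF v(1) _ _ tk(1,2), of T]
      have s1: "cart_factor E (tuple \<B> x y) ?v ?sk \<in> Arr \<T>" "fst (cart_factor E (tuple \<B> x y) ?v ?sk) = ?v"
        "Dom \<T> (cart_factor E (tuple \<B> x y) ?v ?sk) = Dom \<T> k2" "Cod \<T> (cart_factor E (tuple \<B> x y) ?v ?sk) = (?V, S')"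
        "?cS \<star> cart_factor E (tuple \<B> x y) ?v ?sk = ?sk"
        using s' sk v unfolding S'_def by simp_all
      have t1: "cart_factor E (tuple \<B> y z) ?v ?tk \<in> Arr \<T>" "fst (cart_factor E (tuple \<B> y z) ?v ?tk) = ?v"
        "Dom \<T> (cart_factor E (tuple \<B> y z) ?v ?tk) = Dom \<T> k2" "Cod \<T> (cart_factor E (tuple \<B> y z) ?v ?tk) = (?V, T')"
        "?cT \<star> cart_factor E (tuple \<B> y z) ?v ?tk = ?tk"
        using t' tk v unfolding T'_def by simp_all
      obtain l where l: "l \<in> Arr \<T>" "fst l = ?v" "Dom \<T> l = Dom \<T> k1" "Cod \<T> l = (?V, N)" "n1 \<star> l = k1"
        "m2 \<star> l = cart_factor E (tuple \<B> x y) ?v ?sk" "m3 \<star> l = cart_factor E (tuple \<B> y z) ?v ?tk"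
        using lift[of k1 "cart_factor E (tuple \<B> x y) ?v ?sk" "cart_factor E (tuple \<B> y z) ?v ?tk" ?v] s1 t1 k n by auto
      have sl: "s \<star> l = ?sk"
      proof -
        have "s \<star> l = ?cS \<star> (m2 \<star> l)" unfolding s_def by (rule T.Comp_assoc_Arr) (use l(1-4) n in \<open>simp_all add: S'_def\<close>)
        then show ?thesis unfolding l(6) s1(5) .
      qed
      have tl: "t \<star> l = ?tk"
      proof -
        have "t \<star> l = ?cT \<star> (m3 \<star> l)" unfolding t_def by (rule T.Comp_assoc_Arr) (use l(1-4) n in \<open>simp_all add: T'_def\<close>)
        then show ?thesis unfolding l(7) t1(5) .
      qed
      have "?m \<star> l = ?mk"
      proof (rule into_meet_ext[of X Y Z S T])
        have "meet_pr1 X Y Z T S \<star> (?m \<star> l) = (meet_pr1 X Y Z T S \<star> ?m) \<star> l"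
          by (rule T.Comp_assoc_Arr[symmetric]) (use m(1-4) l(1-4) rst in simp_all)
        then show "meet_pr1 X Y Z T S \<star> (?m \<star> l) = meet_pr1 X Y Z T S \<star> ?mk" unfolding m(5) sl .
        have "meet_pr2 X Y Z T S \<star> (?m \<star> l) = (meet_pr2 X Y Z T S \<star> ?m) \<star> l"
          by (rule T.Comp_assoc_Arr[symmetric]) (use m(1-4) l(1-4) rst in simp_all)
        then show "meet_pr2 X Y Z T S \<star> (?m \<star> l) = meet_pr2 X Y Z T S \<star> ?mk" unfolding m(6) tl .
      qed (use m(1-4) l(1-4) mk rst in simp_all)
      moreover have "?cq \<star> (n2 \<star> l) = (?cq \<star> n2) \<star> l"
        by (rule T.Comp_assoc_Arr[symmetric]) (use cq n2(1-4) l(1-4) in simp_all)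
      ultimately have "?cq \<star> (n2 \<star> l) = ?cq \<star> k2" unfolding n2(5) by simp
      then have "n2 \<star> l = k2"
        by (rule cartesian_ext[OF cq(4)]) (use cq n2(1-4) l(1-4) k v in simp_all)
      with l k show "\<exists>k. k \<in> Arr \<T> \<and> fst k = fst k1 \<and> Cod \<T> k = Dom \<T> n1 \<and> n1 \<star> k = k1 \<and> n2 \<star> k = k2"
        using n by (intro exI[of _ l]) simp
    next
      fix k l assume k: "k \<in> Arr \<T>" "l \<in> Arr \<T>" "Cod \<T> k = Dom \<T> n1" "Cod \<T> l = Dom \<T> n1" "fst k = fst l"
        "n1 \<star> k = n1 \<star> l" "n2 \<star> k = n2 \<star> l"
      have v: "Dom \<B> (fst k) = fst (Dom \<T> k)" "Cod \<B> (fst k) = ?V" "fst k \<in> Arr \<B>" using fst_Arr[OF k(1)] k(3) n by simp_all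
      have mk: "?m \<star> k = ?cq \<star> (n2 \<star> k)" "?m \<star> l = ?cq \<star> (n2 \<star> l)"
        unfolding n2(5)[symmetric] by (rule T.Comp_assoc_Arr; use cq n2(1-4) k n in simp)+
      have sk: "s \<star> k = s \<star> l"
      proof -
        have "(meet_pr1 X Y Z T S \<star> ?m) \<star> k = meet_pr1 X Y Z T S \<star> (?m \<star> k)"
          "(meet_pr1 X Y Z T S \<star> ?m) \<star> l = meet_pr1 X Y Z T S \<star> (?m \<star> l)"
          by (rule T.Comp_assoc_Arr; use m(1-4) k n rst in simp)+
        then show ?thesis unfolding m(5) mk k(7) by simp
      qed
      have tk: "t \<star> k = t \<star> l"
      proof -
        have "(meet_pr2 X Y Z T S \<star> ?m) \<star> k = meet_pr2 X Y Z T S \<star> (?m \<star> k)"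
          "(meet_pr2 X Y Z T S \<star> ?m) \<star> l = meet_pr2 X Y Z T S \<star> (?m \<star> l)"
          by (rule T.Comp_assoc_Arr; use m(1-4) k n rst in simp)+
        then show ?thesis unfolding m(6) mk k(7) by simp
      qed
      have "m2 \<star> k = m2 \<star> l"
      proof (rule cart_Comp_ext[of "tuple \<B> x y" S])
        have "?cS \<star> (m2 \<star> k) = s \<star> k" "?cS \<star> (m2 \<star> l) = s \<star> l"
          unfolding s_def by (rule T.Comp_assoc_Arr[symmetric]; use k n in \<open>simp add: S'_def\<close>)+
        then show "?cS \<star> (m2 \<star> k) = ?cS \<star> (m2 \<star> l)" using sk by simp
      qed (use k n in \<open>simp_all add: S'_def\<close>)
      moreover have "m3 \<star> k = m3 \<star> l"
      proof (rule cart_Comp_ext[of "tuple \<B> y z" T])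
        have "?cT \<star> (m3 \<star> k) = t \<star> k" "?cT \<star> (m3 \<star> l) = t \<star> l"
          unfolding t_def by (rule T.Comp_assoc_Arr[symmetric]; use k n in \<open>simp add: T'_def\<close>)+
        then show "?cT \<star> (m3 \<star> k) = ?cT \<star> (m3 \<star> l)" using tk by simp
      qed (use k n in \<open>simp_all add: T'_def\<close>)
      ultimately show "k = l"
        by (intro ext[of k l]) (use k n in simp_all)
    qed (use n n2 in simp_all)
    let ?e' = "cart_factor E (p23 \<B> W X Z) ?wL e"
    have fe: "p23 \<B> W X Z \<bullet> ?wL = p13 \<B> X Y Z \<bullet> ?q" by simp
    note e' = cart_factor_simps[of ?wL "p23 \<B> W X Z" e ?TS]
    have st: "stable_square ?q ?wL (p13 \<B> X Y Z) (p23 \<B> W X Z)"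
    proof (rule projection_stable[of _ _ _ w "Pr1 \<B> W X \<bullet> Pr1 \<B> (W \<odot> X) Z"])
      let ?P = "(X \<odot> Y) \<odot> Z"
      let ?g = "Pr1 \<B> W ?P" and ?h = "Pr2 \<B> W ?P"
      show "is_iso \<B> (tuple \<B> w ?q)"
      proof (rule B.is_isoI[of _ "tuple \<B> (tuple \<B> (tuple \<B> ?g (Pr1 \<B> X Y \<bullet> (Pr1 \<B> (X \<odot> Y) Z \<bullet> ?h)))
           (Pr2 \<B> X Y \<bullet> (Pr1 \<B> (X \<odot> Y) Z \<bullet> ?h))) (Pr2 \<B> (X \<odot> Y) Z \<bullet> ?h)"])
      qed (simp_all add: proj vid)
      show "is_iso \<B> (tuple \<B> (Pr1 \<B> W X \<bullet> Pr1 \<B> (W \<odot> X) Z) (p23 \<B> W X Z))"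
        by (rule B.is_isoI[of _ "tuple \<B> (tuple \<B> (Pr1 \<B> W (X \<odot> Z)) (Pr1 \<B> X Z \<bullet> Pr2 \<B> W (X \<odot> Z))) (Pr2 \<B> X Z \<bullet> Pr2 \<B> W (X \<odot> Z))"])
          (simp_all add: B.proj_defs)
    qed simp_all
    have "opcartesian ?e'"
      by (rule stable_squareD[OF st _ cq(4) cart_cartesian[of "p23 \<B> W X Z" ?TS], of ?o])
        (use e e' fe cq in \<open>simp_all add: matr_comp_def e_def\<close>)
    then have "opcartesian (into_comp E W X Z ?TS R ?wL (?cR \<star> n1) (e \<star> n2))"
      by (intro into_comp_opcartesian_right[OF _ cone])
        (use dl n n2(1-4) e in \<open>simp_all add: en R'_def cart_cartesian flip: r_def\<close>)
    then show ?thesis by (simp add: l0_def en r_def)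
  qed
  have eq: "matr_assoc E W X Y Z T S R = opcart_factor E r0 \<cdot>\<^bsub>fib E (W \<odot> Z)\<^esub> Inv (fib E (W \<odot> Z)) (opcart_factor E l0)"
    unfolding matr_assoc_def Let_def q l0_def r0_def rst_eq R'_def S'_def T'_def RS_def z_def wxy ..
  note ol = opcart_factor_simps[OF l0'] and or = opcart_factor_simps[OF r0']
  have iso: "is_iso (fib E (W \<odot> Z)) (opcart_factor E l0)"
    using opcartesian_iff_factor_iso[OF l0'] l0_op by simp
  show "?A \<in> Arr (fib E (W \<odot> Z))" "Dom (fib E (W \<odot> Z)) ?A = matr_comp E W X Z ?TS R"
    "Cod (fib E (W \<odot> Z)) ?A = matr_comp E W Y Z T ?SR"
    unfolding eq using ol(1-3) or(1-3) iso by simp_all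
  have Al: "vert E (W \<odot> Z) ?A \<star> l0 = r0"
  proof -
    let ?O = "opcart E (tuple \<B> w z) N" and ?l = "vert E (W \<odot> Z) (opcart_factor E l0)" and ?r = "vert E (W \<odot> Z) (opcart_factor E r0)"
    have "is_iso \<T> ?l" using iso ol by (subst vert_iso_iff) auto
    then have "Inv \<T> ?l \<star> (?l \<star> ?O) = ?O" using ol(1-3) by simp
    then have *: "Inv \<T> ?l \<star> l0 = ?O" unfolding ol(4) .
    have "vert E (W \<odot> Z) ?A \<star> l0 = ?r \<star> (Inv \<T> ?l \<star> l0)"
      unfolding eq using ol(1-3) or(1-3) iso l0' \<open>is_iso \<T> ?l\<close> by (simp add: vert_Comp vert_Inv)
    also have "\<dots> = r0" unfolding * or(4) ..
    finally show ?thesis .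
  qed
  fix a b c d D r' s' t' L
  assume abcd [simp]: "a \<in> Arr \<B>" "b \<in> Arr \<B>" "c \<in> Arr \<B>" "d \<in> Arr \<B>" "Cod \<B> a = W" "Cod \<B> b = X" "Cod \<B> c = Y" "Cod \<B> d = Z"
      "Dom \<B> a = D" "Dom \<B> b = D" "Dom \<B> c = D" "Dom \<B> d = D"
    and rst': "r' \<in> Arr \<T>" "s' \<in> Arr \<T>" "t' \<in> Arr \<T>" "fst r' = tuple \<B> a b" "fst s' = tuple \<B> b c" "fst t' = tuple \<B> c d"
      "Dom \<T> r' = (D, L)" "Dom \<T> s' = (D, L)" "Dom \<T> t' = (D, L)"
      "Cod \<T> r' = (W \<odot> X, R)" "Cod \<T> s' = (X \<odot> Y, S)" "Cod \<T> t' = (Y \<odot> Z, T)"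
  let ?v = "tuple \<B> (tuple \<B> (tuple \<B> a b) c) d"
  note pr = proj[of a b c d, simplified]
  have rl: "cart_factor E (tuple \<B> w x) ?v r' \<in> Arr \<T>" "fst (cart_factor E (tuple \<B> w x) ?v r') = ?v"
    "Dom \<T> (cart_factor E (tuple \<B> w x) ?v r') = (D, L)" "Cod \<T> (cart_factor E (tuple \<B> w x) ?v r') = (?V, R')"
    "?cR \<star> cart_factor E (tuple \<B> w x) ?v r' = r'"
    using cart_factor_simps[of ?v "tuple \<B> w x" r' R] rst' by (simp_all add: pr R'_def)
  have sl: "cart_factor E (tuple \<B> x y) ?v s' \<in> Arr \<T>" "fst (cart_factor E (tuple \<B> x y) ?v s') = ?v"
    "Dom \<T> (cart_factor E (tuple \<B> x y) ?v s') = (D, L)" "Cod \<T> (cart_factor E (tuple \<B> x y) ?v s') = (?V, S')"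
    "?cS \<star> cart_factor E (tuple \<B> x y) ?v s' = s'"
    using cart_factor_simps[of ?v "tuple \<B> x y" s' S] rst' by (simp_all add: pr S'_def)
  have tl: "cart_factor E (tuple \<B> y z) ?v t' \<in> Arr \<T>" "fst (cart_factor E (tuple \<B> y z) ?v t') = ?v"
    "Dom \<T> (cart_factor E (tuple \<B> y z) ?v t') = (D, L)" "Cod \<T> (cart_factor E (tuple \<B> y z) ?v t') = (?V, T')"
    "?cT \<star> cart_factor E (tuple \<B> y z) ?v t' = t'"
    using cart_factor_simps[of ?v "tuple \<B> y z" t' T] rst' by (simp_all add: pr T'_def)
  obtain k where k: "k \<in> Arr \<T>" "fst k = ?v" "Dom \<T> k = (D, L)" "Cod \<T> k = (?V, N)"
    "n1 \<star> k = cart_factor E (tuple \<B> w x) ?v r'" "m2 \<star> k = cart_factor E (tuple \<B> x y) ?v s'" "m3 \<star> k = cart_factor E (tuple \<B> y z) ?v t'"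
    using lift[OF rl(1) sl(1) tl(1) rl(2) sl(2) tl(2)] rl sl tl by auto
  have rk: "r \<star> k = r'" "s \<star> k = s'" "t \<star> k = t'"
  proof -
    have "r \<star> k = ?cR \<star> (n1 \<star> k)" unfolding r_def by (rule T.Comp_assoc_Arr) (use k(1-4) n in \<open>simp_all add: R'_def\<close>)
    then show "r \<star> k = r'" unfolding k(5) rl(5) .
    have "s \<star> k = ?cS \<star> (m2 \<star> k)" unfolding s_def by (rule T.Comp_assoc_Arr) (use k(1-4) n in \<open>simp_all add: S'_def\<close>)
    then show "s \<star> k = s'" unfolding k(6) sl(5) .
    have "t \<star> k = ?cT \<star> (m3 \<star> k)" unfolding t_def by (rule T.Comp_assoc_Arr) (use k(1-4) n in \<open>simp_all add: T'_def\<close>)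
    then show "t \<star> k = t'" unfolding k(7) tl(5) .
  qed
  have cod: "Cod \<T> k = Dom \<T> r" "Cod \<T> k = Dom \<T> s" "Cod \<T> k = Dom \<T> ?ri"
    using k rst ri by simp_all
  have base: "?wL \<bullet> fst k = tuple \<B> (tuple \<B> a b) d" "?q \<bullet> fst k = tuple \<B> (tuple \<B> b c) d"
    "tuple \<B> (tuple \<B> w y) z \<bullet> fst k = tuple \<B> (tuple \<B> a c) d" "tuple \<B> (tuple \<B> w x) y \<bullet> fst k = tuple \<B> (tuple \<B> a b) c"
    by (simp_all add: k(2) pr)
  have lk: "l0 \<star> k = into_comp E W X Z ?TS R (tuple \<B> (tuple \<B> a b) d) r' (into_comp E X Y Z T S (tuple \<B> (tuple \<B> b c) d) s' t')"
    unfolding l0_def into_comp_Comp(1)[OF dl k(1) cod(1)] into_comp_Comp(1)[OF dli k(1) cod(2)] rk base ..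
  have rk: "r0 \<star> k = into_comp E W Y Z T ?SR (tuple \<B> (tuple \<B> a c) d) (into_comp E W X Y S R (tuple \<B> (tuple \<B> a b) c) r' s') t'"
    unfolding r0_def into_comp_Comp(1)[OF dr k(1) cod(3)] into_comp_Comp(1)[OF dri k(1) cod(1)] rk base ..
  have "vert E (W \<odot> Z) ?A \<star> (l0 \<star> k) = (vert E (W \<odot> Z) ?A \<star> l0) \<star> k"
    by (rule T.Comp_assoc_Arr[symmetric]) (use l0' k(1-4) in \<open>simp_all add: \<open>?A \<in> Arr _\<close> \<open>Dom _ ?A = _\<close>\<close>)
  then show "vert E (W \<odot> Z) ?A \<star> into_comp E W X Z ?TS R (tuple \<B> (tuple \<B> a b) d) r' (into_comp E X Y Z T S (tuple \<B> (tuple \<B> b c) d) s' t') =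
    into_comp E W Y Z T ?SR (tuple \<B> (tuple \<B> a c) d) (into_comp E W X Y S R (tuple \<B> (tuple \<B> a b) c) r' s') t'"
    unfolding Al lk rk .
qed

section \<open>Two-cells into a composite with a companion\<close>

lemma truncate_simps [simp]:
  "Obj (cat.truncate C) = Obj C" "Arr (cat.truncate C) = Arr C" "Dom (cat.truncate C) = Dom C"
  "Cod (cat.truncate C) = Cod C" "Ide (cat.truncate C) = Ide C" "Comp (cat.truncate C) = Comp C"
  by (simp_all add: cat.truncate_def)

lemma truncate_derived [simp]:
  "Hom (cat.truncate C) = Hom C" "Inv (cat.truncate C) = Inv C" "is_iso (cat.truncate C) = is_iso C"
proof -
  show Hom: "Hom (cat.truncate C) = Hom C" by (intro ext) (simp add: Hom_def)
  show "Inv (cat.truncate C) = Inv C" "is_iso (cat.truncate C) = is_iso C"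
    by (intro ext; simp add: Inv_def is_iso_def inverse_arrows_def Hom)+
qed

abbreviation top :: "'o \<Rightarrow> 'p" where "top X \<equiv> Term (fib E X)"

text \<open>
  The arrow \<open>\<top> \<rightarrow> R\<close> over \<open>(f, g)\<close> that corresponds to a 2-cell \<open>g\<^sub>\<bullet> \<rightarrow> R \<circ> f\<^sub>\<bullet>\<close>.  The correspondence is bijective
  since \<open>\<top> \<rightarrow> g\<^sub>\<bullet>\<close> is opcartesian and \<open>R \<circ> f\<^sub>\<bullet> \<rightarrow> R\<close> is cartesian.
\<close>

definition cell_arrow :: "'a \<Rightarrow> 'a \<Rightarrow> 'p \<Rightarrow> 'q \<Rightarrow> ('a, 'p, 'q) over" where
  "cell_arrow f g R \<phi> = lower_out f (Cod \<B> g) R \<star>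
     (vert E (Dom \<B> f \<odot> Cod \<B> g) \<phi> \<star> lower_refl E g (Ide \<B> (Dom \<B> f)) (top (Dom \<B> f)))"

context
  fixes f g :: 'a and Z X Y :: 'o and R :: 'p
  assumes f [simp]: "f \<in> Arr \<B>" "Dom \<B> f = Z" "Cod \<B> f = X"
    and g [simp]: "g \<in> Arr \<B>" "Dom \<B> g = Z" "Cod \<B> g = Y"
    and R [simp]: "R \<in> Obj (fib E (X \<odot> Y))"
begin

lemma cell_objs [simp]: "X \<in> Obj \<B>" "Y \<in> Obj \<B>" "Z \<in> Obj \<B>"
  using B.Obj_Dom[of f] B.Obj_Cod[of f] B.Obj_Cod[of g] by auto

lemma cell_arrow_simps:
  assumes \<phi>: "\<phi> \<in> Hom (fib E (Z \<odot> Y)) (matr_lower E g) (matr_comp E Z X Y R (matr_lower E f))"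
  shows "cell_arrow f g R \<phi> \<in> Arr \<T>" "fst (cell_arrow f g R \<phi>) = tuple \<B> f g"
    "Dom \<T> (cell_arrow f g R \<phi>) = (Z, top Z)" "Cod \<T> (cell_arrow f g R \<phi>) = (X \<odot> Y, R)"
  using lower_out_simps[of f Z X Y R] \<phi> by (simp_all add: cell_arrow_def Hom_def)

lemma cell_arrow_inj:
  assumes \<phi>: "\<phi> \<in> Hom (fib E (Z \<odot> Y)) (matr_lower E g) (matr_comp E Z X Y R (matr_lower E f))"
    and \<psi>: "\<psi> \<in> Hom (fib E (Z \<odot> Y)) (matr_lower E g) (matr_comp E Z X Y R (matr_lower E f))"
    and eq: "cell_arrow f g R \<phi> = cell_arrow f g R \<psi>"
  shows "\<phi> = \<psi>"
proof -
  note l = lower_out_simps[of f Z X Y R, simplified]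
  have t [simp]: "\<phi> \<in> Arr (fib E (Z \<odot> Y))" "\<psi> \<in> Arr (fib E (Z \<odot> Y))"
    "Dom (fib E (Z \<odot> Y)) \<phi> = matr_lower E g" "Dom (fib E (Z \<odot> Y)) \<psi> = matr_lower E g"
    "Cod (fib E (Z \<odot> Y)) \<phi> = matr_comp E Z X Y R (matr_lower E f)" "Cod (fib E (Z \<odot> Y)) \<psi> = matr_comp E Z X Y R (matr_lower E f)"
    using \<phi> \<psi> by (auto simp: Hom_def)
  let ?g = "lower_refl E g (Ide \<B> Z) (top Z)"
  have "vert E (Z \<odot> Y) \<phi> \<star> ?g = vert E (Z \<odot> Y) \<psi> \<star> ?g"
    by (rule cartesian_ext[OF l(5)]) (use l eq in \<open>simp_all add: cell_arrow_def\<close>)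
  then have "vert E (Z \<odot> Y) \<phi> = vert E (Z \<odot> Y) \<psi>"
    by (rule opcartesian_ext[OF lower_refl_opcartesian[OF g(1,2)]]) simp_all
  then have "vertical E (Z \<odot> Y) (vert E (Z \<odot> Y) \<phi>) = vertical E (Z \<odot> Y) (vert E (Z \<odot> Y) \<psi>)"
    by (rule arg_cong)
  then show ?thesis by simp
qed

lemma cell_arrow_surj:
  assumes \<chi>: "\<chi> \<in> Arr \<T>" "fst \<chi> = tuple \<B> f g" "Dom \<T> \<chi> = (Z, top Z)" "Cod \<T> \<chi> = (X \<odot> Y, R)"
  obtains \<phi> where "\<phi> \<in> Hom (fib E (Z \<odot> Y)) (matr_lower E g) (matr_comp E Z X Y R (matr_lower E f))"
    "cell_arrow f g R \<phi> = \<chi>"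
proof -
  note l = lower_out_simps[of f Z X Y R, simplified]
  let ?g = "lower_refl E g (Ide \<B> Z) (top Z)"
  obtain m where m: "m \<in> Arr \<T>" "fst m = tuple \<B> (Ide \<B> Z) g" "Dom \<T> m = (Z, top Z)" "Cod \<T> m = Dom \<T> (lower_out f Y R)"
    "lower_out f Y R \<star> m = \<chi>"
    by (rule cartesian_obtain[OF l(5), of \<chi> "tuple \<B> (Ide \<B> Z) g"]) (use \<chi> l in simp_all)
  obtain n where n: "n \<in> Arr \<T>" "fst n = Ide \<B> (Z \<odot> Y)" "Dom \<T> n = Cod \<T> ?g" "Cod \<T> n = Cod \<T> m" "n \<star> ?g = m"
    by (rule opcartesian_obtain[OF lower_refl_opcartesian[of g Z], of m "Ide \<B> (Z \<odot> Y)"]) (use m in simp_all)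
  show thesis
    by (rule that[of "vertical E (Z \<odot> Y) n"]) (use n m l in \<open>simp_all add: Hom_def cell_arrow_def\<close>)
qed

end

lemma lower_out_whisker:
  assumes h [simp]: "h \<in> Arr \<B>" "Dom \<B> h = Z" "Cod \<B> h = U" and Y [simp]: "Y \<in> Obj \<B>"
    and \<tau>: "\<tau> \<in> Arr (fib E (U \<odot> Y))" "Dom (fib E (U \<odot> Y)) \<tau> = S" "Cod (fib E (U \<odot> Y)) \<tau> = S'"
  shows "lower_out h Y S' \<star> vert E (Z \<odot> Y) (matr_comp2 E Z U Y \<tau> (Ide (fib E (Z \<odot> U)) (matr_lower E h))) =
    vert E (U \<odot> Y) \<tau> \<star> lower_out h Y S"
proof -
  have [simp]: "Z \<in> Obj \<B>" "U \<in> Obj \<B>" using B.Obj_Dom[of h] B.Obj_Cod[of h] by auto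
  have [simp]: "S \<in> Obj (fib E (U \<odot> Y))" "S' \<in> Obj (fib E (U \<odot> Y))"
    using \<tau> category.Obj_Dom[OF fib_category, of "U \<odot> Y" \<tau>] category.Obj_Cod[OF fib_category, of "U \<odot> Y" \<tau>] by auto
  let ?q = "prod_map \<B> h (Ide \<B> Y)"
  let ?c = "cart E ?q S" and ?m = "matr_comp2 E Z U Y \<tau> (Ide (fib E (Z \<odot> U)) (matr_lower E h))"
  have c: "?c \<in> Arr \<T>" "fst ?c = ?q" "Cod \<T> ?c = (U \<odot> Y, S)" "Dom \<T> ?c = (Z \<odot> Y, FObj (pull E ?q) S)" "cartesian ?c"
    by (simp_all add: cart_cartesian)
  note l = lower_in_simps[OF h Y c(1-4)]
  let ?c' = "vert E (U \<odot> Y) \<tau> \<star> ?c"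
  have c': "?c' \<in> Arr \<T>" "fst ?c' = ?q" "Cod \<T> ?c' = (U \<odot> Y, S')" "Dom \<T> ?c' = (Z \<odot> Y, FObj (pull E ?q) S)"
    using \<tau> by simp_all
  note l' = lower_in_simps[OF h Y c']
  note m = matr_comp2_simps[of Z U Y "Ide (fib E (Z \<odot> U)) (matr_lower E h)" \<tau> "matr_lower E h" "matr_lower E h" S S']
  note o = lower_out_simps[OF h Y, of S] and o' = lower_out_simps[OF h Y, of S']
  have ml: "vert E (Z \<odot> Y) ?m \<star> lower_in h Y S ?c = lower_in h Y S' ?c'"
    using m(5)[OF _ _ _ _ _ _ _ _ _ l(1)] \<tau> by (simp add: l(2) l'(2))
  show ?thesis
  proof (rule T.iso_epi[OF l(7)[OF c(5)]])
    have "(lower_out h Y S' \<star> vert E (Z \<odot> Y) ?m) \<star> lower_in h Y S ?c = lower_out h Y S' \<star> (vert E (Z \<odot> Y) ?m \<star> lower_in h Y S ?c)"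
      by (rule T.Comp_assoc_Arr) (use \<tau> m(1-3) l(3-6) o' in simp_all)
    also have "\<dots> = ?c'"
      unfolding ml by (rule o'(6)[OF _ c']) simp
    also have "\<dots> = vert E (U \<odot> Y) \<tau> \<star> (lower_out h Y S \<star> lower_in h Y S ?c)"
      using o(6)[OF _ c(1-4)] by simp
    also have "\<dots> = (vert E (U \<odot> Y) \<tau> \<star> lower_out h Y S) \<star> lower_in h Y S ?c"
      by (rule T.Comp_assoc_Arr[symmetric]) (use \<tau> l(3-6) o in simp_all)
    finally show "(lower_out h Y S' \<star> vert E (Z \<odot> Y) ?m) \<star> lower_in h Y S ?c = (vert E (U \<odot> Y) \<tau> \<star> lower_out h Y S) \<star> lower_in h Y S ?c" .
  qed (use \<tau> m(1-3) l(3-6) o o' in simp_all)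
qed

text \<open>
  Reindexing along \<open>i \<bullet> h\<close> in one step agrees with reindexing in two.  Both sides are compared on the
  invertible arrow \<open>lower_in\<close> built from canonical elements of \<open>h\<^sub>\<bullet>\<close> and \<open>i\<^sub>\<bullet>\<close> and a cartesian arrow to \<open>R\<close>;
  on such a triple the associativity merely rebrackets, and the inverse of \<open>lower_comp\<close> fuses the first
  two entries.
\<close>

lemma lower_out_assoc:
  assumes i [simp]: "i \<in> Arr \<B>" "Dom \<B> i = U" "Cod \<B> i = X" and h [simp]: "h \<in> Arr \<B>" "Dom \<B> h = Z" "Cod \<B> h = U"
    and Y [simp]: "Y \<in> Obj \<B>" and R [simp]: "R \<in> Obj (fib E (X \<odot> Y))"
  shows "lower_out (i \<bullet> h) Y R \<star> (vert E (Z \<odot> Y) (matr_comp2 E Z X Y (Ide (fib E (X \<odot> Y)) R) (Inv (fib E (Z \<odot> X)) (matr_lower_comp E i h)))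
      \<star> vert E (Z \<odot> Y) (matr_assoc E Z U X Y R (matr_lower E i) (matr_lower E h))) =
    lower_out i Y R \<star> lower_out h Y (matr_comp E U X Y R (matr_lower E i))"
    "matr_comp2 E Z X Y (Ide (fib E (X \<odot> Y)) R) (Inv (fib E (Z \<odot> X)) (matr_lower_comp E i h)) \<in>
      Hom (fib E (Z \<odot> Y)) (matr_comp E Z X Y R (matr_comp E Z U X (matr_lower E i) (matr_lower E h))) (matr_comp E Z X Y R (matr_lower E (i \<bullet> h)))"
    (is "_ \<in> ?H")
proof -
  have [simp]: "Z \<in> Obj \<B>" "U \<in> Obj \<B>" "X \<in> Obj \<B>" using B.Obj_Dom[of h] B.Obj_Dom[of i] B.Obj_Cod[of i] by auto
  let ?i = "matr_lower E i" and ?h = "matr_lower E h" and ?ih = "matr_lower E (i \<bullet> h)"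
  let ?Ri = "matr_comp E U X Y R ?i"
  let ?lc = "matr_lower_comp E i h"
  let ?k = "Inv (fib E (Z \<odot> X)) ?lc"
  let ?m = "matr_comp2 E Z X Y (Ide (fib E (X \<odot> Y)) R) ?k" and ?a = "matr_assoc E Z U X Y R ?i ?h"
  have [simp]: "?i \<in> Obj (fib E (U \<odot> X))" "?h \<in> Obj (fib E (Z \<odot> U))" "?ih \<in> Obj (fib E (Z \<odot> X))" by simp_all
  note lc = matr_lower_comp_simps[OF h i]
  note m = matr_comp2_simps[of Z X Y ?k "Ide (fib E (X \<odot> Y)) R" "matr_comp E Z U X ?i ?h" ?ih R R]
  have m': "?m \<in> Arr (fib E (Z \<odot> Y))" "Dom (fib E (Z \<odot> Y)) ?m = matr_comp E Z X Y R (matr_comp E Z U X ?i ?h)"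
    "Cod (fib E (Z \<odot> Y)) ?m = matr_comp E Z X Y R ?ih"
    using m(1-3) lc(1-4) by simp_all
  then show "?m \<in> ?H" by (simp add: Hom_def)
  note a = matr_assoc_simps[of Z U X Y ?h ?i R]
  let ?pi = "prod_map \<B> i (Ide \<B> Y)" and ?ph = "prod_map \<B> h (Ide \<B> Y)" and ?pih = "prod_map \<B> (i \<bullet> h) (Ide \<B> Y)"
  let ?c0 = "cart E ?pi R"
  define L0 where "L0 = FObj (pull E ?pi) R"
  have c0: "?c0 \<in> Arr \<T>" "fst ?c0 = ?pi" "Cod \<T> ?c0 = (X \<odot> Y, R)" "Dom \<T> ?c0 = (U \<odot> Y, L0)" "cartesian ?c0"
    by (simp_all add: cart_cartesian L0_def)
  have [simp]: "L0 \<in> Obj (fib E (U \<odot> Y))" by (simp add: L0_def)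
  let ?c1 = "cart E ?ph L0"
  define L where "L = FObj (pull E ?ph) L0"
  have c1: "?c1 \<in> Arr \<T>" "fst ?c1 = ?ph" "Cod \<T> ?c1 = (U \<odot> Y, L0)" "Dom \<T> ?c1 = (Z \<odot> Y, L)" "cartesian ?c1"
    by (simp_all add: cart_cartesian L_def)
  have [simp]: "L \<in> Obj (fib E (Z \<odot> Y))" by (simp add: L_def)
  define c where "c = ?c0 \<star> ?c1"
  have c: "c \<in> Arr \<T>" "fst c = ?pih" "Cod \<T> c = (X \<odot> Y, R)" "Dom \<T> c = (Z \<odot> Y, L)"
    using c0 c1 by (simp_all add: c_def) (simp add: B.proj_defs)
  note l0 = lower_in_simps[OF i Y c0(1-4)]
  \<comment> \<open>An isomorphism followed by a cartesian arrow, so that \<open>lower_in h Y ?Ri c2\<close> is invertible.\<close>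
  define c2 where "c2 = lower_in i Y R ?c0 \<star> ?c1"
  have c2: "c2 \<in> Arr \<T>" "fst c2 = ?ph" "Cod \<T> c2 = (U \<odot> Y, ?Ri)" "Dom \<T> c2 = (Z \<odot> Y, L)"
    using l0(3-6) c1 by (simp_all add: c2_def)
  have c2c: "cartesian c2"
    unfolding c2_def by (rule cartesian_Comp[OF c1(5) iso_cartesian[OF l0(7)[OF c0(5)]]]) (use l0 c1 in simp)
  note l2 = lower_in_simps[OF h Y c2]
  let ?p = "Pr1 \<B> Z Y" and ?q = "Pr2 \<B> Z Y"
  let ?hr = "lower_refl E h ?p L" and ?ir = "lower_refl E i (h \<bullet> ?p) L"
  have c2_eq: "c2 = into_comp E U X Y R ?i (tuple \<B> (tuple \<B> (h \<bullet> ?p) (i \<bullet> (h \<bullet> ?p))) ?q) ?ir c"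
  proof -
    have "lower_refl E i (Pr1 \<B> U Y) L0 \<star> ?c1 = ?ir"
      using lower_refl_Comp[of i "Pr1 \<B> U Y" L0 ?c1] c1 by (simp add: prod_map_def)
    then show ?thesis
      unfolding c2_def l0(2) using into_comp_Comp(1)[OF l0(1) c1(1)] c1 c_def by (simp add: prod_map_def)
  qed
  let ?ihr = "lower_refl E (i \<bullet> h) ?p L"
  have ih: "i \<bullet> h \<in> Arr \<B>" "Dom \<B> (i \<bullet> h) = Z" "Cod \<B> (i \<bullet> h) = X" by simp_all
  note l = lower_in_simps[OF ih Y c]
  have "vert E (Z \<odot> Y) ?a \<star> lower_in h Y ?Ri c2 =
      into_comp E Z X Y R (matr_comp E Z U X ?i ?h) (tuple \<B> (tuple \<B> ?p (i \<bullet> (h \<bullet> ?p))) ?q)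
        (into_comp E Z U X ?i ?h (tuple \<B> (tuple \<B> ?p (h \<bullet> ?p)) (i \<bullet> (h \<bullet> ?p))) ?hr ?ir) c"
    unfolding l2(2) by (subst c2_eq, rule a(4)[where D = "Z \<odot> Y" and L = L]) (use c in \<open>simp_all add: prod_map_def\<close>)
  also have "into_comp E Z U X ?i ?h (tuple \<B> (tuple \<B> ?p (h \<bullet> ?p)) (i \<bullet> (h \<bullet> ?p))) ?hr ?ir = vert E (Z \<odot> X) ?lc \<star> ?ihr"
    using lc(5)[of ?p "Z \<odot> Y" L] by simp
  finally have al: "vert E (Z \<odot> Y) ?a \<star> lower_in h Y ?Ri c2 =
      into_comp E Z X Y R (matr_comp E Z U X ?i ?h) (tuple \<B> (tuple \<B> ?p (i \<bullet> (h \<bullet> ?p))) ?q) (vert E (Z \<odot> X) ?lc \<star> ?ihr) c" .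
  have d: "into_data Z X Y R (matr_comp E Z U X ?i ?h) (tuple \<B> (tuple \<B> ?p (i \<bullet> (h \<bullet> ?p))) ?q) (vert E (Z \<odot> X) ?lc \<star> ?ihr) c"
    using lc(1-3) c by (simp add: into_data_def prod_map_def)
  have "vert E (Z \<odot> X) ?k \<star> (vert E (Z \<odot> X) ?lc \<star> ?ihr) = ?ihr"
    using lc(1-4) by (simp add: vert_Inv vert_iso_iff)
  then have ml: "vert E (Z \<odot> Y) ?m \<star> (vert E (Z \<odot> Y) ?a \<star> lower_in h Y ?Ri c2) = lower_in (i \<bullet> h) Y R c"
    unfolding al l(2) using m(5)[OF _ _ _ _ _ _ _ _ _ d] lc(1-4) c by simp
  note o = lower_out_simps[OF ih Y R] and o0 = lower_out_simps[OF i Y R] and o2 = lower_out_simps[OF h Y, of ?Ri]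
  have o2c: "lower_out h Y ?Ri \<star> lower_in h Y ?Ri c2 = c2"
    by (rule o2(6)[OF _ c2]) simp
  have o0c: "lower_out i Y R \<star> c2 = c"
  proof -
    have "lower_out i Y R \<star> c2 = (lower_out i Y R \<star> lower_in i Y R ?c0) \<star> ?c1"
      unfolding c2_def by (rule T.Comp_assoc_Arr[symmetric]) (use o0 l0(3-6) c1 in simp_all)
    then show ?thesis unfolding o0(6)[OF c0(1-4)] c_def .
  qed
  show "lower_out (i \<bullet> h) Y R \<star> (vert E (Z \<odot> Y) ?m \<star> vert E (Z \<odot> Y) ?a) = lower_out i Y R \<star> lower_out h Y ?Ri"
  proof (rule T.iso_epi[OF l2(7)[OF c2c]])
    have "(lower_out (i \<bullet> h) Y R \<star> (vert E (Z \<odot> Y) ?m \<star> vert E (Z \<odot> Y) ?a)) \<star> lower_in h Y ?Ri c2 =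
       lower_out (i \<bullet> h) Y R \<star> (vert E (Z \<odot> Y) ?m \<star> (vert E (Z \<odot> Y) ?a \<star> lower_in h Y ?Ri c2))"
      using o(1-4) m' a(1-3) l2(3-6) by simp
    also have "\<dots> = c" unfolding ml by (rule o(6)[OF c])
    also have "\<dots> = (lower_out i Y R \<star> lower_out h Y ?Ri) \<star> lower_in h Y ?Ri c2"
      using o0(1-4) o2(1-4) l2(3-6) o2c o0c by simp
    finally show "(lower_out (i \<bullet> h) Y R \<star> (vert E (Z \<odot> Y) ?m \<star> vert E (Z \<odot> Y) ?a)) \<star> lower_in h Y ?Ri c2 =
      (lower_out i Y R \<star> lower_out h Y ?Ri) \<star> lower_in h Y ?Ri c2" .
  qed (use o(1-4) m' a(1-3) l2(3-6) o0(1-4) o2(1-4) in simp_all)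
qed

end

context regular_fibration
begin

lemma Matr_simps [simp]:
  "tight (Matr E) = cat.truncate \<B>" "hom (Matr E) X Y = cat.truncate (fib E (X \<odot> Y))" "hcomp (Matr E) = matr_comp E"
  "hcomp2 (Matr E) = matr_comp2 E" "assoc (Matr E) = matr_assoc E" "runit (Matr E) = matr_runit E" "lower (Matr E) = matr_lower E"
  "lower_comp (Matr E) = matr_lower_comp E" "upper (Matr E) = matr_upper E" "adj_counit (Matr E) = matr_adj_counit E"
  by (simp_all add: Matr_def)

text \<open>
  The factors of the pasting composite are absorbed one by one: the associativity together with the last
  constraint by the compatibility of the reindexings, the whiskering of \<open>\<tau>\<close> by naturality, and the first
  constraint because it sends the canonical element of \<open>(j \<bullet> h)\<^sub>\<bullet>\<close> to that of \<open>j\<^sub>\<bullet>\<close>.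
\<close>

lemma cell_arrow_tab_paste:
  assumes i [simp]: "i \<in> Arr \<B>" "Dom \<B> i = U" "Cod \<B> i = X" and j [simp]: "j \<in> Arr \<B>" "Dom \<B> j = U" "Cod \<B> j = Y"
    and h [simp]: "h \<in> Arr \<B>" "Dom \<B> h = Z" "Cod \<B> h = U" and R [simp]: "R \<in> Obj (fib E (X \<odot> Y))"
    and \<tau>: "\<tau> \<in> Hom (fib E (U \<odot> Y)) (matr_lower E j) (matr_comp E U X Y R (matr_lower E i))"
  shows "tab_paste (Matr E) X Y R U i j \<tau> Z h \<in> Hom (fib E (Z \<odot> Y)) (matr_lower E (j \<bullet> h)) (matr_comp E Z X Y R (matr_lower E (i \<bullet> h)))"
    "cell_arrow (i \<bullet> h) (j \<bullet> h) R (tab_paste (Matr E) X Y R U i j \<tau> Z h) = cell_arrow i j R \<tau> \<star> over_top E h (top Z)"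
proof -
  have [simp]: "Z \<in> Obj \<B>" "U \<in> Obj \<B>" "X \<in> Obj \<B>" "Y \<in> Obj \<B>"
    using B.Obj_Dom[of h] B.Obj_Dom[of i] B.Obj_Cod[of i] B.Obj_Cod[of j] by auto
  let ?F = "fib E (Z \<odot> Y)" and ?v = "vert E (Z \<odot> Y)"
  let ?Ri = "matr_comp E U X Y R (matr_lower E i)"
  let ?m = "matr_comp2 E Z X Y (Ide (fib E (X \<odot> Y)) R) (Inv (fib E (Z \<odot> X)) (matr_lower_comp E i h))"
  let ?a = "matr_assoc E Z U X Y R (matr_lower E i) (matr_lower E h)"
  let ?t = "matr_comp2 E Z U Y \<tau> (Ide (fib E (Z \<odot> U)) (matr_lower E h))"
  let ?l = "matr_lower_comp E j h"
  have Y: "Y \<in> Obj \<B>" by simp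
  note as = lower_out_assoc[OF i h Y R]
  have \<tau>' [simp]: "\<tau> \<in> Arr (fib E (U \<odot> Y))" "Dom (fib E (U \<odot> Y)) \<tau> = matr_lower E j" "Cod (fib E (U \<odot> Y)) \<tau> = ?Ri"
    using \<tau> by (auto simp: Hom_def)
  note wh = lower_out_whisker[OF h Y \<tau>']
  have m: "?m \<in> Arr ?F" "Dom ?F ?m = matr_comp E Z X Y R (matr_comp E Z U X (matr_lower E i) (matr_lower E h))"
      "Cod ?F ?m = matr_comp E Z X Y R (matr_lower E (i \<bullet> h))"
    using as(2) by (auto simp: Hom_def)
  note a = matr_assoc_simps(1-3)[of Z U X Y "matr_lower E h" "matr_lower E i" R, simplified]
  have t: "?t \<in> Arr ?F" "Dom ?F ?t = matr_comp E Z U Y (matr_lower E j) (matr_lower E h)" "Cod ?F ?t = matr_comp E Z U Y ?Ri (matr_lower E h)"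
    using matr_comp2_simps(1-3)[of Z U Y "Ide (fib E (Z \<odot> U)) (matr_lower E h)" \<tau>] by simp_all
  note l = matr_lower_comp_simps[OF h j]
  have eq: "tab_paste (Matr E) X Y R U i j \<tau> Z h = ?m \<cdot>\<^bsub>?F\<^esub> (?a \<cdot>\<^bsub>?F\<^esub> (?t \<cdot>\<^bsub>?F\<^esub> ?l))"
    by (simp add: tab_paste_def Let_def)
  show tp: "tab_paste (Matr E) X Y R U i j \<tau> Z h \<in> Hom ?F (matr_lower E (j \<bullet> h)) (matr_comp E Z X Y R (matr_lower E (i \<bullet> h)))"
    unfolding eq using m a t l(1-3) by (simp add: Hom_def)
  let ?g = "lower_refl E (j \<bullet> h) (Ide \<B> Z) (top Z)"
  have ih: "i \<bullet> h \<in> Arr \<B>" "Dom \<B> (i \<bullet> h) = Z" "Cod \<B> (i \<bullet> h) = X" by simp_all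
  note o = lower_out_simps[OF ih Y R] and oi = lower_out_simps[OF i Y R] and oh = lower_out_simps[OF h Y, of ?Ri]
    and oj = lower_out_simps[OF h Y, of "matr_lower E j"]
  have "cell_arrow (i \<bullet> h) (j \<bullet> h) R (tab_paste (Matr E) X Y R U i j \<tau> Z h) =
      (lower_out (i \<bullet> h) Y R \<star> (?v ?m \<star> ?v ?a)) \<star> (?v ?t \<star> (?v ?l \<star> ?g))"
    unfolding cell_arrow_def eq using m a t l(1-3) o(1-4) by (simp add: vert_Comp)
  also have "\<dots> = lower_out i Y R \<star> ((lower_out h Y ?Ri \<star> ?v ?t) \<star> (?v ?l \<star> ?g))"
    unfolding as(1) using t l(1-3) oi(1-4) oh(1-4) by simp
  also have "\<dots> = lower_out i Y R \<star> (vert E (U \<odot> Y) \<tau> \<star> (lower_out h Y (matr_lower E j) \<star> (?v ?l \<star> ?g)))"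
    unfolding wh using l(1-3) oj(1-4) by simp
  also have "\<dots> = lower_out i Y R \<star> (vert E (U \<odot> Y) \<tau> \<star> lower_refl E j h (top Z))"
    using l(6)[of "Ide \<B> Z" Z "top Z"] by simp
  also have "lower_refl E j h (top Z) = lower_refl E j (Ide \<B> U) (top U) \<star> over_top E h (top Z)"
    using lower_refl_Comp[of j "Ide \<B> U" "top U" "over_top E h (top Z)"] over_top_simps[of h "top Z"] by simp
  also have "lower_out i Y R \<star> (vert E (U \<odot> Y) \<tau> \<star> \<dots>) = cell_arrow i j R \<tau> \<star> over_top E h (top Z)"
    using oi(1-4) over_top_simps[of h "top Z"] by (simp add: cell_arrow_def)
  finally show "cell_arrow (i \<bullet> h) (j \<bullet> h) R (tab_paste (Matr E) X Y R U i j \<tau> Z h) = cell_arrow i j R \<tau> \<star> over_top E h (top Z)" .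
qed

section \<open>The mate of a tabulating cell\<close>

text \<open>
  The arrow \<open>S \<rightarrow> S \<circ> i\<^sup>\<bullet>\<close> over \<open>i \<times> 1\<close>; being opcartesian, it exhibits composition with a conjoint as
  taking images.
\<close>

definition upper_in :: "'a \<Rightarrow> 'o \<Rightarrow> 'p \<Rightarrow> ('a, 'p, 'q) over" where
  "upper_in i Y S = into_comp E (Cod \<B> i) (Dom \<B> i) Y S (matr_upper E i)
     (prod_map \<B> (tuple \<B> i (Ide \<B> (Dom \<B> i))) (Ide \<B> Y))
     (upper_refl E i (Pr1 \<B> (Dom \<B> i) Y) S) (Ide \<T> (Dom \<B> i \<odot> Y, S))"

lemma upper_in_simps:
  assumes i [simp]: "i \<in> Arr \<B>" "Dom \<B> i = U" "Cod \<B> i = X" and Y [simp]: "Y \<in> Obj \<B>" and S [simp]: "S \<in> Obj (fib E (U \<odot> Y))"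
  shows "into_data X U Y S (matr_upper E i) (tuple \<B> (tuple \<B> (i \<bullet> Pr1 \<B> U Y) (Pr1 \<B> U Y)) (Pr2 \<B> U Y)) (upper_refl E i (Pr1 \<B> U Y) S) (Ide \<T> (U \<odot> Y, S))"
    and "upper_in i Y S = into_comp E X U Y S (matr_upper E i) (tuple \<B> (tuple \<B> (i \<bullet> Pr1 \<B> U Y) (Pr1 \<B> U Y)) (Pr2 \<B> U Y))
       (upper_refl E i (Pr1 \<B> U Y) S) (Ide \<T> (U \<odot> Y, S))"
    and "upper_in i Y S \<in> Arr \<T>" "fst (upper_in i Y S) = prod_map \<B> i (Ide \<B> Y)" "Dom \<T> (upper_in i Y S) = (U \<odot> Y, S)"
      "Cod \<T> (upper_in i Y S) = (X \<odot> Y, matr_comp E X U Y S (matr_upper E i))"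
    and "opcartesian (upper_in i Y S)"
proof -
  have [simp]: "U \<in> Obj \<B>" "X \<in> Obj \<B>" using B.Obj_Dom[of i] B.Obj_Cod[of i] by auto
  let ?w = "tuple \<B> (tuple \<B> (i \<bullet> Pr1 \<B> U Y) (Pr1 \<B> U Y)) (Pr2 \<B> U Y)"
  have w: "prod_map \<B> (tuple \<B> i (Ide \<B> U)) (Ide \<B> Y) = ?w" by (simp add: prod_map_def)
  show d: "into_data X U Y S (matr_upper E i) ?w (upper_refl E i (Pr1 \<B> U Y) S) (Ide \<T> (U \<odot> Y, S))"
    by (simp add: into_data_def)
  show eq: "upper_in i Y S = into_comp E X U Y S (matr_upper E i) ?w (upper_refl E i (Pr1 \<B> U Y) S) (Ide \<T> (U \<odot> Y, S))"
    by (simp add: upper_in_def w)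
  show "upper_in i Y S \<in> Arr \<T>" "fst (upper_in i Y S) = prod_map \<B> i (Ide \<B> Y)" "Dom \<T> (upper_in i Y S) = (U \<odot> Y, S)"
      "Cod \<T> (upper_in i Y S) = (X \<odot> Y, matr_comp E X U Y S (matr_upper E i))"
    using into_comp_simps[OF d] by (simp_all add: eq) (simp add: prod_map_def)
  let ?e = "upper_refl E i (Ide \<B> U) (top U)"
  have "?e \<star> over_top E (Pr1 \<B> U Y) S = upper_refl E i (Pr1 \<B> U Y) S"
    using upper_refl_Comp[of i "Ide \<B> U" "top U" "over_top E (Pr1 \<B> U Y) S"] over_top_simps[of "Pr1 \<B> U Y" S] by simp
  moreover have "opcartesian (into_comp E X U Y S (matr_upper E i) (prod_map \<B> (tuple \<B> i (Ide \<B> U)) (Ide \<B> Y)) (?e \<star> over_top E (Pr1 \<B> U Y) S) (Ide \<T> (U \<odot> Y, S)))"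
    by (rule into_comp_graph_opcartesian(2)[OF upper_refl_opcartesian[OF i(1,2)]]) (simp_all add: iso_cartesian B.proj_defs)
  ultimately show "opcartesian (upper_in i Y S)"
    by (simp add: w eq)
qed

lemma upper_in_natural:
  assumes i [simp]: "i \<in> Arr \<B>" "Dom \<B> i = U" "Cod \<B> i = X" and Y [simp]: "Y \<in> Obj \<B>"
    and \<tau> [simp]: "\<tau> \<in> Arr (fib E (U \<odot> Y))" "Dom (fib E (U \<odot> Y)) \<tau> = S" "Cod (fib E (U \<odot> Y)) \<tau> = S'"
  shows "vert E (X \<odot> Y) (matr_comp2 E X U Y \<tau> (Ide (fib E (X \<odot> U)) (matr_upper E i))) \<star> upper_in i Y S =
    upper_in i Y S' \<star> vert E (U \<odot> Y) \<tau>"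
proof -
  have [simp]: "U \<in> Obj \<B>" "X \<in> Obj \<B>" using B.Obj_Dom[of i] B.Obj_Cod[of i] by auto
  have [simp]: "S \<in> Obj (fib E (U \<odot> Y))" "S' \<in> Obj (fib E (U \<odot> Y))"
    using \<tau> category.Obj_Dom[OF fib_category, of "U \<odot> Y" \<tau>] category.Obj_Cod[OF fib_category, of "U \<odot> Y" \<tau>] by auto
  have S: "S \<in> Obj (fib E (U \<odot> Y))" and S': "S' \<in> Obj (fib E (U \<odot> Y))" by simp_all
  note u = upper_in_simps[OF i Y S] and u' = upper_in_simps[OF i Y S']
  note m = matr_comp2_simps(5)[of X U Y "Ide (fib E (X \<odot> U)) (matr_upper E i)" \<tau> "matr_upper E i" "matr_upper E i" S S', OF _ _ _ _ _ _ _ _ _ u(1)]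
  have "upper_refl E i (Pr1 \<B> U Y) S' \<star> vert E (U \<odot> Y) \<tau> = upper_refl E i (Pr1 \<B> U Y) S"
    using upper_refl_Comp[of i "Pr1 \<B> U Y" S' "vert E (U \<odot> Y) \<tau>"] by simp
  then show ?thesis
    using m into_comp_Comp(1)[OF u'(1), of "vert E (U \<odot> Y) \<tau>"] by (simp add: u(2) u'(2))
qed

text \<open>
  The first factor of the mate passes \<open>\<tau>\<close> through \<open>upper_in\<close> by naturality.  What remains is an arrow
  \<open>R \<circ> i\<^sub>\<bullet> \<rightarrow> R\<close>, which is evaluated on the invertible arrow \<open>lower_in\<close>: the associativity brings the
  canonical elements of \<open>i\<^sup>\<bullet>\<close> and \<open>i\<^sub>\<bullet>\<close> together, the counit replaces them by reflexivity, and the right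
  unit constraint removes it.
\<close>

lemma tab_mate_upper_in:
  assumes i [simp]: "i \<in> Arr \<B>" "Dom \<B> i = U" "Cod \<B> i = X" and Y [simp]: "Y \<in> Obj \<B>" and R [simp]: "R \<in> Obj (fib E (X \<odot> Y))"
    and \<tau> [simp]: "\<tau> \<in> Arr (fib E (U \<odot> Y))" "Dom (fib E (U \<odot> Y)) \<tau> = S"
      "Cod (fib E (U \<odot> Y)) \<tau> = matr_comp E U X Y R (matr_lower E i)"
  shows "tab_mate (Matr E) X Y R U i \<tau> \<in> Hom (fib E (X \<odot> Y)) (matr_comp E X U Y S (matr_upper E i)) R"
    "vert E (X \<odot> Y) (tab_mate (Matr E) X Y R U i \<tau>) \<star> upper_in i Y S = lower_out i Y R \<star> vert E (U \<odot> Y) \<tau>"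
proof -
  have [simp]: "U \<in> Obj \<B>" "X \<in> Obj \<B>" using B.Obj_Dom[of i] B.Obj_Cod[of i] by auto
  let ?F = "fib E (X \<odot> Y)" and ?v = "vert E (X \<odot> Y)"
  let ?L = "matr_lower E i" and ?U = "matr_upper E i"
  let ?Ri = "matr_comp E U X Y R ?L"
  have [simp]: "?L \<in> Obj (fib E (U \<odot> X))" "?U \<in> Obj (fib E (X \<odot> U))" by simp_all
  have S: "S \<in> Obj (fib E (U \<odot> Y))" and Ri: "?Ri \<in> Obj (fib E (U \<odot> Y))"
    using \<tau> category.Obj_Dom[OF fib_category, of "U \<odot> Y" \<tau>] by auto
  note [simp] = S
  note u = upper_in_simps[OF i Y S] and uR = upper_in_simps[OF i Y Ri]
  let ?r = "matr_runit E X Y R" and ?c = "matr_comp2 E X X Y (Ide ?F R) (matr_adj_counit E i)"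
  let ?a = "matr_assoc E X U X Y R ?L ?U" and ?t = "matr_comp2 E X U Y \<tau> (Ide (fib E (X \<odot> U)) ?U)"
  note k = matr_adj_counit_simps[OF i]
  note r = matr_runit_simps[of X Y R, simplified]
  note a = matr_assoc_simps[of X U X Y ?U ?L R]
  have c: "?c \<in> Arr ?F" "Dom ?F ?c = matr_comp E X X Y R (matr_comp E X U X ?L ?U)" "Cod ?F ?c = matr_comp E X X Y R (matr_id E X)"
    using matr_comp2_simps(1-3)[of X X Y "matr_adj_counit E i" "Ide ?F R"] k(1-3) by simp_all
  have t: "?t \<in> Arr ?F" "Dom ?F ?t = matr_comp E X U Y S ?U" "Cod ?F ?t = matr_comp E X U Y ?Ri ?U"
    using matr_comp2_simps(1-3)[of X U Y "Ide (fib E (X \<odot> U)) ?U" \<tau>] by simp_all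
  have eq: "tab_mate (Matr E) X Y R U i \<tau> = ?r \<cdot>\<^bsub>?F\<^esub> (?c \<cdot>\<^bsub>?F\<^esub> (?a \<cdot>\<^bsub>?F\<^esub> ?t))"
    by (simp add: tab_mate_def Let_def)
  show "tab_mate (Matr E) X Y R U i \<tau> \<in> Hom ?F (matr_comp E X U Y S ?U) R"
    unfolding eq using r(1-3) c a(1-3) t by (simp add: Hom_def)
  let ?q = "prod_map \<B> i (Ide \<B> Y)"
  let ?cR = "cart E ?q R"
  define L where "L = FObj (pull E ?q) R"
  have c0: "?cR \<in> Arr \<T>" "fst ?cR = ?q" "Cod \<T> ?cR = (X \<odot> Y, R)" "Dom \<T> ?cR = (U \<odot> Y, L)" "cartesian ?cR"
    by (simp_all add: cart_cartesian L_def)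
  have [simp]: "L \<in> Obj (fib E (U \<odot> Y))" by (simp add: L_def)
  note l = lower_in_simps[OF i Y c0(1-4)] and o = lower_out_simps[OF i Y R]
  let ?l = "lower_in i Y R ?cR"
  let ?p = "Pr1 \<B> U Y" and ?z = "Pr2 \<B> U Y"
  let ?ip = "i \<bullet> ?p"
  let ?ur = "upper_refl E i ?p L" and ?lr = "lower_refl E i ?p L"
  have ul: "upper_in i Y ?Ri \<star> ?l = into_comp E X U Y ?Ri ?U (tuple \<B> (tuple \<B> ?ip ?p) ?z) ?ur ?l"
  proof -
    have "upper_refl E i ?p ?Ri \<star> ?l = ?ur"
      using upper_refl_Comp[of i ?p ?Ri ?l] l(3-6) by simp
    then show ?thesis
      using into_comp_Comp(1)[OF uR(1) l(3)] l(3-6) by (simp add: uR(2))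
  qed
  have al: "?v ?a \<star> (upper_in i Y ?Ri \<star> ?l) = into_comp E X X Y R (matr_comp E X U X ?L ?U) (tuple \<B> (tuple \<B> ?ip ?ip) ?z)
      (into_comp E X U X ?L ?U (tuple \<B> (tuple \<B> ?ip ?p) ?ip) ?ur ?lr) ?cR"
    unfolding ul by (subst l(2), rule a(4)[where D = "U \<odot> Y" and L = L]) (use c0 in \<open>simp_all add: prod_map_def\<close>)
  have d1: "into_data X U X ?L ?U (tuple \<B> (tuple \<B> ?ip ?p) ?ip) ?ur ?lr"
    by (simp add: into_data_def)
  have d: "into_data X X Y R (matr_comp E X U X ?L ?U) (tuple \<B> (tuple \<B> ?ip ?ip) ?z)
      (into_comp E X U X ?L ?U (tuple \<B> (tuple \<B> ?ip ?p) ?ip) ?ur ?lr) ?cR"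
    using into_comp_simps[OF d1] c0 by (simp add: into_data_def prod_map_def)
  have kl: "vert E (X \<odot> X) (matr_adj_counit E i) \<star> into_comp E X U X ?L ?U (tuple \<B> (tuple \<B> ?ip ?p) ?ip) ?ur ?lr = matr_refl E ?ip L"
    by (rule k(4)[where V = "U \<odot> Y"]) simp_all
  have cl: "?v ?c \<star> (?v ?a \<star> (upper_in i Y ?Ri \<star> ?l)) =
      into_comp E X X Y R (matr_id E X) (tuple \<B> (tuple \<B> ?ip ?ip) ?z) (matr_refl E ?ip L) ?cR"
    unfolding al using matr_comp2_simps(5)[OF _ _ _ _ _ _ _ _ _ d, where \<rho> = "matr_adj_counit E i" and \<sigma> = "Ide ?F R" and R' = "matr_id E X" and S' = R] k(1-3) kl c0
    by simp
  have rl: "?v ?r \<star> (?v ?c \<star> (?v ?a \<star> (upper_in i Y ?Ri \<star> ?l))) = ?cR"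
    unfolding cl by (rule matr_runit_simps(4)[where V = "U \<odot> Y"]) (use c0 in \<open>simp_all add: prod_map_def\<close>)
  have rest: "?v ?r \<star> (?v ?c \<star> (?v ?a \<star> upper_in i Y ?Ri)) = lower_out i Y R"
  proof (rule T.iso_epi[OF l(7)[OF c0(5)]])
    show "(?v ?r \<star> (?v ?c \<star> (?v ?a \<star> upper_in i Y ?Ri))) \<star> ?l = lower_out i Y R \<star> ?l"
      using r(1-3) c a(1-3) uR(3-6) l(3-6) rl o(6)[OF c0(1-4)] by simp
  qed (use r(1-3) c a(1-3) uR(3-6) l(3-6) o(1-4) in simp_all)
  have "?v (tab_mate (Matr E) X Y R U i \<tau>) \<star> upper_in i Y S = ?v ?r \<star> (?v ?c \<star> (?v ?a \<star> (?v ?t \<star> upper_in i Y S)))"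
    unfolding eq using r(1-3) c a(1-3) t u(3-6) by (simp add: vert_Comp)
  also have "?v ?t \<star> upper_in i Y S = upper_in i Y ?Ri \<star> vert E (U \<odot> Y) \<tau>"
    by (rule upper_in_natural[OF i Y \<tau>])
  also have "?v ?r \<star> (?v ?c \<star> (?v ?a \<star> \<dots>)) = (?v ?r \<star> (?v ?c \<star> (?v ?a \<star> upper_in i Y ?Ri))) \<star> vert E (U \<odot> Y) \<tau>"
    using r(1-3) c a(1-3) uR(3-6) by simp
  finally show "?v (tab_mate (Matr E) X Y R U i \<tau>) \<star> upper_in i Y S = lower_out i Y R \<star> vert E (U \<odot> Y) \<tau>"
    unfolding rest .
qed

text \<open>
  The composite \<open>\<top> \<rightarrow> j\<^sub>\<bullet> \<rightarrow> j\<^sub>\<bullet> \<circ> i\<^sup>\<bullet>\<close> is opcartesian over \<open>(i, j)\<close>, and \<open>cell_arrow i j R \<tau>\<close> factors through it by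
  the mate.
\<close>

lemma tab_mate_iso_iff:
  assumes i [simp]: "i \<in> Arr \<B>" "Dom \<B> i = U" "Cod \<B> i = X" and j [simp]: "j \<in> Arr \<B>" "Dom \<B> j = U" "Cod \<B> j = Y"
    and R [simp]: "R \<in> Obj (fib E (X \<odot> Y))"
    and \<tau>: "\<tau> \<in> Hom (fib E (U \<odot> Y)) (matr_lower E j) (matr_comp E U X Y R (matr_lower E i))"
  shows "is_iso (fib E (X \<odot> Y)) (tab_mate (Matr E) X Y R U i \<tau>) \<longleftrightarrow> opcartesian (cell_arrow i j R \<tau>)"
proof -
  have [simp]: "U \<in> Obj \<B>" "X \<in> Obj \<B>" "Y \<in> Obj \<B>" using B.Obj_Dom[of i] B.Obj_Cod[of i] B.Obj_Cod[of j] by auto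
  have Y: "Y \<in> Obj \<B>" and J: "matr_lower E j \<in> Obj (fib E (U \<odot> Y))" by simp_all
  have \<tau>' [simp]: "\<tau> \<in> Arr (fib E (U \<odot> Y))" "Dom (fib E (U \<odot> Y)) \<tau> = matr_lower E j" "Cod (fib E (U \<odot> Y)) \<tau> = matr_comp E U X Y R (matr_lower E i)"
    using \<tau> by (auto simp: Hom_def)
  let ?m = "tab_mate (Matr E) X Y R U i \<tau>" and ?u = "upper_in i Y (matr_lower E j)" and ?g = "lower_refl E j (Ide \<B> U) (top U)"
  note tm = tab_mate_upper_in[OF i Y R \<tau>'] and u = upper_in_simps[OF i Y J] and o = lower_out_simps[OF i Y R]
  have m [simp]: "?m \<in> Arr (fib E (X \<odot> Y))" "Dom (fib E (X \<odot> Y)) ?m = matr_comp E X U Y (matr_lower E j) (matr_upper E i)" "Cod (fib E (X \<odot> Y)) ?m = R"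
    using tm(1) by (auto simp: Hom_def)
  have "cell_arrow i j R \<tau> = (lower_out i Y R \<star> vert E (U \<odot> Y) \<tau>) \<star> ?g"
    using o(1-4) by (simp add: cell_arrow_def)
  also have "\<dots> = vert E (X \<odot> Y) ?m \<star> (?u \<star> ?g)"
    unfolding tm(2)[symmetric] using u(3-6) by simp
  finally have eq: "cell_arrow i j R \<tau> = vert E (X \<odot> Y) ?m \<star> (?u \<star> ?g)" .
  have op: "opcartesian (?u \<star> ?g)"
    by (rule opcartesian_Comp[OF lower_refl_opcartesian[OF j(1,2)] u(7)]) (use u in simp)
  have "is_iso (fib E (X \<odot> Y)) ?m \<longleftrightarrow> is_iso \<T> (vert E (X \<odot> Y) ?m)"
    by (simp add: vert_iso_iff)
  also have "\<dots> \<longleftrightarrow> opcartesian (cell_arrow i j R \<tau>)"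
  proof
    assume "is_iso \<T> (vert E (X \<odot> Y) ?m)"
    then show "opcartesian (cell_arrow i j R \<tau>)"
      unfolding eq by (intro opcartesian_Comp[OF op iso_opcartesian]) (use u in simp_all)
  next
    assume "opcartesian (cell_arrow i j R \<tau>)"
    then have "opcartesian (vert E (X \<odot> Y) ?m)"
      unfolding eq by (rule opcartesian_cancel[OF _ op]) (use u in simp_all)
    then show "is_iso \<T> (vert E (X \<odot> Y) ?m)"
      by (rule opcartesian_iso) simp
  qed
  finally show ?thesis .
qed

end

section \<open>Comprehension as a universal property\<close>

lemma (in category) slice_simps:
  "Obj (slice C X) = {t \<in> Arr C. Cod C t = X}"
  "(t, h, s) \<in> Arr (slice C X) \<longleftrightarrow> t \<in> Arr C \<and> Cod C t = X \<and> s \<in> Arr C \<and> Cod C s = X \<and>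
     h \<in> Arr C \<and> Dom C h = Dom C t \<and> Cod C h = Dom C s \<and> s \<cdot> h = t"
  "Dom (slice C X) (t, h, s) = t" "Cod (slice C X) (t, h, s) = s" "Ide (slice C X) t = (t, Ide C (Dom C t), t)"
  "Comp (slice C X) (t', h', s') (t, h, s) = (t, h' \<cdot> h, s')"
  by (auto simp: slice_def Hom_def)

lemma (in category) slice_category: "category (slice C X)"
proof
  fix k assume "k \<in> Arr (slice C X)"
  then show "Dom (slice C X) k \<in> Obj (slice C X)" "Cod (slice C X) k \<in> Obj (slice C X)"
    by (cases k; auto simp: slice_simps)+
next
  fix t assume "t \<in> Obj (slice C X)"
  then show "Ide (slice C X) t \<in> Hom (slice C X) t t"
    by (simp add: slice_simps Hom_def)
next
  fix k l t s r assume "k \<in> Hom (slice C X) t s" "l \<in> Hom (slice C X) s r"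
  then show "Comp (slice C X) l k \<in> Hom (slice C X) t r"
    by (cases k; cases l) (auto simp: slice_simps Hom_def simp flip: Comp_assoc_Arr)
next
  fix k t s assume "k \<in> Hom (slice C X) t s"
  then show "Comp (slice C X) k (Ide (slice C X) t) = k" "Comp (slice C X) (Ide (slice C X) s) k = k"
    by (cases k; auto simp: slice_simps Hom_def)+
next
  fix k l m W t s r assume "k \<in> Hom (slice C X) W t" "l \<in> Hom (slice C X) t s" "m \<in> Hom (slice C X) s r"
  then show "Comp (slice C X) (Comp (slice C X) m l) k = Comp (slice C X) m (Comp (slice C X) l k)"
    by (cases k; cases l; cases m) (auto simp: slice_simps Hom_def)
qed

context regular_fibration
begin

text \<open>
  The extension of \<open>P\<close> as an arrow \<open>\<chi> : \<top> \<rightarrow> P\<close> over the map \<open>fst \<chi> : {P} \<rightarrow> X\<close>, through which any other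
  arrow from a \<open>\<top>\<close> to \<open>P\<close> factors by a unique map of base objects.
\<close>

definition comprehends :: "'o \<Rightarrow> 'p \<Rightarrow> ('a, 'p, 'q) over \<Rightarrow> bool" where
  "comprehends X P \<chi> \<longleftrightarrow> \<chi> \<in> Arr \<T> \<and> Cod \<T> \<chi> = (X, P) \<and> Dom \<T> \<chi> = (Dom \<B> (fst \<chi>), top (Dom \<B> (fst \<chi>))) \<and>
     (\<forall>\<phi> \<in> Arr \<T>. Cod \<T> \<phi> = (X, P) \<longrightarrow> Dom \<T> \<phi> = (Dom \<B> (fst \<phi>), top (Dom \<B> (fst \<phi>))) \<longrightarrow>
        (\<exists>!h. h \<in> Hom \<B> (Dom \<B> (fst \<phi>)) (Dom \<B> (fst \<chi>)) \<and> \<chi> \<star> over_top E h (top (Dom \<B> h)) = \<phi>))"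

lemma im_simps:
  "FObj (im E) t = FObj (ex E t) (top (Dom \<B> t))"
  "FArr (im E) (t, h, s) = opcart_factor E (opcart E s (top (Dom \<B> s)) \<star> over_top E h (top (Dom \<B> t)))"
  by (simp_all add: im_def Let_def)

text \<open>
  The last equation determines the action of \<open>im\<close> on arrows, because \<open>opcart\<close> is opcartesian.
\<close>

lemma im_slice:
  assumes "(t, h, s) \<in> Arr (slice \<B> X)"
  shows "FArr (im E) (t, h, s) \<in> Arr (fib E X)" "Dom (fib E X) (FArr (im E) (t, h, s)) = FObj (im E) t"
    "Cod (fib E X) (FArr (im E) (t, h, s)) = FObj (im E) s"
    "vert E X (FArr (im E) (t, h, s)) \<star> opcart E t (top (Dom \<B> t)) = opcart E s (top (Dom \<B> s)) \<star> over_top E h (top (Dom \<B> t))"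
proof -
  have t: "t \<in> Arr \<B>" "Cod \<B> t = X" "s \<in> Arr \<B>" "Cod \<B> s = X" "h \<in> Arr \<B>" "Dom \<B> h = Dom \<B> t" "Cod \<B> h = Dom \<B> s" "s \<bullet> h = t"
    using assms by (auto simp: B.slice_simps)
  let ?l = "opcart E s (top (Dom \<B> s)) \<star> over_top E h (top (Dom \<B> t))"
  have l: "?l \<in> Arr \<T>" "fst ?l = t" "Dom \<T> ?l = (Dom \<B> t, top (Dom \<B> t))" "Cod \<T> ?l = (X, FObj (ex E s) (top (Dom \<B> s)))"
    using t over_top_simps[of h "top (Dom \<B> t)"] by simp_all
  show "FArr (im E) (t, h, s) \<in> Arr (fib E X)" "Dom (fib E X) (FArr (im E) (t, h, s)) = FObj (im E) t"
    "Cod (fib E X) (FArr (im E) (t, h, s)) = FObj (im E) s"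
    "vert E X (FArr (im E) (t, h, s)) \<star> opcart E t (top (Dom \<B> t)) = ?l"
    unfolding im_simps by (rule opcart_factor_simps[OF l])+
qed

lemma over_top_Ide: "X \<in> Obj \<B> \<Longrightarrow> over_top E (Ide \<B> X) (top X) = Ide \<T> (X, top X)"
  by (rule over_top_ext[of _ _ X]) (use over_top_simps[of "Ide \<B> X" "top X"] in simp_all)

lemma im_functor:
  assumes X: "X \<in> Obj \<B>"
  shows "is_functor (slice \<B> X) (fib E X) (im E)"
  unfolding is_functor_def
proof (intro conjI ballI allI)
  fix t assume "t \<in> Obj (slice \<B> X)"
  then have t: "t \<in> Arr \<B>" "Cod \<B> t = X" by (auto simp: B.slice_simps)
  show "FObj (im E) t \<in> Obj (fib E X)" using t by (simp add: im_simps)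
  show "FArr (im E) (Ide (slice \<B> X) t) = Ide (fib E X) (FObj (im E) t)"
    using t X unfolding B.slice_simps im_simps
    by (intro opcart_factor_unique[of t X "top (Dom \<B> t)"]) (simp_all add: over_top_Ide)
next
  fix t s k assume "k \<in> Hom (slice \<B> X) t s"
  then show "FArr (im E) k \<in> Hom (fib E X) (FObj (im E) t) (FObj (im E) s)"
    by (cases k) (use im_slice in \<open>auto simp: Hom_def B.slice_simps(3,4)\<close>)
next
  fix t s r k l assume k: "k \<in> Hom (slice \<B> X) t s" and l: "l \<in> Hom (slice \<B> X) s r"
  obtain h where k': "k = (t, h, s)" using k by (cases k) (auto simp: Hom_def B.slice_simps(3,4))
  obtain h' where l': "l = (s, h', r)" using l by (cases l) (auto simp: Hom_def B.slice_simps(3,4))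
  have ks: "(t, h, s) \<in> Arr (slice \<B> X)" and ls: "(s, h', r) \<in> Arr (slice \<B> X)"
    using k l by (auto simp: Hom_def k' l')
  note a = im_slice[OF ks] and b = im_slice[OF ls]
  note t = ks[unfolded B.slice_simps] and s = ls[unfolded B.slice_simps]
  note o = over_top_simps[of h "top (Dom \<B> t)"] and o' = over_top_simps[of h' "top (Dom \<B> s)"]
  let ?ot = "opcart E t (top (Dom \<B> t))"
  have "vert E X (FArr (im E) (s, h', r) \<cdot>\<^bsub>fib E X\<^esub> FArr (im E) (t, h, s)) \<star> ?ot =
      vert E X (FArr (im E) (s, h', r)) \<star> (vert E X (FArr (im E) (t, h, s)) \<star> ?ot)"
    using X a(1-3) b(1-3) t by (simp add: vert_Comp im_simps(1))
  also have "\<dots> = (vert E X (FArr (im E) (s, h', r)) \<star> opcart E s (top (Dom \<B> s))) \<star> over_top E h (top (Dom \<B> t))"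
    unfolding a(4) using X b(1-3) t o by (simp add: im_simps(1))
  also have "\<dots> = opcart E r (top (Dom \<B> r)) \<star> (over_top E h' (top (Dom \<B> s)) \<star> over_top E h (top (Dom \<B> t)))"
    unfolding b(4) using s t o o' by simp
  also have "over_top E h' (top (Dom \<B> s)) \<star> over_top E h (top (Dom \<B> t)) = over_top E (h' \<bullet> h) (top (Dom \<B> t))"
    using over_top_Comp[of h' "top (Dom \<B> s)" "over_top E h (top (Dom \<B> t))"] s t o by simp
  finally have eq: "vert E X (FArr (im E) (s, h', r) \<cdot>\<^bsub>fib E X\<^esub> FArr (im E) (t, h, s)) \<star> ?ot =
    opcart E r (top (Dom \<B> r)) \<star> over_top E (h' \<bullet> h) (top (Dom \<B> t))" .
  have "FArr (im E) (t, h' \<bullet> h, r) = FArr (im E) (s, h', r) \<cdot>\<^bsub>fib E X\<^esub> FArr (im E) (t, h, s)"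
    unfolding im_simps(2)[of t "h' \<bullet> h" r]
    by (rule opcart_factor_unique[OF _ _ _ _ _ eq]) (use X a(1-3) b(1-3) t in \<open>simp_all add: im_simps(1)\<close>)
  then show "FArr (im E) (l \<cdot>\<^bsub>slice \<B> X\<^esub> k) = FArr (im E) l \<cdot>\<^bsub>fib E X\<^esub> FArr (im E) k"
    by (simp add: k' l' B.slice_simps)
qed

text \<open>
  Maps \<open>s\<^sub>! \<top> \<rightarrow> P\<close> are the same as arrows \<open>\<top> \<rightarrow> P\<close> over \<open>s\<close>, and under this transposition a factorisation
  through \<open>\<epsilon>\<close> by \<open>im\<close> of an arrow of the slice is one through \<open>\<chi>\<close> by the underlying base map.
\<close>

lemma couniversal_iff_comprehends:
  assumes X [simp]: "X \<in> Obj \<B>" and t [simp]: "t \<in> Arr \<B>" "Cod \<B> t = X"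
    and \<epsilon> [simp]: "\<epsilon> \<in> Arr (fib E X)" "Dom (fib E X) \<epsilon> = FObj (im E) t" "Cod (fib E X) \<epsilon> = P"
  shows "couniversal (slice \<B> X) (fib E X) (im E) P t \<epsilon> \<longleftrightarrow> comprehends X P (vert E X \<epsilon> \<star> opcart E t (top (Dom \<B> t)))"
proof -
  let ?o = "\<lambda>s. opcart E s (top (Dom \<B> s))"
  let ?\<chi> = "vert E X \<epsilon> \<star> ?o t"
  have P [simp]: "P \<in> Obj (fib E X)" using category.Obj_Cod[OF fib_category[OF X] \<epsilon>(1)] by simp
  have \<epsilon>d: "Dom (fib E X) \<epsilon> = FObj (ex E t) (top (Dom \<B> t))" by (simp add: im_simps)
  have \<chi>: "?\<chi> \<in> Arr \<T>" "fst ?\<chi> = t" "Dom \<T> ?\<chi> = (Dom \<B> t, top (Dom \<B> t))" "Cod \<T> ?\<chi> = (X, P)"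
    using \<epsilon>d by simp_all
  have transfer: "(\<exists>!k. k \<in> Hom (slice \<B> X) s t \<and> \<epsilon> \<cdot>\<^bsub>fib E X\<^esub> FArr (im E) k = \<psi>) \<longleftrightarrow>
      (\<exists>!h. h \<in> Hom \<B> (Dom \<B> s) (Dom \<B> t) \<and> ?\<chi> \<star> over_top E h (top (Dom \<B> h)) = \<phi>)"
    if s: "s \<in> Arr \<B>" "Cod \<B> s = X" and \<psi>: "\<psi> \<in> Hom (fib E X) (FObj (im E) s) P" and \<phi>: "vert E X \<psi> \<star> ?o s = \<phi>" for s \<psi> \<phi>
  proof -
    have \<psi>' [simp]: "\<psi> \<in> Arr (fib E X)" "Dom (fib E X) \<psi> = FObj (ex E s) (top (Dom \<B> s))" "Cod (fib E X) \<psi> = P"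
      using \<psi> by (auto simp: Hom_def im_simps)
    note [simp] = s
    have fst\<phi>: "fst \<phi> = s" by (simp flip: \<phi>)
    have key: "\<epsilon> \<cdot>\<^bsub>fib E X\<^esub> FArr (im E) (s, h, t) = \<psi> \<longleftrightarrow> ?\<chi> \<star> over_top E h (top (Dom \<B> h)) = \<phi>"
      if k: "(s, h, t) \<in> Arr (slice \<B> X)" for h
    proof -
      note i = im_slice[OF k]
      note h = k[unfolded B.slice_simps]
      note o = over_top_simps[of h "top (Dom \<B> s)"]
      have "vert E X (\<epsilon> \<cdot>\<^bsub>fib E X\<^esub> FArr (im E) (s, h, t)) \<star> ?o s = vert E X \<epsilon> \<star> (vert E X (FArr (im E) (s, h, t)) \<star> ?o s)"
        using i(1-3) by (simp add: vert_Comp im_simps(1))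
      also have "\<dots> = ?\<chi> \<star> over_top E h (top (Dom \<B> h))"
        unfolding i(4) using h o \<epsilon>d by simp
      finally have eq: "vert E X (\<epsilon> \<cdot>\<^bsub>fib E X\<^esub> FArr (im E) (s, h, t)) \<star> ?o s = ?\<chi> \<star> over_top E h (top (Dom \<B> h))" .
      show ?thesis
      proof
        assume "?\<chi> \<star> over_top E h (top (Dom \<B> h)) = \<phi>"
        then show "\<epsilon> \<cdot>\<^bsub>fib E X\<^esub> FArr (im E) (s, h, t) = \<psi>"
          by (intro vert_opcart_ext[of s X "top (Dom \<B> s)"]) (use i(1-3) eq \<phi> in \<open>simp_all add: im_simps(1)\<close>)
      qed (use eq \<phi> in simp)
    qed
    have slice: "(s, h, t) \<in> Arr (slice \<B> X)"
      if h: "h \<in> Hom \<B> (Dom \<B> s) (Dom \<B> t)" "?\<chi> \<star> over_top E h (top (Dom \<B> h)) = \<phi>" for h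
    proof -
      have h': "h \<in> Arr \<B>" "Dom \<B> h = Dom \<B> s" "Cod \<B> h = Dom \<B> t" using h(1) by (auto simp: Hom_def)
      have "fst (?\<chi> \<star> over_top E h (top (Dom \<B> h))) = t \<bullet> h"
        using over_top_simps[of h "top (Dom \<B> h)"] h' by (simp only: fst_total_comp) simp
      then have "t \<bullet> h = s" unfolding h(2) fst\<phi> by simp
      then show ?thesis using h' by (simp add: B.slice_simps)
    qed
    show ?thesis
    proof
      assume "\<exists>!k. k \<in> Hom (slice \<B> X) s t \<and> \<epsilon> \<cdot>\<^bsub>fib E X\<^esub> FArr (im E) k = \<psi>"
      then obtain k where k: "k \<in> Hom (slice \<B> X) s t" "\<epsilon> \<cdot>\<^bsub>fib E X\<^esub> FArr (im E) k = \<psi>"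
        and un: "\<And>l. l \<in> Hom (slice \<B> X) s t \<Longrightarrow> \<epsilon> \<cdot>\<^bsub>fib E X\<^esub> FArr (im E) l = \<psi> \<Longrightarrow> l = k" by blast
      obtain h where k': "k = (s, h, t)" using k(1) by (cases k) (auto simp: Hom_def B.slice_simps(3,4))
      have ks: "(s, h, t) \<in> Arr (slice \<B> X)" using k(1) by (simp add: Hom_def k')
      show "\<exists>!h. h \<in> Hom \<B> (Dom \<B> s) (Dom \<B> t) \<and> ?\<chi> \<star> over_top E h (top (Dom \<B> h)) = \<phi>"
      proof (rule ex1I[of _ h], intro conjI)
        show "h \<in> Hom \<B> (Dom \<B> s) (Dom \<B> t)" using ks by (simp add: B.slice_simps Hom_def)
        show "?\<chi> \<star> over_top E h (top (Dom \<B> h)) = \<phi>" using key[OF ks] k(2) k' by simp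
        fix h' assume h': "h' \<in> Hom \<B> (Dom \<B> s) (Dom \<B> t) \<and> ?\<chi> \<star> over_top E h' (top (Dom \<B> h')) = \<phi>"
        have sl: "(s, h', t) \<in> Arr (slice \<B> X)" using slice h' by blast
        then have "(s, h', t) = k" using key[OF sl] h' by (intro un) (simp_all add: Hom_def B.slice_simps(3,4))
        then show "h' = h" by (simp add: k')
      qed
    next
      assume "\<exists>!h. h \<in> Hom \<B> (Dom \<B> s) (Dom \<B> t) \<and> ?\<chi> \<star> over_top E h (top (Dom \<B> h)) = \<phi>"
      then obtain h where h: "h \<in> Hom \<B> (Dom \<B> s) (Dom \<B> t)" "?\<chi> \<star> over_top E h (top (Dom \<B> h)) = \<phi>"
        and un: "\<And>l. l \<in> Hom \<B> (Dom \<B> s) (Dom \<B> t) \<Longrightarrow> ?\<chi> \<star> over_top E l (top (Dom \<B> l)) = \<phi> \<Longrightarrow> l = h" by blast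
      show "\<exists>!k. k \<in> Hom (slice \<B> X) s t \<and> \<epsilon> \<cdot>\<^bsub>fib E X\<^esub> FArr (im E) k = \<psi>"
      proof (rule ex1I[of _ "(s, h, t)"], intro conjI)
        show "(s, h, t) \<in> Hom (slice \<B> X) s t" using slice[OF h] by (simp add: Hom_def B.slice_simps(3,4))
        show "\<epsilon> \<cdot>\<^bsub>fib E X\<^esub> FArr (im E) (s, h, t) = \<psi>" using key[OF slice[OF h]] h(2) by simp
        fix k assume k: "k \<in> Hom (slice \<B> X) s t \<and> \<epsilon> \<cdot>\<^bsub>fib E X\<^esub> FArr (im E) k = \<psi>"
        obtain l where k': "k = (s, l, t)" using k by (cases k) (auto simp: Hom_def B.slice_simps(3,4))
        have ks: "(s, l, t) \<in> Arr (slice \<B> X)" using k by (simp add: Hom_def k')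
        have "l = h"
        proof (rule un)
          show "l \<in> Hom \<B> (Dom \<B> s) (Dom \<B> t)" using ks by (simp add: B.slice_simps Hom_def)
          show "?\<chi> \<star> over_top E l (top (Dom \<B> l)) = \<phi>" using key[OF ks] k k' by simp
        qed
        then show "k = (s, h, t)" by (simp add: k')
      qed
    qed
  qed
  show ?thesis
  proof
    assume c: "couniversal (slice \<B> X) (fib E X) (im E) P t \<epsilon>"
    show "comprehends X P ?\<chi>"
      unfolding comprehends_def
    proof (intro conjI ballI impI)
      show "?\<chi> \<in> Arr \<T>" "Cod \<T> ?\<chi> = (X, P)" "Dom \<T> ?\<chi> = (Dom \<B> (fst ?\<chi>), top (Dom \<B> (fst ?\<chi>)))"
        using \<chi> by (simp_all only: \<chi>(2))
      fix \<phi> assume \<phi>: "\<phi> \<in> Arr \<T>" "Cod \<T> \<phi> = (X, P)" "Dom \<T> \<phi> = (Dom \<B> (fst \<phi>), top (Dom \<B> (fst \<phi>)))"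
      have s: "fst \<phi> \<in> Arr \<B>" "Cod \<B> (fst \<phi>) = X" using fst_Arr[OF \<phi>(1)] \<phi>(2) by simp_all
      note f = opcart_factor_simps[OF \<phi>(1) refl \<phi>(3,2)]
      have \<psi>: "opcart_factor E \<phi> \<in> Hom (fib E X) (FObj (im E) (fst \<phi>)) P" using f by (simp add: Hom_def im_simps(1))
      have "fst \<phi> \<in> Obj (slice \<B> X)" using s by (simp add: B.slice_simps)
      then have "\<exists>!k. k \<in> Hom (slice \<B> X) (fst \<phi>) t \<and> \<epsilon> \<cdot>\<^bsub>fib E X\<^esub> FArr (im E) k = opcart_factor E \<phi>"
        using c \<psi> unfolding couniversal_def by blast
      then show "\<exists>!h. h \<in> Hom \<B> (Dom \<B> (fst \<phi>)) (Dom \<B> (fst ?\<chi>)) \<and> ?\<chi> \<star> over_top E h (top (Dom \<B> h)) = \<phi>"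
        unfolding \<chi>(2) using transfer[OF s \<psi> f(4)] by blast
    qed
  next
    assume c: "comprehends X P ?\<chi>"
    show "couniversal (slice \<B> X) (fib E X) (im E) P t \<epsilon>"
      unfolding couniversal_def
    proof (intro conjI ballI)
      show "t \<in> Obj (slice \<B> X)" by (simp add: B.slice_simps)
      show "\<epsilon> \<in> Hom (fib E X) (FObj (im E) t) P" by (simp add: Hom_def)
      fix s \<psi> assume "s \<in> Obj (slice \<B> X)" and \<psi>: "\<psi> \<in> Hom (fib E X) (FObj (im E) s) P"
      then have s: "s \<in> Arr \<B>" "Cod \<B> s = X" by (auto simp: B.slice_simps)
      let ?\<phi> = "vert E X \<psi> \<star> ?o s"
      have \<phi>: "?\<phi> \<in> Arr \<T>" "Cod \<T> ?\<phi> = (X, P)" "fst ?\<phi> = s" "Dom \<T> ?\<phi> = (Dom \<B> s, top (Dom \<B> s))"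
        using \<psi> s by (auto simp: Hom_def im_simps(1))
      have "\<exists>!h. h \<in> Hom \<B> (Dom \<B> s) (Dom \<B> t) \<and> ?\<chi> \<star> over_top E h (top (Dom \<B> h)) = ?\<phi>"
        using c \<phi>(1,2,4) unfolding comprehends_def \<chi>(2) by (metis (no_types, lifting) \<phi>(3))
      then show "\<exists>!k. k \<in> Hom (slice \<B> X) s t \<and> \<epsilon> \<cdot>\<^bsub>fib E X\<^esub> FArr (im E) k = \<psi>"
        using transfer[OF s \<psi> refl] by blast
    qed
  qed
qed

text \<open>
  The universal arrow \<open>\<chi>\<close> is the transpose of the counit at \<open>P\<close>, so it is opcartesian when the counit is
  invertible, which by adjointness means that extension is fully faithful.
\<close>

lemma comprehension_adjunction_iff:
  assumes X: "X \<in> Obj \<B>"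
  shows "(\<exists>ext \<eta> \<epsilon>. adjunction (slice \<B> X) (fib E X) (im E) ext \<eta> \<epsilon>) \<longleftrightarrow> (\<forall>P \<in> Obj (fib E X). \<exists>\<chi>. comprehends X P \<chi>)"
    "(\<exists>ext \<eta> \<epsilon>. adjunction (slice \<B> X) (fib E X) (im E) ext \<eta> \<epsilon> \<and> fully_faithful (fib E X) (slice \<B> X) ext) \<longleftrightarrow>
      (\<forall>P \<in> Obj (fib E X). \<exists>\<chi>. comprehends X P \<chi> \<and> opcartesian \<chi>)"
proof -
  note cats = B.slice_category[of X] fib_category[OF X]
  have adj: "adjunction (slice \<B> X) (fib E X) (im E) ext \<eta> \<epsilon> \<Longrightarrow> P \<in> Obj (fib E X) \<Longrightarrow>
      \<exists>\<chi>. comprehends X P \<chi> \<and> (is_iso (fib E X) (\<epsilon> P) \<longrightarrow> opcartesian \<chi>)" for ext \<eta> \<epsilon> P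
  proof -
    assume a: "adjunction (slice \<B> X) (fib E X) (im E) ext \<eta> \<epsilon>" and P: "P \<in> Obj (fib E X)"
    let ?t = "FObj ext P"
    have c: "couniversal (slice \<B> X) (fib E X) (im E) P ?t (\<epsilon> P)"
      by (rule adjunction_couniversal[OF cats a P])
    then have t: "?t \<in> Arr \<B>" "Cod \<B> ?t = X" and e: "\<epsilon> P \<in> Arr (fib E X)" "Dom (fib E X) (\<epsilon> P) = FObj (im E) ?t" "Cod (fib E X) (\<epsilon> P) = P"
      unfolding couniversal_def by (auto simp: B.slice_simps Hom_def)
    have "opcartesian (vert E X (\<epsilon> P) \<star> opcart E ?t (top (Dom \<B> ?t)))" if "is_iso (fib E X) (\<epsilon> P)"
      by (intro opcartesian_Comp[OF opcart_opcartesian iso_opcartesian]) (use that t e X in \<open>simp_all add: vert_iso_iff im_simps(1)\<close>)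
    then show ?thesis
      using couniversal_iff_comprehends[OF X t e] c by blast
  qed
  have build: "\<exists>ext \<eta> \<epsilon>. adjunction (slice \<B> X) (fib E X) (im E) ext \<eta> \<epsilon> \<and>
      ((\<forall>P \<in> Obj (fib E X). opcartesian (\<chi> P)) \<longrightarrow> fully_faithful (fib E X) (slice \<B> X) ext)"
    if \<chi>: "\<And>P. P \<in> Obj (fib E X) \<Longrightarrow> comprehends X P (\<chi> P)" for \<chi>
  proof -
    let ?t = "\<lambda>P. fst (\<chi> P)" and ?e = "\<lambda>P. opcart_factor E (\<chi> P)"
    have c: "\<chi> P \<in> Arr \<T>" "Cod \<T> (\<chi> P) = (X, P)" "Dom \<T> (\<chi> P) = (Dom \<B> (?t P), top (Dom \<B> (?t P)))" if "P \<in> Obj (fib E X)" for P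
      using \<chi>[OF that] unfolding comprehends_def by blast+
    have "couniversal (slice \<B> X) (fib E X) (im E) P (?t P) (?e P)" if P: "P \<in> Obj (fib E X)" for P
    proof -
      note f = opcart_factor_simps[OF c(1)[OF P] refl c(3,2)[OF P]]
      have "?t P \<in> Arr \<B>" "Cod \<B> (?t P) = X" using fst_Arr[OF c(1)[OF P]] c(2)[OF P] by simp_all
      then show ?thesis
        using couniversal_iff_comprehends[OF X, of "?t P" "?e P" P] f \<chi>[OF P] by (simp add: im_simps(1))
    qed
    then obtain ext \<eta> where a: "adjunction (slice \<B> X) (fib E X) (im E) ext \<eta> ?e"
      using couniversal_adjunction[OF cats im_functor[OF X], of ?t ?e] by blast
    have "fully_faithful (fib E X) (slice \<B> X) ext" if op: "\<forall>P \<in> Obj (fib E X). opcartesian (\<chi> P)"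
      unfolding fully_faithful_iff_counit_iso[OF cats a]
      using op opcartesian_iff_factor_iso[OF c(1) refl c(3,2)] by blast
    with a show ?thesis by blast
  qed
  show "(\<exists>ext \<eta> \<epsilon>. adjunction (slice \<B> X) (fib E X) (im E) ext \<eta> \<epsilon>) \<longleftrightarrow> (\<forall>P \<in> Obj (fib E X). \<exists>\<chi>. comprehends X P \<chi>)"
    using adj build by metis
  show "(\<exists>ext \<eta> \<epsilon>. adjunction (slice \<B> X) (fib E X) (im E) ext \<eta> \<epsilon> \<and> fully_faithful (fib E X) (slice \<B> X) ext) \<longleftrightarrow>
      (\<forall>P \<in> Obj (fib E X). \<exists>\<chi>. comprehends X P \<chi> \<and> opcartesian \<chi>)" (is "?L \<longleftrightarrow> ?R")
  proof
    assume ?L then show ?R using adj fully_faithful_iff_counit_iso[OF cats] by meson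
  next
    assume ?R
    then obtain \<chi> where "\<And>P. P \<in> Obj (fib E X) \<Longrightarrow> comprehends X P (\<chi> P) \<and> opcartesian (\<chi> P)" by metis
    then show ?L using build[of \<chi>] by blast
  qed
qed

section \<open>Tabulations are comprehensions\<close>

text \<open>
  Tight maps \<open>f\<close> and \<open>g\<close> with a 2-cell \<open>g\<^sub>\<bullet> \<rightarrow> R \<circ> f\<^sub>\<bullet>\<close> are the same as arrows \<open>\<top> \<rightarrow> R\<close> over the base, and pasting
  with \<open>h\<close> corresponds to precomposition with the arrow \<open>\<top> \<rightarrow> \<top>\<close> over \<open>h\<close>.
\<close>

lemma tabulation_iff_comprehends:
  assumes X [simp]: "X \<in> Obj \<B>" and Y [simp]: "Y \<in> Obj \<B>" and R [simp]: "R \<in> Obj (fib E (X \<odot> Y))"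
    and i [simp]: "i \<in> Arr \<B>" "Dom \<B> i = U" "Cod \<B> i = X" and j [simp]: "j \<in> Arr \<B>" "Dom \<B> j = U" "Cod \<B> j = Y"
    and \<tau>: "\<tau> \<in> Hom (fib E (U \<odot> Y)) (matr_lower E j) (matr_comp E U X Y R (matr_lower E i))"
  shows "is_tabulation (Matr E) X Y R U i j \<tau> \<longleftrightarrow> comprehends (X \<odot> Y) R (cell_arrow i j R \<tau>)"
proof -
  let ?\<chi> = "cell_arrow i j R \<tau>"
  have U [simp]: "U \<in> Obj \<B>" using B.Obj_Dom[of i] by simp
  note \<chi> = cell_arrow_simps[OF i j R \<tau>]
  have key: "i \<bullet> h = f \<and> j \<bullet> h = g \<and> \<phi> = tab_paste (Matr E) X Y R U i j \<tau> Z h \<longleftrightarrow> ?\<chi> \<star> over_top E h (top Z) = cell_arrow f g R \<phi>"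
    if h: "h \<in> Hom \<B> Z U" and f: "f \<in> Hom \<B> Z X" and g: "g \<in> Hom \<B> Z Y"
      and \<phi>: "\<phi> \<in> Hom (fib E (Z \<odot> Y)) (matr_lower E g) (matr_comp E Z X Y R (matr_lower E f))" for Z h f g \<phi>
  proof -
    have h': "h \<in> Arr \<B>" "Dom \<B> h = Z" "Cod \<B> h = U" and f': "f \<in> Arr \<B>" "Dom \<B> f = Z" "Cod \<B> f = X"
      and g': "g \<in> Arr \<B>" "Dom \<B> g = Z" "Cod \<B> g = Y" using h f g by (auto simp: Hom_def)
    note p = cell_arrow_tab_paste[OF i j h' R \<tau>]
    have Z: "Z \<in> Obj \<B>" using B.Obj_Dom[of h] h' by simp
    note c = cell_arrow_simps[OF f' g' R \<phi>]
    show ?thesis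
    proof
      assume "i \<bullet> h = f \<and> j \<bullet> h = g \<and> \<phi> = tab_paste (Matr E) X Y R U i j \<tau> Z h"
      then show "?\<chi> \<star> over_top E h (top Z) = cell_arrow f g R \<phi>" using p(2) by simp
    next
      assume eq: "?\<chi> \<star> over_top E h (top Z) = cell_arrow f g R \<phi>"
      have "fst (?\<chi> \<star> over_top E h (top Z)) = tuple \<B> (i \<bullet> h) (j \<bullet> h)"
        using \<chi> over_top_simps[of h "top Z"] h' Z by simp
      then have t: "tuple \<B> (i \<bullet> h) (j \<bullet> h) = tuple \<B> f g" using c eq by simp
      have ijh: "i \<bullet> h \<in> Arr \<B>" "j \<bullet> h \<in> Arr \<B>" "Dom \<B> (i \<bullet> h) = Dom \<B> (j \<bullet> h)" "X = Cod \<B> (i \<bullet> h)" "Y = Cod \<B> (j \<bullet> h)"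
        using h' by simp_all
      have "i \<bullet> h = f"
        using arg_cong[OF t, of "\<lambda>k. Pr1 \<B> X Y \<bullet> k"] B.tuple_simps(4)[OF ijh(1-3,4,5)] B.tuple_simps(4)[of f g X Y] f' g' by simp
      moreover have "j \<bullet> h = g"
        using arg_cong[OF t, of "\<lambda>k. Pr2 \<B> X Y \<bullet> k"] B.tuple_simps(5)[OF ijh(1-3,4,5)] B.tuple_simps(5)[of f g X Y] f' g' by simp
      ultimately show "i \<bullet> h = f \<and> j \<bullet> h = g \<and> \<phi> = tab_paste (Matr E) X Y R U i j \<tau> Z h"
        using cell_arrow_inj[OF f' g' R \<phi>] p eq by metis
    qed
  qed
  have tab: "is_tabulation (Matr E) X Y R U i j \<tau> \<longleftrightarrow>
      (\<forall>Z \<in> Obj \<B>. \<forall>f \<in> Hom \<B> Z X. \<forall>g \<in> Hom \<B> Z Y. \<forall>\<phi> \<in> Hom (fib E (Z \<odot> Y)) (matr_lower E g) (matr_comp E Z X Y R (matr_lower E f)).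
        \<exists>!h. h \<in> Hom \<B> Z U \<and> i \<bullet> h = f \<and> j \<bullet> h = g \<and> \<phi> = tab_paste (Matr E) X Y R U i j \<tau> Z h)"
    unfolding is_tabulation_def using \<tau> by (simp add: Hom_def)
  have compr: "comprehends (X \<odot> Y) R ?\<chi> \<longleftrightarrow>
      (\<forall>\<phi> \<in> Arr \<T>. Cod \<T> \<phi> = (X \<odot> Y, R) \<longrightarrow> Dom \<T> \<phi> = (Dom \<B> (fst \<phi>), top (Dom \<B> (fst \<phi>))) \<longrightarrow>
        (\<exists>!h. h \<in> Hom \<B> (Dom \<B> (fst \<phi>)) U \<and> ?\<chi> \<star> over_top E h (top (Dom \<B> h)) = \<phi>))"
    unfolding comprehends_def using \<chi> by simp
  show ?thesis
    unfolding tab compr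
  proof (intro iffI ballI impI)
    fix \<phi> assume t: "\<forall>Z \<in> Obj \<B>. \<forall>f \<in> Hom \<B> Z X. \<forall>g \<in> Hom \<B> Z Y. \<forall>\<phi> \<in> Hom (fib E (Z \<odot> Y)) (matr_lower E g) (matr_comp E Z X Y R (matr_lower E f)).
        \<exists>!h. h \<in> Hom \<B> Z U \<and> i \<bullet> h = f \<and> j \<bullet> h = g \<and> \<phi> = tab_paste (Matr E) X Y R U i j \<tau> Z h"
      and \<phi>: "\<phi> \<in> Arr \<T>" "Cod \<T> \<phi> = (X \<odot> Y, R)" "Dom \<T> \<phi> = (Dom \<B> (fst \<phi>), top (Dom \<B> (fst \<phi>)))"
    let ?Z = "Dom \<B> (fst \<phi>)" and ?f = "Pr1 \<B> X Y \<bullet> fst \<phi>" and ?g = "Pr2 \<B> X Y \<bullet> fst \<phi>"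
    have cf: "Cod \<B> (fst \<phi>) = X \<odot> Y" and af: "fst \<phi> \<in> Arr \<B>" using fst_Arr[OF \<phi>(1)] \<phi>(2) by simp_all
    have Z: "?Z \<in> Obj \<B>" using af by (rule B.Obj_Dom)
    have f: "?f \<in> Arr \<B>" "Dom \<B> ?f = ?Z" "Cod \<B> ?f = X" and g: "?g \<in> Arr \<B>" "Dom \<B> ?g = ?Z" "Cod \<B> ?g = Y"
      using cf af by (simp_all del: fst_Arr)
    have "fst \<phi> = tuple \<B> ?f ?g" using cf af by (simp del: fst_Arr)
    then obtain \<psi> where \<psi>: "\<psi> \<in> Hom (fib E (?Z \<odot> Y)) (matr_lower E ?g) (matr_comp E ?Z X Y R (matr_lower E ?f))" "cell_arrow ?f ?g R \<psi> = \<phi>"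
      using cell_arrow_surj[OF f g R \<phi>(1) _ \<phi>(3,2)] by blast
    have fg: "?f \<in> Hom \<B> ?Z X" "?g \<in> Hom \<B> ?Z Y" using f g by (simp_all add: Hom_def)
    have "\<exists>!h. h \<in> Hom \<B> ?Z U \<and> i \<bullet> h = ?f \<and> j \<bullet> h = ?g \<and> \<psi> = tab_paste (Matr E) X Y R U i j \<tau> ?Z h"
      using t Z fg \<psi>(1) by blast
    moreover have "h \<in> Hom \<B> ?Z U \<and> i \<bullet> h = ?f \<and> j \<bullet> h = ?g \<and> \<psi> = tab_paste (Matr E) X Y R U i j \<tau> ?Z h \<longleftrightarrow>
        h \<in> Hom \<B> ?Z U \<and> ?\<chi> \<star> over_top E h (top (Dom \<B> h)) = \<phi>" for h
      using key[OF _ fg \<psi>(1), of h] \<psi>(2) by (auto simp: Hom_def simp del: fst_Arr)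
    ultimately show "\<exists>!h. h \<in> Hom \<B> ?Z U \<and> ?\<chi> \<star> over_top E h (top (Dom \<B> h)) = \<phi>" by simp
  next
    fix Z f g \<phi>
    assume c: "\<forall>\<phi> \<in> Arr \<T>. Cod \<T> \<phi> = (X \<odot> Y, R) \<longrightarrow> Dom \<T> \<phi> = (Dom \<B> (fst \<phi>), top (Dom \<B> (fst \<phi>))) \<longrightarrow>
        (\<exists>!h. h \<in> Hom \<B> (Dom \<B> (fst \<phi>)) U \<and> ?\<chi> \<star> over_top E h (top (Dom \<B> h)) = \<phi>)"
      and fg: "f \<in> Hom \<B> Z X" "g \<in> Hom \<B> Z Y"
      and \<phi>: "\<phi> \<in> Hom (fib E (Z \<odot> Y)) (matr_lower E g) (matr_comp E Z X Y R (matr_lower E f))"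
    have f': "f \<in> Arr \<B>" "Dom \<B> f = Z" "Cod \<B> f = X" and g': "g \<in> Arr \<B>" "Dom \<B> g = Z" "Cod \<B> g = Y" using fg by (auto simp: Hom_def)
    note a = cell_arrow_simps[OF f' g' R \<phi>]
    have d: "Dom \<B> (fst (cell_arrow f g R \<phi>)) = Z" using a f' g' by simp
    have "\<exists>!h. h \<in> Hom \<B> Z U \<and> ?\<chi> \<star> over_top E h (top (Dom \<B> h)) = cell_arrow f g R \<phi>"
      using c[rule_format, OF a(1,4)] a(3) unfolding d by blast
    moreover have "h \<in> Hom \<B> Z U \<and> i \<bullet> h = f \<and> j \<bullet> h = g \<and> \<phi> = tab_paste (Matr E) X Y R U i j \<tau> Z h \<longleftrightarrow>
        h \<in> Hom \<B> Z U \<and> ?\<chi> \<star> over_top E h (top (Dom \<B> h)) = cell_arrow f g R \<phi>" for h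
      using key[OF _ fg \<phi>, of h] by (auto simp: Hom_def)
    ultimately show "\<exists>!h. h \<in> Hom \<B> Z U \<and> i \<bullet> h = f \<and> j \<bullet> h = g \<and> \<phi> = tab_paste (Matr E) X Y R U i j \<tau> Z h" by simp
  qed
qed

lemma tabulation_iff:
  assumes X [simp]: "X \<in> Obj \<B>" and Y [simp]: "Y \<in> Obj \<B>" and R [simp]: "R \<in> Obj (fib E (X \<odot> Y))"
  shows "(\<exists>U i j \<tau>. is_tabulation (Matr E) X Y R U i j \<tau>) \<longleftrightarrow> (\<exists>\<chi>. comprehends (X \<odot> Y) R \<chi>)"
    "(\<exists>U i j \<tau>. is_tabulation (Matr E) X Y R U i j \<tau> \<and> is_iso (hom (Matr E) X Y) (tab_mate (Matr E) X Y R U i \<tau>)) \<longleftrightarrow>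
      (\<exists>\<chi>. comprehends (X \<odot> Y) R \<chi> \<and> opcartesian \<chi>)"
proof -
  have 1: "comprehends (X \<odot> Y) R (cell_arrow i j R \<tau>) \<and> (is_iso (fib E (X \<odot> Y)) (tab_mate (Matr E) X Y R U i \<tau>) \<longrightarrow> opcartesian (cell_arrow i j R \<tau>))"
    if "is_tabulation (Matr E) X Y R U i j \<tau>" for U i j \<tau>
  proof -
    have t: "i \<in> Arr \<B>" "Dom \<B> i = U" "Cod \<B> i = X" "j \<in> Arr \<B>" "Dom \<B> j = U" "Cod \<B> j = Y"
      "\<tau> \<in> Hom (fib E (U \<odot> Y)) (matr_lower E j) (matr_comp E U X Y R (matr_lower E i))"
      using that unfolding is_tabulation_def by (auto simp: Hom_def)
    show ?thesis
      using tabulation_iff_comprehends[OF X Y R t] tab_mate_iso_iff[OF t(1-6) R t(7)] that by blast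
  qed
  have 2: "\<exists>U i j \<tau>. is_tabulation (Matr E) X Y R U i j \<tau> \<and> (opcartesian \<chi> \<longrightarrow> is_iso (fib E (X \<odot> Y)) (tab_mate (Matr E) X Y R U i \<tau>))"
    if c: "comprehends (X \<odot> Y) R \<chi>" for \<chi>
  proof -
    have \<chi>: "\<chi> \<in> Arr \<T>" "Cod \<T> \<chi> = (X \<odot> Y, R)" "Dom \<T> \<chi> = (Dom \<B> (fst \<chi>), top (Dom \<B> (fst \<chi>)))"
      using c unfolding comprehends_def by blast+
    let ?U = "Dom \<B> (fst \<chi>)" and ?i = "Pr1 \<B> X Y \<bullet> fst \<chi>" and ?j = "Pr2 \<B> X Y \<bullet> fst \<chi>"
    have cf: "Cod \<B> (fst \<chi>) = X \<odot> Y" and af: "fst \<chi> \<in> Arr \<B>" using fst_Arr[OF \<chi>(1)] \<chi>(2) by simp_all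
    have i: "?i \<in> Arr \<B>" "Dom \<B> ?i = ?U" "Cod \<B> ?i = X" and j: "?j \<in> Arr \<B>" "Dom \<B> ?j = ?U" "Cod \<B> ?j = Y"
      using cf af by (simp_all del: fst_Arr)
    have "fst \<chi> = tuple \<B> ?i ?j" using cf af by (simp del: fst_Arr)
    then obtain \<tau> where \<tau>: "\<tau> \<in> Hom (fib E (?U \<odot> Y)) (matr_lower E ?j) (matr_comp E ?U X Y R (matr_lower E ?i))" "cell_arrow ?i ?j R \<tau> = \<chi>"
      using cell_arrow_surj[OF i j R \<chi>(1) _ \<chi>(3,2)] by blast
    have "is_tabulation (Matr E) X Y R ?U ?i ?j \<tau>"
      unfolding tabulation_iff_comprehends[OF X Y R i j \<tau>(1)] \<tau>(2) by (rule c)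
    moreover have "opcartesian \<chi> \<longrightarrow> is_iso (fib E (X \<odot> Y)) (tab_mate (Matr E) X Y R ?U ?i \<tau>)"
      unfolding tab_mate_iso_iff[OF i j R \<tau>(1)] \<tau>(2) by simp
    ultimately show ?thesis by blast
  qed
  show "(\<exists>U i j \<tau>. is_tabulation (Matr E) X Y R U i j \<tau>) \<longleftrightarrow> (\<exists>\<chi>. comprehends (X \<odot> Y) R \<chi>)"
    using 1 2 by blast
  show "(\<exists>U i j \<tau>. is_tabulation (Matr E) X Y R U i j \<tau> \<and> is_iso (hom (Matr E) X Y) (tab_mate (Matr E) X Y R U i \<tau>)) \<longleftrightarrow>
      (\<exists>\<chi>. comprehends (X \<odot> Y) R \<chi> \<and> opcartesian \<chi>)"
    unfolding Matr_simps(2) truncate_derived using 1 2 by blast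
qed

lemma comprehends_iso:
  assumes \<chi>: "comprehends X P \<chi>" and c: "is_iso \<T> c" "Dom \<T> c = (X, P)" "Cod \<T> c = (Y, Q)"
  shows "comprehends Y Q (c \<star> \<chi>)"
proof -
  have cA [simp]: "c \<in> Arr \<T>" using c(1) by (rule T.is_iso_Arr)
  have a: "\<chi> \<in> Arr \<T>" "Cod \<T> \<chi> = (X, P)" "Dom \<T> \<chi> = (Dom \<B> (fst \<chi>), top (Dom \<B> (fst \<chi>)))"
    using \<chi> unfolding comprehends_def by blast+
  have d: "Dom \<B> (fst (c \<star> \<chi>)) = Dom \<B> (fst \<chi>)"
    using fst_Arr(1,2)[OF a(1)] fst_Arr(2)[of "c \<star> \<chi>"] a(1,2) c(2) by simp
  show ?thesis
    unfolding comprehends_def d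
  proof (intro conjI ballI impI)
    show "c \<star> \<chi> \<in> Arr \<T>" "Cod \<T> (c \<star> \<chi>) = (Y, Q)"
      using a(1,2) c by simp_all
    show "Dom \<T> (c \<star> \<chi>) = (Dom \<B> (fst \<chi>), top (Dom \<B> (fst \<chi>)))"
      using a c by (metis T.Dom_Comp cA)
    fix \<phi> assume \<phi>: "\<phi> \<in> Arr \<T>" "Cod \<T> \<phi> = (Y, Q)" "Dom \<T> \<phi> = (Dom \<B> (fst \<phi>), top (Dom \<B> (fst \<phi>)))"
    let ?\<phi> = "Inv \<T> c \<star> \<phi>"
    have \<phi>': "?\<phi> \<in> Arr \<T>" "Cod \<T> ?\<phi> = (X, P)" "Dom \<T> ?\<phi> = Dom \<T> \<phi>" using \<phi>(1,2) c by simp_all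
    have d': "Dom \<B> (fst ?\<phi>) = Dom \<B> (fst \<phi>)"
      using fst_Arr(2)[OF \<phi>(1)] fst_Arr(2)[OF \<phi>'(1)] \<phi>'(3) by (simp only:)
    have "Dom \<T> ?\<phi> = (Dom \<B> (fst ?\<phi>), top (Dom \<B> (fst ?\<phi>)))" using \<phi>(3) \<phi>'(3) d' by (simp only:)
    then have ex: "\<exists>!h. h \<in> Hom \<B> (Dom \<B> (fst \<phi>)) (Dom \<B> (fst \<chi>)) \<and> \<chi> \<star> over_top E h (top (Dom \<B> h)) = ?\<phi>"
      using \<chi> \<phi>'(1,2) d' unfolding comprehends_def by metis
    have "\<chi> \<star> over_top E h (top (Dom \<B> h)) = ?\<phi> \<longleftrightarrow> (c \<star> \<chi>) \<star> over_top E h (top (Dom \<B> h)) = \<phi>"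
      if "h \<in> Hom \<B> (Dom \<B> (fst \<phi>)) (Dom \<B> (fst \<chi>))" for h
    proof -
      have h: "h \<in> Arr \<B>" "Cod \<B> h = Dom \<B> (fst \<chi>)" using that by (auto simp: Hom_def)
      let ?o = "over_top E h (top (Dom \<B> h))"
      have o: "?o \<in> Arr \<T>" "Cod \<T> ?o = Dom \<T> \<chi>"
        using over_top_simps(1,4)[OF h(1), of "top (Dom \<B> h)"] h(1) unfolding a(3) h(2) by simp_all
      have as: "(c \<star> \<chi>) \<star> ?o = c \<star> (\<chi> \<star> ?o)"
        by (rule T.Comp_assoc_Arr) (use a(1,2) c o in simp_all)
      have xo: "\<chi> \<star> ?o \<in> Arr \<T>" "Cod \<T> (\<chi> \<star> ?o) = (X, P)" using a(1,2) o by simp_all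
      show ?thesis
      proof
        assume e: "\<chi> \<star> ?o = ?\<phi>"
        show "(c \<star> \<chi>) \<star> ?o = \<phi>" unfolding as e using \<phi>(1,2) c by simp
      next
        assume e: "(c \<star> \<chi>) \<star> ?o = \<phi>"
        show "\<chi> \<star> ?o = ?\<phi>" unfolding e[symmetric] as using xo c by simp
      qed
    qed
    then show "\<exists>!h. h \<in> Hom \<B> (Dom \<B> (fst \<phi>)) (Dom \<B> (fst \<chi>)) \<and> (c \<star> \<chi>) \<star> over_top E h (top (Dom \<B> h)) = \<phi>"
      using ex by metis
  qed
qed

lemma comprehends_opcartesian_iso:
  assumes "comprehends X P \<chi>" and c: "is_iso \<T> c" "Dom \<T> c = (X, P)" and "opcartesian \<chi>"
  shows "opcartesian (c \<star> \<chi>)"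
  by (rule opcartesian_Comp[OF assms(4) iso_opcartesian[OF c(1)]]) (use assms in \<open>simp add: comprehends_def\<close>)

text \<open>
  A tabulation of \<open>R : X \<rightarrow> Y\<close> is an extension of \<open>R\<close> over \<open>X \<times> Y\<close>.  That these suffice follows by
  viewing an object over \<open>X\<close> as a matrix \<open>X \<rightarrow> 1\<close>.
\<close>

lemma comprehension_iff_tabulation:
  "(has_comprehension E \<longleftrightarrow> has_tabulation (Matr E)) \<and> (has_full_comprehension E \<longleftrightarrow> has_full_tabulation (Matr E))"
proof -
  have product_one: "\<exists>c. is_iso \<T> c \<and> Dom \<T> c = (X \<odot> Term \<B>, FObj (pull E (Pr1 \<B> X (Term \<B>))) P) \<and> Cod \<T> c = (X, P)"
    if "X \<in> Obj \<B>" "P \<in> Obj (fib E X)" for X P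
    using that B.is_iso_Pr1_Term[of X]
    by (intro exI[of _ "cart E (Pr1 \<B> X (Term \<B>)) P"]) (auto intro!: cartesian_iso cart_cartesian)
  have comp: "has_comprehension E \<longleftrightarrow> (\<forall>X \<in> Obj \<B>. \<forall>P \<in> Obj (fib E X). \<exists>\<chi>. comprehends X P \<chi>)"
    unfolding has_comprehension_def by (rule ball_cong[OF refl comprehension_adjunction_iff(1)])
  have full_comp: "has_full_comprehension E \<longleftrightarrow>
      (\<forall>X \<in> Obj \<B>. \<forall>P \<in> Obj (fib E X). \<exists>\<chi>. comprehends X P \<chi> \<and> opcartesian \<chi>)"
    unfolding has_full_comprehension_def by (rule ball_cong[OF refl comprehension_adjunction_iff(2)])
  have tab: "has_tabulation (Matr E) \<longleftrightarrow>
      (\<forall>X \<in> Obj \<B>. \<forall>Y \<in> Obj \<B>. \<forall>R \<in> Obj (fib E (X \<odot> Y)). \<exists>\<chi>. comprehends (X \<odot> Y) R \<chi>)"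
    unfolding has_tabulation_def using tabulation_iff(1) by simp
  have full_tab: "has_full_tabulation (Matr E) \<longleftrightarrow>
      (\<forall>X \<in> Obj \<B>. \<forall>Y \<in> Obj \<B>. \<forall>R \<in> Obj (fib E (X \<odot> Y)). \<exists>\<chi>. comprehends (X \<odot> Y) R \<chi> \<and> opcartesian \<chi>)"
    unfolding has_full_tabulation_def using tabulation_iff(2) by simp
  have transport: "\<exists>R \<in> Obj (fib E (X \<odot> Term \<B>)). \<forall>\<chi>. comprehends (X \<odot> Term \<B>) R \<chi> \<longrightarrow>
      (\<exists>\<chi>'. comprehends X P \<chi>' \<and> (opcartesian \<chi> \<longrightarrow> opcartesian \<chi>'))"
    if X: "X \<in> Obj \<B>" and P: "P \<in> Obj (fib E X)" for X P
  proof -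
    obtain c where c: "is_iso \<T> c" "Dom \<T> c = (X \<odot> Term \<B>, FObj (pull E (Pr1 \<B> X (Term \<B>))) P)" "Cod \<T> c = (X, P)"
      using product_one[OF X P] by blast
    have "FObj (pull E (Pr1 \<B> X (Term \<B>))) P \<in> Obj (fib E (X \<odot> Term \<B>))"
      using X P by simp
    then show ?thesis
      using comprehends_iso[OF _ c] comprehends_opcartesian_iso[OF _ c(1,2)] by blast
  qed
  have "has_comprehension E \<longleftrightarrow> has_tabulation (Matr E)"
    unfolding comp tab
  proof (intro iffI ballI)
    fix X P assume t: "\<forall>X \<in> Obj \<B>. \<forall>Y \<in> Obj \<B>. \<forall>R \<in> Obj (fib E (X \<odot> Y)). \<exists>\<chi>. comprehends (X \<odot> Y) R \<chi>"
      and "X \<in> Obj \<B>" "P \<in> Obj (fib E X)"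
    then show "\<exists>\<chi>. comprehends X P \<chi>"
      using transport[of X P] t[rule_format, of X "Term \<B>"] B.Obj_Term by blast
  qed (use B.Obj_Prod in blast)
  moreover have "has_full_comprehension E \<longleftrightarrow> has_full_tabulation (Matr E)"
    unfolding full_comp full_tab
  proof (intro iffI ballI)
    fix X P assume t: "\<forall>X \<in> Obj \<B>. \<forall>Y \<in> Obj \<B>. \<forall>R \<in> Obj (fib E (X \<odot> Y)). \<exists>\<chi>. comprehends (X \<odot> Y) R \<chi> \<and> opcartesian \<chi>"
      and "X \<in> Obj \<B>" "P \<in> Obj (fib E X)"
    then show "\<exists>\<chi>. comprehends X P \<chi> \<and> opcartesian \<chi>"
      using transport[of X P] t[rule_format, of X "Term \<B>"] B.Obj_Term by blast
  qed (use B.Obj_Prod in blast)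
  ultimately show ?thesis ..
qed

end

theorem mainTheorem4:
  fixes E :: "('o, 'a, 'p, 'q) fibration"
  assumes "regular_fibration E"
  shows "(has_comprehension E \<longleftrightarrow> has_tabulation (Matr E)) \<and>
         (has_full_comprehension E \<longleftrightarrow> has_full_tabulation (Matr E))"
  by (rule regular_fibration.comprehension_iff_tabulation[OF assms])

end
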